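(* It is consistent with $\mathsf{ZFC}$ (that is, if $\mathsf{ZFC}$ is consistent, then so is $\mathsf{ZFC}$ together with the following statement) that there is a nonempty compact Hausdorff space $X$ with no isolated points and with uniform $\pi$-weight $\kappa$, for some cardinal $\kappa$, such that $$\mathrm{non}(\mathcal M_X) < \mathrm{cf}[\kappa]^\omega \cdot \mathrm{non}(\mathcal M).$$
   Context: For a topological space $X$, $\mathcal M_X$ is the collection of all meager subsets of $X$ (countable unions of nowhere dense sets), and $\mathcal M = \mathcal M_{\mathbb R}$. For an ideal $\mathcal I$ of subsets of a set $X$, $\mathrm{non}(\mathcal I) = \min\{|Y| : Y \subseteq X \text{ and } Y \notin \mathcal I\}$. A $\pi$-base for $X$ is a collection $\mathcal B$ of nonempty open subsets of $X$ such that every nonempty open subset of $X$ contains a member of $\mathcal B$. The $\pi$-weight of a space is the minimum cardinality of a $\pi$-base for it. $X$ has uniform $\pi$-weight $\kappa$ if every nonempty open subset of $X$ has $\pi$-weight $\kappa$. For an infinite cardinal $\kappa$, $[\kappa]^\omega$ is the set of all countably infinite subsets of $\kappa$; a family $\mathcal F \subseteq [\kappa]^\omega$ is cofinal if for every $A \in [\kappa]^\omega$ there is $B \in \mathcal F$ with $B \supseteq A$; and $\mathrm{cf}[\kappa]^\omega$ is the minimum cardinality of a cofinal subset of $[\kappa]^\omega$. The dot denotes cardinal multiplication. *)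

theory Defs
  imports Main
begin

section \<open>First-order logic in the language of set theory\<close>

text \<open>Formulas over the two binary predicates \<open>\<in>\<close> and \<open>=\<close>, with de Bruijn indices. The language has
  no function symbols, so substituting terms for variables is the same as renaming variables.\<close>

datatype fm = Mem nat nat | Eq nat nat | Fls | Imp fm fm | All fm

fun ren :: "(nat \<Rightarrow> nat) \<Rightarrow> fm \<Rightarrow> fm" where
  "ren r (Mem i j) = Mem (r i) (r j)"
| "ren r (Eq i j) = Eq (r i) (r j)"
| "ren r Fls = Fls"
| "ren r (Imp p q) = Imp (ren r p) (ren r q)"
| "ren r (All p) = All (ren (case_nat 0 (\<lambda>i. Suc (r i))) p)"

text \<open>\<open>bounded n p\<close>: all free variables of \<open>p\<close> are below \<open>n\<close>.\<close>

fun bounded :: "nat \<Rightarrow> fm \<Rightarrow> bool" where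
  "bounded n (Mem i j) \<longleftrightarrow> i < n \<and> j < n"
| "bounded n (Eq i j) \<longleftrightarrow> i < n \<and> j < n"
| "bounded n Fls \<longleftrightarrow> True"
| "bounded n (Imp p q) \<longleftrightarrow> bounded n p \<and> bounded n q"
| "bounded n (All p) \<longleftrightarrow> bounded (Suc n) p"

abbreviation inst :: "nat \<Rightarrow> fm \<Rightarrow> fm" where
  "inst t \<equiv> ren (case_nat t (\<lambda>i. i))"

text \<open>Natural deduction for classical first-order logic with equality. As usual, the domain of
  discourse is taken to be nonempty.\<close>

inductive proves :: "fm set \<Rightarrow> fm \<Rightarrow> bool" (infix "\<turnstile>" 50) where
  assm: "p \<in> \<Gamma> \<Longrightarrow> \<Gamma> \<turnstile> p"
| impI: "insert p \<Gamma> \<turnstile> q \<Longrightarrow> \<Gamma> \<turnstile> Imp p q"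
| impE: "\<Gamma> \<turnstile> Imp p q \<Longrightarrow> \<Gamma> \<turnstile> p \<Longrightarrow> \<Gamma> \<turnstile> q"
| contr: "insert (Imp p Fls) \<Gamma> \<turnstile> Fls \<Longrightarrow> \<Gamma> \<turnstile> p"
| allI: "ren Suc ` \<Gamma> \<turnstile> p \<Longrightarrow> \<Gamma> \<turnstile> All p"
| allE: "\<Gamma> \<turnstile> All p \<Longrightarrow> \<Gamma> \<turnstile> inst t p"
| eq_refl: "\<Gamma> \<turnstile> Eq t t"
| eq_subst: "\<Gamma> \<turnstile> Eq s t \<Longrightarrow> \<Gamma> \<turnstile> inst s p \<Longrightarrow> \<Gamma> \<turnstile> inst t p"

definition consistent :: "fm set \<Rightarrow> bool" where
  "consistent T \<longleftrightarrow> \<not> T \<turnstile> Fls"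


section \<open>Writing formulas with named bound variables\<close>

text \<open>A \<open>form\<close> is a formula as a function of the number \<open>d\<close> of quantifiers in whose scope it stands.
  Variables are referred to by their level: the variable bound by the outermost quantifier has
  level \<open>0\<close>, and at depth \<open>d\<close> the variable of level \<open>x\<close> has de Bruijn index \<open>d - Suc x\<close>. The
  quantifiers below hand the level of the variable they bind to their body, so that formulas are
  written with the bound variables of the metalogic. A \<open>form\<close> whose free variables are the levels
  \<open>0, \<dots>, n - 1\<close> denotes the formula obtained by applying it to \<open>n\<close>; a closed one is applied to
  \<open>0\<close>.\<close>

type_synonym form = "nat \<Rightarrow> fm"

definition mem :: "nat \<Rightarrow> nat \<Rightarrow> form" (infix "\<^bold>\<in>" 50) where
  "(x \<^bold>\<in> y) = (\<lambda>d. Mem (d - Suc x) (d - Suc y))"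

definition equ :: "nat \<Rightarrow> nat \<Rightarrow> form" (infix "\<^bold>=" 50) where
  "(x \<^bold>= y) = (\<lambda>d. Eq (d - Suc x) (d - Suc y))"

definition imp :: "form \<Rightarrow> form \<Rightarrow> form" (infixr "\<^bold>\<longrightarrow>" 25) where
  "(P \<^bold>\<longrightarrow> Q) = (\<lambda>d. Imp (P d) (Q d))"

definition neg :: "form \<Rightarrow> form" ("\<^bold>\<not> _" [40] 40) where
  "(\<^bold>\<not> P) = (P \<^bold>\<longrightarrow> (\<lambda>d. Fls))"

definition disj :: "form \<Rightarrow> form \<Rightarrow> form" (infixr "\<^bold>\<or>" 30) where
  "(P \<^bold>\<or> Q) = (\<^bold>\<not> P \<^bold>\<longrightarrow> Q)"

definition conj :: "form \<Rightarrow> form \<Rightarrow> form" (infixr "\<^bold>\<and>" 35) where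
  "(P \<^bold>\<and> Q) = (\<^bold>\<not> (P \<^bold>\<longrightarrow> \<^bold>\<not> Q))"

definition iff :: "form \<Rightarrow> form \<Rightarrow> form" (infixr "\<^bold>\<longleftrightarrow>" 25) where
  "(P \<^bold>\<longleftrightarrow> Q) = ((P \<^bold>\<longrightarrow> Q) \<^bold>\<and> (Q \<^bold>\<longrightarrow> P))"

definition all :: "(nat \<Rightarrow> form) \<Rightarrow> form" (binder "\<^bold>\<forall>" 10) where
  "(\<^bold>\<forall>x. P x) = (\<lambda>d. All (P d (Suc d)))"

definition ex :: "(nat \<Rightarrow> form) \<Rightarrow> form" (binder "\<^bold>\<exists>" 10) where
  "(\<^bold>\<exists>x. P x) = (\<^bold>\<not> (\<^bold>\<forall>x. \<^bold>\<not> P x))"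

definition ex1 :: "(nat \<Rightarrow> form) \<Rightarrow> form" (binder "\<^bold>\<exists>!" 10) where
  "(\<^bold>\<exists>!x. P x) = (\<^bold>\<exists>x. P x \<^bold>\<and> (\<^bold>\<forall>y. P y \<^bold>\<longrightarrow> y \<^bold>= x))"

text \<open>\<open>app p vs\<close> is the formula \<open>p\<close> with its free variable \<open>i\<close> replaced by the \<open>i\<close>-th level in \<open>vs\<close>.\<close>

definition app :: "fm \<Rightarrow> nat list \<Rightarrow> form" where
  "app p vs = (\<lambda>d. ren (\<lambda>i. d - Suc (vs ! i)) p)"


section \<open>Basic set-theoretic vocabulary\<close>

definition sub :: "nat \<Rightarrow> nat \<Rightarrow> form" (infix "\<^bold>\<subseteq>" 50) where
  "(x \<^bold>\<subseteq> y) = (\<^bold>\<forall>z. z \<^bold>\<in> x \<^bold>\<longrightarrow> z \<^bold>\<in> y)"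

definition nonempty :: "nat \<Rightarrow> form" where
  "nonempty x = (\<^bold>\<exists>z. z \<^bold>\<in> x)"

definition is_succ :: "nat \<Rightarrow> nat \<Rightarrow> form" where
  "is_succ s x = (\<^bold>\<forall>z. z \<^bold>\<in> s \<^bold>\<longleftrightarrow> z \<^bold>\<in> x \<^bold>\<or> z \<^bold>= x)"

definition is_inter :: "nat \<Rightarrow> nat \<Rightarrow> nat \<Rightarrow> form" where
  "is_inter w x y = (\<^bold>\<forall>z. z \<^bold>\<in> w \<^bold>\<longleftrightarrow> z \<^bold>\<in> x \<^bold>\<and> z \<^bold>\<in> y)"

definition is_Union :: "nat \<Rightarrow> nat \<Rightarrow> form" where
  "is_Union u x = (\<^bold>\<forall>z. z \<^bold>\<in> u \<^bold>\<longleftrightarrow> (\<^bold>\<exists>y. y \<^bold>\<in> x \<^bold>\<and> z \<^bold>\<in> y))"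

definition is_upair :: "nat \<Rightarrow> nat \<Rightarrow> nat \<Rightarrow> form" where
  "is_upair p x y = (\<^bold>\<forall>z. z \<^bold>\<in> p \<^bold>\<longleftrightarrow> z \<^bold>= x \<^bold>\<or> z \<^bold>= y)"

text \<open>Kuratowski pairs\<close>

definition is_pair :: "nat \<Rightarrow> nat \<Rightarrow> nat \<Rightarrow> form" where
  "is_pair p x y = (\<^bold>\<forall>z. z \<^bold>\<in> p \<^bold>\<longleftrightarrow> is_upair z x x \<^bold>\<or> is_upair z x y)"

definition is_prod :: "nat \<Rightarrow> nat \<Rightarrow> nat \<Rightarrow> form" where
  "is_prod c a b = (\<^bold>\<forall>p. p \<^bold>\<in> c \<^bold>\<longleftrightarrow> (\<^bold>\<exists>x. \<^bold>\<exists>y. x \<^bold>\<in> a \<^bold>\<and> y \<^bold>\<in> b \<^bold>\<and> is_pair p x y))"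

text \<open>\<open>rel r x y\<close>: the pair of \<open>x\<close> and \<open>y\<close> belongs to \<open>r\<close>; for a function \<open>r\<close> this says \<open>r(x) = y\<close>.\<close>

definition rel :: "nat \<Rightarrow> nat \<Rightarrow> nat \<Rightarrow> form" where
  "rel r x y = (\<^bold>\<exists>p. is_pair p x y \<^bold>\<and> p \<^bold>\<in> r)"

definition rel2 :: "nat \<Rightarrow> nat \<Rightarrow> nat \<Rightarrow> nat \<Rightarrow> form" where
  "rel2 f x y z = (\<^bold>\<exists>p. is_pair p x y \<^bold>\<and> rel f p z)"

definition is_func :: "nat \<Rightarrow> nat \<Rightarrow> nat \<Rightarrow> form" where
  "is_func f a b =
    ((\<^bold>\<forall>p. p \<^bold>\<in> f \<^bold>\<longrightarrow> (\<^bold>\<exists>x. \<^bold>\<exists>y. x \<^bold>\<in> a \<^bold>\<and> y \<^bold>\<in> b \<^bold>\<and> is_pair p x y)) \<^bold>\<and>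
     (\<^bold>\<forall>x. x \<^bold>\<in> a \<^bold>\<longrightarrow> (\<^bold>\<exists>!y. rel f x y)))"

definition is_injection :: "nat \<Rightarrow> nat \<Rightarrow> nat \<Rightarrow> form" where
  "is_injection f a b =
    (is_func f a b \<^bold>\<and> (\<^bold>\<forall>x. \<^bold>\<forall>x'. \<^bold>\<forall>y. rel f x y \<^bold>\<and> rel f x' y \<^bold>\<longrightarrow> x \<^bold>= x'))"

definition is_bijection :: "nat \<Rightarrow> nat \<Rightarrow> nat \<Rightarrow> form" where
  "is_bijection f a b =
    (is_injection f a b \<^bold>\<and> (\<^bold>\<forall>y. y \<^bold>\<in> b \<^bold>\<longrightarrow> (\<^bold>\<exists>x. x \<^bold>\<in> a \<^bold>\<and> rel f x y)))"

definition equipollent :: "nat \<Rightarrow> nat \<Rightarrow> form" where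
  "equipollent a b = (\<^bold>\<exists>f. is_bijection f a b)"


section \<open>The axioms of ZFC\<close>

definition ax_extensionality :: fm where
  "ax_extensionality = (\<^bold>\<forall>x. \<^bold>\<forall>y. (\<^bold>\<forall>z. z \<^bold>\<in> x \<^bold>\<longleftrightarrow> z \<^bold>\<in> y) \<^bold>\<longrightarrow> x \<^bold>= y) 0"

definition ax_foundation :: fm where
  "ax_foundation =
    (\<^bold>\<forall>x. nonempty x \<^bold>\<longrightarrow> (\<^bold>\<exists>y. y \<^bold>\<in> x \<^bold>\<and> \<^bold>\<not> (\<^bold>\<exists>z. z \<^bold>\<in> x \<^bold>\<and> z \<^bold>\<in> y))) 0"

definition ax_pairing :: fm where
  "ax_pairing = (\<^bold>\<forall>x. \<^bold>\<forall>y. \<^bold>\<exists>p. is_upair p x y) 0"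

definition ax_union :: fm where
  "ax_union = (\<^bold>\<forall>x. \<^bold>\<exists>u. is_Union u x) 0"

definition ax_power :: fm where
  "ax_power = (\<^bold>\<forall>x. \<^bold>\<exists>p. \<^bold>\<forall>y. y \<^bold>\<in> p \<^bold>\<longleftrightarrow> y \<^bold>\<subseteq> x) 0"

definition ax_infinity :: fm where
  "ax_infinity =
    (\<^bold>\<exists>x. (\<^bold>\<exists>e. \<^bold>\<not> nonempty e \<^bold>\<and> e \<^bold>\<in> x) \<^bold>\<and>
         (\<^bold>\<forall>y. y \<^bold>\<in> x \<^bold>\<longrightarrow> (\<^bold>\<exists>s. is_succ s y \<^bold>\<and> s \<^bold>\<in> x))) 0"

text \<open>Every family of nonempty sets has a choice function.\<close>

definition ax_choice :: fm where
  "ax_choice =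
    (\<^bold>\<forall>a. (\<^bold>\<forall>x. x \<^bold>\<in> a \<^bold>\<longrightarrow> nonempty x) \<^bold>\<longrightarrow>
      (\<^bold>\<exists>f. \<^bold>\<exists>b. is_func f a b \<^bold>\<and> (\<^bold>\<forall>x. \<^bold>\<forall>y. rel f x y \<^bold>\<longrightarrow> y \<^bold>\<in> x))) 0"

text \<open>In the two schemas, the parameters are the variables of levels \<open>0, \<dots>, n - 1\<close>, bound by the
  outermost \<open>n\<close> quantifiers.\<close>

definition ax_separation :: "nat \<Rightarrow> fm \<Rightarrow> fm" where
  "ax_separation n p = (All ^^ n)
    ((\<^bold>\<forall>a. \<^bold>\<exists>b. \<^bold>\<forall>z. z \<^bold>\<in> b \<^bold>\<longleftrightarrow> z \<^bold>\<in> a \<^bold>\<and> app p (z # a # [0..<n])) n)"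

definition ax_replacement :: "nat \<Rightarrow> fm \<Rightarrow> fm" where
  "ax_replacement n p = (All ^^ n)
    (((\<^bold>\<forall>x. \<^bold>\<forall>y. \<^bold>\<forall>z. app p (x # y # [0..<n]) \<^bold>\<and> app p (x # z # [0..<n]) \<^bold>\<longrightarrow> y \<^bold>= z) \<^bold>\<longrightarrow>
      (\<^bold>\<forall>a. \<^bold>\<exists>b. \<^bold>\<forall>y. y \<^bold>\<in> b \<^bold>\<longleftrightarrow> (\<^bold>\<exists>x. x \<^bold>\<in> a \<^bold>\<and> app p (x # y # [0..<n])))) n)"

definition ZFC :: "fm set" where
  "ZFC =
    {ax_extensionality, ax_foundation, ax_pairing, ax_union, ax_power, ax_infinity, ax_choice} \<union>
    {ax_separation n p | n p. bounded (n + 2) p} \<union>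
    {ax_replacement n p | n p. bounded (n + 2) p}"


section \<open>Ordinals and cardinals\<close>

text \<open>Von Neumann ordinals: transitive sets well-ordered by \<open>\<in>\<close>\<close>

definition is_ordinal :: "nat \<Rightarrow> form" where
  "is_ordinal a =
    ((\<^bold>\<forall>x. x \<^bold>\<in> a \<^bold>\<longrightarrow> x \<^bold>\<subseteq> a) \<^bold>\<and>
     (\<^bold>\<forall>x. x \<^bold>\<in> a \<^bold>\<longrightarrow> \<^bold>\<not> x \<^bold>\<in> x) \<^bold>\<and>
     (\<^bold>\<forall>x. \<^bold>\<forall>y. \<^bold>\<forall>z. x \<^bold>\<in> a \<^bold>\<and> y \<^bold>\<in> a \<^bold>\<and> z \<^bold>\<in> a \<^bold>\<and> x \<^bold>\<in> y \<^bold>\<and> y \<^bold>\<in> z \<^bold>\<longrightarrow> x \<^bold>\<in> z) \<^bold>\<and>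
     (\<^bold>\<forall>x. \<^bold>\<forall>y. x \<^bold>\<in> a \<^bold>\<and> y \<^bold>\<in> a \<^bold>\<longrightarrow> x \<^bold>\<in> y \<^bold>\<or> x \<^bold>= y \<^bold>\<or> y \<^bold>\<in> x) \<^bold>\<and>
     (\<^bold>\<forall>s. s \<^bold>\<subseteq> a \<^bold>\<and> nonempty s \<^bold>\<longrightarrow>
       (\<^bold>\<exists>x. x \<^bold>\<in> s \<^bold>\<and> (\<^bold>\<forall>y. y \<^bold>\<in> s \<^bold>\<longrightarrow> x \<^bold>= y \<^bold>\<or> x \<^bold>\<in> y))))"

definition is_limit :: "nat \<Rightarrow> form" where
  "is_limit a = (is_ordinal a \<^bold>\<and> nonempty a \<^bold>\<and> (\<^bold>\<forall>x. x \<^bold>\<in> a \<^bold>\<longrightarrow> (\<^bold>\<exists>y. y \<^bold>\<in> a \<^bold>\<and> x \<^bold>\<in> y)))"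

definition is_omega :: "nat \<Rightarrow> form" where
  "is_omega w = (is_limit w \<^bold>\<and> (\<^bold>\<forall>x. x \<^bold>\<in> w \<^bold>\<longrightarrow> \<^bold>\<not> is_limit x))"

definition is_cardinal :: "nat \<Rightarrow> form" where
  "is_cardinal k = (is_ordinal k \<^bold>\<and> (\<^bold>\<forall>b. b \<^bold>\<in> k \<^bold>\<longrightarrow> \<^bold>\<not> equipollent k b))"

definition has_card :: "nat \<Rightarrow> nat \<Rightarrow> form" where
  "has_card x k = (is_cardinal k \<^bold>\<and> equipollent x k)"

definition is_finite :: "nat \<Rightarrow> form" where
  "is_finite x = (\<^bold>\<exists>w. \<^bold>\<exists>n. is_omega w \<^bold>\<and> n \<^bold>\<in> w \<^bold>\<and> equipollent x n)"

definition is_countable :: "nat \<Rightarrow> form" where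
  "is_countable x = (\<^bold>\<exists>w. \<^bold>\<exists>f. is_omega w \<^bold>\<and> is_injection f x w)"

definition is_countably_infinite :: "nat \<Rightarrow> form" where
  "is_countably_infinite x = (\<^bold>\<exists>w. is_omega w \<^bold>\<and> equipollent x w)"

text \<open>\<open>is_min_card k P\<close>: \<open>k\<close> is the least cardinality of a set satisfying \<open>P\<close>.\<close>

definition is_min_card :: "nat \<Rightarrow> (nat \<Rightarrow> form) \<Rightarrow> form" where
  "is_min_card k P =
    ((\<^bold>\<exists>y. P y \<^bold>\<and> has_card y k) \<^bold>\<and>
     (\<^bold>\<forall>y. \<^bold>\<forall>l. P y \<^bold>\<and> has_card y l \<^bold>\<longrightarrow> k \<^bold>= l \<^bold>\<or> k \<^bold>\<in> l))"

definition is_card_mult :: "nat \<Rightarrow> nat \<Rightarrow> nat \<Rightarrow> form" where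
  "is_card_mult m k l = (\<^bold>\<exists>c. is_prod c k l \<^bold>\<and> has_card c m)"

definition is_cofinal_family :: "nat \<Rightarrow> nat \<Rightarrow> form" where
  "is_cofinal_family f k =
    ((\<^bold>\<forall>a. a \<^bold>\<in> f \<^bold>\<longrightarrow> a \<^bold>\<subseteq> k \<^bold>\<and> is_countably_infinite a) \<^bold>\<and>
     (\<^bold>\<forall>a. a \<^bold>\<subseteq> k \<^bold>\<and> is_countably_infinite a \<^bold>\<longrightarrow> (\<^bold>\<exists>b. b \<^bold>\<in> f \<^bold>\<and> a \<^bold>\<subseteq> b)))"

definition is_cf_countable_subsets :: "nat \<Rightarrow> nat \<Rightarrow> form" where
  "is_cf_countable_subsets c k = is_min_card c (\<lambda>f. is_cofinal_family f k)"


section \<open>Topology\<close>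

text \<open>A topological space is given by its point set \<open>X\<close> and its set \<open>T\<close> of open sets.\<close>

definition is_topology :: "nat \<Rightarrow> nat \<Rightarrow> form" where
  "is_topology X T =
    ((\<^bold>\<forall>u. u \<^bold>\<in> T \<^bold>\<longrightarrow> u \<^bold>\<subseteq> X) \<^bold>\<and>
     (\<^bold>\<forall>e. \<^bold>\<not> nonempty e \<^bold>\<longrightarrow> e \<^bold>\<in> T) \<^bold>\<and>
     X \<^bold>\<in> T \<^bold>\<and>
     (\<^bold>\<forall>u. \<^bold>\<forall>v. \<^bold>\<forall>w. u \<^bold>\<in> T \<^bold>\<and> v \<^bold>\<in> T \<^bold>\<and> is_inter w u v \<^bold>\<longrightarrow> w \<^bold>\<in> T) \<^bold>\<and>
     (\<^bold>\<forall>s. \<^bold>\<forall>u. s \<^bold>\<subseteq> T \<^bold>\<and> is_Union u s \<^bold>\<longrightarrow> u \<^bold>\<in> T))"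

definition is_subspace_topology :: "nat \<Rightarrow> nat \<Rightarrow> nat \<Rightarrow> form" where
  "is_subspace_topology S U T = (\<^bold>\<forall>w. w \<^bold>\<in> S \<^bold>\<longleftrightarrow> (\<^bold>\<exists>v. v \<^bold>\<in> T \<^bold>\<and> is_inter w v U))"

definition compact :: "nat \<Rightarrow> nat \<Rightarrow> form" where
  "compact X T =
    (\<^bold>\<forall>c. c \<^bold>\<subseteq> T \<^bold>\<and> is_Union X c \<^bold>\<longrightarrow> (\<^bold>\<exists>d. d \<^bold>\<subseteq> c \<^bold>\<and> is_finite d \<^bold>\<and> is_Union X d))"

definition hausdorff :: "nat \<Rightarrow> nat \<Rightarrow> form" where
  "hausdorff X T =
    (\<^bold>\<forall>x. \<^bold>\<forall>y. x \<^bold>\<in> X \<^bold>\<and> y \<^bold>\<in> X \<^bold>\<and> \<^bold>\<not> x \<^bold>= y \<^bold>\<longrightarrow>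
      (\<^bold>\<exists>u. \<^bold>\<exists>v. u \<^bold>\<in> T \<^bold>\<and> v \<^bold>\<in> T \<^bold>\<and> x \<^bold>\<in> u \<^bold>\<and> y \<^bold>\<in> v \<^bold>\<and> \<^bold>\<not> (\<^bold>\<exists>z. z \<^bold>\<in> u \<^bold>\<and> z \<^bold>\<in> v)))"

definition no_isolated_points :: "nat \<Rightarrow> nat \<Rightarrow> form" where
  "no_isolated_points X T = (\<^bold>\<not> (\<^bold>\<exists>x. \<^bold>\<exists>u. x \<^bold>\<in> X \<^bold>\<and> is_upair u x x \<^bold>\<and> u \<^bold>\<in> T))"

definition is_closure :: "nat \<Rightarrow> nat \<Rightarrow> nat \<Rightarrow> nat \<Rightarrow> form" where
  "is_closure c a X T =
    (\<^bold>\<forall>x. x \<^bold>\<in> c \<^bold>\<longleftrightarrow>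
      x \<^bold>\<in> X \<^bold>\<and> (\<^bold>\<forall>u. u \<^bold>\<in> T \<^bold>\<and> x \<^bold>\<in> u \<^bold>\<longrightarrow> (\<^bold>\<exists>z. z \<^bold>\<in> u \<^bold>\<and> z \<^bold>\<in> a)))"

text \<open>The closure has empty interior.\<close>

definition nowhere_dense :: "nat \<Rightarrow> nat \<Rightarrow> nat \<Rightarrow> form" where
  "nowhere_dense a X T =
    (a \<^bold>\<subseteq> X \<^bold>\<and> (\<^bold>\<exists>c. is_closure c a X T \<^bold>\<and> \<^bold>\<not> (\<^bold>\<exists>u. u \<^bold>\<in> T \<^bold>\<and> nonempty u \<^bold>\<and> u \<^bold>\<subseteq> c)))"

definition meager :: "nat \<Rightarrow> nat \<Rightarrow> nat \<Rightarrow> form" where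
  "meager a X T =
    (\<^bold>\<exists>f. is_countable f \<^bold>\<and> (\<^bold>\<forall>b. b \<^bold>\<in> f \<^bold>\<longrightarrow> nowhere_dense b X T) \<^bold>\<and> is_Union a f)"

definition is_non_meager :: "nat \<Rightarrow> nat \<Rightarrow> nat \<Rightarrow> form" where
  "is_non_meager m X T = is_min_card m (\<lambda>y. y \<^bold>\<subseteq> X \<^bold>\<and> \<^bold>\<not> meager y X T)"

text \<open>The notions of \<open>\<pi>\<close>-base and \<open>\<pi>\<close>-weight depend on the set \<open>T\<close> of open sets only.\<close>

definition is_pi_base :: "nat \<Rightarrow> nat \<Rightarrow> form" where
  "is_pi_base B T =
    ((\<^bold>\<forall>b. b \<^bold>\<in> B \<^bold>\<longrightarrow> b \<^bold>\<in> T \<^bold>\<and> nonempty b) \<^bold>\<and>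
     (\<^bold>\<forall>u. u \<^bold>\<in> T \<^bold>\<and> nonempty u \<^bold>\<longrightarrow> (\<^bold>\<exists>b. b \<^bold>\<in> B \<^bold>\<and> b \<^bold>\<subseteq> u)))"

definition is_pi_weight :: "nat \<Rightarrow> nat \<Rightarrow> form" where
  "is_pi_weight k T = is_min_card k (\<lambda>B. is_pi_base B T)"

definition uniform_pi_weight :: "nat \<Rightarrow> nat \<Rightarrow> form" where
  "uniform_pi_weight k T =
    (\<^bold>\<forall>u. u \<^bold>\<in> T \<^bold>\<and> nonempty u \<^bold>\<longrightarrow> (\<^bold>\<exists>S. is_subspace_topology S u T \<^bold>\<and> is_pi_weight k S))"


section \<open>The real line\<close>

definition comm_monoid_op :: "nat \<Rightarrow> nat \<Rightarrow> nat \<Rightarrow> form" where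
  "comm_monoid_op R f e =
    ((\<^bold>\<exists>c. is_prod c R R \<^bold>\<and> is_func f c R) \<^bold>\<and>
     (\<^bold>\<forall>x. \<^bold>\<forall>y. \<^bold>\<forall>z. \<^bold>\<forall>u. \<^bold>\<forall>v. \<^bold>\<forall>w. rel2 f x y u \<^bold>\<and> rel2 f u z w \<^bold>\<and> rel2 f y z v \<^bold>\<longrightarrow> rel2 f x v w) \<^bold>\<and>
     (\<^bold>\<forall>x. \<^bold>\<forall>y. \<^bold>\<forall>z. rel2 f x y z \<^bold>\<longrightarrow> rel2 f y x z) \<^bold>\<and>
     e \<^bold>\<in> R \<^bold>\<and>
     (\<^bold>\<forall>x. x \<^bold>\<in> R \<^bold>\<longrightarrow> rel2 f x e x))"

definition is_field :: "nat \<Rightarrow> nat \<Rightarrow> nat \<Rightarrow> nat \<Rightarrow> nat \<Rightarrow> form" where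
  "is_field R add mul zero one =
    (comm_monoid_op R add zero \<^bold>\<and>
     (\<^bold>\<forall>x. x \<^bold>\<in> R \<^bold>\<longrightarrow> (\<^bold>\<exists>y. rel2 add x y zero)) \<^bold>\<and>
     comm_monoid_op R mul one \<^bold>\<and>
     (\<^bold>\<forall>x. x \<^bold>\<in> R \<^bold>\<and> \<^bold>\<not> x \<^bold>= zero \<^bold>\<longrightarrow> (\<^bold>\<exists>y. rel2 mul x y one)) \<^bold>\<and>
     \<^bold>\<not> zero \<^bold>= one \<^bold>\<and>
     (\<^bold>\<forall>x. \<^bold>\<forall>y. \<^bold>\<forall>z. \<^bold>\<forall>s. \<^bold>\<forall>u. \<^bold>\<forall>v. \<^bold>\<forall>w.
       rel2 add y z s \<^bold>\<and> rel2 mul x s w \<^bold>\<and> rel2 mul x y u \<^bold>\<and> rel2 mul x z v \<^bold>\<longrightarrow> rel2 add u v w))"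

definition is_strict_linorder :: "nat \<Rightarrow> nat \<Rightarrow> form" where
  "is_strict_linorder R lt =
    ((\<^bold>\<forall>x. x \<^bold>\<in> R \<^bold>\<longrightarrow> \<^bold>\<not> rel lt x x) \<^bold>\<and>
     (\<^bold>\<forall>x. \<^bold>\<forall>y. \<^bold>\<forall>z. x \<^bold>\<in> R \<^bold>\<and> y \<^bold>\<in> R \<^bold>\<and> z \<^bold>\<in> R \<^bold>\<and> rel lt x y \<^bold>\<and> rel lt y z \<^bold>\<longrightarrow> rel lt x z) \<^bold>\<and>
     (\<^bold>\<forall>x. \<^bold>\<forall>y. x \<^bold>\<in> R \<^bold>\<and> y \<^bold>\<in> R \<^bold>\<longrightarrow> rel lt x y \<^bold>\<or> x \<^bold>= y \<^bold>\<or> rel lt y x))"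

definition is_ordered_field :: "nat \<Rightarrow> nat \<Rightarrow> nat \<Rightarrow> nat \<Rightarrow> nat \<Rightarrow> nat \<Rightarrow> form" where
  "is_ordered_field R add mul zero one lt =
    (is_field R add mul zero one \<^bold>\<and>
     is_strict_linorder R lt \<^bold>\<and>
     (\<^bold>\<forall>x. \<^bold>\<forall>y. \<^bold>\<forall>z. \<^bold>\<forall>u. \<^bold>\<forall>v.
       x \<^bold>\<in> R \<^bold>\<and> y \<^bold>\<in> R \<^bold>\<and> rel lt x y \<^bold>\<and> rel2 add x z u \<^bold>\<and> rel2 add y z v \<^bold>\<longrightarrow> rel lt u v) \<^bold>\<and>
     (\<^bold>\<forall>x. \<^bold>\<forall>y. \<^bold>\<forall>z.
       x \<^bold>\<in> R \<^bold>\<and> y \<^bold>\<in> R \<^bold>\<and> rel lt zero x \<^bold>\<and> rel lt zero y \<^bold>\<and> rel2 mul x y z \<^bold>\<longrightarrow> rel lt zero z))"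

definition is_upper_bound :: "nat \<Rightarrow> nat \<Rightarrow> nat \<Rightarrow> nat \<Rightarrow> form" where
  "is_upper_bound b s R lt = (b \<^bold>\<in> R \<^bold>\<and> (\<^bold>\<forall>x. x \<^bold>\<in> s \<^bold>\<longrightarrow> x \<^bold>= b \<^bold>\<or> rel lt x b))"

definition is_order_complete :: "nat \<Rightarrow> nat \<Rightarrow> form" where
  "is_order_complete R lt =
    (\<^bold>\<forall>s. s \<^bold>\<subseteq> R \<^bold>\<and> nonempty s \<^bold>\<and> (\<^bold>\<exists>b. is_upper_bound b s R lt) \<^bold>\<longrightarrow>
      (\<^bold>\<exists>b. is_upper_bound b s R lt \<^bold>\<and>
        (\<^bold>\<forall>c. is_upper_bound c s R lt \<^bold>\<longrightarrow> b \<^bold>= c \<^bold>\<or> rel lt b c)))"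

text \<open>The topology generated by the bounded open intervals; it is the order topology if the order
  has no endpoints.\<close>

definition is_interval_topology :: "nat \<Rightarrow> nat \<Rightarrow> nat \<Rightarrow> form" where
  "is_interval_topology T R lt =
    (\<^bold>\<forall>u. u \<^bold>\<in> T \<^bold>\<longleftrightarrow>
      u \<^bold>\<subseteq> R \<^bold>\<and>
      (\<^bold>\<forall>x. x \<^bold>\<in> u \<^bold>\<longrightarrow>
        (\<^bold>\<exists>a. \<^bold>\<exists>b. a \<^bold>\<in> R \<^bold>\<and> b \<^bold>\<in> R \<^bold>\<and> rel lt a x \<^bold>\<and> rel lt x b \<^bold>\<and>
          (\<^bold>\<forall>y. y \<^bold>\<in> R \<^bold>\<and> rel lt a y \<^bold>\<and> rel lt y b \<^bold>\<longrightarrow> y \<^bold>\<in> u))))"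

text \<open>\<open>R\<close> is the underlying set of a complete ordered field and \<open>T\<close> its usual topology. Such a field
  exists (in ZFC) and is unique up to isomorphism, so this is the real line.\<close>

definition is_real_line :: "nat \<Rightarrow> nat \<Rightarrow> form" where
  "is_real_line R T =
    (\<^bold>\<exists>add. \<^bold>\<exists>mul. \<^bold>\<exists>zero. \<^bold>\<exists>one. \<^bold>\<exists>lt.
      is_ordered_field R add mul zero one lt \<^bold>\<and> is_order_complete R lt \<^bold>\<and>
      is_interval_topology T R lt)"


section \<open>The sentence claimed to be consistent\<close>

text \<open>Below, \<open>m = non(\<M>\<^sub>X)\<close>, \<open>c = cf[k]\<^sup>\<omega>\<close>, \<open>n = non(\<M>\<^sub>R)\<close> and \<open>p = c \<cdot> n\<close>; for cardinals, \<open>m < p\<close> means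
  \<open>m \<in> p\<close>.\<close>

definition small_non_meager_space :: fm where
  "small_non_meager_space =
    (\<^bold>\<exists>X. \<^bold>\<exists>T. \<^bold>\<exists>k.
      is_topology X T \<^bold>\<and> nonempty X \<^bold>\<and> compact X T \<^bold>\<and> hausdorff X T \<^bold>\<and> no_isolated_points X T \<^bold>\<and>
      is_cardinal k \<^bold>\<and> uniform_pi_weight k T \<^bold>\<and>
      (\<^bold>\<exists>R. \<^bold>\<exists>S. \<^bold>\<exists>m. \<^bold>\<exists>c. \<^bold>\<exists>n. \<^bold>\<exists>p.
        is_real_line R S \<^bold>\<and> is_non_meager m X T \<^bold>\<and> is_cf_countable_subsets c k \<^bold>\<and>
        is_non_meager n R S \<^bold>\<and> is_card_mult p c n \<^bold>\<and> m \<^bold>\<in> p)) 0"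

end

theory Submission
  imports Defs "HOL-Library.Countable" "HOL-Library.Infinite_Set"
begin

text \<open>The sentence is a theorem of ZFC, so by completeness and soundness of the calculus it suffices to
  verify it in an arbitrary model of ZFC.

  Let \<open>W\<close> be a set that contains \<open>\<omega>\<close> and is closed under ordered pairs, let \<open>V\<close> be the power set of \<open>W\<close> and
  \<open>I\<close> that of \<open>V\<close>, and let \<open>X\<close> be the Cantor cube of all subsets of \<open>I\<close>. Its uniform \<open>\<pi>\<close>-weight is
  \<open>\<kappa> = |I|\<close>. For \<open>a \<subseteq> V\<close> and \<open>t\<close> of size at most \<open>|W|\<close> consider the point \<open>{x \<in> I. x \<inter> a \<in> t}\<close> of \<open>X\<close>.
  There are at most \<open>|V|\<close> such points, and every intersection of countably many nested basic open sets
  contains one of them (as in the theorems of Hewitt-Marczewski-Pondiczery and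
  Engelking-Karlowicz), so that they form a non-meager set. Hence
  \<open>non(\<M>\<^sub>X) \<le> |V| < \<kappa> \<le> cf[\<kappa>]\<^sup>\<omega>\<close>. The real line enters only because it has to exist and to be
  non-meager in itself.\<close>

text \<open>Both lower bounds by |I|, for the \<pi>-weight and for cf[\<kappa>]^\<omega>, are one
  counting fact: a family of sets of size at most |V| that covers I has at least |I| members. A
  cofinal family covers \<kappa>, and a \<pi>-base covers I by finite sets, up to finitely many
  elements, once a finite point is chosen in each of its members. Two power sets are taken because
  the small sets \<open>a\<close> and \<open>t\<close> have to be coded by elements of V, which
  amounts to |V|^|W| = |V| and holds as V is a power set; the second one gives the strict gap. Facts
  like \<kappa> times \<kappa> = \<kappa> are bypassed: W is closed under pairing, and that closure
  passes to power sets. The obstacle is that a model is just a type with a relation, possibly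
  ill-founded from outside. Its ordinals, natural numbers and reals have to be built inside, and
  separation and replacement apply to definable predicates only, so every construction comes with a
  proof of definability.\<close>

hide_fact (open) proves.impI proves.impE proves.allI proves.allE

section \<open>Soundness and completeness\<close>

text \<open>Equality has its own relation \<open>Q\<close>: in the term model it is provable
  equality, and only the quotient turns it into identity. With de Bruijn indices a quantifier
  prepends the chosen element to the environment by \<open>case_nat\<close>.\<close>

primrec sat :: "('a \<Rightarrow> 'a \<Rightarrow> bool) \<Rightarrow> ('a \<Rightarrow> 'a \<Rightarrow> bool) \<Rightarrow> (nat \<Rightarrow> 'a) \<Rightarrow> fm \<Rightarrow> bool" where
  "sat E Q e (Mem i j) \<longleftrightarrow> E (e i) (e j)"
| "sat E Q e (Eq i j) \<longleftrightarrow> Q (e i) (e j)"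
| "sat E Q e Fls \<longleftrightarrow> False"
| "sat E Q e (Imp p q) \<longleftrightarrow> (sat E Q e p \<longrightarrow> sat E Q e q)"
| "sat E Q e (All p) \<longleftrightarrow> (\<forall>x. sat E Q (case_nat x e) p)"

lemma sat_ren: "sat E Q e (ren r p) \<longleftrightarrow> sat E Q (\<lambda>i. e (r i)) p"
proof (induction p arbitrary: e r)
  case (All p)
  have "(\<lambda>i. case_nat x e (case_nat 0 (\<lambda>i. Suc (r i)) i)) = case_nat x (\<lambda>i. e (r i))" for x
    by (auto split: nat.split)
  then show ?case by (simp add: All)
qed auto

lemma sat_cong_bounded:
  "bounded n p \<Longrightarrow> (\<And>i. i < n \<Longrightarrow> e i = e' i) \<Longrightarrow> sat E Q e p \<longleftrightarrow> sat E Q e' p"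
proof (induction p arbitrary: n e e')
  case (All p)
  have "sat E Q (case_nat x e) p \<longleftrightarrow> sat E Q (case_nat x e') p" for x
    by (rule All.IH[of "Suc n"]) (use All.prems in \<open>auto split: nat.split\<close>)
  then show ?case by simp
next
  case (Imp p q)
  then show ?case by (metis bounded.simps(4) sat.simps(4))
qed auto

lemma soundness: "\<Gamma> \<turnstile> p \<Longrightarrow> (\<And>q. q \<in> \<Gamma> \<Longrightarrow> sat E (=) e q) \<Longrightarrow> sat E (=) e p"
proof (induction arbitrary: e rule: proves.induct)
  case (allI \<Gamma> p)
  have "sat E (=) (case_nat x e) p" for x
    by (rule allI.IH) (auto simp: sat_ren allI.prems)
  then show ?case by simp
next
  case (allE \<Gamma> p t)
  have *: "(\<lambda>i. e (case i of 0 \<Rightarrow> t | Suc i \<Rightarrow> i)) = case_nat (e t) e"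
    by (auto split: nat.split)
  have "sat E (=) e (All p)" using allE by blast
  then show ?case by (simp add: sat_ren *)
next
  case (eq_subst \<Gamma> s t p)
  have "(\<lambda>i. e (case i of 0 \<Rightarrow> s | Suc i \<Rightarrow> i)) = (\<lambda>i. e (case i of 0 \<Rightarrow> t | Suc i \<Rightarrow> i))"
    using eq_subst.IH(1)[of e] eq_subst.prems by (auto split: nat.split)
  then show ?case
    using eq_subst.IH(2)[of e] eq_subst.prems by (simp add: sat_ren)
next
  case (contr p \<Gamma>)
  show ?case
  proof (rule ccontr)
    assume "\<not> ?case"
    then have "sat E (=) e q" if "q \<in> insert (Imp p Fls) \<Gamma>" for q
      using that contr.prems by auto
    from contr.IH[OF this] show False by simp
  qed
qed auto

section \<open>Renaming, weakening, finiteness and generalization in the calculus\<close>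

lemma ren_ren: "ren r (ren s p) = ren (\<lambda>i. r (s i)) p"
proof (induction p arbitrary: r s)
  case (All p)
  have "(\<lambda>i. case_nat 0 (\<lambda>i. Suc (r i)) (case_nat 0 (\<lambda>i. Suc (s i)) i)) =
    case_nat 0 (\<lambda>i. Suc (r (s i)))"
    by (auto split: nat.split)
  then show ?case by (simp add: All)
qed auto

lemma ren_cong_bounded:
  "bounded n p \<Longrightarrow> (\<And>i. i < n \<Longrightarrow> r i = s i) \<Longrightarrow> ren r p = ren s p"
proof (induction p arbitrary: n r s)
  case (All p)
  show ?case
    by (simp, rule All.IH[of "Suc n"]) (use All.prems in \<open>auto split: nat.split\<close>)
next
  case (Imp p q)
  then show ?case by (metis bounded.simps(4) ren.simps(4))
qed auto

lemma ren_id: "ren (\<lambda>i. i) p = p"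
proof (induction p)
  case (All p)
  have "case_nat 0 Suc = (\<lambda>i. i)" by (auto split: nat.split)
  then show ?case by (simp add: All)
qed auto

lemma bounded_ren: "bounded n p \<Longrightarrow> (\<And>i. i < n \<Longrightarrow> r i < m) \<Longrightarrow> bounded m (ren r p)"
proof (induction p arbitrary: n r m)
  case (All p)
  show ?case
    by (simp, rule All.IH[of "Suc n"]) (use All.prems in \<open>auto split: nat.split\<close>)
next
  case (Imp p q)
  then show ?case by (metis bounded.simps(4) ren.simps(4))
qed auto

lemma bounded_mono: "bounded n p \<Longrightarrow> n \<le> m \<Longrightarrow> bounded m p"
  using bounded_ren[of n p "\<lambda>i. i" m] by (simp add: ren_id)

lemma ex_bounded: "\<exists>n. bounded n p"
proof (induction p)
  case (Mem i j)
  show ?case by (rule exI[of _ "Suc (i + j)"]) simp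
next
  case (Eq i j)
  show ?case by (rule exI[of _ "Suc (i + j)"]) simp
next
  case (Imp p q)
  then obtain m n where "bounded m p" "bounded n q" by blast
  then have "bounded (max m n) (Imp p q)" by (auto intro: bounded_mono)
  then show ?case ..
next
  case (All p)
  then obtain n where "bounded n p" ..
  then have "bounded n (All p)" by (auto intro: bounded_mono)
  then show ?case ..
qed simp

lemma inst_ren: "inst t (ren (case_nat 0 (\<lambda>i. Suc (r i))) p) = ren (case_nat t r) p"
proof -
  have "(\<lambda>i. case_nat t (\<lambda>i. i) (case_nat 0 (\<lambda>i. Suc (r i)) i)) = case_nat t r"
    by (auto split: nat.split)
  then show ?thesis by (simp add: ren_ren)
qed

lemma ren_inst: "ren r (inst t p) = inst (r t) (ren (case_nat 0 (\<lambda>i. Suc (r i))) p)"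
proof -
  have "(\<lambda>i. r (case_nat t (\<lambda>i. i) i)) = case_nat (r t) r"
    by (auto split: nat.split)
  then have "ren r (inst t p) = ren (case_nat (r t) r) p" by (simp only: ren_ren)
  then show ?thesis by (simp only: inst_ren)
qed

lemma weaken: "\<Gamma> \<turnstile> p \<Longrightarrow> \<Gamma> \<subseteq> \<Delta> \<Longrightarrow> \<Delta> \<turnstile> p"
proof (induction arbitrary: \<Delta> rule: proves.induct)
  case (impI p \<Gamma> q)
  then show ?case by (meson insert_mono proves.impI)
next
  case (contr p \<Gamma>)
  then show ?case by (meson insert_mono proves.contr)
next
  case (allI \<Gamma> p)
  then show ?case by (meson image_mono proves.allI)
next
  case (eq_subst \<Gamma> s t p)
  then show ?case using proves.eq_subst[of \<Delta> s t p] by blast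
next
  case (allE \<Gamma> p t)
  then show ?case using proves.allE[of \<Delta> p t] by blast
qed (auto intro: proves.intros)

text \<open>Every rule has finitely many premises; for \<open>allI\<close>, a finite set of shifted
  hypotheses is the image of a finite subset of \<Gamma>. This carries consistency through the union
  of the Henkin sequence.\<close>

lemma proves_finite: "\<Gamma> \<turnstile> p \<Longrightarrow> \<exists>F. finite F \<and> F \<subseteq> \<Gamma> \<and> F \<turnstile> p"
proof (induction rule: proves.induct)
  case (assm p \<Gamma>)
  then show ?case by (intro exI[of _ "{p}"]) (auto intro: proves.assm)
next
  case (impI p \<Gamma> q)
  then obtain F where "finite F" "F \<subseteq> insert p \<Gamma>" "F \<turnstile> q" by blast
  then have "finite (F - {p})" "F - {p} \<subseteq> \<Gamma>" "insert p (F - {p}) \<turnstile> q"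
    by (auto intro: weaken)
  then show ?case by (meson proves.impI)
next
  case (impE \<Gamma> p q)
  then obtain F G where "finite F" "F \<subseteq> \<Gamma>" "F \<turnstile> Imp p q" "finite G" "G \<subseteq> \<Gamma>" "G \<turnstile> p" by blast
  then show ?case
    by (intro exI[of _ "F \<union> G"]) (auto intro: weaken proves.impE[of _ p])
next
  case (contr p \<Gamma>)
  then obtain F where "finite F" "F \<subseteq> insert (Imp p Fls) \<Gamma>" "F \<turnstile> Fls" by blast
  then have "finite (F - {Imp p Fls})" "F - {Imp p Fls} \<subseteq> \<Gamma>"
    "insert (Imp p Fls) (F - {Imp p Fls}) \<turnstile> Fls"
    by (auto intro: weaken)
  then show ?case by (meson proves.contr)
next
  case (allI \<Gamma> p)
  then obtain F where "finite F" "F \<subseteq> ren Suc ` \<Gamma>" "F \<turnstile> p" by blast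
  then show ?case by (metis finite_subset_image proves.allI)
next
  case (allE \<Gamma> p t)
  then show ?case using proves.allE[of _ p t] by blast
next
  case (eq_refl \<Gamma> t)
  show ?case by (intro exI[of _ "{}"]) (auto intro: proves.eq_refl)
next
  case (eq_subst \<Gamma> s t p)
  then obtain F G where "finite F" "F \<subseteq> \<Gamma>" "F \<turnstile> Eq s t" "finite G" "G \<subseteq> \<Gamma>" "G \<turnstile> inst s p" by blast
  then show ?case
    by (intro exI[of _ "F \<union> G"]) (auto intro: weaken proves.eq_subst[of _ s])
qed

lemma proves_ren: "\<Gamma> \<turnstile> p \<Longrightarrow> ren r ` \<Gamma> \<turnstile> ren r p"
proof (induction arbitrary: r rule: proves.induct)
  case (impI p \<Gamma> q)
  then show ?case by (auto intro: proves.impI)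
next
  case (impE \<Gamma> p q)
  then show ?case by (metis proves.impE ren.simps(4))
next
  case (contr p \<Gamma>)
  then show ?case by (auto intro: proves.contr)
next
  case (allI \<Gamma> p)
  have "ren (case_nat 0 (\<lambda>i. Suc (r i))) ` ren Suc ` \<Gamma> = ren Suc ` ren r ` \<Gamma>"
    by (simp add: image_image ren_ren)
  then show ?case using allI.IH[of "case_nat 0 (\<lambda>i. Suc (r i))"] by (auto intro: proves.allI)
next
  case (allE \<Gamma> p t)
  show ?case unfolding ren_inst by (rule proves.allE) (use allE.IH in simp)
next
  case (eq_refl \<Gamma> t)
  then show ?case by (auto intro: proves.eq_refl)
next
  case (eq_subst \<Gamma> s t p)
  show ?case unfolding ren_inst
    by (rule proves.eq_subst) (use eq_subst.IH in \<open>auto simp: ren_inst\<close>)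
qed (auto intro: proves.assm)

text \<open>The variable \<open>t\<close> is fresh for \<open>\<Gamma>\<close> and
  \<open>All p\<close>. Renaming \<open>t\<close> to 0 and shifting every other variable acts on
  \<Gamma> like \<open>Suc\<close> and undoes the instantiation, so that \<open>allI\<close>
  applies.\<close>

lemma proves_generalize:
  assumes "\<Gamma> \<turnstile> inst t p" and "\<And>q. q \<in> \<Gamma> \<Longrightarrow> bounded t q" and "bounded t (All p)"
  shows "\<Gamma> \<turnstile> All p"
proof (rule proves.allI)
  define r where "r i = (if i = t then 0 else Suc i)" for i
  have "ren r ` \<Gamma> = ren Suc ` \<Gamma>"
    using assms(2) by (intro image_cong refl ren_cong_bounded[of t]) (auto simp: r_def)
  moreover have "ren r (inst t p) = ren (\<lambda>i. i) p"
    unfolding ren_ren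
    by (rule ren_cong_bounded[of "Suc t"]) (use assms(3) in \<open>auto simp: r_def split: nat.split\<close>)
  ultimately show "ren Suc ` \<Gamma> \<turnstile> p"
    using proves_ren[OF assms(1), of r] by (simp add: ren_id)
qed

lemma inconsistent_insert: "\<not> consistent (insert p \<Gamma>) \<Longrightarrow> \<Gamma> \<turnstile> Imp p Fls"
  by (simp add: consistent_def proves.impI)

section \<open>Henkin completion of a theory\<close>

instance fm :: countable
  by countable_datatype

text \<open>Variables that do not occur in the formulas collected so far serve as Henkin witnesses; they
  exist because the initial theory consists of sentences.\<close>

definition henkin_step :: "fm set \<Rightarrow> fm \<Rightarrow> fm set" where
  "henkin_step \<Gamma> p =
    (if consistent (insert p \<Gamma>) then
       insert p \<Gamma> \<union>
       {Imp (inst (SOME t. \<forall>r \<in> insert p \<Gamma>. bounded t r) q) Fls | q. p = Imp (All q) Fls}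
     else \<Gamma>)"

primrec henkin_seq :: "fm set \<Rightarrow> nat \<Rightarrow> fm set" where
  "henkin_seq T 0 = T"
| "henkin_seq T (Suc n) = henkin_step (henkin_seq T n) (from_nat n)"

definition henkin :: "fm set \<Rightarrow> fm set" where
  "henkin T = (\<Union>n. henkin_seq T n)"

lemma henkin_step_mono: "\<Gamma> \<subseteq> henkin_step \<Gamma> p"
  by (auto simp: henkin_step_def)

text \<open>The invariant is one bound for the variables of the whole, possibly infinite set. A step
  adds at most two formulas, so a bound survives and a fresh variable is available at the next
  step.\<close>

lemma henkin_step_bounded:
  assumes "\<forall>q \<in> \<Gamma>. bounded n q" shows "\<exists>m. \<forall>q \<in> henkin_step \<Gamma> p. bounded m q"
proof -
  let ?t = "SOME t. \<forall>r \<in> insert p \<Gamma>. bounded t r"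
  obtain k where "bounded k p" using ex_bounded by blast
  show ?thesis
  proof (cases "\<exists>q. p = Imp (All q) Fls")
    case True
    then obtain q where q: "p = Imp (All q) Fls" by blast
    obtain l where "bounded l (inst ?t q)" using ex_bounded by blast
    with \<open>bounded k p\<close> assms q show ?thesis
      by (intro exI[of _ "max (max n k) l"])
        (auto simp: henkin_step_def intro: bounded_mono split: if_splits)
  next
    case False
    with \<open>bounded k p\<close> assms show ?thesis
      by (intro exI[of _ "max n k"])
        (auto simp: henkin_step_def intro: bounded_mono split: if_splits)
  qed
qed

text \<open>Were the witness formula inconsistent with the rest, the calculus would prove the
  instance at a fresh variable and hence the universal formula that \<open>p\<close> denies.\<close>

lemma henkin_step_consistent:
  assumes "\<forall>q \<in> \<Gamma>. bounded n q" and "consistent \<Gamma>" shows "consistent (henkin_step \<Gamma> p)"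
proof (cases "consistent (insert p \<Gamma>)")
  case True
  let ?P = "\<lambda>t. \<forall>r \<in> insert p \<Gamma>. bounded t r"
  obtain k where "bounded k p" using ex_bounded by blast
  with assms(1) have "?P (max n k)" by (auto intro: bounded_mono)
  then have t: "?P (SOME t. ?P t)" by (rule someI)
  show ?thesis
  proof (cases "\<exists>q. p = Imp (All q) Fls")
    case True
    then obtain q where q: "p = Imp (All q) Fls" by blast
    show ?thesis
    proof (rule ccontr)
      assume "\<not> consistent (henkin_step \<Gamma> p)"
      then have "insert (Imp (inst (SOME t. ?P t) q) Fls) (insert p \<Gamma>) \<turnstile> Fls"
        using \<open>consistent (insert p \<Gamma>)\<close> by (simp add: henkin_step_def consistent_def q)
      then have "insert p \<Gamma> \<turnstile> inst (SOME t. ?P t) q" by (rule proves.contr)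
      then have "insert p \<Gamma> \<turnstile> All q"
        by (rule proves_generalize) (use t q in auto)
      moreover have "insert p \<Gamma> \<turnstile> Imp (All q) Fls" using q by (auto intro: proves.assm)
      ultimately show False using \<open>consistent (insert p \<Gamma>)\<close> unfolding consistent_def
        by (meson proves.impE)
    qed
  next
    case False
    with \<open>consistent (insert p \<Gamma>)\<close> show ?thesis by (simp add: henkin_step_def)
  qed
next
  case False
  with assms(2) show ?thesis by (simp add: henkin_step_def)
qed

locale henkin_theory =
  fixes T :: "fm set"
  assumes sentences: "\<And>q. q \<in> T \<Longrightarrow> bounded 0 q" and cons: "consistent T"
begin

lemma seq_bounded_consistent:
  "(\<exists>m. \<forall>q \<in> henkin_seq T n. bounded m q) \<and> consistent (henkin_seq T n)"
proof (induction n)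
  case 0
  then show ?case using sentences cons by auto
next
  case (Suc n)
  then show ?case using henkin_step_bounded henkin_step_consistent by auto
qed

lemma seq_mono: "m \<le> n \<Longrightarrow> henkin_seq T m \<subseteq> henkin_seq T n"
  by (rule lift_Suc_mono_le) (auto intro: henkin_step_mono[THEN subsetD])

lemma finite_sub_henkin:
  "finite F \<Longrightarrow> F \<subseteq> henkin T \<Longrightarrow> \<exists>n. F \<subseteq> henkin_seq T n"
proof (induction rule: finite_induct)
  case (insert x F)
  then obtain m n where "F \<subseteq> henkin_seq T n" "x \<in> henkin_seq T m" by (auto simp: henkin_def)
  then have "insert x F \<subseteq> henkin_seq T (max m n)"
    using seq_mono[of m "max m n"] seq_mono[of n "max m n"] by auto
  then show ?case ..
qed auto

lemma henkin_consistent: "consistent (henkin T)"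
proof -
  have "\<not> henkin T \<turnstile> Fls"
    using proves_finite finite_sub_henkin seq_bounded_consistent weaken unfolding consistent_def
    by metis
  then show ?thesis by (simp add: consistent_def)
qed

lemma henkin_maximal: "consistent (insert p (henkin T)) \<Longrightarrow> p \<in> henkin T"
proof -
  assume "consistent (insert p (henkin T))"
  then have "consistent (insert p (henkin_seq T (to_nat p)))"
    unfolding consistent_def henkin_def by (meson UN_upper UNIV_I insert_mono weaken)
  then have "p \<in> henkin_seq T (Suc (to_nat p))" by (simp add: henkin_step_def)
  then show "p \<in> henkin T" unfolding henkin_def by blast
qed

lemma henkin_closed: "henkin T \<turnstile> p \<Longrightarrow> p \<in> henkin T"
  using henkin_maximal henkin_consistent inconsistent_insert unfolding consistent_def
  by (metis proves.impE)

lemma henkin_Fls: "Fls \<notin> henkin T"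
  using henkin_consistent by (auto simp: consistent_def intro: proves.assm)

lemma henkin_neg: "p \<notin> henkin T \<Longrightarrow> Imp p Fls \<in> henkin T"
  using henkin_maximal inconsistent_insert henkin_closed by blast

lemma henkin_Imp: "Imp p q \<in> henkin T \<longleftrightarrow> (p \<in> henkin T \<longrightarrow> q \<in> henkin T)"
proof
  show "Imp p q \<in> henkin T \<Longrightarrow> p \<in> henkin T \<longrightarrow> q \<in> henkin T"
    by (meson henkin_closed proves.assm proves.impE)
next
  assume *: "p \<in> henkin T \<longrightarrow> q \<in> henkin T"
  show "Imp p q \<in> henkin T"
  proof (cases "p \<in> henkin T")
    case True
    with * have "insert p (henkin T) \<turnstile> q" by (auto intro: proves.assm)
    then show ?thesis by (meson henkin_closed proves.impI)
  next
    case False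
    then have "Imp p Fls \<in> henkin T" by (rule henkin_neg)
    then have "insert (Imp q Fls) (insert p (henkin T)) \<turnstile> Fls"
      by (meson insertI1 insertI2 proves.assm proves.impE)
    then show ?thesis by (meson henkin_closed proves.impI proves.contr)
  qed
qed

lemma henkin_All: "All p \<in> henkin T \<longleftrightarrow> (\<forall>t. inst t p \<in> henkin T)"
proof
  show "All p \<in> henkin T \<Longrightarrow> \<forall>t. inst t p \<in> henkin T"
    using henkin_closed proves.assm proves.allE[of "henkin T" p] by blast
next
  assume *: "\<forall>t. inst t p \<in> henkin T"
  show "All p \<in> henkin T"
  proof (rule ccontr)
    assume "All p \<notin> henkin T"
    then have neg: "Imp (All p) Fls \<in> henkin T" by (rule henkin_neg)
    \<comment> \<open>The number of the stage at which the denied universal formula is considered,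
      and hence at which its witness enters.\<close>
    let ?n = "to_nat (Imp (All p) Fls)"
    have "insert (Imp (All p) Fls) (henkin_seq T ?n) \<subseteq> henkin T"
      using neg by (auto simp: henkin_def)
    then have "consistent (insert (Imp (All p) Fls) (henkin_seq T ?n))"
      using henkin_consistent weaken unfolding consistent_def by blast
    then have "\<exists>t. Imp (inst t p) Fls \<in> henkin_seq T (Suc ?n)"
      by (auto simp: henkin_step_def)
    then obtain t where "Imp (inst t p) Fls \<in> henkin T" unfolding henkin_def by blast
    with * show False using henkin_Imp henkin_Fls by blast
  qed
qed

section \<open>The term model and its quotient\<close>

abbreviation hmem where "hmem i j \<equiv> Mem i j \<in> henkin T"
abbreviation heq where "heq i j \<equiv> Eq i j \<in> henkin T"

text \<open>Variables are the only terms, so they are the elements of the term model and an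
  environment is itself a renaming. This makes the truth lemma a statement about
  \<open>ren e p\<close>.\<close>

lemma sat_henkin: "sat hmem heq e p \<longleftrightarrow> ren e p \<in> henkin T"
proof (induction p arbitrary: e)
  case (All p)
  then show ?case by (simp add: henkin_All inst_ren)
qed (auto simp: henkin_Fls henkin_Imp)

lemma sat_henkin_T: "p \<in> T \<Longrightarrow> sat hmem heq e p"
proof -
  assume "p \<in> T"
  then have "ren e p = p" using ren_cong_bounded[OF sentences, of p e "\<lambda>i. i"] by (simp add: ren_id)
  moreover have "p \<in> henkin T" using \<open>p \<in> T\<close> unfolding henkin_def by (auto intro: exI[of _ 0])
  ultimately show ?thesis by (simp only: sat_henkin)
qed

lemma heq_refl: "heq s s"
  by (auto intro: henkin_closed proves.eq_refl)

lemma heq_subst: "heq s t \<Longrightarrow> inst s p \<in> henkin T \<Longrightarrow> inst t p \<in> henkin T"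
  using henkin_closed proves.assm proves.eq_subst[of "henkin T" s t p] by blast

lemma heq_sym: "heq s t \<Longrightarrow> heq t s"
  using heq_subst[of s t "Eq 0 (Suc s)"] heq_refl by simp

lemma heq_trans: "heq s t \<Longrightarrow> heq t u \<Longrightarrow> heq s u"
  using heq_subst[of t u "Eq (Suc s) 0"] by simp

lemma hmem_cong: "heq s s' \<Longrightarrow> heq t t' \<Longrightarrow> hmem s t \<Longrightarrow> hmem s' t'"
  using heq_subst[of t t' "Mem (Suc s) 0"] heq_subst[of s s' "Mem 0 (Suc t')"] by simp

lemma sat_heq: "(\<And>i. heq (e i) (e' i)) \<Longrightarrow> sat hmem heq e p \<longleftrightarrow> sat hmem heq e' p"
proof (induction p arbitrary: e e')
  case (Mem i j)
  have "heq (e k) (e' k)" "heq (e' k) (e k)" for k using Mem heq_sym by auto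
  then show ?case
    using hmem_cong[of "e i" "e' i" "e j" "e' j"] hmem_cong[of "e' i" "e i" "e' j" "e j"] by auto
next
  case (Eq i j)
  have "heq (e k) (e' k)" "heq (e' k) (e k)" for k using Eq heq_sym by auto
  then show ?case
    using heq_trans[of "e i" "e' i" "e' j"] heq_trans[of "e i" "e' j" "e j"]
      heq_trans[of "e' i" "e i" "e j"] heq_trans[of "e' i" "e j" "e' j"] by auto
next
  case (All p)
  have "sat hmem heq (case_nat x e) p \<longleftrightarrow> sat hmem heq (case_nat x e') p" for x
    by (rule All.IH) (auto simp: All.prems heq_refl split: nat.split)
  then show ?case by simp
next
  case (Imp p q)
  then show ?case unfolding sat.simps by blast
qed auto

text \<open>Instead of forming classes, \<open>f\<close> lists one representative for each of them;
  the quotient then lives on the index type, with identity as equality.\<close>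

lemma sat_quotient:
  assumes surj: "\<And>t. \<exists>i. heq t (f i)" and inj: "\<And>i j. heq (f i) (f j) \<longleftrightarrow> i = j"
  shows "sat (\<lambda>i j. hmem (f i) (f j)) (=) e p \<longleftrightarrow> sat hmem heq (\<lambda>i. f (e i)) p"
proof (induction p arbitrary: e)
  case (All p)
  have *: "(\<lambda>i. f (case_nat x e i)) = case_nat (f x) (\<lambda>i. f (e i))" for x
    by (auto split: nat.split)
  have "sat hmem heq (case_nat t (\<lambda>i. f (e i))) p"
    if "\<forall>x. sat hmem heq (case_nat (f x) (\<lambda>i. f (e i))) p" for t
  proof -
    obtain x where "heq t (f x)" using surj by blast
    then have "sat hmem heq (case_nat t (\<lambda>i. f (e i))) p \<longleftrightarrow>
        sat hmem heq (case_nat (f x) (\<lambda>i. f (e i))) p"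
      by (intro sat_heq) (auto simp: heq_refl split: nat.split)
    with that show ?thesis by simp
  qed
  then have "(\<forall>x. sat hmem heq (case_nat (f x) (\<lambda>i. f (e i))) p) \<longleftrightarrow>
    (\<forall>t. sat hmem heq (case_nat t (\<lambda>i. f (e i))) p)" by blast
  then show ?case by (simp add: All *)
qed (simp_all add: inj)

text \<open>The equivalence classes of variables are enumerated by the natural numbers if there are
  infinitely many of them, which holds as soon as there is an injection that is not surjective.\<close>

lemma ex_infinite_model:
  assumes s: "\<And>x y. heq (s x) (s y) \<longleftrightarrow> heq x y" and z: "\<And>x. \<not> heq (s x) z"
  shows "\<exists>E :: nat \<Rightarrow> nat \<Rightarrow> bool. \<forall>p \<in> T. \<forall>e. sat E (=) e p"
proof -
  define rep where "rep x = (LEAST y. heq x y)" for x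
  have rep: "heq x (rep x)" for x
    unfolding rep_def by (rule LeastI[of _ x]) (rule heq_refl)
  have rep_eq: "heq x y \<longleftrightarrow> rep x = rep y" for x y
  proof
    assume "heq x y"
    then have "heq x w \<longleftrightarrow> heq y w" for w by (metis heq_sym heq_trans)
    then show "rep x = rep y" by (simp add: rep_def)
  next
    assume "rep x = rep y"
    then show "heq x y" using rep[of x] rep[of y] by (metis heq_sym heq_trans)
  qed
  have rep_rep: "rep (rep x) = rep x" for x
    using rep rep_eq by metis
  \<comment> \<open>The elements z, s z, s (s z), ... are pairwise inequivalent: cancelling
    \<open>s\<close> from an equality between two of them ends in an equality of \<open>z\<close>
    with a value of \<open>s\<close>.\<close>
  have s_inj: "heq ((s ^^ m) z) ((s ^^ n) z) \<Longrightarrow> m = n" for m n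
  proof (induction m arbitrary: n)
    case 0
    then show ?case using z heq_sym by (cases n) auto
  next
    case (Suc m)
    then show ?case using z s by (cases n) auto
  qed
  have "inj (\<lambda>n. rep ((s ^^ n) z))"
    by (rule injI) (use s_inj rep_eq in blast)
  then have inf: "infinite (range rep)"
    by (metis finite_imageD finite_subset image_subset_iff infinite_UNIV_nat rangeI)
  define f where "f = enumerate (range rep)"
  have bij: "bij_betw f UNIV (range rep)"
    unfolding f_def using inf by (rule bij_enumerate)
  have surj: "\<exists>i. heq t (f i)" for t
    using bij rep[of t] by (metis bij_betw_imp_surj_on imageE rangeI)
  have inj: "heq (f i) (f j) \<longleftrightarrow> i = j" for i j
  proof -
    have "rep (f k) = f k" for k
      using bij rep_rep by (metis bij_betw_imp_surj_on imageE rangeI)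
    then show ?thesis
      using bij by (metis bij_betw_imp_inj_on injD rep_eq)
  qed
  show ?thesis
    using sat_quotient[of f, OF surj inj] sat_henkin_T by blast
qed

end

section \<open>Reading the formulas in a structure\<close>

text \<open>The variable of level \<open>x\<close> has index \<open>d - Suc x\<close> at depth
  \<open>d\<close> and \<open>d - x\<close> below one more quantifier. Its value is thus unaffected
  by entering the quantifier, and this rule lets the simplifier evaluate all formulas written with
  levels.\<close>

lemma lookup [simp]: "x < d \<Longrightarrow> case_nat a e (d - x) = e (d - Suc x)"
  by (metis Suc_diff_Suc old.nat.simps(5))

lemma sat_mem [simp]: "sat E Q e ((x \<^bold>\<in> y) d) \<longleftrightarrow> E (e (d - Suc x)) (e (d - Suc y))"
  by (simp add: mem_def)

lemma sat_equ [simp]: "sat E Q e ((x \<^bold>= y) d) \<longleftrightarrow> Q (e (d - Suc x)) (e (d - Suc y))"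
  by (simp add: equ_def)

lemma sat_imp [simp]: "sat E Q e ((F \<^bold>\<longrightarrow> G) d) \<longleftrightarrow> (sat E Q e (F d) \<longrightarrow> sat E Q e (G d))"
  by (simp add: imp_def)

lemma sat_neg [simp]: "sat E Q e ((\<^bold>\<not> F) d) \<longleftrightarrow> \<not> sat E Q e (F d)"
  by (simp add: neg_def)

lemma sat_disj [simp]: "sat E Q e ((F \<^bold>\<or> G) d) \<longleftrightarrow> sat E Q e (F d) \<or> sat E Q e (G d)"
  by (auto simp add: disj_def)

lemma sat_conj [simp]: "sat E Q e ((F \<^bold>\<and> G) d) \<longleftrightarrow> sat E Q e (F d) \<and> sat E Q e (G d)"
  by (auto simp add: conj_def)

lemma sat_iff [simp]: "sat E Q e ((F \<^bold>\<longleftrightarrow> G) d) \<longleftrightarrow> (sat E Q e (F d) \<longleftrightarrow> sat E Q e (G d))"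
  by (auto simp add: iff_def)

lemma sat_all [simp]: "sat E Q e ((\<^bold>\<forall>x. F x) d) \<longleftrightarrow> (\<forall>a. sat E Q (case_nat a e) (F d (Suc d)))"
  by (simp add: all_def)

lemma sat_ex [simp]: "sat E Q e ((\<^bold>\<exists>x. F x) d) \<longleftrightarrow> (\<exists>a. sat E Q (case_nat a e) (F d (Suc d)))"
  by (simp add: ex_def)

lemma bounded_app: "bounded n p \<Longrightarrow> (\<And>i. i < n \<Longrightarrow> vs ! i < d) \<Longrightarrow> bounded d (app p vs d)"
  unfolding app_def by (rule bounded_ren[of n]) (assumption, fastforce)

lemma bounded_All_pow: "bounded (m + n) p \<Longrightarrow> bounded m ((All ^^ n) p)"
  by (induction n arbitrary: m p) auto

text \<open>The \<open>n\<close> quantifiers are instantiated from the outside in by e (n - 1), ...,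
  e 0; this supplies the parameters of the axiom schemas.\<close>

lemma sat_All_pow: "sat E Q (\<lambda>i. e (i + n)) ((All ^^ n) p) \<Longrightarrow> sat E Q e p"
proof (induction n)
  case (Suc n)
  have "case_nat (e n) (\<lambda>i. e (i + Suc n)) = (\<lambda>i. e (i + n))" by (auto split: nat.split)
  with Suc show ?case by (auto dest: spec[of _ "e n"])
qed simp

lemmas form_defs = mem_def equ_def imp_def neg_def disj_def conj_def iff_def all_def ex_def ex1_def

lemma ZFC_bounded: "p \<in> ZFC \<Longrightarrow> bounded 0 p"
proof -
  have sep: "bounded 0 (ax_separation n q)" if "bounded (n + 2) q" for n q
  proof -
    have "bounded (Suc (Suc (Suc n))) (app q (Suc (Suc n) # n # [0..<n]) (Suc (Suc (Suc n))))"
      using that by (rule bounded_app) (auto simp: nth_Cons nth_append split: nat.split)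
    then show ?thesis
      unfolding ax_separation_def by (intro bounded_All_pow) (simp add: form_defs)
  qed
  have rep: "bounded 0 (ax_replacement n q)" if "bounded (n + 2) q" for n q
  proof -
    have "bounded (Suc (Suc (Suc n))) (app q (n # Suc n # [0..<n]) (Suc (Suc (Suc n))))"
      "bounded (Suc (Suc (Suc n))) (app q (n # Suc (Suc n) # [0..<n]) (Suc (Suc (Suc n))))"
      "bounded (Suc (Suc (Suc (Suc n)))) (app q (Suc (Suc (Suc n)) # Suc (Suc n) # [0..<n]) (Suc (Suc (Suc (Suc n)))))"
      using that
      by - ((rule bounded_app, assumption, auto simp: nth_Cons nth_append split: nat.split)[1])+
    then show ?thesis
      unfolding ax_replacement_def by (intro bounded_All_pow) (simp add: form_defs)
  qed
  show "p \<in> ZFC \<Longrightarrow> bounded 0 p"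
    unfolding ZFC_def using sep rep
    by (auto simp: ax_extensionality_def ax_foundation_def ax_pairing_def ax_union_def ax_power_def
      ax_infinity_def ax_choice_def form_defs nonempty_def is_upair_def is_Union_def sub_def
      is_succ_def is_func_def is_pair_def rel_def)
qed

lemma axioms_in_ZFC:
  "ax_extensionality \<in> ZFC" "ax_foundation \<in> ZFC" "ax_pairing \<in> ZFC" "ax_union \<in> ZFC"
  "ax_power \<in> ZFC" "ax_infinity \<in> ZFC" "ax_choice \<in> ZFC"
  by (simp_all add: ZFC_def)

text \<open>Forming singletons respects and reflects \<open>heq\<close> and never yields the empty
  set, which is what makes the quotient of the term model infinite. The model can therefore be taken
  on the natural numbers with identity as equality.\<close>

theorem ZFC_model:
  assumes "consistent ZFC"
  shows "\<exists>E :: nat \<Rightarrow> nat \<Rightarrow> bool. \<forall>p \<in> ZFC. \<forall>e. sat E (=) e p"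
proof -
  interpret henkin_theory ZFC
    by unfold_locales (use ZFC_bounded assms in auto)
  have "sat hmem heq e ax_pairing" "sat hmem heq e ax_infinity" for e
    by (auto intro!: sat_henkin_T axioms_in_ZFC)
  then have pair: "\<forall>x y. \<exists>p. \<forall>z. hmem z p \<longleftrightarrow> heq z x \<or> heq z y"
    and "\<exists>z. \<forall>x. \<not> hmem x z"
    by (auto simp: ax_pairing_def ax_infinity_def is_upair_def is_succ_def nonempty_def numeral_2_eq_2 simp del: lookup)
  from pair have "\<forall>x. \<exists>p. \<forall>z. hmem z p \<longleftrightarrow> heq z x"
    using pair[rule_format, of x x for x] by simp
  from choice[OF this] obtain s where s: "\<And>x z. hmem z (s x) \<longleftrightarrow> heq z x" by blast
  from \<open>\<exists>z. \<forall>x. \<not> hmem x z\<close> obtain z where z: "\<And>x. \<not> hmem x z" by blast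
  show ?thesis
  proof (rule ex_infinite_model[of s z])
    fix x y
    show "heq (s x) (s y) \<longleftrightarrow> heq x y"
    proof
      assume "heq (s x) (s y)"
      then have "hmem x (s y)" using hmem_cong[OF heq_refl] heq_refl s by blast
      then show "heq x y" by (simp add: s)
    next
      assume xy: "heq x y"
      have "sat hmem heq (\<lambda>_. x) ax_extensionality"
        by (rule sat_henkin_T) (rule axioms_in_ZFC)
      then have "\<And>a b. (\<forall>z. hmem z a \<longleftrightarrow> hmem z b) \<Longrightarrow> heq a b"
        by (simp add: ax_extensionality_def numeral_2_eq_2)
      then show "heq (s x) (s y)" using xy by (metis heq_sym heq_trans s)
    qed
  next
    fix x
    show "\<not> heq (s x) z"
      using z s heq_refl hmem_cong by blast
  qed
qed

section \<open>Definable predicates over a model of ZFC\<close>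

text \<open>A predicate \<open>P\<close> of environments is definable if it is the interpretation of a formula with
  parameters; the even variables of the formula stand for the environment, the odd ones for the
  parameters. The closure rules collected in \<open>definable\<close> leave no formula to be written by hand.\<close>

named_theorems definable

locale zfc =
  fixes E :: "'m \<Rightarrow> 'm \<Rightarrow> bool" (infix "\<epsilon>" 50)
  assumes ZFC: "p \<in> ZFC \<Longrightarrow> sat E (=) e p"
begin

definition mix :: "(nat \<Rightarrow> 'm) \<Rightarrow> (nat \<Rightarrow> 'm) \<Rightarrow> nat \<Rightarrow> 'm" where
  "mix e g i = (if even i then e (i div 2) else g (i div 2))"

lemma mix_simps [simp]: "mix e g 0 = e 0" "mix e g (2 * i) = e i" "mix e g (Suc (2 * i)) = g i"
  by (auto simp: mix_def)

lemma mix_eqI: "(\<And>i. h (2 * i) = e i) \<Longrightarrow> (\<And>i. h (Suc (2 * i)) = g i) \<Longrightarrow> h = mix e g"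
  by (rule ext) (auto simp: mix_def elim!: evenE oddE)

definition D :: "((nat \<Rightarrow> 'm) \<Rightarrow> bool) \<Rightarrow> bool" where
  "D P \<longleftrightarrow> (\<exists>p g. \<forall>e. P e \<longleftrightarrow> sat E (=) (mix e g) p)"

text \<open>The counterpart of \<open>D\<close> for terms: the graph of \<open>t\<close> is
  definable, with the value in variable 0 and the arguments shifted by one.\<close>

definition DT :: "((nat \<Rightarrow> 'm) \<Rightarrow> 'm) \<Rightarrow> bool" where
  "DT t \<longleftrightarrow> D (\<lambda>e. e 0 = t (\<lambda>n. e (Suc n)))"

lemma D_mem0: "D (\<lambda>e. e i \<epsilon> e j)"
  unfolding D_def by (rule exI[of _ "Mem (2 * i) (2 * j)"]) simp

lemma D_eq0: "D (\<lambda>e. e i = e j)"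
  unfolding D_def by (rule exI[of _ "Eq (2 * i) (2 * j)"]) simp

lemma D_const [definable]: "D (\<lambda>e. c)"
proof (cases c)
  case True
  then show ?thesis using D_eq0[of 0 0] by simp
next
  case False
  then show ?thesis unfolding D_def by (intro exI[of _ Fls]) simp
qed

lemma D_imp [definable]:
  assumes "D P" "D Q" shows "D (\<lambda>e. P e \<longrightarrow> Q e)"
proof -
  obtain p g q h where p: "\<And>e. P e \<longleftrightarrow> sat E (=) (mix e g) p"
    and q: "\<And>e. Q e \<longleftrightarrow> sat E (=) (mix e h) q"
    using assms by (auto simp: D_def)
  \<comment> \<open>The two parameter lists are merged by a second \<open>mix\<close>: the odd
    variables of \<open>p\<close> are redirected to the even places of the merged list, those of
    \<open>q\<close> to its odd places.\<close>
  let ?r = "\<lambda>c i. if even i then i else Suc (2 * (2 * (i div 2) + c))"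
  have "(\<lambda>i. mix e (mix g h) (?r 0 i)) = mix e g" "(\<lambda>i. mix e (mix g h) (?r 1 i)) = mix e h" for e
    by (auto intro!: mix_eqI simp: mix_def)
  then show ?thesis unfolding D_def
    by (intro exI[of _ "Imp (ren (?r 0) p) (ren (?r 1) q)"] exI[of _ "mix g h"])
      (simp only: sat.simps sat_ren p q simp_thms)
qed

lemma D_not [definable]: "D P \<Longrightarrow> D (\<lambda>e. \<not> P e)"
  using D_imp[of P "\<lambda>e. False"] by (simp add: D_const)

lemma D_or [definable]: "D P \<Longrightarrow> D Q \<Longrightarrow> D (\<lambda>e. P e \<or> Q e)"
  using D_imp[of "\<lambda>e. \<not> P e" Q] D_not[of P] by (simp add: imp_conv_disj)

lemma D_and [definable]: "D P \<Longrightarrow> D Q \<Longrightarrow> D (\<lambda>e. P e \<and> Q e)"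
  using D_not[OF D_or[of "\<lambda>e. \<not> P e" "\<lambda>e. \<not> Q e"]] D_not[of P] D_not[of Q] by simp

lemma D_iff [definable]: "D P \<Longrightarrow> D Q \<Longrightarrow> D (\<lambda>e. P e \<longleftrightarrow> Q e)"
  using D_and[OF D_imp[of P Q] D_imp[of Q P]] by (simp add: iff_conv_conj_imp)

lemma D_reindex: "D P \<Longrightarrow> D (\<lambda>e. P (\<lambda>n. e (f n)))"
proof -
  assume "D P"
  then obtain p g where p: "\<And>e. P e \<longleftrightarrow> sat E (=) (mix e g) p" by (auto simp: D_def)
  let ?r = "\<lambda>i. if even i then 2 * f (i div 2) else i"
  have "(\<lambda>i. mix e g (?r i)) = mix (\<lambda>n. e (f n)) g" for e
    by (auto intro!: mix_eqI)
  then show ?thesis unfolding D_def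
    by (intro exI[of _ "ren ?r p"] exI[of _ g]) (simp only: sat_ren p simp_thms)
qed

lemma D_all [definable]:
  assumes "D (\<lambda>e. R (e 0) (\<lambda>n. e (Suc n)))" shows "D (\<lambda>e. \<forall>x. R x e)"
proof -
  obtain p g where p: "\<And>e. R (e 0) (\<lambda>n. e (Suc n)) \<longleftrightarrow> sat E (=) (mix e g) p"
    using assms by (auto simp: D_def)
  \<comment> \<open>Variable 0 is the one to be bound. The other environment variables, which are
    even, lose one place of the environment, and all free variables then move up by one to make room
    for the binder.\<close>
  let ?r = "\<lambda>i. if i = 0 then 0 else if even i then Suc (2 * (i div 2 - 1)) else Suc i"
  have "(\<lambda>i. case_nat x (mix e g) (?r i)) = mix (case_nat x e) g" for x e
    by (auto intro!: mix_eqI split: nat.split)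
  moreover have "R x e \<longleftrightarrow> sat E (=) (mix (case_nat x e) g) p" for x e
    using p[of "case_nat x e"] by simp
  ultimately show ?thesis unfolding D_def
    by (intro exI[of _ "All (ren ?r p)"] exI[of _ g]) (simp only: sat.simps sat_ren simp_thms)
qed

lemma D_ex [definable]: "D (\<lambda>e. R (e 0) (\<lambda>n. e (Suc n))) \<Longrightarrow> D (\<lambda>e. \<exists>x. R x e)"
  using D_not[OF D_all[of "\<lambda>x e. \<not> R x e"]] D_not by simp

lemma DT_var [definable]: "DT (\<lambda>e. e i)"
  unfolding DT_def by (rule D_eq0)

lemma DT_const [definable]: "DT (\<lambda>e. c)"
  unfolding DT_def D_def by (rule exI[of _ "Eq 0 1"], rule exI[of _ "\<lambda>_. c"]) (auto simp: mix_def)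

lemma D_eq_term: "DT t \<Longrightarrow> D (\<lambda>e. e i = t (\<lambda>n. e (f n)))"
  unfolding DT_def by (drule D_reindex[of _ "case_nat i f"]) simp

lemma DT_reindex: "DT t \<Longrightarrow> DT (\<lambda>e. t (\<lambda>n. e (f n)))"
  unfolding DT_def[of "\<lambda>e. t (\<lambda>n. e (f n))"] by (rule D_eq_term)

lemma D_app1:
  assumes "D (\<lambda>e. P (e 0))" "DT s" shows "D (\<lambda>e. P (s e))"
proof -
  have "D (\<lambda>e. \<exists>x. x = s e \<and> P x)"
    using D_reindex[OF assms(1), of "\<lambda>_. 0"] assms(2)
    by (intro D_ex D_and D_eq_term) auto
  then show ?thesis by simp
qed

lemma D_app2:
  assumes "D (\<lambda>e. P (e 0) (e 1))" "DT s" "DT t" shows "D (\<lambda>e. P (s e) (t e))"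
proof -
  have "D (\<lambda>e. \<exists>x y. x = s e \<and> y = t e \<and> P x y)"
    using D_reindex[OF assms(1), of "case_nat 1 (\<lambda>_. 0)"] assms(2,3)
    by (intro D_ex D_and D_eq_term) auto
  then show ?thesis by simp
qed

lemma D_app3:
  assumes "D (\<lambda>e. P (e 0) (e 1) (e 2))" "DT s" "DT t" "DT u" shows "D (\<lambda>e. P (s e) (t e) (u e))"
proof -
  have "D (\<lambda>e. \<exists>x y z. x = s e \<and> y = t e \<and> z = u e \<and> P x y z)"
    using D_reindex[OF assms(1), of "case_nat 2 (case_nat 1 (\<lambda>_. 0))"] assms(2,3,4)
    by (intro D_ex D_and D_eq_term) (auto simp: numeral_2_eq_2)
  then show ?thesis by simp
qed

lemma D_app4:
  assumes "D (\<lambda>e. P (e 0) (e 1) (e 2) (e 3))" "DT s" "DT t" "DT u" "DT v"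
  shows "D (\<lambda>e. P (s e) (t e) (u e) (v e))"
proof -
  have "D (\<lambda>e. \<exists>x y z w. x = s e \<and> y = t e \<and> z = u e \<and> w = v e \<and> P x y z w)"
    using D_reindex[OF assms(1), of "case_nat 3 (case_nat 2 (case_nat 1 (\<lambda>_. 0)))"] assms(2-5)
    by (intro D_ex D_and D_eq_term) (auto simp: numeral_2_eq_2 numeral_3_eq_3)
  then show ?thesis by simp
qed

lemma D_mem [definable]: "DT s \<Longrightarrow> DT t \<Longrightarrow> D (\<lambda>e. s e \<epsilon> t e)"
  by (rule D_app2[of "\<lambda>x y. x \<epsilon> y"]) (rule D_mem0)

lemma D_eq [definable]: "DT s \<Longrightarrow> DT t \<Longrightarrow> D (\<lambda>e. s e = t e)"
  by (rule D_app2[of "\<lambda>x y. x = y"]) (rule D_eq0)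

lemma D_ex1 [definable]:
  assumes "D (\<lambda>e. R (e 0) (\<lambda>n. e (Suc n)))" shows "D (\<lambda>e. \<exists>!x. R x e)"
proof -
  have "D (\<lambda>e. R (e (f 0)) (\<lambda>n. e (f (Suc n))))" for f
    using D_reindex[OF assms, of f] .
  from this[of "\<lambda>n. n"] this[of "case_nat 0 (\<lambda>n. Suc (Suc n))"]
  show ?thesis unfolding Ex1_def by (intro definable) simp_all
qed

lemma DT_app1: "DT (\<lambda>e. F (e 0)) \<Longrightarrow> DT s \<Longrightarrow> DT (\<lambda>e. F (s e))"
  unfolding DT_def[of "\<lambda>e. F (_ e)"]
  by (rule D_app2[of "\<lambda>z x. z = F x"]) (simp_all add: DT_def[of "\<lambda>e. F (e 0)"] DT_var DT_reindex)

lemma DT_app2: "DT (\<lambda>e. F (e 0) (e 1)) \<Longrightarrow> DT s \<Longrightarrow> DT t \<Longrightarrow> DT (\<lambda>e. F (s e) (t e))"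
  unfolding DT_def[of "\<lambda>e. F (_ e) (_ e)"]
  by (rule D_app3[of "\<lambda>z x y. z = F x y"])
    (simp_all add: DT_def[of "\<lambda>e. F (e 0) (e _)"] DT_var DT_reindex numeral_2_eq_2)

lemma DT_app3:
  "DT (\<lambda>e. F (e 0) (e 1) (e 2)) \<Longrightarrow> DT s \<Longrightarrow> DT t \<Longrightarrow> DT u \<Longrightarrow> DT (\<lambda>e. F (s e) (t e) (u e))"
  unfolding DT_def[of "\<lambda>e. F (_ e) (_ e) (_ e)"]
  by (rule D_app4[of "\<lambda>z x y w. z = F x y w"])
    (simp_all add: DT_def[of "\<lambda>e. F (e 0) (e _) (e _)"] DT_var DT_reindex numeral_2_eq_2 numeral_3_eq_3)

section \<open>Separation and replacement for definable predicates\<close>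

lemma extensionality: "(\<And>z. z \<epsilon> x \<longleftrightarrow> z \<epsilon> y) \<Longrightarrow> x = y"
  using ZFC[of ax_extensionality "\<lambda>_. undefined", OF axioms_in_ZFC(1)]
  by (simp add: ax_extensionality_def numeral_2_eq_2)

text \<open>By extensionality a set-valued term is definable as soon as membership in its value is.
  Hence the new operations below are given by a membership rule, which settles their definability as
  well.\<close>

lemma DT_ext:
  assumes "\<And>z e. z \<epsilon> t e \<longleftrightarrow> R z e" and "D (\<lambda>e. R (e 0) (\<lambda>n. e (Suc n)))" shows "DT t"
proof -
  have "e 0 = t (\<lambda>n. e (Suc n)) \<longleftrightarrow> (\<forall>z. z \<epsilon> e 0 \<longleftrightarrow> R z (\<lambda>n. e (Suc n)))" for e
    using extensionality[of "e 0" "t (\<lambda>n. e (Suc n))"] by (auto simp: assms(1))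
  moreover have "D (\<lambda>e. R (e 0) (\<lambda>n. e (Suc (Suc n))))"
    using D_reindex[OF assms(2), of "case_nat 0 (\<lambda>n. Suc (Suc n))"] by simp
  ultimately show ?thesis unfolding DT_def by (simp only:) (intro definable)
qed

lemma separation_fm: "\<exists>b. \<forall>z. z \<epsilon> b \<longleftrightarrow> z \<epsilon> a \<and> sat E (=) (case_nat z g) p"
proof -
  obtain m where "bounded m p" using ex_bounded by blast
  then have m: "bounded (Suc m) p" by (rule bounded_mono) simp
  \<comment> \<open>The schema reserves variable 1 for the set \<open>a\<close>, so all variables of
    \<open>p\<close> except 0 are moved up by one.\<close>
  let ?q = "ren (case_nat 0 (\<lambda>i. Suc (Suc i))) p"
  have q: "bounded (m + 2) ?q" by (rule bounded_ren[OF m]) (auto split: nat.split)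
  \<comment> \<open>Parameters are addressed by level in the schema and by index in
    \<open>g\<close>; the two count in opposite directions.\<close>
  let ?e = "\<lambda>j. g (m - Suc j)"
  have "sat E (=) e (ax_separation m ?q)" for e
    by (rule ZFC) (use q in \<open>auto simp: ZFC_def\<close>)
  then have "sat E (=) (\<lambda>i. ?e (i + m)) (ax_separation m ?q)" .
  from sat_All_pow[OF this[unfolded ax_separation_def]]
  have "\<exists>b. \<forall>z. z \<epsilon> b \<longleftrightarrow> z \<epsilon> a \<and>
      sat E (=) (case_nat z (case_nat b (case_nat a ?e))) (app ?q (Suc (Suc m) # m # [0..<m]) (Suc (Suc (Suc m))))"
    by (simp add: Suc_diff_le)
  moreover have "sat E (=) (case_nat z (case_nat b (case_nat a ?e))) (app ?q (Suc (Suc m) # m # [0..<m]) (Suc (Suc (Suc m))))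
    \<longleftrightarrow> sat E (=) (case_nat z g) p" for z b
    unfolding app_def sat_ren
    by (rule sat_cong_bounded[OF m]) (auto simp: nth_Cons Suc_diff_le split: nat.split)
  ultimately show ?thesis by simp
qed

lemma replacement_fm:
  assumes "\<And>x y z. sat E (=) (case_nat x (case_nat y g)) p \<Longrightarrow> sat E (=) (case_nat x (case_nat z g)) p \<Longrightarrow> y = z"
  shows "\<exists>b. \<forall>y. y \<epsilon> b \<longleftrightarrow> (\<exists>x. x \<epsilon> a \<and> sat E (=) (case_nat x (case_nat y g)) p)"
proof -
  obtain m where "bounded m p" using ex_bounded by blast
  then have m: "bounded (m + 2) p" by (rule bounded_mono) simp
  let ?e = "\<lambda>j. g (m - Suc j)"
  have "sat E (=) e (ax_replacement m p)" for e
    by (rule ZFC) (use m in \<open>auto simp: ZFC_def\<close>)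
  then have "sat E (=) (\<lambda>i. ?e (i + m)) (ax_replacement m p)" .
  note ax = sat_All_pow[OF this[unfolded ax_replacement_def]]
  have 1: "sat E (=) (case_nat z (case_nat y (case_nat x ?e))) (app p (m # Suc m # [0..<m]) (Suc (Suc (Suc m))))
    \<longleftrightarrow> sat E (=) (case_nat x (case_nat y g)) p" for x y z
    unfolding app_def sat_ren
    by (rule sat_cong_bounded[OF m]) (auto simp: nth_Cons Suc_diff_le split: nat.split)
  have 2: "sat E (=) (case_nat z (case_nat y (case_nat x ?e))) (app p (m # Suc (Suc m) # [0..<m]) (Suc (Suc (Suc m))))
    \<longleftrightarrow> sat E (=) (case_nat x (case_nat z g)) p" for x y z
    unfolding app_def sat_ren
    by (rule sat_cong_bounded[OF m]) (auto simp: nth_Cons Suc_diff_le split: nat.split)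
  have 3: "sat E (=) (case_nat x (case_nat y (case_nat b (case_nat a ?e))))
      (app p (Suc (Suc (Suc m)) # Suc (Suc m) # [0..<m]) (Suc (Suc (Suc (Suc m)))))
    \<longleftrightarrow> sat E (=) (case_nat x (case_nat y g)) p" for x y a b
    unfolding app_def sat_ren
    by (rule sat_cong_bounded[OF m]) (auto simp: nth_Cons Suc_diff_le split: nat.split)
  let ?A = "\<lambda>x y. sat E (=) (case_nat x (case_nat y g)) p"
  have imp: "(\<forall>x y z. ?A x y \<and> ?A x z \<longrightarrow> y = z) \<longrightarrow> (\<forall>a. \<exists>b. \<forall>y. y \<epsilon> b \<longleftrightarrow> (\<exists>x. x \<epsilon> a \<and> ?A x y))"
    using ax by (simp add: 1 2 3 Suc_diff_le)
  have prem: "\<forall>x y z. ?A x y \<and> ?A x z \<longrightarrow> y = z"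
  proof (intro allI impI)
    fix x y z
    assume "?A x y \<and> ?A x z"
    then show "y = z" using assms[of x y z] by simp
  qed
  show ?thesis using mp[OF imp prem] by (rule spec)
qed

lemma separation: "D (\<lambda>e. P (e 0)) \<Longrightarrow> \<exists>b. \<forall>z. z \<epsilon> b \<longleftrightarrow> z \<epsilon> a \<and> P z"
proof -
  assume "D (\<lambda>e. P (e 0))"
  then obtain p g where p: "\<And>e. P (e 0) \<longleftrightarrow> sat E (=) (mix e g) p" by (auto simp: D_def)
  have *: "(\<lambda>i. case_nat z g (if even i then 0 else Suc (i div 2))) = mix (\<lambda>_. z) g" for z
    by (auto intro!: mix_eqI)
  have "P z \<longleftrightarrow> sat E (=) (case_nat z g) (ren (\<lambda>i. if even i then 0 else Suc (i div 2)) p)" for z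
    unfolding sat_ren * using p[of "\<lambda>_. z"] by simp
  then show ?thesis using separation_fm by simp
qed

lemma replacement:
  assumes "D (\<lambda>e. R (e 0) (e 1))" and fn: "\<And>x y z. R x y \<Longrightarrow> R x z \<Longrightarrow> y = z"
  shows "\<exists>b. \<forall>y. y \<epsilon> b \<longleftrightarrow> (\<exists>x. x \<epsilon> a \<and> R x y)"
proof -
  obtain p g where p: "\<And>e. R (e 0) (e 1) \<longleftrightarrow> sat E (=) (mix e g) p" using assms(1) by (auto simp: D_def)
  let ?r = "\<lambda>i. if even i then (if i = 0 then 0 else 1) else Suc (Suc (i div 2))"
  have *: "(\<lambda>i. case_nat x (case_nat y g) (?r i)) = mix (case_nat x (\<lambda>_. y)) g" for x y
    by (auto intro!: mix_eqI split: nat.split)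
  have R: "sat E (=) (case_nat x (case_nat y g)) (ren ?r p) \<longleftrightarrow> R x y" for x y
    unfolding sat_ren * using p[of "case_nat x (\<lambda>_. y)"] by simp
  show ?thesis using replacement_fm[of g "ren ?r p" a, unfolded R] fn by blast
qed

text \<open>\<open>Sep\<close> and \<open>Rep\<close> accept arbitrary predicates and functions of
  the metalogic; their membership rules are available for definable ones, where the description is
  known to denote.\<close>

definition Sep :: "'m \<Rightarrow> ('m \<Rightarrow> bool) \<Rightarrow> 'm" where
  "Sep a P = (THE b. \<forall>z. z \<epsilon> b \<longleftrightarrow> z \<epsilon> a \<and> P z)"

definition Rep :: "'m \<Rightarrow> ('m \<Rightarrow> 'm) \<Rightarrow> 'm" where
  "Rep a F = (THE b. \<forall>y. y \<epsilon> b \<longleftrightarrow> (\<exists>x. x \<epsilon> a \<and> y = F x))"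

lemma the_set: "\<exists>b. \<forall>z. z \<epsilon> b \<longleftrightarrow> P z \<Longrightarrow> z \<epsilon> (THE b. \<forall>z. z \<epsilon> b \<longleftrightarrow> P z) \<longleftrightarrow> P z"
proof -
  assume "\<exists>b. \<forall>z. z \<epsilon> b \<longleftrightarrow> P z"
  then have "\<exists>!b. \<forall>z. z \<epsilon> b \<longleftrightarrow> P z" by (metis extensionality)
  from theI'[OF this] show ?thesis by blast
qed

lemma Sep_iff: "D (\<lambda>e. P (e 0)) \<Longrightarrow> z \<epsilon> Sep a P \<longleftrightarrow> z \<epsilon> a \<and> P z"
  unfolding Sep_def by (rule the_set) (rule separation)

lemma Rep_iff:
  assumes "DT (\<lambda>e. F (e 0))" shows "y \<epsilon> Rep a F \<longleftrightarrow> (\<exists>x. x \<epsilon> a \<and> y = F x)"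
  unfolding Rep_def
  by (rule the_set, rule replacement[of "\<lambda>x y. y = F x"]) (intro definable DT_app1[OF assms], simp)

end

section \<open>Elementary set theory inside the model\<close>

context zfc
begin

definition subs :: "'m \<Rightarrow> 'm \<Rightarrow> bool" (infix "\<sqsubseteq>" 50) where
  "a \<sqsubseteq> b \<longleftrightarrow> (\<forall>z. z \<epsilon> a \<longrightarrow> z \<epsilon> b)"

lemma subsI [intro]: "(\<And>z. z \<epsilon> a \<Longrightarrow> z \<epsilon> b) \<Longrightarrow> a \<sqsubseteq> b"
  by (simp add: subs_def)

lemma subsD: "a \<sqsubseteq> b \<Longrightarrow> z \<epsilon> a \<Longrightarrow> z \<epsilon> b"
  by (simp add: subs_def)

lemma subs_refl [simp]: "a \<sqsubseteq> a"
  by (simp add: subs_def)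

lemma subs_antisym: "a \<sqsubseteq> b \<Longrightarrow> b \<sqsubseteq> a \<Longrightarrow> a = b"
  by (rule extensionality) (auto simp: subs_def)

lemma D_subs [definable]: "DT s \<Longrightarrow> DT t \<Longrightarrow> D (\<lambda>e. s e \<sqsubseteq> t e)"
  by (rule D_app2[of subs]) (unfold subs_def, intro definable)

text \<open>This is the pattern for the whole vocabulary: a simplification rule replaces each
  formula by a predicate on the model. The side conditions say that the levels are in scope.\<close>

lemma sat_sub [simp]: "x < d \<Longrightarrow> y < d \<Longrightarrow>
  sat E (=) e ((x \<^bold>\<subseteq> y) d) \<longleftrightarrow> e (d - Suc x) \<sqsubseteq> e (d - Suc y)"
  by (simp add: sub_def subs_def)

lemma sat_nonempty [simp]: "x < d \<Longrightarrow> sat E (=) e (nonempty x d) \<longleftrightarrow> (\<exists>z. z \<epsilon> e (d - Suc x))"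
  by (simp add: nonempty_def)

definition emp :: 'm where "emp = Sep undefined (\<lambda>_. False)"

lemma emp_iff [simp]: "\<not> z \<epsilon> emp"
  by (simp add: emp_def Sep_iff D_const)

lemma emp_eqI: "(\<And>z. \<not> z \<epsilon> a) \<Longrightarrow> a = emp"
  by (rule extensionality) simp

definition up :: "'m \<Rightarrow> 'm \<Rightarrow> 'm" where
  "up x y = (THE p. \<forall>z. z \<epsilon> p \<longleftrightarrow> z = x \<or> z = y)"

lemma up_iff [simp]: "z \<epsilon> up x y \<longleftrightarrow> z = x \<or> z = y"
  unfolding up_def
  by (rule the_set) (use ZFC[of ax_pairing "\<lambda>_. undefined", OF axioms_in_ZFC(3)] in
    \<open>simp add: ax_pairing_def is_upair_def numeral_2_eq_2\<close>)

definition Uni :: "'m \<Rightarrow> 'm" where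
  "Uni a = (THE u. \<forall>z. z \<epsilon> u \<longleftrightarrow> (\<exists>y. y \<epsilon> a \<and> z \<epsilon> y))"

lemma Uni_iff [simp]: "z \<epsilon> Uni a \<longleftrightarrow> (\<exists>y. y \<epsilon> a \<and> z \<epsilon> y)"
  unfolding Uni_def
  by (rule the_set) (use ZFC[of ax_union "\<lambda>_. undefined", OF axioms_in_ZFC(4)] in
    \<open>simp add: ax_union_def is_Union_def numeral_2_eq_2\<close>)

definition Pw :: "'m \<Rightarrow> 'm" where
  "Pw a = (THE u. \<forall>z. z \<epsilon> u \<longleftrightarrow> z \<sqsubseteq> a)"

lemma Pw_iff [simp]: "z \<epsilon> Pw a \<longleftrightarrow> z \<sqsubseteq> a"
  unfolding Pw_def
  by (rule the_set) (use ZFC[of ax_power "\<lambda>_. undefined", OF axioms_in_ZFC(5)] in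
    \<open>simp add: ax_power_def numeral_2_eq_2\<close>)

lemma DT_up [definable]: "DT s \<Longrightarrow> DT t \<Longrightarrow> DT (\<lambda>e. up (s e) (t e))"
  by (rule DT_app2[of up], rule DT_ext, rule up_iff, intro definable)

lemma DT_Uni [definable]: "DT s \<Longrightarrow> DT (\<lambda>e. Uni (s e))"
  by (rule DT_app1[of Uni], rule DT_ext, rule Uni_iff, intro definable)

definition un :: "'m \<Rightarrow> 'm \<Rightarrow> 'm" where "un a b = Uni (up a b)"

lemma un_iff [simp]: "z \<epsilon> un a b \<longleftrightarrow> z \<epsilon> a \<or> z \<epsilon> b"
  by (auto simp: un_def)

lemma DT_un [definable]: "DT s \<Longrightarrow> DT t \<Longrightarrow> DT (\<lambda>e. un (s e) (t e))"
  unfolding un_def by (intro definable)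

definition cap :: "'m \<Rightarrow> 'm \<Rightarrow> 'm" where "cap a b = Sep a (\<lambda>z. z \<epsilon> b)"

lemma cap_iff [simp]: "z \<epsilon> cap a b \<longleftrightarrow> z \<epsilon> a \<and> z \<epsilon> b"
  unfolding cap_def by (rule Sep_iff) (intro definable)

lemma DT_cap [definable]: "DT s \<Longrightarrow> DT t \<Longrightarrow> DT (\<lambda>e. cap (s e) (t e))"
  by (rule DT_app2[of cap], rule DT_ext, rule cap_iff, intro definable)

definition dif :: "'m \<Rightarrow> 'm \<Rightarrow> 'm" where "dif a b = Sep a (\<lambda>z. \<not> z \<epsilon> b)"

lemma dif_iff [simp]: "z \<epsilon> dif a b \<longleftrightarrow> z \<epsilon> a \<and> \<not> z \<epsilon> b"
  unfolding dif_def by (rule Sep_iff) (intro definable)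

lemma DT_dif [definable]: "DT s \<Longrightarrow> DT t \<Longrightarrow> DT (\<lambda>e. dif (s e) (t e))"
  by (rule DT_app2[of dif], rule DT_ext, rule dif_iff, intro definable)

definition ins :: "'m \<Rightarrow> 'm \<Rightarrow> 'm" where "ins x a = un a (up x x)"

lemma ins_iff [simp]: "z \<epsilon> ins x a \<longleftrightarrow> z = x \<or> z \<epsilon> a"
  by (auto simp: ins_def)

lemma DT_ins [definable]: "DT s \<Longrightarrow> DT t \<Longrightarrow> DT (\<lambda>e. ins (s e) (t e))"
  unfolding ins_def by (intro definable)

definition sc :: "'m \<Rightarrow> 'm" where "sc x = ins x x"

lemma sc_iff [simp]: "z \<epsilon> sc x \<longleftrightarrow> z = x \<or> z \<epsilon> x"
  by (auto simp: sc_def)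

lemma DT_sc [definable]: "DT s \<Longrightarrow> DT (\<lambda>e. sc (s e))"
  unfolding sc_def by (intro definable)

definition pr :: "'m \<Rightarrow> 'm \<Rightarrow> 'm" where "pr x y = up (up x x) (up x y)"

lemma up_eq: "up x y = up u v \<longleftrightarrow> x = u \<and> y = v \<or> x = v \<and> y = u"
proof
  assume "up x y = up u v"
  then have "\<And>z. z = x \<or> z = y \<longleftrightarrow> z = u \<or> z = v" by (metis up_iff)
  then show "x = u \<and> y = v \<or> x = v \<and> y = u" by metis
next
  assume "x = u \<and> y = v \<or> x = v \<and> y = u"
  then show "up x y = up u v" by (intro extensionality) auto
qed

lemma pr_eq [simp]: "pr x y = pr u v \<longleftrightarrow> x = u \<and> y = v"
  unfolding pr_def by (auto simp: up_eq)

lemma pr_nonempty: "pr x y \<noteq> emp"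
  by (metis emp_iff pr_def up_iff)

lemma DT_pr [definable]: "DT s \<Longrightarrow> DT t \<Longrightarrow> DT (\<lambda>e. pr (s e) (t e))"
  unfolding pr_def by (intro definable)

lemma sat_upair [simp]: "p < d \<Longrightarrow> x < d \<Longrightarrow> y < d \<Longrightarrow>
  sat E (=) e (is_upair p x y d) \<longleftrightarrow> e (d - Suc p) = up (e (d - Suc x)) (e (d - Suc y))"
  by (auto simp: is_upair_def intro: extensionality)

lemma sat_pair [simp]: "p < d \<Longrightarrow> x < d \<Longrightarrow> y < d \<Longrightarrow>
  sat E (=) e (is_pair p x y d) \<longleftrightarrow> e (d - Suc p) = pr (e (d - Suc x)) (e (d - Suc y))"
  by (auto simp: is_pair_def pr_def intro: extensionality)

lemma sat_succ [simp]: "p < d \<Longrightarrow> x < d \<Longrightarrow>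
  sat E (=) e (is_succ p x d) \<longleftrightarrow> e (d - Suc p) = sc (e (d - Suc x))"
  by (auto simp: is_succ_def intro: extensionality)

lemma sat_inter [simp]: "p < d \<Longrightarrow> x < d \<Longrightarrow> y < d \<Longrightarrow>
  sat E (=) e (is_inter p x y d) \<longleftrightarrow> e (d - Suc p) = cap (e (d - Suc x)) (e (d - Suc y))"
  by (auto simp: is_inter_def intro: extensionality)

lemma sat_Union [simp]: "p < d \<Longrightarrow> x < d \<Longrightarrow>
  sat E (=) e (is_Union p x d) \<longleftrightarrow> e (d - Suc p) = Uni (e (d - Suc x))"
  by (auto simp: is_Union_def intro: extensionality)

definition prd :: "'m \<Rightarrow> 'm \<Rightarrow> 'm" where
  "prd a b = Sep (Pw (Pw (un a b))) (\<lambda>p. \<exists>x y. x \<epsilon> a \<and> y \<epsilon> b \<and> p = pr x y)"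

lemma prd_iff: "p \<epsilon> prd a b \<longleftrightarrow> (\<exists>x y. x \<epsilon> a \<and> y \<epsilon> b \<and> p = pr x y)"
proof -
  have "p \<epsilon> prd a b \<longleftrightarrow> p \<epsilon> Pw (Pw (un a b)) \<and> (\<exists>x y. x \<epsilon> a \<and> y \<epsilon> b \<and> p = pr x y)"
    unfolding prd_def by (rule Sep_iff) (intro definable)
  then show ?thesis by (auto simp: pr_def subs_def)
qed

lemma pr_prd [simp]: "pr x y \<epsilon> prd a b \<longleftrightarrow> x \<epsilon> a \<and> y \<epsilon> b"
  by (auto simp: prd_iff)

lemma DT_prd [definable]: "DT s \<Longrightarrow> DT t \<Longrightarrow> DT (\<lambda>e. prd (s e) (t e))"
  by (rule DT_app2[of prd], rule DT_ext, rule prd_iff, intro definable)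

lemma sat_prod [simp]: "p < d \<Longrightarrow> x < d \<Longrightarrow> y < d \<Longrightarrow>
  sat E (=) e (is_prod p x y d) \<longleftrightarrow> e (d - Suc p) = prd (e (d - Suc x)) (e (d - Suc y))"
  by (auto simp: is_prod_def prd_iff intro: extensionality)

lemma sat_rel [simp]: "r < d \<Longrightarrow> x < d \<Longrightarrow> y < d \<Longrightarrow>
  sat E (=) e (rel r x y d) \<longleftrightarrow> pr (e (d - Suc x)) (e (d - Suc y)) \<epsilon> e (d - Suc r)"
  by (simp add: rel_def)

lemma sat_rel2 [simp]: "f < d \<Longrightarrow> x < d \<Longrightarrow> y < d \<Longrightarrow> z < d \<Longrightarrow> sat E (=) e (rel2 f x y z d) \<longleftrightarrow>
  pr (pr (e (d - Suc x)) (e (d - Suc y))) (e (d - Suc z)) \<epsilon> e (d - Suc f)"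
  by (simp add: rel2_def)

subsection \<open>Functions and equipollence\<close>

definition func :: "'m \<Rightarrow> 'm \<Rightarrow> 'm \<Rightarrow> bool" where
  "func f a b \<longleftrightarrow> (\<forall>p. p \<epsilon> f \<longrightarrow> (\<exists>x y. x \<epsilon> a \<and> y \<epsilon> b \<and> p = pr x y)) \<and>
    (\<forall>x. x \<epsilon> a \<longrightarrow> (\<exists>!y. pr x y \<epsilon> f))"

definition injection :: "'m \<Rightarrow> 'm \<Rightarrow> 'm \<Rightarrow> bool" where
  "injection f a b \<longleftrightarrow> func f a b \<and> (\<forall>x x' y. pr x y \<epsilon> f \<and> pr x' y \<epsilon> f \<longrightarrow> x = x')"

definition bijection :: "'m \<Rightarrow> 'm \<Rightarrow> 'm \<Rightarrow> bool" where
  "bijection f a b \<longleftrightarrow> injection f a b \<and> (\<forall>y. y \<epsilon> b \<longrightarrow> (\<exists>x. x \<epsilon> a \<and> pr x y \<epsilon> f))"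

definition lep :: "'m \<Rightarrow> 'm \<Rightarrow> bool" where "lep a b \<longleftrightarrow> (\<exists>f. injection f a b)"

definition eqp :: "'m \<Rightarrow> 'm \<Rightarrow> bool" where "eqp a b \<longleftrightarrow> (\<exists>f. bijection f a b)"

lemma D_func [definable]: "DT s \<Longrightarrow> DT t \<Longrightarrow> DT u \<Longrightarrow> D (\<lambda>e. func (s e) (t e) (u e))"
  by (rule D_app3[of func]) (unfold func_def, intro definable)

lemma D_injection [definable]: "DT s \<Longrightarrow> DT t \<Longrightarrow> DT u \<Longrightarrow> D (\<lambda>e. injection (s e) (t e) (u e))"
  by (rule D_app3[of injection]) (unfold injection_def, intro definable)

lemma D_bijection [definable]: "DT s \<Longrightarrow> DT t \<Longrightarrow> DT u \<Longrightarrow> D (\<lambda>e. bijection (s e) (t e) (u e))"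
  by (rule D_app3[of bijection]) (unfold bijection_def, intro definable)

lemma D_lep [definable]: "DT s \<Longrightarrow> DT t \<Longrightarrow> D (\<lambda>e. lep (s e) (t e))"
  by (rule D_app2[of lep]) (unfold lep_def, intro definable)

lemma D_eqp [definable]: "DT s \<Longrightarrow> DT t \<Longrightarrow> D (\<lambda>e. eqp (s e) (t e))"
  by (rule D_app2[of eqp]) (unfold eqp_def, intro definable)

lemma sat_ex1: "sat E (=) e ((\<^bold>\<exists>!x. F x) d) \<longleftrightarrow>
  (\<exists>a. sat E (=) (case_nat a e) (F d (Suc d)) \<and>
    (\<forall>b. sat E (=) (case_nat b (case_nat a e)) (F (Suc d) (Suc (Suc d))) \<longrightarrow> b = a))"
  by (simp add: ex1_def)

lemma sat_func [simp]: "f < d \<Longrightarrow> a < d \<Longrightarrow> b < d \<Longrightarrow>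
  sat E (=) e (is_func f a b d) \<longleftrightarrow> func (e (d - Suc f)) (e (d - Suc a)) (e (d - Suc b))"
  by (simp add: is_func_def func_def sat_ex1 Ex1_def)

lemma sat_injection [simp]: "f < d \<Longrightarrow> a < d \<Longrightarrow> b < d \<Longrightarrow>
  sat E (=) e (is_injection f a b d) \<longleftrightarrow> injection (e (d - Suc f)) (e (d - Suc a)) (e (d - Suc b))"
  by (simp add: is_injection_def injection_def)

lemma sat_bijection [simp]: "f < d \<Longrightarrow> a < d \<Longrightarrow> b < d \<Longrightarrow>
  sat E (=) e (is_bijection f a b d) \<longleftrightarrow> bijection (e (d - Suc f)) (e (d - Suc a)) (e (d - Suc b))"
  by (simp add: is_bijection_def bijection_def)

lemma sat_equipollent [simp]: "a < d \<Longrightarrow> b < d \<Longrightarrow>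
  sat E (=) e (equipollent a b d) \<longleftrightarrow> eqp (e (d - Suc a)) (e (d - Suc b))"
  by (simp add: equipollent_def eqp_def)

text \<open>As the union of all values at \<open>x\<close> this is a total term; for a function the
  union runs over a single value, and with no value it is \<open>emp\<close>. Kuratowski pairs place
  the second components in the double union of \<open>f\<close>.\<close>

definition ap :: "'m \<Rightarrow> 'm \<Rightarrow> 'm" where
  "ap f x = Uni (Sep (Uni (Uni f)) (\<lambda>y. pr x y \<epsilon> f))"

lemma ap_iff: "z \<epsilon> ap f x \<longleftrightarrow> (\<exists>y. pr x y \<epsilon> f \<and> z \<epsilon> y)"
proof -
  have "y \<epsilon> Sep (Uni (Uni f)) (\<lambda>y. pr x y \<epsilon> f) \<longleftrightarrow> y \<epsilon> Uni (Uni f) \<and> pr x y \<epsilon> f" for y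
    by (rule Sep_iff) (intro definable)
  moreover have "pr x y \<epsilon> f \<Longrightarrow> y \<epsilon> Uni (Uni f)" for y
    unfolding Uni_iff by (metis pr_def up_iff)
  ultimately have "y \<epsilon> Sep (Uni (Uni f)) (\<lambda>y. pr x y \<epsilon> f) \<longleftrightarrow> pr x y \<epsilon> f" for y by blast
  then show ?thesis by (auto simp: ap_def)
qed

lemma DT_ap [definable]: "DT s \<Longrightarrow> DT t \<Longrightarrow> DT (\<lambda>e. ap (s e) (t e))"
  by (rule DT_app2[of ap], rule DT_ext, rule ap_iff, intro definable)

lemma func_pr: "func f a b \<Longrightarrow> pr x y \<epsilon> f \<Longrightarrow> x \<epsilon> a \<and> y \<epsilon> b"
  unfolding func_def by (metis pr_eq)

lemma func_ap: "func f a b \<Longrightarrow> x \<epsilon> a \<Longrightarrow> pr x y \<epsilon> f \<longleftrightarrow> y = ap f x"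
proof -
  assume f: "func f a b" "x \<epsilon> a"
  then have "\<exists>!y. pr x y \<epsilon> f" by (simp add: func_def)
  then obtain y' where y': "pr x y' \<epsilon> f" "\<And>y. pr x y \<epsilon> f \<Longrightarrow> y = y'" by blast
  then have "pr x y \<epsilon> f \<longleftrightarrow> y = y'" for y by blast
  moreover from this have "ap f x = y'" by (intro extensionality) (simp add: ap_iff)
  ultimately show ?thesis by simp
qed

lemma ap_in: "func f a b \<Longrightarrow> x \<epsilon> a \<Longrightarrow> ap f x \<epsilon> b"
  using func_ap func_pr by blast

definition lam :: "'m \<Rightarrow> ('m \<Rightarrow> 'm) \<Rightarrow> 'm" where "lam a F = Rep a (\<lambda>x. pr x (F x))"

lemma lam_iff:
  assumes "DT (\<lambda>e. F (e 0))" shows "p \<epsilon> lam a F \<longleftrightarrow> (\<exists>x. x \<epsilon> a \<and> p = pr x (F x))"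
  unfolding lam_def by (rule Rep_iff) (intro definable DT_app1[OF assms])

lemma func_lam: "DT (\<lambda>e. F (e 0)) \<Longrightarrow> (\<And>x. x \<epsilon> a \<Longrightarrow> F x \<epsilon> b) \<Longrightarrow> func (lam a F) a b"
  unfolding func_def by (auto simp: lam_iff)

lemma ap_lam: "DT (\<lambda>e. F (e 0)) \<Longrightarrow> x \<epsilon> a \<Longrightarrow> ap (lam a F) x = F x"
  by (rule extensionality) (auto simp: ap_iff lam_iff)

text \<open>Together with \<open>lepE\<close> this trades injections that are sets of the model for
  definable functions of the metalogic: \<open>lam\<close> turns the latter into sets and
  \<open>ap\<close> leads back. Cardinality arguments can then compose functions directly.\<close>

lemma lepI:
  assumes F: "DT (\<lambda>e. F (e 0))" and "\<And>x. x \<epsilon> a \<Longrightarrow> F x \<epsilon> b"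
    and "\<And>x y. x \<epsilon> a \<Longrightarrow> y \<epsilon> a \<Longrightarrow> F x = F y \<Longrightarrow> x = y"
  shows "lep a b"
  unfolding lep_def injection_def
  by (rule exI[of _ "lam a F"]) (use assms func_lam[OF F] in \<open>auto simp: lam_iff\<close>)

lemma eqpI:
  assumes F: "DT (\<lambda>e. F (e 0))" and "\<And>x. x \<epsilon> a \<Longrightarrow> F x \<epsilon> b"
    and "\<And>x y. x \<epsilon> a \<Longrightarrow> y \<epsilon> a \<Longrightarrow> F x = F y \<Longrightarrow> x = y" and "\<And>y. y \<epsilon> b \<Longrightarrow> \<exists>x. x \<epsilon> a \<and> F x = y"
  shows "eqp a b"
  unfolding eqp_def bijection_def injection_def
  by (rule exI[of _ "lam a F"]) (use assms func_lam[OF F] in \<open>fastforce simp: lam_iff\<close>)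

lemma lepE:
  assumes "lep a b"
  obtains F where "DT (\<lambda>e. F (e 0))" "\<And>x. x \<epsilon> a \<Longrightarrow> F x \<epsilon> b"
    "\<And>x y. x \<epsilon> a \<Longrightarrow> y \<epsilon> a \<Longrightarrow> F x = F y \<Longrightarrow> x = y"
proof -
  obtain f where f: "injection f a b" using assms by (auto simp: lep_def)
  then have fn: "func f a b" by (simp add: injection_def)
  note fap = func_ap[OF fn]
  show thesis
  proof (rule that[of "ap f"])
    show "DT (\<lambda>e. ap f (e 0))" by (intro definable)
    show "x \<epsilon> a \<Longrightarrow> ap f x \<epsilon> b" for x by (rule ap_in[OF fn])
    show "x \<epsilon> a \<Longrightarrow> y \<epsilon> a \<Longrightarrow> ap f x = ap f y \<Longrightarrow> x = y" for x y
      using f fap[of x "ap f x"] fap[of y "ap f x"] unfolding injection_def by blast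
  qed
qed

lemma eqpE:
  assumes "eqp a b"
  obtains F where "DT (\<lambda>e. F (e 0))" "\<And>x. x \<epsilon> a \<Longrightarrow> F x \<epsilon> b"
    "\<And>x y. x \<epsilon> a \<Longrightarrow> y \<epsilon> a \<Longrightarrow> F x = F y \<Longrightarrow> x = y" "\<And>y. y \<epsilon> b \<Longrightarrow> \<exists>x. x \<epsilon> a \<and> F x = y"
proof -
  obtain f where f: "bijection f a b" using assms by (auto simp: eqp_def)
  then have inj: "injection f a b" and fn: "func f a b" by (simp_all add: injection_def bijection_def)
  note fap = func_ap[OF fn]
  show thesis
  proof (rule that[of "ap f"])
    show "DT (\<lambda>e. ap f (e 0))" by (intro definable)
    show "x \<epsilon> a \<Longrightarrow> ap f x \<epsilon> b" for x by (rule ap_in[OF fn])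
    show "x \<epsilon> a \<Longrightarrow> y \<epsilon> a \<Longrightarrow> ap f x = ap f y \<Longrightarrow> x = y" for x y
      using inj fap[of x "ap f x"] fap[of y "ap f x"] unfolding injection_def by blast
    show "y \<epsilon> b \<Longrightarrow> \<exists>x. x \<epsilon> a \<and> ap f x = y" for y
      using f fap unfolding bijection_def by metis
  qed
qed

lemma eqp_imp_lep: "eqp a b \<Longrightarrow> lep a b"
  by (auto simp: eqp_def lep_def bijection_def)

lemma lep_refl [simp]: "lep a a"
  by (rule lepI[of "\<lambda>x. x"]) (auto intro: definable)

lemma subs_imp_lep: "a \<sqsubseteq> b \<Longrightarrow> lep a b"
  by (rule lepI[of "\<lambda>x. x"]) (auto intro: definable subsD)

lemma eqp_refl [simp]: "eqp a a"
  by (rule eqpI[of "\<lambda>x. x"]) (auto intro: definable)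

lemma lep_trans: "lep a b \<Longrightarrow> lep b c \<Longrightarrow> lep a c"
proof (elim lepE)
  fix F G
  assume F: "DT (\<lambda>e. F (e 0))" and G: "DT (\<lambda>e. G (e 0))"
    and "\<And>x. x \<epsilon> a \<Longrightarrow> F x \<epsilon> b" "\<And>x y. x \<epsilon> a \<Longrightarrow> y \<epsilon> a \<Longrightarrow> F x = F y \<Longrightarrow> x = y"
    "\<And>x. x \<epsilon> b \<Longrightarrow> G x \<epsilon> c" "\<And>x y. x \<epsilon> b \<Longrightarrow> y \<epsilon> b \<Longrightarrow> G x = G y \<Longrightarrow> x = y"
  then show "lep a c"
    by (intro lepI[of "\<lambda>x. G (F x)"]) (auto intro: DT_app1[OF G] F)
qed

lemma eqp_trans: "eqp a b \<Longrightarrow> eqp b c \<Longrightarrow> eqp a c"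
proof (elim eqpE)
  fix F G
  assume F: "DT (\<lambda>e. F (e 0))" and G: "DT (\<lambda>e. G (e 0))"
    and *: "\<And>x. x \<epsilon> a \<Longrightarrow> F x \<epsilon> b" "\<And>x y. x \<epsilon> a \<Longrightarrow> y \<epsilon> a \<Longrightarrow> F x = F y \<Longrightarrow> x = y"
    "\<And>x. x \<epsilon> b \<Longrightarrow> G x \<epsilon> c" "\<And>x y. x \<epsilon> b \<Longrightarrow> y \<epsilon> b \<Longrightarrow> G x = G y \<Longrightarrow> x = y"
    "\<And>y. y \<epsilon> b \<Longrightarrow> \<exists>x. x \<epsilon> a \<and> F x = y" "\<And>y. y \<epsilon> c \<Longrightarrow> \<exists>x. x \<epsilon> b \<and> G x = y"
  have "\<exists>x. x \<epsilon> a \<and> G (F x) = y" if "y \<epsilon> c" for y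
    using *(5,6) that by metis
  with * show "eqp a c"
    by (intro eqpI[of "\<lambda>x. G (F x)"]) (auto intro: DT_app1[OF G] F)
qed

lemma eqp_sym: "eqp a b \<Longrightarrow> eqp b a"
proof -
  assume "eqp a b"
  then obtain f where f: "bijection f a b" by (auto simp: eqp_def)
  then have fn: "func f a b" by (simp add: bijection_def injection_def)
  define g where "g = Sep (prd b a) (\<lambda>p. \<exists>x y. p = pr y x \<and> pr x y \<epsilon> f)"
  have g: "p \<epsilon> g \<longleftrightarrow> p \<epsilon> prd b a \<and> (\<exists>x y. p = pr y x \<and> pr x y \<epsilon> f)" for p
    unfolding g_def by (rule Sep_iff) (intro definable)
  have "bijection g b a"
    using f func_pr[OF fn] func_ap[OF fn]
    unfolding bijection_def injection_def func_def by (fastforce simp: g prd_iff)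
  then show ?thesis by (auto simp: eqp_def)
qed

text \<open>Schroeder-Bernstein by way of the set of points of \<open>a\<close> all of whose chains of preimages
  stay in the image of the second injection.\<close>

lemma schroeder_bernstein: "lep a b \<Longrightarrow> lep b a \<Longrightarrow> eqp a b"
proof (elim lepE)
  fix F G
  assume F: "DT (\<lambda>e. F (e 0))" and G: "DT (\<lambda>e. G (e 0))"
    and Fb: "\<And>x. x \<epsilon> a \<Longrightarrow> F x \<epsilon> b" and Fi: "\<And>x y. x \<epsilon> a \<Longrightarrow> y \<epsilon> a \<Longrightarrow> F x = F y \<Longrightarrow> x = y"
    and Ga: "\<And>x. x \<epsilon> b \<Longrightarrow> G x \<epsilon> a" and Gi: "\<And>x y. x \<epsilon> b \<Longrightarrow> y \<epsilon> b \<Longrightarrow> G x = G y \<Longrightarrow> x = y"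
  note [definable] = DT_app1[OF F] DT_app1[OF G]
  let ?ok = "\<lambda>s. \<forall>x. x \<epsilon> s \<longrightarrow> (\<exists>y. y \<epsilon> b \<and> x = G y \<and> (\<forall>z. z \<epsilon> a \<longrightarrow> y = F z \<longrightarrow> z \<epsilon> s))"
  define S where "S = Uni (Sep (Pw a) ?ok)"
  have okD: "D (\<lambda>e. ?ok (e 0))" by (intro definable)
  have S: "x \<epsilon> S \<longleftrightarrow> (\<exists>s. s \<sqsubseteq> a \<and> ?ok s \<and> x \<epsilon> s)" for x
    unfolding S_def Uni_iff Sep_iff[OF okD] by auto
  have S_ok: "?ok S"
    using S by blast
  have S_sub: "x \<epsilon> S \<Longrightarrow> x \<epsilon> a" for x
    using S by (auto simp: subs_def)
  have S_max: "x \<epsilon> S" if "y \<epsilon> b" "x = G y" "\<And>z. z \<epsilon> a \<Longrightarrow> y = F z \<Longrightarrow> z \<epsilon> S" for x y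
  proof -
    have "ins x S \<sqsubseteq> a" using that S_sub Ga by (auto simp: subs_def)
    moreover have "?ok (ins x S)" using that S_ok unfolding ins_iff by blast
    ultimately show ?thesis using S[of x] by (meson ins_iff)
  qed
  \<comment> \<open>The inverse of \<open>G\<close> is written as the union of a set that has
    exactly one element on \<open>S\<close>, so that \<open>H\<close> is a term defined
    everywhere.\<close>
  define H where "H x = (if x \<epsilon> S then Uni (Sep b (\<lambda>y. x = G y)) else F x)" for x
  have H1: "Uni (Sep b (\<lambda>y. x = G y)) = y" if "y \<epsilon> b" "x = G y" for x y
  proof -
    have "z \<epsilon> Sep b (\<lambda>y. x = G y) \<longleftrightarrow> z \<epsilon> b \<and> x = G z" for z
      by (rule Sep_iff) (intro definable)
    then show ?thesis using that Gi by (intro extensionality) auto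
  qed
  have HS: "H (G y) = y" if "y \<epsilon> b" "G y \<epsilon> S" for y
    using that H1 by (simp add: H_def)
  have HF: "H x = F x" if "\<not> x \<epsilon> S" for x
    using that by (simp add: H_def)
  have HD: "DT (\<lambda>e. H (e 0))"
  proof (rule DT_ext)
    fix z e
    have "y \<epsilon> Sep b (\<lambda>y. e 0 = G y) \<longleftrightarrow> y \<epsilon> b \<and> e 0 = G y" for y
      by (rule Sep_iff) (intro definable)
    then show "z \<epsilon> H (e 0) \<longleftrightarrow> (e 0 \<epsilon> S \<and> (\<exists>y. (y \<epsilon> b \<and> e 0 = G y) \<and> z \<epsilon> y)) \<or> (\<not> e 0 \<epsilon> S \<and> z \<epsilon> F (e 0))"
      by (auto simp: H_def)
  qed (intro definable)
  show "eqp a b"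
  proof (rule eqpI[of H])
    show "DT (\<lambda>e. H (e 0))" by (rule HD)
  next
    fix x assume "x \<epsilon> a"
    then show "H x \<epsilon> b"
      using HS HF S_ok Fb by metis
  next
    fix x x'
    assume x: "x \<epsilon> a" "x' \<epsilon> a" "H x = H x'"
    have *: False if "x \<epsilon> a" "x \<epsilon> S" "\<not> x' \<epsilon> S" "x' \<epsilon> a" "H x = H x'" for x x'
      using that HS HF S_ok by metis
    show "x = x'"
      using x *[of x x'] *[of x' x] HS HF S_ok Fi by metis
  next
    fix y assume y: "y \<epsilon> b"
    show "\<exists>x. x \<epsilon> a \<and> H x = y"
    proof (cases "G y \<epsilon> S")
      case True
      then show ?thesis using HS y Ga by blast
    next
      case False
      then obtain z where "z \<epsilon> a" "y = F z" "\<not> z \<epsilon> S" using S_max[OF y refl] by blast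
      then show ?thesis using HF by blast
    qed
  qed
qed

text \<open>The axiom is applied once, to the family of all nonempty subsets of \<open>b\<close>;
  evaluating its function at the set of admissible \<open>y\<close> makes the choice definable in
  \<open>x\<close>.\<close>

lemma choice_function:
  assumes "\<And>x. x \<epsilon> a \<Longrightarrow> \<exists>y. y \<epsilon> b \<and> R x y" and R: "D (\<lambda>e. R (e 0) (e 1))"
  obtains F where "DT (\<lambda>e. F (e 0))" "\<And>x. x \<epsilon> a \<Longrightarrow> F x \<epsilon> b \<and> R x (F x)"
proof -
  define P where "P = dif (Pw b) (up emp emp)"
  have P: "s \<epsilon> P \<longleftrightarrow> s \<sqsubseteq> b \<and> s \<noteq> emp" for s by (simp add: P_def)
  have "\<exists>z. z \<epsilon> s" if "s \<epsilon> P" for s using that emp_eqI by (auto simp: P)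
  moreover have "(\<forall>x. x \<epsilon> P \<longrightarrow> (\<exists>z. z \<epsilon> x)) \<longrightarrow> (\<exists>f b. func f P b \<and> (\<forall>x y. pr x y \<epsilon> f \<longrightarrow> y \<epsilon> x))"
    using ZFC[of ax_choice "\<lambda>_. undefined", OF axioms_in_ZFC(7)]
    by (simp add: ax_choice_def numeral_2_eq_2)
  ultimately obtain f c where f: "func f P c" "\<And>x y. pr x y \<epsilon> f \<Longrightarrow> y \<epsilon> x" by blast
  have S: "y \<epsilon> Sep b (R x) \<longleftrightarrow> y \<epsilon> b \<and> R x y" for x y
    by (rule Sep_iff) (intro D_app2[OF R] definable)
  have "DT (\<lambda>e. Sep b (R (e 0)))"
    by (rule DT_ext, rule S, intro definable D_app2[OF R])
  then have "DT (\<lambda>e. ap f (Sep b (R (e 0))))" by (rule DT_ap[OF DT_const])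
  moreover have "ap f (Sep b (R x)) \<epsilon> b \<and> R x (ap f (Sep b (R x)))" if x: "x \<epsilon> a" for x
  proof -
    obtain y where "y \<epsilon> b" "R x y" using assms(1)[OF x] by blast
    then have "Sep b (R x) \<epsilon> P" using S by (metis P emp_iff subsI)
    then have "ap f (Sep b (R x)) \<epsilon> Sep b (R x)" using f func_ap by blast
    then show ?thesis by (simp add: S)
  qed
  ultimately show thesis by (rule that)
qed

lemma lep_surj:
  assumes F: "DT (\<lambda>e. F (e 0))" and "\<And>y. y \<epsilon> b \<Longrightarrow> \<exists>x. x \<epsilon> a \<and> y = F x" shows "lep b a"
proof -
  note [definable] = DT_app1[OF F]
  obtain G where "DT (\<lambda>e. G (e 0))" "\<And>y. y \<epsilon> b \<Longrightarrow> G y \<epsilon> a \<and> y = F (G y)"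
    by (rule choice_function[of b a "\<lambda>y x. y = F x"]) (rule assms(2), assumption, intro definable, blast)
  then show ?thesis by (intro lepI[of G]) (auto, metis)
qed

lemma cantor: "\<not> lep (Pw a) a"
proof
  assume "lep (Pw a) a"
  then obtain F where F: "DT (\<lambda>e. F (e 0))" "\<And>x. x \<sqsubseteq> a \<Longrightarrow> F x \<epsilon> a"
    "\<And>x y. x \<sqsubseteq> a \<Longrightarrow> y \<sqsubseteq> a \<Longrightarrow> F x = F y \<Longrightarrow> x = y"
    by (rule lepE) simp
  note [definable] = DT_app1[OF F(1)]
  define d where "d = Sep a (\<lambda>z. \<exists>s. s \<sqsubseteq> a \<and> z = F s \<and> \<not> z \<epsilon> s)"
  have d: "z \<epsilon> d \<longleftrightarrow> z \<epsilon> a \<and> (\<exists>s. s \<sqsubseteq> a \<and> z = F s \<and> \<not> z \<epsilon> s)" for z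
    unfolding d_def by (rule Sep_iff) (intro definable)
  have "d \<sqsubseteq> a" by (auto simp: d)
  then show False using d[of "F d"] F(2,3) by blast
qed

lemma foundation: "z \<epsilon> x \<Longrightarrow> \<exists>y. y \<epsilon> x \<and> \<not> (\<exists>z. z \<epsilon> x \<and> z \<epsilon> y)"
  using ZFC[of ax_foundation "\<lambda>_. undefined", OF axioms_in_ZFC(2)]
  by (auto simp: ax_foundation_def numeral_2_eq_2)

lemma mem_irrefl: "\<not> x \<epsilon> x"
  using foundation[of x "up x x"] by auto

lemma mem_asym: "x \<epsilon> y \<Longrightarrow> \<not> y \<epsilon> x"
  using foundation[of x "up x y"] by auto

end

section \<open>Ordinals and recursion\<close>

context zfc
begin

lemma DT_if [definable]: "D P \<Longrightarrow> DT s \<Longrightarrow> DT t \<Longrightarrow> DT (\<lambda>e. if P e then s e else t e)"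
proof -
  assume P: "D P" and s: "DT s" and t: "DT t"
  note [definable] = D_reindex[OF P] DT_reindex[OF s] DT_reindex[OF t]
  have "D (\<lambda>e. P (\<lambda>n. e (Suc n)) \<and> e 0 \<epsilon> s (\<lambda>n. e (Suc n)) \<or>
      \<not> P (\<lambda>n. e (Suc n)) \<and> e 0 \<epsilon> t (\<lambda>n. e (Suc n)))"
    by (intro definable)
  then show ?thesis
    by (intro DT_ext[of _ "\<lambda>z e. P e \<and> z \<epsilon> s e \<or> \<not> P e \<and> z \<epsilon> t e"]) auto
qed

definition trans :: "'m \<Rightarrow> bool" where "trans a \<longleftrightarrow> (\<forall>x. x \<epsilon> a \<longrightarrow> x \<sqsubseteq> a)"

text \<open>In the presence of foundation, hereditary transitivity already gives a linear and
  well-founded membership relation; \<open>sat_ordinal\<close> proves the agreement with the formula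
  \<open>is_ordinal\<close>.\<close>

definition Ord :: "'m \<Rightarrow> bool" where "Ord a \<longleftrightarrow> trans a \<and> (\<forall>x. x \<epsilon> a \<longrightarrow> trans x)"

lemma D_Ord [definable]: "DT s \<Longrightarrow> D (\<lambda>e. Ord (s e))"
  by (rule D_app1[of Ord]) (unfold Ord_def trans_def, intro definable)

lemma Ord_trans: "Ord a \<Longrightarrow> x \<epsilon> a \<Longrightarrow> y \<epsilon> x \<Longrightarrow> y \<epsilon> a"
  unfolding Ord_def trans_def subs_def by blast

lemma Ord_mem: "Ord a \<Longrightarrow> x \<epsilon> a \<Longrightarrow> Ord x"
proof -
  assume a: "Ord a" and x: "x \<epsilon> a"
  have "trans y" if "y \<epsilon> x" for y using Ord_trans[OF a x that] a by (simp add: Ord_def)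
  with a x show ?thesis by (simp add: Ord_def)
qed

lemma Ord_subs: "Ord a \<Longrightarrow> x \<epsilon> a \<Longrightarrow> x \<sqsubseteq> a"
  by (simp add: Ord_def trans_def)

lemma Ord_emp [simp]: "Ord emp"
  by (simp add: Ord_def trans_def)

lemma Ord_sc: "Ord a \<Longrightarrow> Ord (sc a)"
  unfolding Ord_def trans_def subs_def sc_iff by blast

lemma Ord_least:
  assumes P: "D (\<lambda>e. P (e 0))" and "Ord a" "P a"
  shows "\<exists>b. Ord b \<and> P b \<and> (\<forall>c. c \<epsilon> b \<longrightarrow> \<not> P c)"
proof -
  define S where "S = Sep (sc a) P"
  have S: "x \<epsilon> S \<longleftrightarrow> x \<epsilon> sc a \<and> P x" for x
    unfolding S_def by (rule Sep_iff) (rule P)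
  have "a \<epsilon> S" using assms by (simp add: S)
  then obtain b where b: "b \<epsilon> S" "\<not> (\<exists>z. z \<epsilon> S \<and> z \<epsilon> b)" using foundation by blast
  have "Ord (sc a)" using \<open>Ord a\<close> by (rule Ord_sc)
  have "Ord b" using b(1) S \<open>Ord (sc a)\<close> Ord_mem by blast
  moreover have "P b" using b(1) S by blast
  moreover have "\<not> P c" if "c \<epsilon> b" for c
  proof -
    have "c \<epsilon> sc a" using b(1) S \<open>Ord (sc a)\<close> that Ord_trans by blast
    then show ?thesis using b(2) S that by blast
  qed
  ultimately show ?thesis by blast
qed

lemma Ord_induct:
  assumes "Ord a" and P: "D (\<lambda>e. P (e 0))"
    and step: "\<And>a. Ord a \<Longrightarrow> (\<And>x. x \<epsilon> a \<Longrightarrow> P x) \<Longrightarrow> P a"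
  shows "P a"
proof (rule ccontr)
  assume "\<not> P a"
  then obtain b where "Ord b" "\<not> P b" "\<forall>c. c \<epsilon> b \<longrightarrow> P c"
    using Ord_least[of "\<lambda>x. \<not> P x" a] assms D_not[OF P] by blast
  then show False using step by blast
qed

lemma Ord_linear: "Ord a \<Longrightarrow> Ord b \<Longrightarrow> a \<epsilon> b \<or> a = b \<or> b \<epsilon> a"
proof -
  let ?C = "\<lambda>a b. a \<epsilon> b \<or> a = b \<or> b \<epsilon> a"
  have "\<forall>b. Ord b \<longrightarrow> ?C a b" if "Ord a" for a
  proof (rule Ord_induct[OF that], intro definable)
    fix a
    assume a: "Ord a" and IH: "\<And>x. x \<epsilon> a \<Longrightarrow> \<forall>b. Ord b \<longrightarrow> ?C x b"
    have "?C a b" if "Ord b" for b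
    proof (rule Ord_induct[OF that], intro definable)
      fix b
      assume b: "Ord b" and IH': "\<And>y. y \<epsilon> b \<Longrightarrow> ?C a y"
      show "?C a b"
      proof (rule ccontr)
        assume *: "\<not> ?C a b"
        then have "y \<epsilon> a" if "y \<epsilon> b" for y using IH'[OF that] that b Ord_trans by blast
        moreover have "x \<epsilon> b" if "x \<epsilon> a" for x using IH[OF that] that a b * Ord_trans by blast
        ultimately show False using * extensionality by blast
      qed
    qed
    then show "\<forall>b. Ord b \<longrightarrow> ?C a b" by blast
  qed
  then show "Ord a \<Longrightarrow> Ord b \<Longrightarrow> ?C a b" by blast
qed

lemma Ord_subs_iff: "Ord a \<Longrightarrow> Ord b \<Longrightarrow> a \<sqsubseteq> b \<longleftrightarrow> a \<epsilon> b \<or> a = b"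
  using Ord_linear[of a b] Ord_subs[of b a] mem_irrefl subsD by blast

text \<open>Burali-Forti: the ordinals in such a set would form an ordinal that is a member of
  itself. It lets the ordinals outlast a given set in \<open>ex_omega\<close> and
  \<open>well_ordering\<close>.\<close>

lemma no_set_of_Ords: "\<exists>a. Ord a \<and> \<not> a \<epsilon> s"
proof (rule ccontr)
  assume *: "\<nexists>a. Ord a \<and> \<not> a \<epsilon> s"
  define S where "S = Sep s Ord"
  have "x \<epsilon> S \<longleftrightarrow> x \<epsilon> s \<and> Ord x" for x
    unfolding S_def by (rule Sep_iff) (intro definable)
  with * have S: "x \<epsilon> S \<longleftrightarrow> Ord x" for x by blast
  have "trans S" unfolding trans_def using S Ord_mem by blast
  moreover have "trans x" if "x \<epsilon> S" for x using that S by (simp add: Ord_def)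
  ultimately have "Ord S" by (simp add: Ord_def)
  then show False using S mem_irrefl by blast
qed

lemma sat_ordinal [simp]: "a < d \<Longrightarrow> sat E (=) e (is_ordinal a d) \<longleftrightarrow> Ord (e (d - Suc a))"
proof -
  assume d: "a < d"
  define A where "A = e (d - Suc a)"
  have "sat E (=) e (is_ordinal a d) \<longleftrightarrow>
    (\<forall>x. x \<epsilon> A \<longrightarrow> x \<sqsubseteq> A) \<and> (\<forall>x. x \<epsilon> A \<longrightarrow> \<not> x \<epsilon> x) \<and>
    (\<forall>x y z. x \<epsilon> A \<and> y \<epsilon> A \<and> z \<epsilon> A \<and> x \<epsilon> y \<and> y \<epsilon> z \<longrightarrow> x \<epsilon> z) \<and>
    (\<forall>x y. x \<epsilon> A \<and> y \<epsilon> A \<longrightarrow> x \<epsilon> y \<or> x = y \<or> y \<epsilon> x) \<and>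
    (\<forall>s. s \<sqsubseteq> A \<and> (\<exists>z. z \<epsilon> s) \<longrightarrow> (\<exists>x. x \<epsilon> s \<and> (\<forall>y. y \<epsilon> s \<longrightarrow> x = y \<or> x \<epsilon> y)))" (is "_ \<longleftrightarrow> ?O")
    using d by (simp add: is_ordinal_def A_def)
  also have "\<dots> \<longleftrightarrow> Ord A"
  proof
    assume O: ?O
    have "trans x" if x: "x \<epsilon> A" for x
      unfolding trans_def
    proof (intro allI impI subsI)
      fix y z assume yz: "y \<epsilon> x" "z \<epsilon> y"
      then have "y \<epsilon> A" using O x subsD by blast
      moreover from this have "z \<epsilon> A" using O yz subsD by blast
      ultimately show "z \<epsilon> x" using O x yz by blast
    qed
    moreover have "trans A" using O unfolding trans_def by blast
    ultimately show "Ord A" unfolding Ord_def by blast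
  next
    assume A: "Ord A"
    have "\<exists>x. x \<epsilon> s \<and> (\<forall>y. y \<epsilon> s \<longrightarrow> x = y \<or> x \<epsilon> y)" if s: "s \<sqsubseteq> A" "z \<epsilon> s" for s z
    proof -
      obtain x where "x \<epsilon> s" "\<not> (\<exists>z. z \<epsilon> s \<and> z \<epsilon> x)" using foundation s(2) by blast
      moreover from this have "x = y \<or> x \<epsilon> y" if "y \<epsilon> s" for y
        using that Ord_linear[of x y] Ord_mem[OF A] subsD[OF s(1)] by blast
      ultimately show ?thesis by blast
    qed
    then show ?O
      using Ord_subs[OF A] mem_irrefl Ord_linear Ord_mem[OF A] Ord_trans[OF Ord_mem[OF A]] by blast
  qed
  finally show ?thesis by (simp add: A_def)
qed

section \<open>Limit ordinals and omega\<close>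

definition Limit :: "'m \<Rightarrow> bool" where
  "Limit a \<longleftrightarrow> Ord a \<and> (\<exists>x. x \<epsilon> a) \<and> (\<forall>x. x \<epsilon> a \<longrightarrow> (\<exists>y. y \<epsilon> a \<and> x \<epsilon> y))"

lemma D_Limit [definable]: "DT s \<Longrightarrow> D (\<lambda>e. Limit (s e))"
  by (rule D_app1[of Limit]) (unfold Limit_def, intro definable)

lemma sat_limit [simp]: "a < d \<Longrightarrow> sat E (=) e (is_limit a d) \<longleftrightarrow> Limit (e (d - Suc a))"
  by (simp add: is_limit_def Limit_def)

lemma ex_omega: "\<exists>!w. Limit w \<and> (\<forall>x. x \<epsilon> w \<longrightarrow> \<not> Limit x)"
proof -
  obtain i where i0: "emp \<epsilon> i" and i: "\<And>y. y \<epsilon> i \<Longrightarrow> sc y \<epsilon> i"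
    using ZFC[of ax_infinity "\<lambda>_. undefined", OF axioms_in_ZFC(6)] emp_eqI
    by (auto simp: ax_infinity_def numeral_2_eq_2)
  \<comment> \<open>The axiom of infinity provides only an inductive set. The least ordinal outside
    it is a limit, so there is a least limit ordinal.\<close>
  obtain a where "Ord a" "\<not> a \<epsilon> i" using no_set_of_Ords by blast
  moreover have "D (\<lambda>e. \<not> e 0 \<epsilon> i)" by (intro definable)
  ultimately obtain c where c: "Ord c" "\<not> c \<epsilon> i" "\<forall>x. x \<epsilon> c \<longrightarrow> x \<epsilon> i"
    using Ord_least[of "\<lambda>x. \<not> x \<epsilon> i" a] by blast
  have "\<exists>x. x \<epsilon> c" using c i0 emp_eqI by metis
  moreover have "sc x \<epsilon> c" if "x \<epsilon> c" for x
  proof -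
    have "sc x \<sqsubseteq> c" using that c(1) Ord_subs subsD by fastforce
    moreover have "sc x \<noteq> c" using i that c by metis
    ultimately show ?thesis using Ord_subs_iff Ord_sc Ord_mem c(1) that by blast
  qed
  ultimately have "Limit c" unfolding Limit_def using c(1) sc_iff by blast
  moreover have "D (\<lambda>e. Limit (e 0))" by (intro definable)
  ultimately obtain w where "Limit w" "\<forall>x. x \<epsilon> w \<longrightarrow> \<not> Limit x"
    using Ord_least[of Limit c] c(1) by blast
  moreover have "v = w" if "Limit v" "\<forall>x. x \<epsilon> v \<longrightarrow> \<not> Limit x" "Limit w" "\<forall>x. x \<epsilon> w \<longrightarrow> \<not> Limit x" for v w
    using that Ord_linear[of v w] by (auto simp: Limit_def[of v] Limit_def[of w])
  ultimately show ?thesis by blast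
qed

definition om :: 'm where "om = (THE w. Limit w \<and> (\<forall>x. x \<epsilon> w \<longrightarrow> \<not> Limit x))"

lemma om: "Limit om" "x \<epsilon> om \<Longrightarrow> \<not> Limit x"
  using theI'[OF ex_omega, folded om_def] by blast+

lemma Ord_om [simp]: "Ord om"
  using om by (simp add: Limit_def)

lemma om_Ord: "n \<epsilon> om \<Longrightarrow> Ord n"
  using Ord_mem Ord_om by blast

lemma sat_omega [simp]: "w < d \<Longrightarrow> sat E (=) e (is_omega w d) \<longleftrightarrow> e (d - Suc w) = om"
  using ex_omega om by (auto simp: is_omega_def)

lemma Limit_sc: "Limit a \<Longrightarrow> x \<epsilon> a \<Longrightarrow> sc x \<epsilon> a"
proof -
  assume a: "Limit a" and x: "x \<epsilon> a"
  then obtain y where y: "y \<epsilon> a" "x \<epsilon> y" by (auto simp: Limit_def)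
  have ord: "Ord a" using a by (simp add: Limit_def)
  then have "Ord y" using y(1) Ord_mem by blast
  then have "sc x \<sqsubseteq> y" using y(2) Ord_subs subsD by fastforce
  then have "sc x \<epsilon> y \<or> sc x = y" using Ord_subs_iff \<open>Ord y\<close> Ord_sc Ord_mem y(2) by blast
  then show ?thesis using y(1) ord Ord_trans by blast
qed

lemma Limit_emp: "Limit a \<Longrightarrow> emp \<epsilon> a"
  using Ord_linear[of a emp] by (auto simp: Limit_def)

lemma om_emp [simp]: "emp \<epsilon> om"
  using Limit_emp om by blast

lemma om_sc [simp]: "n \<epsilon> om \<Longrightarrow> sc n \<epsilon> om"
  using Limit_sc om by blast

lemma om_cases: "n \<epsilon> om \<Longrightarrow> n = emp \<or> (\<exists>m. m \<epsilon> om \<and> n = sc m)"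
proof -
  assume n: "n \<epsilon> om"
  then have on: "Ord n" by (rule om_Ord)
  show ?thesis
  proof (cases "n = emp")
    case False
    then have "\<exists>x. x \<epsilon> n" using emp_eqI by blast
    then obtain m where m: "m \<epsilon> n" "\<And>y. y \<epsilon> n \<Longrightarrow> \<not> m \<epsilon> y"
      using om(2)[OF n] on unfolding Limit_def by blast
    have "y \<epsilon> n \<longleftrightarrow> y \<epsilon> sc m" for y
      using m Ord_linear[of y m] Ord_mem[OF on] Ord_trans[OF on] by auto
    then have "n = sc m" by (rule extensionality)
    moreover have "m \<epsilon> om" using m(1) n Ord_om Ord_trans by blast
    ultimately show ?thesis by blast
  qed simp
qed

lemma om_induct [consumes 1, case_names D zero succ]:
  assumes "n \<epsilon> om" and P: "D (\<lambda>e. P (e 0))" and "P emp" and "\<And>n. n \<epsilon> om \<Longrightarrow> P n \<Longrightarrow> P (sc n)"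
  shows "P n"
proof -
  have "n \<epsilon> om \<longrightarrow> P n"
  proof (rule Ord_induct[OF om_Ord[OF assms(1)]])
    show "D (\<lambda>e. e 0 \<epsilon> om \<longrightarrow> P (e 0))" by (intro definable P)
  next
    fix a
    assume IH: "\<And>x. x \<epsilon> a \<Longrightarrow> x \<epsilon> om \<longrightarrow> P x"
    have "P a" if "a \<epsilon> om" using om_cases[OF that] IH assms(3,4) sc_iff by blast
    then show "a \<epsilon> om \<longrightarrow> P a" by blast
  qed
  with assms(1) show ?thesis by blast
qed

section \<open>Recursion and dependent choice\<close>

definition restr :: "'m \<Rightarrow> 'm \<Rightarrow> 'm" where
  "restr f x = Sep f (\<lambda>p. \<exists>u v. u \<epsilon> x \<and> p = pr u v)"

lemma restr_iff: "p \<epsilon> restr f x \<longleftrightarrow> p \<epsilon> f \<and> (\<exists>u v. u \<epsilon> x \<and> p = pr u v)"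
  unfolding restr_def by (rule Sep_iff) (intro definable)

lemma DT_restr [definable]: "DT s \<Longrightarrow> DT t \<Longrightarrow> DT (\<lambda>e. restr (s e) (t e))"
  by (rule DT_app2[of restr], rule DT_ext, rule restr_iff, intro definable)

lemma restr_restr: "u \<sqsubseteq> y \<Longrightarrow> restr (restr f y) u = restr f u"
  by (rule extensionality) (auto simp: restr_iff subs_def)

text \<open>The approximations \<open>?A\<close> are unique by induction. Describing the elements of
  \<open>F x\<close> through some approximation makes \<open>F\<close> a total definable term before
  existence is known; a second induction then shows that \<open>lam x F\<close> is the approximation
  at \<open>x\<close>.\<close>

theorem Ord_recursion:
  assumes G: "DT (\<lambda>e. G (e 0) (e 1))"
  obtains F where "DT (\<lambda>e. F (e 0))" "\<And>x. Ord x \<Longrightarrow> F x = G x (lam x F)"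
proof -
  note [definable] = DT_app2[OF G]
  let ?A = "\<lambda>f x. Ord x \<and> (\<forall>p. p \<epsilon> f \<longleftrightarrow> (\<exists>y. y \<epsilon> x \<and> p = pr y (G y (restr f y))))"
  have restrA: "?A (restr f y) y" if "?A f x" "y \<epsilon> x" for f x y
  proof -
    have "Ord y" using that Ord_mem by blast
    moreover have "restr (restr f y) u = restr f u" if "u \<epsilon> y" for u
      using that \<open>Ord y\<close> Ord_subs restr_restr by blast
    moreover have "u \<epsilon> x" if "u \<epsilon> y" for u using that \<open>?A f x\<close> \<open>y \<epsilon> x\<close> Ord_trans by blast
    ultimately show ?thesis using that by (auto simp: restr_iff)
  qed
  have unique: "f = g" if "?A f x" "?A g x" for f g x
  proof -
    have "\<forall>f g. ?A f x \<and> ?A g x \<longrightarrow> f = g" if "Ord x" for x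
    proof (rule Ord_induct[OF that], intro definable)
      fix a
      assume IH: "\<And>x. x \<epsilon> a \<Longrightarrow> \<forall>f g. ?A f x \<and> ?A g x \<longrightarrow> f = g"
      show "\<forall>f g. ?A f a \<and> ?A g a \<longrightarrow> f = g"
      proof (intro allI impI)
        fix f g assume fg: "?A f a \<and> ?A g a"
        have "restr f y = restr g y" if "y \<epsilon> a" for y
          using IH[OF that] restrA fg that by blast
        with fg show "f = g" by (intro extensionality) metis
      qed
    qed
    with that show ?thesis by blast
  qed
  define F where "F x = (THE b. \<forall>z. z \<epsilon> b \<longleftrightarrow> (\<exists>f. ?A f x \<and> z \<epsilon> G x f))" for x
  have F: "z \<epsilon> F x \<longleftrightarrow> (\<exists>f. ?A f x \<and> z \<epsilon> G x f)" for z x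
    unfolding F_def
  proof (rule the_set, cases "\<exists>f. ?A f x")
    case True
    then obtain f where "?A f x" by blast
    then have "\<forall>z. z \<epsilon> G x f \<longleftrightarrow> (\<exists>f. ?A f x \<and> z \<epsilon> G x f)" using unique by blast
    then show "\<exists>b. \<forall>z. z \<epsilon> b \<longleftrightarrow> (\<exists>f. ?A f x \<and> z \<epsilon> G x f)" by blast
  next
    case False
    then show "\<exists>b. \<forall>z. z \<epsilon> b \<longleftrightarrow> (\<exists>f. ?A f x \<and> z \<epsilon> G x f)"
      by (intro exI[of _ emp]) auto
  qed
  have FA: "F x = G x f" if "?A f x" for f x
  proof (rule extensionality)
    fix z
    show "z \<epsilon> F x \<longleftrightarrow> z \<epsilon> G x f" unfolding F using that unique by blast
  qed
  have FD: "DT (\<lambda>e. F (e 0))"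
    by (rule DT_ext, rule F, intro definable)
  have restr_lam: "restr (lam a F) y = lam y F" if "y \<sqsubseteq> a" for y a
    using that by (intro extensionality) (auto simp: restr_iff lam_iff[OF FD] subs_def)
  have lamA: "?A (lam x F) x" if "Ord x" for x
  proof (rule Ord_induct[OF that])
    show "D (\<lambda>e. ?A (lam (e 0) F) (e 0))"
    proof -
      have "DT (\<lambda>e. lam (e 0) F)"
        by (rule DT_ext, rule lam_iff[OF FD], intro definable DT_app1[OF FD])
      note [definable] = DT_app1[of "\<lambda>a. lam a F", OF this]
      show ?thesis by (intro definable)
    qed
  next
    fix a
    assume a: "Ord a" and IH: "\<And>x. x \<epsilon> a \<Longrightarrow> ?A (lam x F) x"
    have "F y = G y (restr (lam a F) y)" if "y \<epsilon> a" for y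
      using FA[OF IH[OF that]] restr_lam Ord_subs a that by simp
    then show "?A (lam a F) a" using a by (auto simp: lam_iff[OF FD])
  qed
  show thesis
    by (rule that[of F], rule FD, rule FA, rule lamA)
qed

lemma om_recursion:
  assumes H: "DT (\<lambda>e. H (e 0) (e 1))"
  obtains F where "DT (\<lambda>e. F (e 0))" "F emp = a" "\<And>n. n \<epsilon> om \<Longrightarrow> F (sc n) = H n (F n)"
proof -
  note [definable] = DT_app2[OF H]
  \<comment> \<open>The union of a successor ordinal is its predecessor, because ordinals are
    transitive.\<close>
  let ?G = "\<lambda>x f. if x = emp then a else H (Uni x) (ap f (Uni x))"
  have GD: "DT (\<lambda>e. ?G (e 0) (e 1))" by (intro definable)
  obtain F where F: "DT (\<lambda>e. F (e 0))" "\<And>x. Ord x \<Longrightarrow> F x = ?G x (lam x F)"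
    by (rule Ord_recursion[of ?G, OF GD], rule that)
  have "F emp = a" using F(2)[of emp] by simp
  moreover have "F (sc n) = H n (F n)" if n: "n \<epsilon> om" for n
  proof -
    have on: "Ord n" using n by (rule om_Ord)
    have "Uni (sc n) = n" by (rule extensionality) (use on Ord_trans in auto)
    moreover have "sc n \<noteq> emp" by (metis emp_iff sc_iff)
    moreover have "ap (lam (sc n) F) n = F n" by (rule ap_lam[OF F(1)]) simp
    ultimately show ?thesis using F(2)[OF Ord_sc[OF on]] by simp
  qed
  ultimately show thesis using that F(1) by blast
qed

lemma dependent_choice:
  assumes "a \<epsilon> A" and R: "D (\<lambda>e. R (e 0) (e 1) (e 2))"
    and step: "\<And>n x. n \<epsilon> om \<Longrightarrow> x \<epsilon> A \<Longrightarrow> \<exists>y. y \<epsilon> A \<and> R n x y"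
  obtains F where "DT (\<lambda>e. F (e 0))" "F emp = a" "\<And>n. n \<epsilon> om \<Longrightarrow> F n \<epsilon> A"
    "\<And>n. n \<epsilon> om \<Longrightarrow> R n (F n) (F (sc n))"
proof -
  note [definable] = D_app3[OF R]
  \<comment> \<open>A single choice function on the pairs of a stage and a point makes all choices
    beforehand, which leaves a plain recursion.\<close>
  obtain G where G: "DT (\<lambda>e. G (e 0))"
    "\<And>p. p \<epsilon> prd om A \<Longrightarrow> G p \<epsilon> A \<and> (\<forall>n x. p = pr n x \<longrightarrow> R n x (G p))"
  proof (rule choice_function[of "prd om A" A "\<lambda>p y. \<forall>n x. p = pr n x \<longrightarrow> R n x y"])
    fix p assume "p \<epsilon> prd om A"
    then show "\<exists>y. y \<epsilon> A \<and> (\<forall>n x. p = pr n x \<longrightarrow> R n x y)" using step by (fastforce simp: prd_iff)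
  next
    show "D (\<lambda>e. \<forall>n x. e 0 = pr n x \<longrightarrow> R n x (e 1))" by (intro definable)
  qed blast
  note [definable] = DT_app1[OF G(1)]
  have GD: "DT (\<lambda>e. G (pr (e 0) (e 1)))" by (intro definable)
  obtain F where F: "DT (\<lambda>e. F (e 0))" "F emp = a" "\<And>n. n \<epsilon> om \<Longrightarrow> F (sc n) = G (pr n (F n))"
    by (rule om_recursion[of "\<lambda>n x. G (pr n x)", OF GD], rule that)
  note [definable] = DT_app1[OF F(1)]
  have FA: "F n \<epsilon> A" if "n \<epsilon> om" for n
    using that
  proof (induction rule: om_induct)
    case D
    show ?case by (intro definable)
  qed (use F G(2) assms(1) in auto)
  then have "R n (F n) (F (sc n))" if "n \<epsilon> om" for n
    using that F(3) G(2)[of "pr n (F n)"] by simp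
  with FA F show thesis using that by blast
qed

subsection \<open>Cardinals\<close>

definition ran :: "'m \<Rightarrow> 'm" where "ran f = Sep (Uni (Uni f)) (\<lambda>y. \<exists>x. pr x y \<epsilon> f)"

lemma ran_iff: "y \<epsilon> ran f \<longleftrightarrow> (\<exists>x. pr x y \<epsilon> f)"
proof -
  have "y \<epsilon> ran f \<longleftrightarrow> y \<epsilon> Uni (Uni f) \<and> (\<exists>x. pr x y \<epsilon> f)"
    unfolding ran_def by (rule Sep_iff) (intro definable)
  moreover have "pr x y \<epsilon> f \<Longrightarrow> y \<epsilon> Uni (Uni f)" for x
    unfolding Uni_iff by (metis pr_def up_iff)
  ultimately show ?thesis by blast
qed

lemma DT_ran [definable]: "DT s \<Longrightarrow> DT (\<lambda>e. ran (s e))"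
  by (rule DT_app1[of ran], rule DT_ext, rule ran_iff, intro definable)

lemma ran_lam: "DT (\<lambda>e. F (e 0)) \<Longrightarrow> y \<epsilon> ran (lam a F) \<longleftrightarrow> (\<exists>x. x \<epsilon> a \<and> y = F x)"
  by (auto simp: ran_iff lam_iff)

theorem well_ordering: "\<exists>k. Ord k \<and> eqp a k"
proof -
  obtain c where c: "DT (\<lambda>e. c (e 0))" "\<And>s. s \<epsilon> dif (Pw a) (up emp emp) \<Longrightarrow> c s \<epsilon> a \<and> c s \<epsilon> s"
  proof (rule choice_function[of "dif (Pw a) (up emp emp)" a "\<lambda>s y. y \<epsilon> s"])
    show "s \<epsilon> dif (Pw a) (up emp emp) \<Longrightarrow> \<exists>y. y \<epsilon> a \<and> y \<epsilon> s" for s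
      using emp_eqI[of s] by (auto simp: subs_def)
  qed (intro definable, blast)
  note [definable] = DT_app1[OF c(1)]
  \<comment> \<open>Each stage lists an element of \<open>a\<close> that has not occurred before;
    \<open>a\<close> itself is the default value once the list is complete.\<close>
  let ?G = "\<lambda>x f. if dif a (ran f) = emp then a else c (dif a (ran f))"
  have GD: "DT (\<lambda>e. ?G (e 0) (e 1))" by (intro definable)
  obtain F where F: "DT (\<lambda>e. F (e 0))" "\<And>x. Ord x \<Longrightarrow> F x = ?G x (lam x F)"
    by (rule Ord_recursion[of ?G, OF GD], rule that)
  note [definable] = DT_app1[OF F(1)]
  let ?full = "\<lambda>x. \<forall>y. y \<epsilon> a \<longrightarrow> (\<exists>z. z \<epsilon> x \<and> y = F z)"
  have full: "dif a (ran (lam x F)) = emp \<longleftrightarrow> ?full x" for x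
  proof -
    have "dif a (ran (lam x F)) = emp \<longleftrightarrow> (\<forall>y. \<not> y \<epsilon> dif a (ran (lam x F)))"
      using emp_eqI emp_iff by metis
    then show ?thesis by (auto simp: ran_lam[OF F(1)])
  qed
  have new: "F x \<epsilon> a \<and> (\<forall>z. z \<epsilon> x \<longrightarrow> F z \<noteq> F x)" if "Ord x" "\<not> ?full x" for x
  proof -
    have "F x = c (dif a (ran (lam x F)))" using F(2) that full by auto
    moreover have "c (dif a (ran (lam x F))) \<epsilon> dif a (ran (lam x F))"
      using c(2)[of "dif a (ran (lam x F))"] that(2) full[of x] by (auto simp: subs_def)
    ultimately show ?thesis by (auto simp: ran_lam[OF F(1)])
  qed
  \<comment> \<open>If \<open>a\<close> were never exhausted, \<open>F\<close> would be injective on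
    all ordinals, and replacement along its inverse would collect all ordinals in a set.\<close>
  have "\<exists>x. Ord x \<and> ?full x"
  proof (rule ccontr)
    assume *: "\<not> ?thesis"
    let ?R = "\<lambda>y x. Ord x \<and> y = F x"
    have "x = z" if "?R y x" "?R y z" for x y z
      using that new[of x] new[of z] * Ord_linear[of x z] by metis
    then have "\<exists>b. \<forall>x. x \<epsilon> b \<longleftrightarrow> (\<exists>y. y \<epsilon> a \<and> ?R y x)"
      by (intro replacement definable) blast
    then show False using no_set_of_Ords new * by metis
  qed
  moreover have fullD: "D (\<lambda>e. ?full (e 0))" by (intro definable)
  ultimately obtain k where k: "Ord k" "?full k" "\<forall>x. x \<epsilon> k \<longrightarrow> \<not> ?full x"
    using Ord_least[of ?full, OF fullD] by blast
  have "x = z" if "x \<epsilon> k" "z \<epsilon> k" "F x = F z" for x z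
    using that new[of x] new[of z] k Ord_linear[of x z] Ord_mem[OF k(1)] by metis
  then have "eqp k a"
    by (intro eqpI[of F] F(1)) (use new k Ord_mem in metis)+
  with k(1) show ?thesis using eqp_sym by blast
qed

definition Card :: "'m \<Rightarrow> bool" where "Card k \<longleftrightarrow> Ord k \<and> (\<forall>b. b \<epsilon> k \<longrightarrow> \<not> eqp k b)"

lemma D_Card [definable]: "DT s \<Longrightarrow> D (\<lambda>e. Card (s e))"
  by (rule D_app1[of Card]) (unfold Card_def, intro definable)

lemma sat_cardinal [simp]: "a < d \<Longrightarrow> sat E (=) e (is_cardinal a d) \<longleftrightarrow> Card (e (d - Suc a))"
  by (simp add: is_cardinal_def Card_def)

lemma sat_has_card [simp]: "a < d \<Longrightarrow> k < d \<Longrightarrow>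
  sat E (=) e (has_card a k d) \<longleftrightarrow> Card (e (d - Suc k)) \<and> eqp (e (d - Suc a)) (e (d - Suc k))"
  by (simp add: has_card_def)

definition crd :: "'m \<Rightarrow> 'm" where "crd a = (SOME k. Card k \<and> eqp a k)"

lemma crd: "Card (crd a)" "eqp a (crd a)"
proof -
  obtain l where "Ord l" "eqp a l" using well_ordering by blast
  moreover have "D (\<lambda>e. eqp a (e 0))" by (intro definable)
  ultimately obtain k where "Ord k" "eqp a k" "\<forall>b. b \<epsilon> k \<longrightarrow> \<not> eqp a b"
    using Ord_least[of "\<lambda>k. eqp a k" l] by blast
  then have "Card k \<and> eqp a k" unfolding Card_def using eqp_trans by blast
  then show "Card (crd a)" "eqp a (crd a)" unfolding crd_def by (metis (mono_tags) someI)+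
qed

lemma Card_Ord: "Card k \<Longrightarrow> Ord k"
  by (simp add: Card_def)

lemma Card_le: "Card k \<Longrightarrow> Card l \<Longrightarrow> lep k l \<Longrightarrow> k = l \<or> k \<epsilon> l"
proof -
  assume k: "Card k" and l: "Card l" and "lep k l"
  have "\<not> l \<epsilon> k"
  proof
    assume "l \<epsilon> k"
    then have "lep l k" using k Card_Ord Ord_subs subs_imp_lep by blast
    then have "eqp k l" using \<open>lep k l\<close> schroeder_bernstein by blast
    with \<open>l \<epsilon> k\<close> k show False by (simp add: Card_def)
  qed
  then show ?thesis using Ord_linear k l Card_Ord by blast
qed

lemma Card_less: "Card k \<Longrightarrow> Card l \<Longrightarrow> \<not> lep l k \<Longrightarrow> k \<epsilon> l"
  using Ord_linear[of k l] Card_Ord Ord_subs subs_imp_lep lep_refl by metis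

definition min_card :: "'m \<Rightarrow> ('m \<Rightarrow> bool) \<Rightarrow> bool" where
  "min_card k P \<longleftrightarrow> (\<exists>y. P y \<and> Card k \<and> eqp y k) \<and>
    (\<forall>y l. P y \<and> Card l \<and> eqp y l \<longrightarrow> k = l \<or> k \<epsilon> l)"

lemma min_card_Card: "min_card k P \<Longrightarrow> Card k"
  by (auto simp: min_card_def)

lemma ex_min_card:
  assumes P: "D (\<lambda>e. P (e 0))" and "P y" shows "\<exists>k. min_card k P"
proof -
  let ?Q = "\<lambda>k. \<exists>y. P y \<and> Card k \<and> eqp y k"
  have "D (\<lambda>e. ?Q (e 0))" by (intro definable D_app1[OF P])
  moreover have "?Q (crd y)" using assms crd by blast
  ultimately obtain k where k: "Ord k" "?Q k" "\<forall>c. c \<epsilon> k \<longrightarrow> \<not> ?Q c"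
    using Ord_least[of ?Q] Card_Ord by blast
  then have "min_card k P"
    unfolding min_card_def using Ord_linear[of k] Card_Ord by blast
  then show ?thesis by blast
qed

lemma min_card_lep:
  assumes "min_card k P" "P y" shows "lep k y"
proof -
  have "k = crd y \<or> k \<epsilon> crd y" using assms crd[of y] by (auto simp: min_card_def)
  then have "lep k (crd y)" using crd Card_Ord Ord_subs subs_imp_lep lep_refl by metis
  then show ?thesis using crd eqp_sym eqp_imp_lep lep_trans by blast
qed

lemma min_card_attained: "min_card k P \<Longrightarrow> \<exists>y. P y \<and> eqp y k"
  by (auto simp: min_card_def)

lemma min_cardI:
  assumes "Card k" "P y" "lep y k" "\<And>y. P y \<Longrightarrow> lep k y" shows "min_card k P"
  unfolding min_card_def
proof (intro conjI allI impI)
  show "\<exists>y. P y \<and> Card k \<and> eqp y k" using assms schroeder_bernstein by blast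
next
  fix y l assume "P y \<and> Card l \<and> eqp y l"
  then show "k = l \<or> k \<epsilon> l"
    using assms(1,4) Card_le eqp_imp_lep lep_trans by blast
qed

text \<open>In \<open>is_min_card\<close> the property \<open>P\<close> stands below one quantifier
  in the existence part and below two in the minimality part, where the cardinal \<open>l\<close> is
  bound as well. Its reading is therefore required at both depths.\<close>

lemma sat_min_card:
  assumes "k < d"
    and "\<And>a. sat E (=) (case_nat a e) (P d (Suc d)) \<longleftrightarrow> Q a"
    and "\<And>a b. sat E (=) (case_nat b (case_nat a e)) (P d (Suc (Suc d))) \<longleftrightarrow> Q a"
  shows "sat E (=) e (is_min_card k P d) \<longleftrightarrow> min_card (e (d - Suc k)) Q"
  using assms by (simp add: is_min_card_def min_card_def)

subsection \<open>Finite sets\<close>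

definition Fin :: "'m \<Rightarrow> bool" where "Fin a \<longleftrightarrow> (\<exists>n. n \<epsilon> om \<and> eqp a n)"

lemma D_Fin [definable]: "DT s \<Longrightarrow> D (\<lambda>e. Fin (s e))"
  by (rule D_app1[of Fin]) (unfold Fin_def, intro definable)

lemma sat_finite [simp]: "a < d \<Longrightarrow> sat E (=) e (is_finite a d) \<longleftrightarrow> Fin (e (d - Suc a))"
  by (simp add: is_finite_def Fin_def)

lemma Fin_emp [simp]: "Fin emp"
  unfolding Fin_def by (rule exI[of _ emp]) simp

lemma ins_absorb: "x \<epsilon> s \<Longrightarrow> ins x s = s"
  by (rule extensionality) auto

lemma Fin_ins [simp]: "Fin s \<Longrightarrow> Fin (ins x s)"
proof (cases "x \<epsilon> s")
  case False
  assume "Fin s"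
  then obtain n where n: "n \<epsilon> om" "eqp s n" by (auto simp: Fin_def)
  obtain F where F: "DT (\<lambda>e. F (e 0))" "\<And>x. x \<epsilon> s \<Longrightarrow> F x \<epsilon> n"
    "\<And>x y. x \<epsilon> s \<Longrightarrow> y \<epsilon> s \<Longrightarrow> F x = F y \<Longrightarrow> x = y" "\<And>y. y \<epsilon> n \<Longrightarrow> \<exists>x. x \<epsilon> s \<and> F x = y"
    by (rule eqpE[OF n(2)], rule that)
  note [definable] = DT_app1[OF F(1)]
  have ne: "F y \<noteq> n" if "y \<epsilon> s" for y using F(2)[OF that] mem_irrefl by auto
  have "eqp (ins x s) (sc n)"
  proof (rule eqpI[of "\<lambda>y. if y = x then n else F y"])
    show "DT (\<lambda>e. if e 0 = x then n else F (e 0))" by (intro definable)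
  next
    fix y assume "y \<epsilon> sc n"
    then consider "y = n" | "y \<epsilon> n" by auto
    then show "\<exists>z. z \<epsilon> ins x s \<and> (if z = x then n else F z) = y"
    proof cases
      case 2
      then obtain z where "z \<epsilon> s" "F z = y" using F(4) by blast
      with False show ?thesis by (intro exI[of _ z]) auto
    qed auto
  next
    fix y assume "y \<epsilon> ins x s"
    then show "(if y = x then n else F y) \<epsilon> sc n" using F(2) by auto
  next
    fix y z assume yz: "y \<epsilon> ins x s" "z \<epsilon> ins x s" "(if y = x then n else F y) = (if z = x then n else F z)"
    show "y = z"
      using yz ne[of y] ne[of z] F(3)[of y z] by (auto split: if_splits)
  qed
  then show ?thesis using om_sc[OF n(1)] unfolding Fin_def by blast
qed (simp add: ins_absorb)

lemma Fin_induct: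
  assumes "Fin s" and P: "D (\<lambda>e. P (e 0))" and P0: "P emp"
    and step: "\<And>x s. Fin s \<Longrightarrow> P s \<Longrightarrow> P (ins x s)"
  shows "P s"
proof -
  have "\<forall>s. eqp s n \<longrightarrow> P s" if "n \<epsilon> om" for n
    using that
  proof (induction rule: om_induct)
    case D
    show ?case by (intro definable D_app1[OF P])
  next
    case zero
    have "s = emp" if "eqp s emp" for s
      using that by (elim eqpE) (auto intro: emp_eqI)
    with P0 show ?case by blast
  next
    case (succ n)
    show ?case
    proof (intro allI impI)
      fix s assume "eqp s (sc n)"
      then obtain F where F: "DT (\<lambda>e. F (e 0))" "\<And>x. x \<epsilon> s \<Longrightarrow> F x = n \<or> F x \<epsilon> n"
        "\<And>x y. x \<epsilon> s \<Longrightarrow> y \<epsilon> s \<Longrightarrow> F x = F y \<Longrightarrow> x = y"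
        "\<And>y. y = n \<or> y \<epsilon> n \<Longrightarrow> \<exists>x. x \<epsilon> s \<and> F x = y"
        by (rule eqpE) simp
      obtain x where x: "x \<epsilon> s" "F x = n" using F(4) by blast
      have "eqp (dif s (up x x)) n"
      proof (rule eqpI[OF F(1)])
        fix y assume "y \<epsilon> n"
        moreover from this obtain z where "z \<epsilon> s" "F z = y" using F(4) by blast
        ultimately show "\<exists>z. z \<epsilon> dif s (up x x) \<and> F z = y" using x mem_irrefl by auto
      next
        fix y assume "y \<epsilon> dif s (up x x)"
        then show "F y \<epsilon> n" using F(2)[of y] F(3)[of x y] x by auto
      qed (use F(3) in auto)
      then have "P (dif s (up x x))" "Fin (dif s (up x x))" using succ by (auto simp: Fin_def)
      then have "P (ins x (dif s (up x x)))" using step by blast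
      moreover have "ins x (dif s (up x x)) = s" by (rule extensionality) (use x in auto)
      ultimately show "P s" by simp
    qed
  qed
  then show ?thesis using assms(1) by (auto simp: Fin_def)
qed

lemma Fin_un: "Fin s \<Longrightarrow> Fin t \<Longrightarrow> Fin (un s t)"
proof -
  assume "Fin s" "Fin t"
  show ?thesis
  proof (rule Fin_induct[OF \<open>Fin s\<close>])
    show "D (\<lambda>e. Fin (un (e 0) t))" by (intro definable)
    have "un emp t = t" by (rule extensionality) simp
    with \<open>Fin t\<close> show "Fin (un emp t)" by simp
    fix x s assume "Fin (un s t)"
    moreover have "un (ins x s) t = ins x (un s t)" by (rule extensionality) auto
    ultimately show "Fin (un (ins x s) t)" by simp
  qed
qed

lemma Fin_subs:
  assumes "Fin s" "t \<sqsubseteq> s" shows "Fin t"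
proof -
  have "\<forall>t. t \<sqsubseteq> s \<longrightarrow> Fin t"
  proof (rule Fin_induct[OF assms(1)])
    show "D (\<lambda>e. \<forall>t. t \<sqsubseteq> e 0 \<longrightarrow> Fin t)" by (intro definable)
    have "t = emp" if "t \<sqsubseteq> emp" for t using that by (auto simp: subs_def intro: emp_eqI)
    then show "\<forall>t. t \<sqsubseteq> emp \<longrightarrow> Fin t" by (metis Fin_emp)
    fix x s assume IH: "\<forall>t. t \<sqsubseteq> s \<longrightarrow> Fin t"
    show "\<forall>t. t \<sqsubseteq> ins x s \<longrightarrow> Fin t"
    proof (intro allI impI)
      fix t assume "t \<sqsubseteq> ins x s"
      then have "dif t (up x x) \<sqsubseteq> s" by (auto simp: subs_def)
      then have fin: "Fin (dif t (up x x))" using IH by blast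
      have "t = (if x \<epsilon> t then ins x (dif t (up x x)) else dif t (up x x))"
        by (rule extensionality) auto
      then show "Fin t" using fin Fin_ins by metis
    qed
  qed
  with assms(2) show ?thesis by blast
qed

lemma Rep_ins: "DT (\<lambda>e. F (e 0)) \<Longrightarrow> Rep (ins x s) F = ins (F x) (Rep s F)"
  by (rule extensionality) (auto simp: Rep_iff)

lemma DT_Rep1: "DT (\<lambda>e. F (e 0)) \<Longrightarrow> DT s \<Longrightarrow> DT (\<lambda>e. Rep (s e) F)"
proof -
  assume F: "DT (\<lambda>e. F (e 0))" and s: "DT s"
  have "DT (\<lambda>e. Rep (e 0) F)"
    by (rule DT_ext, rule Rep_iff[OF F], intro definable DT_app1[OF F])
  then show ?thesis using s by (rule DT_app1[of "\<lambda>a. Rep a F"])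
qed

lemma Fin_Rep:
  assumes F: "DT (\<lambda>e. F (e 0))" and "Fin s" shows "Fin (Rep s F)"
proof (rule Fin_induct[OF \<open>Fin s\<close>])
  show "D (\<lambda>e. Fin (Rep (e 0) F))" by (intro definable DT_Rep1 F)
  have "Rep emp F = emp" by (rule emp_eqI) (simp add: Rep_iff[OF F])
  then show "Fin (Rep emp F)" by simp
qed (simp add: Rep_ins[OF F])

lemma Fin_lep_om: "Fin s \<Longrightarrow> lep s om"
  unfolding Fin_def using eqp_imp_lep lep_trans Ord_subs[OF Ord_om] subs_imp_lep by blast

subsection \<open>Families of finite character\<close>

text \<open>The members of \<open>L\<close> are added one by one along a well-ordering whenever the result stays good.\<close>

theorem tukey:
  assumes good: "D (\<lambda>e. good (e 0))" and good_emp: "good emp"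
    and fin_char: "\<And>s. s \<sqsubseteq> L \<Longrightarrow> good s \<longleftrightarrow> (\<forall>t. t \<sqsubseteq> s \<and> Fin t \<longrightarrow> good t)"
  obtains m where "m \<sqsubseteq> L" "good m" "\<And>x. x \<epsilon> L \<Longrightarrow> good (ins x m) \<Longrightarrow> x \<epsilon> m"
proof -
  note [definable] = D_app1[OF good]
  have good_subs: "good t" if "good s" "t \<sqsubseteq> s" "s \<sqsubseteq> L" for s t
  proof -
    have "t \<sqsubseteq> L" using that by (auto simp: subs_def)
    moreover have "u \<sqsubseteq> s" if "u \<sqsubseteq> t" for u using that \<open>t \<sqsubseteq> s\<close> by (auto simp: subs_def)
    ultimately show ?thesis using fin_char[of s] fin_char[of t] that by blast
  qed
  obtain k where k: "Ord k" "eqp k L" using well_ordering eqp_sym by blast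
  obtain h where h: "DT (\<lambda>e. h (e 0))" "\<And>x. x \<epsilon> k \<Longrightarrow> h x \<epsilon> L"
    "\<And>x y. x \<epsilon> k \<Longrightarrow> y \<epsilon> k \<Longrightarrow> h x = h y \<Longrightarrow> x = y" "\<And>y. y \<epsilon> L \<Longrightarrow> \<exists>x. x \<epsilon> k \<and> h x = y"
    by (rule eqpE[OF k(2)], rule that)
  note [definable] = DT_app1[OF h(1)]
  \<comment> \<open>A stage contributes a singleton or nothing, so the union of the range of
    \<open>f\<close> is the set collected so far.\<close>
  let ?G = "\<lambda>x f. if good (ins (h x) (Uni (ran f))) then up (h x) (h x) else emp"
  have GD: "DT (\<lambda>e. ?G (e 0) (e 1))" by (intro definable)
  obtain F where F: "DT (\<lambda>e. F (e 0))" "\<And>x. Ord x \<Longrightarrow> F x = ?G x (lam x F)"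
    by (rule Ord_recursion[of ?G, OF GD], rule that)
  note [definable] = DT_app1[OF F(1)]
  define M where "M x = Uni (ran (lam x F))" for x
  have M: "z \<epsilon> M x \<longleftrightarrow> (\<exists>y. y \<epsilon> x \<and> z \<epsilon> F y)" for z x
    by (auto simp: M_def ran_lam[OF F(1)])
  have MD: "DT (\<lambda>e. M (e 0))"
    by (rule DT_ext, rule M, intro definable)
  note [definable] = DT_app1[OF MD]
  have FM: "F x = (if good (ins (h x) (M x)) then up (h x) (h x) else emp)" if "Ord x" for x
    using F(2)[OF that] by (simp add: M_def)
  have M_sub: "M x \<sqsubseteq> L" if "x \<sqsubseteq> k" for x
    using that FM h(2) Ord_mem[OF k(1)] by (auto simp: M subs_def split: if_splits)
  have goodM: "x \<sqsubseteq> k \<longrightarrow> good (M x)" if "Ord x" for x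
  proof (rule Ord_induct[OF that], intro definable, intro impI)
    fix a
    assume a: "Ord a" "a \<sqsubseteq> k" and IH: "\<And>x. x \<epsilon> a \<Longrightarrow> x \<sqsubseteq> k \<longrightarrow> good (M x)"
    have sub: "x \<sqsubseteq> k" "x \<epsilon> k" "Ord x" if "x \<epsilon> a" for x
      using that a k(1) Ord_subs subsD Ord_mem by blast+
    have good1: "good (un (M x) (F x))" if "x \<epsilon> a" for x
    proof (cases "good (ins (h x) (M x))")
      case True
      then have "un (M x) (F x) = ins (h x) (M x)"
        using FM sub(3)[OF that] by (intro extensionality) auto
      with True show ?thesis by simp
    next
      case False
      then have "un (M x) (F x) = M x" using FM sub(3)[OF that] by (intro extensionality) auto
      then show ?thesis using IH sub that by simp
    qed
    \<comment> \<open>A finite subset of \<open>M a\<close> has already been collected right after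
      some stage below \<open>a\<close>; finite character then lifts goodness to
      \<open>M a\<close>.\<close>
    have "t \<sqsubseteq> M a \<longrightarrow> t = emp \<or> (\<exists>x. x \<epsilon> a \<and> t \<sqsubseteq> un (M x) (F x))" if "Fin t" for t
    proof (rule Fin_induct[OF that], intro definable)
      fix y s
      assume IH: "s \<sqsubseteq> M a \<longrightarrow> s = emp \<or> (\<exists>x. x \<epsilon> a \<and> s \<sqsubseteq> un (M x) (F x))"
      have "\<exists>x. x \<epsilon> a \<and> ins y s \<sqsubseteq> un (M x) (F x)" if "ins y s \<sqsubseteq> M a"
      proof -
        have "s \<sqsubseteq> M a" "y \<epsilon> M a" using that by (auto simp: subs_def)
        then obtain z where z: "z \<epsilon> a" "y \<epsilon> F z" using M by blast
        consider "s = emp" | x where "x \<epsilon> a" "s \<sqsubseteq> un (M x) (F x)"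
          using IH \<open>s \<sqsubseteq> M a\<close> by blast
        then show ?thesis
        proof cases
          case 1
          then show ?thesis using z by (intro exI[of _ z]) auto
        next
          case 2
          have "z \<epsilon> x \<or> z = x \<or> x \<epsilon> z" using sub z(1) 2(1) Ord_linear by blast
          then show ?thesis
          proof (elim disjE)
            assume "z \<epsilon> x"
            then show ?thesis using 2 z by (intro exI[of _ x]) (auto simp: subs_def M)
          next
            assume "z = x"
            then show ?thesis using 2 z by (intro exI[of _ x]) (auto simp: subs_def)
          next
            assume "x \<epsilon> z"
            moreover from this have "w \<epsilon> z" if "w \<epsilon> x" for w using that sub z(1) Ord_trans by blast
            ultimately show ?thesis using 2 z by (intro exI[of _ z]) (fastforce simp: subs_def M)
          qed
        qed
      qed
      then show "ins y s \<sqsubseteq> M a \<longrightarrow> ins y s = emp \<or> (\<exists>x. x \<epsilon> a \<and> ins y s \<sqsubseteq> un (M x) (F x))" by blast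
    qed simp
    moreover have "un (M x) (F x) \<sqsubseteq> L" if "x \<epsilon> a" for x
    proof -
      have "un (M x) (F x) \<sqsubseteq> M a" unfolding subs_def un_iff M using that Ord_trans[OF a(1)] by blast
      then show ?thesis using M_sub[OF a(2)] by (auto simp: subs_def)
    qed
    ultimately show "good (M a)"
      using fin_char[OF M_sub[OF a(2)]] good1 good_subs good_emp by metis
  qed
  show thesis
  proof (rule that[of "M k"])
    show "M k \<sqsubseteq> L" by (rule M_sub) simp
    show "good (M k)" using goodM[OF k(1)] by simp
    fix x assume x: "x \<epsilon> L" "good (ins x (M k))"
    then obtain y where y: "y \<epsilon> k" "h y = x" using h(4) by blast
    \<comment> \<open>What can be added at the end could also have been added at its own stage
      \<open>y\<close>, when less had been collected.\<close>
    have "ins x (M y) \<sqsubseteq> ins x (M k)"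
      unfolding subs_def ins_iff M using y(1) Ord_trans[OF k(1)] by blast
    moreover have "ins x (M k) \<sqsubseteq> L" using x(1) \<open>M k \<sqsubseteq> L\<close> by (auto simp: subs_def)
    ultimately have "good (ins x (M y))" using x(2) good_subs by blast
    then show "x \<epsilon> M k" using FM Ord_mem[OF k(1) y(1)] y by (auto simp: M)
  qed
qed

end

section \<open>Cofinal families and topological notions\<close>

context zfc
begin

lemma sat_countable [simp]: "a < d \<Longrightarrow> sat E (=) e (is_countable a d) \<longleftrightarrow> lep (e (d - Suc a)) om"
  by (simp add: is_countable_def lep_def)

lemma sat_countably_infinite [simp]:
  "a < d \<Longrightarrow> sat E (=) e (is_countably_infinite a d) \<longleftrightarrow> eqp (e (d - Suc a)) om"
  by (simp add: is_countably_infinite_def)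

lemma sat_card_mult [simp]: "m < d \<Longrightarrow> k < d \<Longrightarrow> l < d \<Longrightarrow> sat E (=) e (is_card_mult m k l d) \<longleftrightarrow>
  Card (e (d - Suc m)) \<and> eqp (prd (e (d - Suc k)) (e (d - Suc l))) (e (d - Suc m))"
  by (simp add: is_card_mult_def)

definition cof :: "'m \<Rightarrow> 'm \<Rightarrow> bool" where
  "cof f k \<longleftrightarrow> (\<forall>a. a \<epsilon> f \<longrightarrow> a \<sqsubseteq> k \<and> eqp a om) \<and>
    (\<forall>a. a \<sqsubseteq> k \<and> eqp a om \<longrightarrow> (\<exists>b. b \<epsilon> f \<and> a \<sqsubseteq> b))"

lemma D_cof [definable]: "DT s \<Longrightarrow> DT t \<Longrightarrow> D (\<lambda>e. cof (s e) (t e))"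
  by (rule D_app2[of cof]) (unfold cof_def, intro definable)

lemma sat_cofinal_family [simp]: "f < d \<Longrightarrow> k < d \<Longrightarrow>
  sat E (=) e (is_cofinal_family f k d) \<longleftrightarrow> cof (e (d - Suc f)) (e (d - Suc k))"
  by (simp add: is_cofinal_family_def cof_def)

lemma sat_cf [simp]: "c < d \<Longrightarrow> k < d \<Longrightarrow> sat E (=) e (is_cf_countable_subsets c k d) \<longleftrightarrow>
  min_card (e (d - Suc c)) (\<lambda>f. cof f (e (d - Suc k)))"
  unfolding is_cf_countable_subsets_def by (rule sat_min_card) simp_all

definition topology :: "'m \<Rightarrow> 'm \<Rightarrow> bool" where
  "topology X T \<longleftrightarrow> (\<forall>u. u \<epsilon> T \<longrightarrow> u \<sqsubseteq> X) \<and> emp \<epsilon> T \<and> X \<epsilon> T \<and>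
    (\<forall>u v. u \<epsilon> T \<and> v \<epsilon> T \<longrightarrow> cap u v \<epsilon> T) \<and> (\<forall>s. s \<sqsubseteq> T \<longrightarrow> Uni s \<epsilon> T)"

lemma ex_emp_iff: "(\<forall>x. \<not> x \<epsilon> a) \<longleftrightarrow> a = emp"
  using emp_eqI by auto

lemma sat_topology [simp]: "X < d \<Longrightarrow> T < d \<Longrightarrow>
  sat E (=) e (is_topology X T d) \<longleftrightarrow> topology (e (d - Suc X)) (e (d - Suc T))"
  by (auto simp: is_topology_def topology_def ex_emp_iff)

lemma sat_subspace [simp]: "S < d \<Longrightarrow> U < d \<Longrightarrow> T < d \<Longrightarrow>
  sat E (=) e (is_subspace_topology S U T d) \<longleftrightarrow>
    e (d - Suc S) = Rep (e (d - Suc T)) (\<lambda>v. cap v (e (d - Suc U)))"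
proof -
  have "DT (\<lambda>e'. cap (e' 0) u)" for u by (intro definable)
  from Rep_iff[OF this] show "S < d \<Longrightarrow> U < d \<Longrightarrow> T < d \<Longrightarrow> ?thesis"
    by (auto simp: is_subspace_topology_def intro!: extensionality)
qed

definition cpt :: "'m \<Rightarrow> 'm \<Rightarrow> bool" where
  "cpt X T \<longleftrightarrow> (\<forall>c. c \<sqsubseteq> T \<and> X = Uni c \<longrightarrow> (\<exists>s. s \<sqsubseteq> c \<and> Fin s \<and> X = Uni s))"

lemma sat_compact [simp]: "X < d \<Longrightarrow> T < d \<Longrightarrow>
  sat E (=) e (compact X T d) \<longleftrightarrow> cpt (e (d - Suc X)) (e (d - Suc T))"
  by (simp add: compact_def cpt_def)

definition haus :: "'m \<Rightarrow> 'm \<Rightarrow> bool" where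
  "haus X T \<longleftrightarrow> (\<forall>x y. x \<epsilon> X \<and> y \<epsilon> X \<and> x \<noteq> y \<longrightarrow>
    (\<exists>u v. u \<epsilon> T \<and> v \<epsilon> T \<and> x \<epsilon> u \<and> y \<epsilon> v \<and> \<not> (\<exists>z. z \<epsilon> u \<and> z \<epsilon> v)))"

lemma sat_hausdorff [simp]: "X < d \<Longrightarrow> T < d \<Longrightarrow>
  sat E (=) e (hausdorff X T d) \<longleftrightarrow> haus (e (d - Suc X)) (e (d - Suc T))"
  by (simp add: hausdorff_def haus_def)

lemma sat_no_isolated_points [simp]: "X < d \<Longrightarrow> T < d \<Longrightarrow>
  sat E (=) e (no_isolated_points X T d) \<longleftrightarrow>
    \<not> (\<exists>x. x \<epsilon> e (d - Suc X) \<and> up x x \<epsilon> e (d - Suc T))"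
  by (auto simp: no_isolated_points_def)

definition closure :: "'m \<Rightarrow> 'm \<Rightarrow> 'm \<Rightarrow> 'm" where
  "closure a X T = Sep X (\<lambda>x. \<forall>u. u \<epsilon> T \<and> x \<epsilon> u \<longrightarrow> (\<exists>z. z \<epsilon> u \<and> z \<epsilon> a))"

lemma closure_iff: "x \<epsilon> closure a X T \<longleftrightarrow> x \<epsilon> X \<and> (\<forall>u. u \<epsilon> T \<and> x \<epsilon> u \<longrightarrow> (\<exists>z. z \<epsilon> u \<and> z \<epsilon> a))"
  unfolding closure_def by (rule Sep_iff) (intro definable)

lemma DT_closure [definable]: "DT s \<Longrightarrow> DT t \<Longrightarrow> DT u \<Longrightarrow> DT (\<lambda>e. closure (s e) (t e) (u e))"
  by (rule DT_app3[of closure], rule DT_ext, rule closure_iff, intro definable)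

lemma sat_closure [simp]: "c < d \<Longrightarrow> a < d \<Longrightarrow> X < d \<Longrightarrow> T < d \<Longrightarrow>
  sat E (=) e (is_closure c a X T d) \<longleftrightarrow>
    e (d - Suc c) = closure (e (d - Suc a)) (e (d - Suc X)) (e (d - Suc T))"
  by (auto simp: is_closure_def closure_iff intro!: extensionality)

definition nwd :: "'m \<Rightarrow> 'm \<Rightarrow> 'm \<Rightarrow> bool" where
  "nwd a X T \<longleftrightarrow> a \<sqsubseteq> X \<and> \<not> (\<exists>u. u \<epsilon> T \<and> (\<exists>x. x \<epsilon> u) \<and> u \<sqsubseteq> closure a X T)"

lemma D_nwd [definable]: "DT s \<Longrightarrow> DT t \<Longrightarrow> DT u \<Longrightarrow> D (\<lambda>e. nwd (s e) (t e) (u e))"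
  by (rule D_app3[of nwd]) (unfold nwd_def, intro definable)

lemma sat_nowhere_dense [simp]: "a < d \<Longrightarrow> X < d \<Longrightarrow> T < d \<Longrightarrow>
  sat E (=) e (nowhere_dense a X T d) \<longleftrightarrow> nwd (e (d - Suc a)) (e (d - Suc X)) (e (d - Suc T))"
  by (simp add: nowhere_dense_def nwd_def)

definition mgr :: "'m \<Rightarrow> 'm \<Rightarrow> 'm \<Rightarrow> bool" where
  "mgr a X T \<longleftrightarrow> (\<exists>f. lep f om \<and> (\<forall>b. b \<epsilon> f \<longrightarrow> nwd b X T) \<and> a = Uni f)"

lemma D_mgr [definable]: "DT s \<Longrightarrow> DT t \<Longrightarrow> DT u \<Longrightarrow> D (\<lambda>e. mgr (s e) (t e) (u e))"
  by (rule D_app3[of mgr]) (unfold mgr_def, intro definable)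

lemma sat_meager [simp]: "a < d \<Longrightarrow> X < d \<Longrightarrow> T < d \<Longrightarrow>
  sat E (=) e (meager a X T d) \<longleftrightarrow> mgr (e (d - Suc a)) (e (d - Suc X)) (e (d - Suc T))"
  by (simp add: meager_def mgr_def)

lemma sat_non_meager [simp]: "m < d \<Longrightarrow> X < d \<Longrightarrow> T < d \<Longrightarrow>
  sat E (=) e (is_non_meager m X T d) \<longleftrightarrow>
    min_card (e (d - Suc m)) (\<lambda>y. y \<sqsubseteq> e (d - Suc X) \<and> \<not> mgr y (e (d - Suc X)) (e (d - Suc T)))"
  unfolding is_non_meager_def by (rule sat_min_card) simp_all

definition pi_base :: "'m \<Rightarrow> 'm \<Rightarrow> bool" where
  "pi_base B T \<longleftrightarrow> (\<forall>b. b \<epsilon> B \<longrightarrow> b \<epsilon> T \<and> (\<exists>x. x \<epsilon> b)) \<and>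
    (\<forall>u. u \<epsilon> T \<and> (\<exists>x. x \<epsilon> u) \<longrightarrow> (\<exists>b. b \<epsilon> B \<and> b \<sqsubseteq> u))"

lemma sat_pi_base [simp]: "B < d \<Longrightarrow> T < d \<Longrightarrow>
  sat E (=) e (is_pi_base B T d) \<longleftrightarrow> pi_base (e (d - Suc B)) (e (d - Suc T))"
  by (simp add: is_pi_base_def pi_base_def)

lemma sat_pi_weight [simp]: "k < d \<Longrightarrow> T < d \<Longrightarrow>
  sat E (=) e (is_pi_weight k T d) \<longleftrightarrow> min_card (e (d - Suc k)) (\<lambda>B. pi_base B (e (d - Suc T)))"
  unfolding is_pi_weight_def by (rule sat_min_card) simp_all

lemma sat_uniform_pi_weight [simp]: "k < d \<Longrightarrow> T < d \<Longrightarrow> sat E (=) e (uniform_pi_weight k T d) \<longleftrightarrow>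
  (\<forall>u. u \<epsilon> e (d - Suc T) \<and> (\<exists>x. x \<epsilon> u) \<longrightarrow>
    min_card (e (d - Suc k)) (\<lambda>B. pi_base B (Rep (e (d - Suc T)) (\<lambda>v. cap v u))))"
  by (simp add: uniform_pi_weight_def)

lemma nwd_refine:
  assumes "nwd a X T" "topology X T" "u \<epsilon> T" "x \<epsilon> u"
  shows "\<exists>v x. v \<epsilon> T \<and> x \<epsilon> v \<and> v \<sqsubseteq> u \<and> \<not> (\<exists>z. z \<epsilon> v \<and> z \<epsilon> a)"
proof -
  obtain y where y: "y \<epsilon> u" "\<not> y \<epsilon> closure a X T"
    using assms unfolding nwd_def subs_def by blast
  have "y \<epsilon> X" using assms y(1) unfolding topology_def subs_def by blast
  with y(2) obtain v where "v \<epsilon> T" "y \<epsilon> v" "\<not> (\<exists>z. z \<epsilon> v \<and> z \<epsilon> a)"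
    unfolding closure_iff by blast
  moreover have "cap u v \<epsilon> T" using assms(2,3) \<open>v \<epsilon> T\<close> by (simp add: topology_def)
  ultimately show ?thesis using y(1) by (intro exI[of _ "cap u v"] exI[of _ y]) auto
qed

section \<open>Sets closed under pairing\<close>

text \<open>An injective pairing function on \<open>V\<close> together with an element
  \<open>tk\<close> outside its range, which serves as a tag. It provides the embeddings of squares
  and of small unions into \<open>V\<close> that are otherwise drawn from cardinal
  arithmetic.\<close>

definition pairing :: "('m \<Rightarrow> 'm \<Rightarrow> 'm) \<Rightarrow> 'm \<Rightarrow> 'm \<Rightarrow> bool" where
  "pairing j tk V \<longleftrightarrow> DT (\<lambda>e. j (e 0) (e 1)) \<and> tk \<epsilon> V \<and>
    (\<forall>x y. x \<epsilon> V \<and> y \<epsilon> V \<longrightarrow> j x y \<epsilon> V \<and> j x y \<noteq> tk \<and>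
      (\<forall>x' y'. x' \<epsilon> V \<and> y' \<epsilon> V \<and> j x y = j x' y' \<longrightarrow> x = x' \<and> y = y'))"

lemma pairingD:
  assumes "pairing j tk V"
  shows "DT (\<lambda>e. j (e 0) (e 1))" "tk \<epsilon> V" "x \<epsilon> V \<Longrightarrow> y \<epsilon> V \<Longrightarrow> j x y \<epsilon> V"
    "x \<epsilon> V \<Longrightarrow> y \<epsilon> V \<Longrightarrow> j x y \<noteq> tk"
    "x \<epsilon> V \<Longrightarrow> y \<epsilon> V \<Longrightarrow> x' \<epsilon> V \<Longrightarrow> y' \<epsilon> V \<Longrightarrow> j x y = j x' y' \<longleftrightarrow> x = x' \<and> y = y'"
  using assms unfolding pairing_def by blast+

lemma lep_prd: "lep a c \<Longrightarrow> lep b d \<Longrightarrow> lep (prd a b) (prd c d)"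
proof -
  assume "lep a c" "lep b d"
  obtain F where F: "DT (\<lambda>e. F (e 0))" "\<And>x. x \<epsilon> a \<Longrightarrow> F x \<epsilon> c"
    "\<And>x y. x \<epsilon> a \<Longrightarrow> y \<epsilon> a \<Longrightarrow> F x = F y \<Longrightarrow> x = y"
    by (rule lepE[OF \<open>lep a c\<close>], rule that)
  obtain G where G: "DT (\<lambda>e. G (e 0))" "\<And>x. x \<epsilon> b \<Longrightarrow> G x \<epsilon> d"
    "\<And>x y. x \<epsilon> b \<Longrightarrow> y \<epsilon> b \<Longrightarrow> G x = G y \<Longrightarrow> x = y"
    by (rule lepE[OF \<open>lep b d\<close>], rule that)
  note [definable] = DT_app1[OF F(1)] DT_app1[OF G(1)]
  let ?R = "\<lambda>p q. \<exists>x y. p = pr x y \<and> q = pr (F x) (G y)"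
  have RD: "D (\<lambda>e. ?R (e 0) (e 1))" by (intro definable)
  obtain H where H: "DT (\<lambda>e. H (e 0))" "\<And>p. p \<epsilon> prd a b \<Longrightarrow> H p \<epsilon> prd c d \<and> ?R p (H p)"
  proof (rule choice_function[of "prd a b" "prd c d" ?R, OF _ RD])
    fix p assume "p \<epsilon> prd a b"
    then show "\<exists>q. q \<epsilon> prd c d \<and> ?R p q" using F(2) G(2) by (auto simp: prd_iff)
  qed blast
  show ?thesis
  proof (rule lepI[OF H(1)])
    fix p q assume pq: "p \<epsilon> prd a b" "q \<epsilon> prd a b" "H p = H q"
    from H(2)[OF pq(1)] H(2)[OF pq(2)] pq obtain x y x' y' where
      "p = pr x y" "q = pr x' y'" "F x = F x'" "G y = G y'" by auto
    then show "p = q" using pq F(3) G(3) by simp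
  qed (use H(2) in blast)
qed

lemma pairing_prd: "pairing j tk V \<Longrightarrow> lep (prd V V) V"
proof -
  assume j: "pairing j tk V"
  note [definable] = DT_app2[OF pairingD(1)[OF j]]
  let ?R = "\<lambda>p q. \<exists>x y. p = pr x y \<and> q = j x y"
  have RD: "D (\<lambda>e. ?R (e 0) (e 1))" by (intro definable)
  obtain H where H: "DT (\<lambda>e. H (e 0))" "\<And>p. p \<epsilon> prd V V \<Longrightarrow> H p \<epsilon> V \<and> ?R p (H p)"
  proof (rule choice_function[of "prd V V" V ?R, OF _ RD])
    fix p assume "p \<epsilon> prd V V"
    then show "\<exists>q. q \<epsilon> V \<and> ?R p q" using pairingD(3)[OF j] by (auto simp: prd_iff)
  qed blast
  show ?thesis
  proof (rule lepI[OF H(1)])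
    fix p q assume pq: "p \<epsilon> prd V V" "q \<epsilon> prd V V" "H p = H q"
    from H(2)[OF pq(1)] H(2)[OF pq(2)] pq obtain x y x' y' where
      "p = pr x y" "q = pr x' y'" "j x y = j x' y'" by auto
    then show "p = q" using pq pairingD(5)[OF j] by simp
  qed (use H(2) in blast)
qed

text \<open>Two subsets of \<open>V\<close> are joined into a disjoint union with the tags
  \<open>tk\<close> and \<open>j tk tk\<close>, which differ because \<open>tk\<close> is not a
  value of \<open>j\<close>. For the same reason the singleton of \<open>tk\<close> is no such union
  and can be the new tag.\<close>

lemma pairing_Pw:
  assumes j: "pairing j tk V" obtains j' tk' where "pairing j' tk' (Pw V)"
proof -
  note jD = pairingD[OF j]
  note [definable] = DT_app2[OF jD(1)]
  define j' where "j' x y = Sep V (\<lambda>z. (\<exists>w. w \<epsilon> x \<and> z = j tk w) \<or> (\<exists>w. w \<epsilon> y \<and> z = j (j tk tk) w))" for x y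
  have j': "z \<epsilon> j' x y \<longleftrightarrow> z \<epsilon> V \<and> ((\<exists>w. w \<epsilon> x \<and> z = j tk w) \<or> (\<exists>w. w \<epsilon> y \<and> z = j (j tk tk) w))" for x y z
    unfolding j'_def by (rule Sep_iff) (intro definable)
  have 1: "j tk w \<epsilon> j' x y \<longleftrightarrow> w \<epsilon> x" "j (j tk tk) w \<epsilon> j' x y \<longleftrightarrow> w \<epsilon> y"
    if "x \<sqsubseteq> V" "y \<sqsubseteq> V" "w \<epsilon> V" for x y w
  proof -
    have *: "j tk w \<epsilon> V" "j (j tk tk) w \<epsilon> V" "j tk tk \<epsilon> V" "j tk tk \<noteq> tk" using that(3) by (simp_all add: jD(2,3,4))
    have "j tk w \<noteq> j (j tk tk) w'" "j (j tk tk) w \<noteq> j tk w'" if "w' \<epsilon> V" for w'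
      using jD(5) jD(2) * that \<open>w \<epsilon> V\<close> by metis+
    then show "j tk w \<epsilon> j' x y \<longleftrightarrow> w \<epsilon> x" "j (j tk tk) w \<epsilon> j' x y \<longleftrightarrow> w \<epsilon> y"
      unfolding j' using * jD(2,5) that subsD by metis+
  qed
  have "pairing j' (up tk tk) (Pw V)"
    unfolding pairing_def
  proof (intro conjI allI impI; (elim conjE)?)
    show "DT (\<lambda>e. j' (e 0) (e 1))" by (rule DT_ext, rule j', intro definable)
    show "up tk tk \<epsilon> Pw V" using jD(2) by (auto simp: subs_def)
  next
    fix x y assume xy: "x \<epsilon> Pw V" "y \<epsilon> Pw V"
    show "j' x y \<epsilon> Pw V" by (auto simp: subs_def j')
    show "j' x y \<noteq> up tk tk"
    proof
      assume "j' x y = up tk tk"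
      then have "tk \<epsilon> j' x y" by simp
      then show False unfolding j' using xy jD(2,3,4) subsD Pw_iff by metis
    qed
    fix x' y' assume xy': "x' \<epsilon> Pw V" "y' \<epsilon> Pw V" and eq: "j' x y = j' x' y'"
    show "x = x'"
    proof (rule extensionality)
      fix z
      have "z \<epsilon> x \<Longrightarrow> z \<epsilon> V" "z \<epsilon> x' \<Longrightarrow> z \<epsilon> V" using xy xy' by (auto dest: subsD)
      then show "z \<epsilon> x \<longleftrightarrow> z \<epsilon> x'"
        using 1(1)[of x y z] 1(1)[of x' y' z] xy xy' eq by auto
    qed
    show "y = y'"
    proof (rule extensionality)
      fix z
      have "z \<epsilon> y \<Longrightarrow> z \<epsilon> V" "z \<epsilon> y' \<Longrightarrow> z \<epsilon> V" using xy xy' by (auto dest: subsD)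
      then show "z \<epsilon> y \<longleftrightarrow> z \<epsilon> y'"
        using 1(2)[of x y z] 1(2)[of x' y' z] xy xy' eq by auto
    qed
  qed
  then show thesis by (rule that)
qed

text \<open>A small set of subsets of \<open>V\<close> is stored as a table:
  \<open>j n (j w w)\<close> records that \<open>w\<close> belongs to row \<open>n\<close>, and
  \<open>j n tk\<close> that row \<open>n\<close> is in use, which distinguishes an empty row from
  an absent one. Entries have the form \<open>j w w\<close> because such a value is never
  \<open>tk\<close>.\<close>

lemma coding:
  assumes j: "pairing j tk V"
  obtains dec where "DT (\<lambda>e. dec (e 0))"
    "\<And>a. a \<sqsubseteq> Pw V \<Longrightarrow> lep a V \<Longrightarrow> \<exists>c. c \<sqsubseteq> V \<and> dec c = a"
proof -
  note jD = pairingD[OF j]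
  note [definable] = DT_app2[OF jD(1)]
  define row where "row c n = Sep V (\<lambda>w. j n (j w w) \<epsilon> c)" for c n
  have row: "w \<epsilon> row c n \<longleftrightarrow> w \<epsilon> V \<and> j n (j w w) \<epsilon> c" for w c n
    unfolding row_def by (rule Sep_iff) (intro definable)
  have "DT (\<lambda>e. row (e 0) (e 1))" by (rule DT_ext, rule row, intro definable)
  note [definable] = DT_app2[of row, OF this]
  define dec where "dec c = Sep (Pw V) (\<lambda>x. \<exists>n. n \<epsilon> V \<and> j n tk \<epsilon> c \<and> x = row c n)" for c
  have dec: "x \<epsilon> dec c \<longleftrightarrow> x \<epsilon> Pw V \<and> (\<exists>n. n \<epsilon> V \<and> j n tk \<epsilon> c \<and> x = row c n)" for x c
    unfolding dec_def by (rule Sep_iff) (intro definable)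
  show thesis
  proof (rule that[of dec])
    show "DT (\<lambda>e. dec (e 0))" by (rule DT_ext, rule dec, intro definable)
  next
    fix a assume a: "a \<sqsubseteq> Pw V" "lep a V"
    obtain h where h: "DT (\<lambda>e. h (e 0))" "\<And>x. x \<epsilon> a \<Longrightarrow> h x \<epsilon> V"
      "\<And>x y. x \<epsilon> a \<Longrightarrow> y \<epsilon> a \<Longrightarrow> h x = h y \<Longrightarrow> x = y"
      by (rule lepE[OF a(2)], rule that)
    note [definable] = DT_app1[OF h(1)]
    have aV: "w \<epsilon> V" if "x \<epsilon> a" "w \<epsilon> x" for x w using a(1) that unfolding subs_def Pw_iff by blast
    define c where "c = Sep V (\<lambda>z. \<exists>x. x \<epsilon> a \<and> (z = j (h x) tk \<or> (\<exists>w. w \<epsilon> x \<and> z = j (h x) (j w w))))"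
    have c: "z \<epsilon> c \<longleftrightarrow> z \<epsilon> V \<and> (\<exists>x. x \<epsilon> a \<and> (z = j (h x) tk \<or> (\<exists>w. w \<epsilon> x \<and> z = j (h x) (j w w))))" for z
      unfolding c_def by (rule Sep_iff) (intro definable)
    have cV: "c \<sqsubseteq> V" by (auto simp: c)
    have c1: "j n tk \<epsilon> c \<longleftrightarrow> (\<exists>x. x \<epsilon> a \<and> n = h x)" if n: "n \<epsilon> V" for n
    proof
      assume "j n tk \<epsilon> c"
      then obtain x where x: "x \<epsilon> a" "j n tk = j (h x) tk \<or> (\<exists>w. w \<epsilon> x \<and> j n tk = j (h x) (j w w))"
        unfolding c by blast
      have "j n tk \<noteq> j (h x) (j w w)" if "w \<epsilon> x" for w
        using jD(5)[of n tk "h x" "j w w"] jD(2,3) jD(4)[of w w] aV[OF x(1) that] n h(2)[OF x(1)] by auto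
      with x have "j n tk = j (h x) tk" by blast
      then show "\<exists>x. x \<epsilon> a \<and> n = h x" using jD(5)[of n tk "h x" tk] jD(2) n h(2) x(1) by blast
    next
      assume "\<exists>x. x \<epsilon> a \<and> n = h x"
      moreover have "j n tk \<epsilon> V" using n by (simp add: jD(2,3))
      ultimately show "j n tk \<epsilon> c" unfolding c by blast
    qed
    have c2: "j (h x) (j w w) \<epsilon> c \<longleftrightarrow> w \<epsilon> x" if x: "x \<epsilon> a" and w: "w \<epsilon> V" for x w
    proof
      assume "j (h x) (j w w) \<epsilon> c"
      then obtain y where y: "y \<epsilon> a" "j (h x) (j w w) = j (h y) tk \<or>
          (\<exists>v. v \<epsilon> y \<and> j (h x) (j w w) = j (h y) (j v v))"
        unfolding c by blast
      have hx: "h x \<epsilon> V" "h y \<epsilon> V" "j w w \<epsilon> V" "j w w \<noteq> tk" using h x y w jD by auto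
      then have "j (h x) (j w w) \<noteq> j (h y) tk" using jD(5)[of "h x" "j w w" "h y" tk] jD(2) by blast
      with y obtain v where v: "v \<epsilon> y" "j (h x) (j w w) = j (h y) (j v v)" by blast
      have vV: "v \<epsilon> V" using aV y(1) v(1) by blast
      then have "h x = h y" "j w w = j v v"
        using jD(5)[of "h x" "j w w" "h y" "j v v"] jD(3) hx v(2) by blast+
      then have "x = y" "w = v" using h(3) x y(1) jD(5) w vV by blast+
      with v show "w \<epsilon> x" by simp
    next
      assume "w \<epsilon> x"
      moreover have "j (h x) (j w w) \<epsilon> V" using x w h(2) by (simp add: jD(3))
      ultimately show "j (h x) (j w w) \<epsilon> c" unfolding c using x by blast
    qed
    have row_h: "row c (h x) = x" if "x \<epsilon> a" for x
      by (rule extensionality) (use that c2 row aV in blast)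
    have "x \<epsilon> dec c \<longleftrightarrow> x \<epsilon> a" for x
    proof
      assume "x \<epsilon> dec c"
      then obtain n where "n \<epsilon> V" "j n tk \<epsilon> c" "x = row c n" unfolding dec by blast
      then show "x \<epsilon> a" using c1 row_h by auto
    next
      assume x: "x \<epsilon> a"
      then have "x \<epsilon> Pw V" using a(1) subsD by blast
      moreover have "h x \<epsilon> V" "j (h x) tk \<epsilon> c" "x = row c (h x)" using x h(2) c1 row_h by auto
      ultimately show "x \<epsilon> dec c" unfolding dec by blast
    qed
    then have "dec c = a" by (rule extensionality)
    with cV show "\<exists>c. c \<sqsubseteq> V \<and> dec c = a" by blast
  qed
qed

text \<open>This is the cardinal equation (2^\<lambda>)^\<lambda> = 2^\<lambda> in the form of an
  embedding; the decoding function maps \<open>Pw V\<close> onto a family containing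
  \<open>A\<close>.\<close>

lemma small_subsets_lep:
  assumes "pairing j tk V" "\<And>a. a \<epsilon> A \<Longrightarrow> a \<sqsubseteq> Pw V \<and> lep a V" shows "lep A (Pw V)"
proof -
  obtain dec where "DT (\<lambda>e. dec (e 0))" "\<And>a. a \<sqsubseteq> Pw V \<Longrightarrow> lep a V \<Longrightarrow> \<exists>c. c \<sqsubseteq> V \<and> dec c = a"
    by (rule coding[OF assms(1)], rule that)
  then show ?thesis using assms(2) by (intro lep_surj[of dec]) (metis Pw_iff)+
qed

lemma choose_injections:
  assumes d: "DT (\<lambda>e. d (e 0))" and "\<And>b. b \<epsilon> K \<Longrightarrow> lep (d b) V"
  obtains H where "DT (\<lambda>e. H (e 0))" "\<And>b. b \<epsilon> K \<Longrightarrow> injection (H b) (d b) V"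
proof -
  note [definable] = DT_app1[OF d]
  let ?U = "Uni (Rep K d)"
  have RD: "D (\<lambda>e. injection (e 1) (d (e 0)) V)" by (intro definable)
  obtain H where "DT (\<lambda>e. H (e 0))"
    "\<And>b. b \<epsilon> K \<Longrightarrow> H b \<epsilon> Pw (prd ?U V) \<and> injection (H b) (d b) V"
  proof (rule choice_function[of K "Pw (prd ?U V)" "\<lambda>b f. injection f (d b) V", OF _ RD])
    fix b assume b: "b \<epsilon> K"
    then obtain f where f: "injection f (d b) V" using assms(2) by (auto simp: lep_def)
    then have "f \<sqsubseteq> prd ?U V"
      using b unfolding injection_def func_def subs_def prd_iff Uni_iff Rep_iff[OF d] by blast
    with f show "\<exists>f. f \<epsilon> Pw (prd ?U V) \<and> injection f (d b) V" by auto
  qed blast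
  then show thesis using that by blast
qed

lemma lep_relation:
  assumes "D (\<lambda>e. R (e 0) (e 1))" "\<And>x. x \<epsilon> a \<Longrightarrow> \<exists>y. y \<epsilon> b \<and> R x y"
    "\<And>x x' y. x \<epsilon> a \<Longrightarrow> x' \<epsilon> a \<Longrightarrow> R x y \<Longrightarrow> R x' y \<Longrightarrow> x = x'"
  shows "lep a b"
proof -
  obtain F where "DT (\<lambda>e. F (e 0))" "\<And>x. x \<epsilon> a \<Longrightarrow> F x \<epsilon> b \<and> R x (F x)"
    by (rule choice_function[OF assms(2,1)], assumption, rule that)
  then show ?thesis using assms(3) by (intro lepI[of F]) metis+
qed

text \<open>An element is coded by the pair of the number of a set that contains it and its own
  number in that set.\<close>

lemma lep_Uni:
  assumes j: "pairing j tk V" and d: "DT (\<lambda>e. d (e 0))" and dV: "\<And>b. b \<epsilon> K \<Longrightarrow> lep (d b) V" and "lep K V"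
  shows "lep (Uni (Rep K d)) V"
proof -
  note jD = pairingD[OF j]
  obtain H where H: "DT (\<lambda>e. H (e 0))" "\<And>b. b \<epsilon> K \<Longrightarrow> injection (H b) (d b) V"
    by (rule choose_injections[OF d dV], assumption, rule that)
  obtain G where G: "DT (\<lambda>e. G (e 0))" "\<And>b. b \<epsilon> K \<Longrightarrow> G b \<epsilon> V"
    "\<And>x y. x \<epsilon> K \<Longrightarrow> y \<epsilon> K \<Longrightarrow> G x = G y \<Longrightarrow> x = y"
    by (rule lepE[OF \<open>lep K V\<close>], rule that)
  note [definable] = DT_app2[OF jD(1)] DT_app1[OF H(1)] DT_app1[OF G(1)]
  have inV: "x \<epsilon> d b \<and> n \<epsilon> V" if "b \<epsilon> K" "pr x n \<epsilon> H b" for b x n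
    using H(2)[OF that(1)] that(2) func_pr unfolding injection_def by blast
  show ?thesis
  proof (rule lep_relation[of "\<lambda>x w. \<exists>b n. b \<epsilon> K \<and> w = j (G b) n \<and> pr x n \<epsilon> H b"])
    show "D (\<lambda>e. \<exists>b n. b \<epsilon> K \<and> e 1 = j (G b) n \<and> pr (e 0) n \<epsilon> H b)" by (intro definable)
  next
    fix x assume "x \<epsilon> Uni (Rep K d)"
    then obtain b where b: "b \<epsilon> K" "x \<epsilon> d b" unfolding Uni_iff Rep_iff[OF d] by blast
    then obtain n where n: "pr x n \<epsilon> H b" using H(2) unfolding injection_def func_def by blast
    then have "j (G b) n \<epsilon> V" using inV b G(2) jD(3) by blast
    with b n show "\<exists>y. y \<epsilon> V \<and> (\<exists>b n. b \<epsilon> K \<and> y = j (G b) n \<and> pr x n \<epsilon> H b)" by blast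
  next
    fix x x' y
    assume "\<exists>b n. b \<epsilon> K \<and> y = j (G b) n \<and> pr x n \<epsilon> H b" "\<exists>b n. b \<epsilon> K \<and> y = j (G b) n \<and> pr x' n \<epsilon> H b"
    then obtain b n b' n' where b: "b \<epsilon> K" "b' \<epsilon> K" "j (G b) n = j (G b') n'" "pr x n \<epsilon> H b" "pr x' n' \<epsilon> H b'"
      by blast
    then have "G b = G b'" "n = n'" using jD(5)[of "G b" n "G b'" n'] G(2) inV by blast+
    then have "b = b'" using G(3) b by blast
    then show "x = x'" using b \<open>n = n'\<close> H(2) unfolding injection_def by blast
  qed
qed

text \<open>A form of Koenig's theorem: as \<open>Pw V\<close> is as large as the set of all functions from \<open>V\<close> to
  \<open>Pw V\<close>, it is not a union of \<open>|V|\<close> smaller sets.\<close>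

theorem koenig:
  assumes j: "pairing j tk V" and d: "DT (\<lambda>e. d (e 0))" and dV: "\<And>b. b \<epsilon> K \<Longrightarrow> lep (d b) V"
    and cover: "\<And>x. x \<sqsubseteq> V \<Longrightarrow> \<exists>b. b \<epsilon> K \<and> x \<epsilon> d b"
  shows "lep (Pw V) K"
proof -
  note jD = pairingD[OF j]
  obtain H where H: "DT (\<lambda>e. H (e 0))" "\<And>b. b \<epsilon> K \<Longrightarrow> injection (H b) (d b) V"
    by (rule choose_injections[OF d dV], assumption, rule that)
  note [definable] = DT_app2[OF jD(1)] DT_app1[OF H(1)]
  have inV: "x \<epsilon> d b \<and> n \<epsilon> V" if "b \<epsilon> K" "pr x n \<epsilon> H b" for b x n
    using H(2)[OF that(1)] that(2) func_pr unfolding injection_def by blast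
  \<comment> \<open>A subset of \<open>V\<close> is read as a function from \<open>V\<close> to
    \<open>Pw V\<close>, with \<open>ev x n\<close> as its value at \<open>n\<close>.\<close>
  define ev where "ev x n = Sep V (\<lambda>z. j z n \<epsilon> x)" for x n
  have ev: "z \<epsilon> ev x n \<longleftrightarrow> z \<epsilon> V \<and> j z n \<epsilon> x" for z x n
    unfolding ev_def by (rule Sep_iff) (intro definable)
  have "DT (\<lambda>e. ev (e 0) (e 1))" by (rule DT_ext, rule ev, intro definable)
  note [definable] = DT_app2[of ev, OF this]
  \<comment> \<open>Diagonalization: if for every \<open>n\<close> some value \<open>Y n\<close>
    were missed by all elements with number \<open>n\<close>, the subset \<open>x\<close> with
    values \<open>Y n\<close> would lie in some \<open>d b\<close> under a number \<open>n\<close>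
    and yet have the value \<open>Y n\<close> there.\<close>
  have "\<exists>n. n \<epsilon> V \<and> (\<forall>y. y \<epsilon> Pw V \<longrightarrow> (\<exists>b x. b \<epsilon> K \<and> pr x n \<epsilon> H b \<and> ev x n = y))"
  proof (rule ccontr)
    assume no: "\<not> ?thesis"
    have RD: "D (\<lambda>e. \<not> (\<exists>b x. b \<epsilon> K \<and> pr x (e 0) \<epsilon> H b \<and> ev x (e 0) = e 1))" by (intro definable)
    obtain Y where Y: "DT (\<lambda>e. Y (e 0))"
      "\<And>n. n \<epsilon> V \<Longrightarrow> Y n \<epsilon> Pw V \<and> \<not> (\<exists>b x. b \<epsilon> K \<and> pr x n \<epsilon> H b \<and> ev x n = Y n)"
      by (rule choice_function[of V "Pw V" "\<lambda>n y. \<not> (\<exists>b x. b \<epsilon> K \<and> pr x n \<epsilon> H b \<and> ev x n = y)", OF _ RD])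
        (use no in blast, blast)
    note [definable] = DT_app1[OF Y(1)]
    define x where "x = Sep V (\<lambda>w. \<exists>z n. z \<epsilon> V \<and> n \<epsilon> V \<and> w = j z n \<and> z \<epsilon> Y n)"
    have x: "w \<epsilon> x \<longleftrightarrow> w \<epsilon> V \<and> (\<exists>z n. z \<epsilon> V \<and> n \<epsilon> V \<and> w = j z n \<and> z \<epsilon> Y n)" for w
      unfolding x_def by (rule Sep_iff) (intro definable)
    have "x \<sqsubseteq> V" by (auto simp: x)
    then obtain b where b: "b \<epsilon> K" "x \<epsilon> d b" using cover by blast
    then obtain n where n: "pr x n \<epsilon> H b" using H(2) unfolding injection_def func_def by blast
    then have nV: "n \<epsilon> V" using inV b by blast
    have "z \<epsilon> ev x n \<longleftrightarrow> z \<epsilon> Y n" for z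
    proof -
      have "z \<epsilon> Y n \<Longrightarrow> z \<epsilon> V" using Y(2)[OF nV] subsD by auto
      then show ?thesis unfolding ev x using jD(3,5) nV by metis
    qed
    then have "ev x n = Y n" by (rule extensionality)
    then show False using Y(2)[OF nV] b n by blast
  qed
  then obtain n where n: "n \<epsilon> V"
    "\<And>y. y \<epsilon> Pw V \<Longrightarrow> \<exists>b x. b \<epsilon> K \<and> pr x n \<epsilon> H b \<and> ev x n = y" by blast
  \<comment> \<open>In each \<open>d b\<close> at most one element has the number \<open>n\<close>,
    so \<open>b\<close> determines the value at \<open>n\<close> of that element; choosing some
    \<open>b\<close> for every value is injective.\<close>
  show ?thesis
  proof (rule lep_relation[of "\<lambda>y b. b \<epsilon> K \<and> (\<exists>x. pr x n \<epsilon> H b \<and> ev x n = y)"])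
    show "D (\<lambda>e. e 1 \<epsilon> K \<and> (\<exists>x. pr x n \<epsilon> H (e 1) \<and> ev x n = e 0))" by (intro definable)
    show "y \<epsilon> Pw V \<Longrightarrow> \<exists>b. b \<epsilon> K \<and> b \<epsilon> K \<and> (\<exists>x. pr x n \<epsilon> H b \<and> ev x n = y)" for y
      using n(2) by blast
    show "b \<epsilon> K \<and> (\<exists>x. pr x n \<epsilon> H b \<and> ev x n = y) \<Longrightarrow> b \<epsilon> K \<and> (\<exists>x. pr x n \<epsilon> H b \<and> ev x n = y') \<Longrightarrow> y = y'" for y y' b
      using H(2) unfolding injection_def by blast
  qed
qed

text \<open>\<omega> is closed off under Kuratowski pairs in \<omega> steps. Pairs are nonempty,
  which makes \<open>emp\<close> a tag.\<close>

lemma ex_pairing: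
  obtains V where "om \<sqsubseteq> V" "pairing pr emp V"
proof -
  have HD: "DT (\<lambda>e. un (e 1) (prd (e 1) (e 1)))" by (intro definable)
  obtain F where F: "DT (\<lambda>e. F (e 0))" "F emp = om"
    "\<And>n. n \<epsilon> om \<Longrightarrow> F (sc n) = un (F n) (prd (F n) (F n))"
    by (rule om_recursion[of "\<lambda>n x. un x (prd x x)" om, OF HD], rule that)
  note [definable] = DT_app1[OF F(1)]
  have mono: "\<forall>m. m \<epsilon> n \<or> m = n \<longrightarrow> F m \<sqsubseteq> F n" if "n \<epsilon> om" for n
    using that
  proof (induction rule: om_induct)
    case D
    show ?case by (intro definable)
  next
    case (succ n)
    have "F n \<sqsubseteq> F (sc n)" using F(3)[OF succ(1)] by auto
    with succ(2) show ?case by (auto simp: subs_def)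
  qed simp
  define V where "V = Uni (Rep om F)"
  have V: "x \<epsilon> V \<longleftrightarrow> (\<exists>n. n \<epsilon> om \<and> x \<epsilon> F n)" for x
    unfolding V_def Uni_iff Rep_iff[OF F(1)] by blast
  have "om \<sqsubseteq> V" using F(2) V om_emp by (metis subsI)
  moreover have "pr x y \<epsilon> V" if xy: "x \<epsilon> V" "y \<epsilon> V" for x y
  proof -
    obtain m n where mn: "m \<epsilon> om" "x \<epsilon> F m" "n \<epsilon> om" "y \<epsilon> F n" using xy V by blast
    then obtain k where "k \<epsilon> om" "x \<epsilon> F k" "y \<epsilon> F k"
      using Ord_linear[of m n] om_Ord mono[of m] mono[of n] subsD by metis
    then have "k \<epsilon> om" "pr x y \<epsilon> F (sc k)" using F(3) by auto
    then show ?thesis using V om_sc by blast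
  qed
  moreover have "DT (\<lambda>e. pr (e 0) (e 1))" by (intro definable)
  ultimately have "pairing pr emp V"
    unfolding pairing_def using subsD[of om V emp] pr_nonempty by auto
  with \<open>om \<sqsubseteq> V\<close> show thesis by (rule that)
qed

lemma lep_Pw: "lep a (Pw a)"
proof (rule lepI[of "\<lambda>x. up x x"])
  show "DT (\<lambda>e. up (e 0) (e 0))" by (intro definable)
qed (auto simp: subs_def up_eq)

lemma Rep_lep: "DT (\<lambda>e. F (e 0)) \<Longrightarrow> lep (Rep a F) a"
  by (rule lep_surj[of F]) (auto simp: Rep_iff)

end

section \<open>Cantor cubes\<close>

context zfc
begin

text \<open>Points of the cube are the subsets of \<open>I\<close>; \<open>bs I p q\<close> is the basic open set of those that
  contain \<open>p\<close> and are disjoint from \<open>q\<close>.\<close>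

definition bs :: "'m \<Rightarrow> 'm \<Rightarrow> 'm \<Rightarrow> 'm" where
  "bs I p q = Sep (Pw I) (\<lambda>x. p \<sqsubseteq> x \<and> \<not> (\<exists>z. z \<epsilon> q \<and> z \<epsilon> x))"

lemma bs_iff: "x \<epsilon> bs I p q \<longleftrightarrow> x \<sqsubseteq> I \<and> p \<sqsubseteq> x \<and> \<not> (\<exists>z. z \<epsilon> q \<and> z \<epsilon> x)"
proof -
  have "x \<epsilon> bs I p q \<longleftrightarrow> x \<epsilon> Pw I \<and> p \<sqsubseteq> x \<and> \<not> (\<exists>z. z \<epsilon> q \<and> z \<epsilon> x)"
    unfolding bs_def by (rule Sep_iff) (intro definable)
  then show ?thesis by simp
qed

lemma DT_bs [definable]: "DT s \<Longrightarrow> DT t \<Longrightarrow> DT u \<Longrightarrow> DT (\<lambda>e. bs (s e) (t e) (u e))"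
  by (rule DT_app3[of bs], rule DT_ext, rule bs_iff, intro definable)

text \<open>The product topology on the power of the two-point space with exponent \<open>I\<close>,
  with points written as subsets. The positive condition \<open>p\<close> lies in the point
  \<open>x\<close> and thereby in \<open>I\<close>; for the negative one this is demanded.\<close>

definition cube :: "'m \<Rightarrow> 'm" where
  "cube I = Sep (Pw (Pw I)) (\<lambda>u. \<forall>x. x \<epsilon> u \<longrightarrow>
    (\<exists>p q. Fin p \<and> Fin q \<and> q \<sqsubseteq> I \<and> x \<epsilon> bs I p q \<and> bs I p q \<sqsubseteq> u))"

lemma cube_iff: "u \<epsilon> cube I \<longleftrightarrow> u \<sqsubseteq> Pw I \<and> (\<forall>x. x \<epsilon> u \<longrightarrow>
    (\<exists>p q. Fin p \<and> Fin q \<and> q \<sqsubseteq> I \<and> x \<epsilon> bs I p q \<and> bs I p q \<sqsubseteq> u))"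
proof -
  have "u \<epsilon> cube I \<longleftrightarrow> u \<epsilon> Pw (Pw I) \<and> (\<forall>x. x \<epsilon> u \<longrightarrow>
    (\<exists>p q. Fin p \<and> Fin q \<and> q \<sqsubseteq> I \<and> x \<epsilon> bs I p q \<and> bs I p q \<sqsubseteq> u))"
    unfolding cube_def by (rule Sep_iff) (intro definable)
  then show ?thesis by simp
qed

lemma bs_open: "Fin p \<Longrightarrow> Fin q \<Longrightarrow> q \<sqsubseteq> I \<Longrightarrow> bs I p q \<epsilon> cube I"
  unfolding cube_iff by (auto simp: subs_def bs_iff)

lemma bs_un: "x \<epsilon> bs I (un p p') (un q q') \<longleftrightarrow> x \<epsilon> bs I p q \<and> x \<epsilon> bs I p' q'"
  by (auto simp: bs_iff subs_def)

lemma un_subs: "p \<sqsubseteq> I \<Longrightarrow> q \<sqsubseteq> I \<Longrightarrow> un p q \<sqsubseteq> I"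
  by (auto simp: subs_def)

lemma cube_refine:
  assumes "u \<epsilon> cube I" "x \<epsilon> u"
  obtains p q where "Fin p" "Fin q" "q \<sqsubseteq> I" "x \<epsilon> bs I p q" "bs I p q \<sqsubseteq> u"
  using assms unfolding cube_iff by blast

lemma cube_topology: "topology (Pw I) (cube I)"
  unfolding topology_def
proof (intro conjI allI impI)
  show "u \<epsilon> cube I \<Longrightarrow> u \<sqsubseteq> Pw I" for u by (simp add: cube_iff)
  show "emp \<epsilon> cube I" by (auto simp: cube_iff subs_def)
  have "x \<epsilon> bs I emp emp" if "x \<sqsubseteq> I" for x using that by (auto simp: bs_iff)
  moreover have "bs I emp emp \<sqsubseteq> Pw I" by (auto simp: bs_iff)
  ultimately show "Pw I \<epsilon> cube I" unfolding cube_iff Pw_iff using Fin_emp by (metis emp_iff subsI)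
next
  fix u v assume uv: "u \<epsilon> cube I \<and> v \<epsilon> cube I"
  have "\<exists>p q. Fin p \<and> Fin q \<and> q \<sqsubseteq> I \<and> x \<epsilon> bs I p q \<and> bs I p q \<sqsubseteq> cap u v" if x: "x \<epsilon> u" "x \<epsilon> v" for x
  proof -
    obtain p q where p: "Fin p" "Fin q" "q \<sqsubseteq> I" "x \<epsilon> bs I p q" "bs I p q \<sqsubseteq> u"
      using uv x cube_refine by blast
    obtain p' q' where p': "Fin p'" "Fin q'" "q' \<sqsubseteq> I" "x \<epsilon> bs I p' q'" "bs I p' q' \<sqsubseteq> v"
      using uv x cube_refine by blast
    have "bs I (un p p') (un q q') \<sqsubseteq> cap u v"
      using p(5) p'(5) by (auto simp: bs_un subs_def)
    then show ?thesis using p p' by (metis Fin_un bs_un un_subs)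
  qed
  moreover have "cap u v \<sqsubseteq> Pw I" using uv unfolding cube_iff subs_def by simp
  ultimately show "cap u v \<epsilon> cube I" unfolding cube_iff[of "cap u v"] by simp
next
  fix s assume s: "s \<sqsubseteq> cube I"
  show "Uni s \<epsilon> cube I" unfolding cube_iff
  proof (intro conjI allI impI)
    show "Uni s \<sqsubseteq> Pw I" using s unfolding subs_def cube_iff by auto
    fix x assume "x \<epsilon> Uni s"
    then obtain u where u: "u \<epsilon> s" "x \<epsilon> u" by auto
    then have "u \<epsilon> cube I" using s subsD by blast
    then obtain p q where p: "Fin p" "Fin q" "q \<sqsubseteq> I" "x \<epsilon> bs I p q" "bs I p q \<sqsubseteq> u"
      using u(2) cube_refine by blast
    moreover have "bs I p q \<sqsubseteq> Uni s" using p(5) u(1) by (auto simp: subs_def)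
    ultimately show "\<exists>p q. Fin p \<and> Fin q \<and> q \<sqsubseteq> I \<and> x \<epsilon> bs I p q \<and> bs I p q \<sqsubseteq> Uni s" by blast
  qed
qed

lemma cube_hausdorff: "haus (Pw I) (cube I)"
proof -
  have sep: "\<exists>u v. u \<epsilon> cube I \<and> v \<epsilon> cube I \<and> x \<epsilon> u \<and> y \<epsilon> v \<and> \<not> (\<exists>z. z \<epsilon> u \<and> z \<epsilon> v)"
    if "x \<sqsubseteq> I" "y \<sqsubseteq> I" "i \<epsilon> x" "\<not> i \<epsilon> y" for x y i
  proof (intro exI conjI)
    have "i \<epsilon> I" using that subsD by blast
    then show "bs I (ins i emp) emp \<epsilon> cube I" "bs I emp (ins i emp) \<epsilon> cube I"
      by (auto intro!: bs_open)
  qed (use that in \<open>auto simp: bs_iff subs_def\<close>)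
  show ?thesis
    unfolding haus_def
  proof (intro allI impI)
    fix x y assume xy: "x \<epsilon> Pw I \<and> y \<epsilon> Pw I \<and> x \<noteq> y"
    then obtain i where "i \<epsilon> x \<and> \<not> i \<epsilon> y \<or> i \<epsilon> y \<and> \<not> i \<epsilon> x" using extensionality by blast
    then show "\<exists>u v. u \<epsilon> cube I \<and> v \<epsilon> cube I \<and> x \<epsilon> u \<and> y \<epsilon> v \<and> \<not> (\<exists>z. z \<epsilon> u \<and> z \<epsilon> v)"
      using sep[of x y i] sep[of y x i] xy unfolding Pw_iff by blast
  qed
qed

lemma cube_no_isolated_points:
  assumes inf: "\<And>s. Fin s \<Longrightarrow> \<exists>i. i \<epsilon> I \<and> \<not> i \<epsilon> s"
  shows "\<not> (\<exists>x. x \<epsilon> Pw I \<and> up x x \<epsilon> cube I)"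
proof (intro notI, elim exE conjE)
  fix x assume "up x x \<epsilon> cube I"
  then obtain p q where p: "Fin p" "Fin q" "x \<epsilon> bs I p q" "bs I p q \<sqsubseteq> up x x"
    by (rule cube_refine[of _ _ x]) simp
  obtain i where i: "i \<epsilon> I" "\<not> i \<epsilon> un p q" using inf p(1,2) Fin_un by blast
  \<comment> \<open>The point \<open>x\<close> with its coordinate \<open>i\<close> flipped, on
    which the basic set puts no condition.\<close>
  define y where "y = (if i \<epsilon> x then dif x (up i i) else ins i x)"
  have "y \<epsilon> bs I p q" using p(3) i by (auto simp: y_def bs_iff subs_def)
  then have "y = x" using p(4) subsD by fastforce
  moreover have "i \<epsilon> y \<longleftrightarrow> \<not> i \<epsilon> x" by (auto simp: y_def)
  ultimately show False by simp
qed

text \<open>A maximal family of subsets of the cube whose finite intersections are not finitely covered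
  contains one of the two subbasic sets for every index, hence determines a point.\<close>

lemma cube_compact: "cpt (Pw I) (cube I)"
  unfolding cpt_def
proof (intro allI impI, rule ccontr)
  fix c assume c: "c \<sqsubseteq> cube I \<and> Pw I = Uni c"
  assume no: "\<not> (\<exists>s. s \<sqsubseteq> c \<and> Fin s \<and> Pw I = Uni s)"
  \<comment> \<open>\<open>?bad t\<close> says that no finite part of \<open>c\<close> covers the
    intersection of \<open>t\<close>. Demanding this of all finite subsets, as \<open>?good\<close>
    does, has finite character.\<close>
  let ?bad = "\<lambda>t. \<forall>d. d \<sqsubseteq> c \<and> Fin d \<longrightarrow> (\<exists>x. x \<sqsubseteq> I \<and> (\<forall>A. A \<epsilon> t \<longrightarrow> x \<epsilon> A) \<and> \<not> x \<epsilon> Uni d)"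
  let ?good = "\<lambda>s. \<forall>t. t \<sqsubseteq> s \<and> Fin t \<longrightarrow> ?bad t"
  have goodD: "D (\<lambda>e. ?good (e 0))" by (intro definable)
  have bad_mono: "?bad t'" if "?bad t" "t' \<sqsubseteq> t" for t t'
    using that unfolding subs_def by meson
  have "?bad emp"
  proof (intro allI impI)
    fix d assume d: "d \<sqsubseteq> c \<and> Fin d"
    have "Uni d \<sqsubseteq> Pw I" using c d unfolding subs_def by (metis Uni_iff)
    then have "\<not> Pw I \<sqsubseteq> Uni d" using no d subs_antisym by blast
    then show "\<exists>x. x \<sqsubseteq> I \<and> (\<forall>A. A \<epsilon> emp \<longrightarrow> x \<epsilon> A) \<and> \<not> x \<epsilon> Uni d"
      unfolding subs_def[of "Pw I"] by auto
  qed
  then have good_emp: "?good emp" using bad_mono by blast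
  have fc: "?good s \<longleftrightarrow> (\<forall>t. t \<sqsubseteq> s \<and> Fin t \<longrightarrow> ?good t)" for s
  proof
    show "?good s \<Longrightarrow> \<forall>t. t \<sqsubseteq> s \<and> Fin t \<longrightarrow> ?good t" using bad_mono by blast
    show "\<forall>t. t \<sqsubseteq> s \<and> Fin t \<longrightarrow> ?good t \<Longrightarrow> ?good s" using subs_refl by blast
  qed
  obtain m where m: "m \<sqsubseteq> Pw (Pw I)" "?good m"
    "\<And>A. A \<epsilon> Pw (Pw I) \<Longrightarrow> ?good (ins A m) \<Longrightarrow> A \<epsilon> m"
    by (rule tukey[OF goodD good_emp, of "Pw (Pw I)"], rule fc, rule that)
  define A where "A i = Sep (Pw I) (\<lambda>x. i \<epsilon> x)" for i
  define A' where "A' i = Sep (Pw I) (\<lambda>x. \<not> i \<epsilon> x)" for i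
  have A: "x \<epsilon> A i \<longleftrightarrow> x \<epsilon> Pw I \<and> i \<epsilon> x" for x i
    unfolding A_def by (rule Sep_iff) (intro definable)
  have A': "x \<epsilon> A' i \<longleftrightarrow> x \<epsilon> Pw I \<and> \<not> i \<epsilon> x" for x i
    unfolding A'_def by (rule Sep_iff) (intro definable)
  have AD: "DT (\<lambda>e. A (e 0))" by (rule DT_ext, rule A, intro definable)
  have A'D: "DT (\<lambda>e. A' (e 0))" by (rule DT_ext, rule A', intro definable)
  note [definable] = DT_app1[OF AD] DT_app1[OF A'D]
  have notin: "\<exists>t d. t \<sqsubseteq> m \<and> Fin t \<and> d \<sqsubseteq> c \<and> Fin d \<and>
      (\<forall>x. x \<sqsubseteq> I \<and> (\<forall>A. A \<epsilon> t \<longrightarrow> x \<epsilon> A) \<and> x \<epsilon> B \<longrightarrow> x \<epsilon> Uni d)" if B: "B \<sqsubseteq> Pw I" "\<not> B \<epsilon> m" for B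
  proof -
    have "B \<epsilon> Pw (Pw I)" using B(1) by simp
    then have "\<not> ?good (ins B m)" using m(3)[of B] B(2) by blast
    then obtain t d where t: "t \<sqsubseteq> ins B m" "Fin t" "d \<sqsubseteq> c" "Fin d"
      "\<And>x. x \<sqsubseteq> I \<Longrightarrow> (\<forall>A. A \<epsilon> t \<longrightarrow> x \<epsilon> A) \<Longrightarrow> x \<epsilon> Uni d"
      by blast
    have "dif t (up B B) \<sqsubseteq> m" using t(1) by (auto simp: subs_def)
    moreover have "Fin (dif t (up B B))" by (rule Fin_subs[OF t(2)]) (auto simp: subs_def)
    moreover have "x \<epsilon> Uni d"
      if x: "x \<sqsubseteq> I" "\<forall>A. A \<epsilon> dif t (up B B) \<longrightarrow> x \<epsilon> A" "x \<epsilon> B" for x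
      by (rule t(5)[OF x(1)]) (use x in auto)
    ultimately show ?thesis using t(3,4) by blast
  qed
  have dichotomy: "A i \<epsilon> m \<or> A' i \<epsilon> m" for i
  proof (rule ccontr)
    assume *: "\<not> ?thesis"
    have "A i \<sqsubseteq> Pw I" "A' i \<sqsubseteq> Pw I" by (auto simp: A A' subs_def)
    with * obtain t d t' d' where t: "t \<sqsubseteq> m" "Fin t" "d \<sqsubseteq> c" "Fin d"
      "\<And>x. x \<sqsubseteq> I \<Longrightarrow> (\<forall>A. A \<epsilon> t \<longrightarrow> x \<epsilon> A) \<Longrightarrow> x \<epsilon> A i \<Longrightarrow> x \<epsilon> Uni d"
      and t': "t' \<sqsubseteq> m" "Fin t'" "d' \<sqsubseteq> c" "Fin d'"
      "\<And>x. x \<sqsubseteq> I \<Longrightarrow> (\<forall>A. A \<epsilon> t' \<longrightarrow> x \<epsilon> A) \<Longrightarrow> x \<epsilon> A' i \<Longrightarrow> x \<epsilon> Uni d'"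
      using notin[of "A i"] notin[of "A' i"] by blast
    have "un t t' \<sqsubseteq> m" "Fin (un t t')" "un d d' \<sqsubseteq> c" "Fin (un d d')"
      using t t' by (auto intro: Fin_un un_subs)
    then obtain x where x: "x \<sqsubseteq> I" "\<forall>A. A \<epsilon> un t t' \<longrightarrow> x \<epsilon> A" "\<not> x \<epsilon> Uni (un d d')"
      using m(2) by blast
    have "x \<epsilon> A i \<or> x \<epsilon> A' i" using x(1) by (auto simp: A A')
    then have "x \<epsilon> Uni d \<or> x \<epsilon> Uni d'" using t(5) t'(5) x by auto
    then show False using x(3) by auto
  qed
  define x where "x = Sep I (\<lambda>i. A i \<epsilon> m)"
  have x: "i \<epsilon> x \<longleftrightarrow> i \<epsilon> I \<and> A i \<epsilon> m" for i
    unfolding x_def by (rule Sep_iff) (intro definable)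
  have "x \<epsilon> Uni c" using c x by (metis Pw_iff subsI)
  then obtain u where u: "u \<epsilon> c" "x \<epsilon> u" by auto
  then have "u \<epsilon> cube I" using c subsD by blast
  then obtain p q where p: "Fin p" "Fin q" "q \<sqsubseteq> I" "x \<epsilon> bs I p q" "bs I p q \<sqsubseteq> u"
    using u(2) cube_refine by blast
  \<comment> \<open>The basic neighbourhood of \<open>x\<close> inside \<open>u\<close> is the
    intersection of this finite family in the cube. The definition of \<open>x\<close> and the
    dichotomy put the family inside \<open>m\<close>, so it cannot be covered by the single member
    \<open>u\<close> of the cover.\<close>
  define t where "t = un (Rep p A) (Rep q A')"
  have t: "B \<epsilon> t \<longleftrightarrow> (\<exists>i. i \<epsilon> p \<and> B = A i) \<or> (\<exists>i. i \<epsilon> q \<and> B = A' i)" for B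
    by (simp add: t_def Rep_iff[OF AD] Rep_iff[OF A'D])
  have "A i \<epsilon> m" if "i \<epsilon> p" for i using that p(4) x by (auto simp: bs_iff subs_def)
  moreover have "A' i \<epsilon> m" if "i \<epsilon> q" for i
    using that p(3,4) x dichotomy[of i] by (auto simp: bs_iff subs_def)
  ultimately have "t \<sqsubseteq> m" unfolding subs_def t by blast
  moreover have "Fin t" unfolding t_def by (intro Fin_un Fin_Rep AD A'D p)
  moreover have "up u u \<sqsubseteq> c" using u(1) by (auto simp: subs_def)
  moreover have "Fin (up u u)"
    using Fin_ins[OF Fin_emp, of u] by (metis emp_iff ins_iff up_iff extensionality)
  ultimately obtain y where y: "y \<sqsubseteq> I" "\<forall>A. A \<epsilon> t \<longrightarrow> y \<epsilon> A" "\<not> y \<epsilon> Uni (up u u)"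
    using m(2) by blast
  have "y \<epsilon> A i" if "i \<epsilon> p" for i using that y(2) t by blast
  moreover have "y \<epsilon> A' i" if "i \<epsilon> q" for i using that y(2) t by blast
  ultimately have "y \<epsilon> bs I p q" using y(1) unfolding bs_iff subs_def A A' by blast
  then show False using p(5) y(3) subsD by auto
qed

text \<open>A Baire argument with finite conditions, each step leaving the next nowhere dense set.
  The hypothesis on \<open>Y\<close> takes the place of completeness: the conditions have unions
  \<open>p\<close> and \<open>q\<close> of size at most |V|, and a point of \<open>Y\<close> in
  \<open>bs I p q\<close> escapes all the sets.\<close>

lemma cube_nonmeager:
  assumes j: "pairing j tk V" and omV: "om \<sqsubseteq> V" and "Y \<sqsubseteq> Pw I"
    and Y: "\<And>p q. p \<sqsubseteq> I \<Longrightarrow> q \<sqsubseteq> I \<Longrightarrow> \<not> (\<exists>z. z \<epsilon> p \<and> z \<epsilon> q) \<Longrightarrow> lep p V \<Longrightarrow> lep q V \<Longrightarrow>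
      \<exists>y. y \<epsilon> Y \<and> y \<epsilon> bs I p q"
  shows "\<not> mgr Y (Pw I) (cube I)"
proof
  assume "mgr Y (Pw I) (cube I)"
  then obtain f where f: "lep f om" "\<And>b. b \<epsilon> f \<Longrightarrow> nwd b (Pw I) (cube I)" "Y = Uni f"
    by (auto simp: mgr_def)
  obtain g where g: "DT (\<lambda>e. g (e 0))" "\<And>x. x \<epsilon> f \<Longrightarrow> g x \<epsilon> om"
    "\<And>x y. x \<epsilon> f \<Longrightarrow> y \<epsilon> f \<Longrightarrow> g x = g y \<Longrightarrow> x = y"
    by (rule lepE[OF f(1)], rule that)
  note [definable] = DT_app1[OF g(1)]
  let ?C = "\<lambda>p q. Fin p \<and> Fin q \<and> p \<sqsubseteq> I \<and> q \<sqsubseteq> I \<and> \<not> (\<exists>z. z \<epsilon> p \<and> z \<epsilon> q)"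
  define A where "A = Sep (prd (Pw I) (Pw I)) (\<lambda>s. \<exists>p q. s = pr p q \<and> ?C p q)"
  have A: "s \<epsilon> A \<longleftrightarrow> s \<epsilon> prd (Pw I) (Pw I) \<and> (\<exists>p q. s = pr p q \<and> ?C p q)" for s
    unfolding A_def by (rule Sep_iff) (intro definable)
  have prA: "pr p q \<epsilon> A \<longleftrightarrow> ?C p q" for p q by (auto simp: A)
  let ?R = "\<lambda>n s s'. \<forall>p q p' q'. s = pr p q \<and> s' = pr p' q' \<longrightarrow> p \<sqsubseteq> p' \<and> q \<sqsubseteq> q' \<and>
    (\<forall>b. b \<epsilon> f \<and> g b = n \<longrightarrow> \<not> (\<exists>x. x \<epsilon> b \<and> x \<epsilon> bs I p' q'))"
  have RD: "D (\<lambda>e. ?R (e 0) (e 1) (e 2))" by (intro definable)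
  have step: "\<exists>s'. s' \<epsilon> A \<and> ?R n s s'" if s: "s \<epsilon> A" for n s
  proof -
    obtain p q where pq: "s = pr p q" "?C p q" using s unfolding A by blast
    show ?thesis
    \<comment> \<open>The numbering \<open>g\<close> is injective but may skip numbers; at a skipped
      one the condition is kept.\<close>
    proof (cases "\<exists>b. b \<epsilon> f \<and> g b = n")
      case False
      then show ?thesis using s by (intro exI[of _ s]) auto
    next
      case True
      then obtain b where b: "b \<epsilon> f" "g b = n" by blast
      \<comment> \<open>As \<open>p\<close> and \<open>q\<close> are disjoint, \<open>p\<close>
        itself is a point of the basic set.\<close>
      have "p \<epsilon> bs I p q" using pq(2) by (auto simp: bs_iff)
      moreover have "bs I p q \<epsilon> cube I" using pq(2) bs_open by blast
      ultimately obtain v x where v: "v \<epsilon> cube I" "x \<epsilon> v" "v \<sqsubseteq> bs I p q" "\<not> (\<exists>z. z \<epsilon> v \<and> z \<epsilon> b)"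
        using nwd_refine[OF f(2)[OF b(1)] cube_topology] by blast
      obtain p' q' where p': "Fin p'" "Fin q'" "q' \<sqsubseteq> I" "x \<epsilon> bs I p' q'" "bs I p' q' \<sqsubseteq> v"
        using v(1,2) cube_refine by blast
      have x: "x \<epsilon> bs I (un p p') (un q q')" using p'(4) v(2,3) subsD by (simp add: bs_un) 
      then have "un p p' \<sqsubseteq> x" "x \<sqsubseteq> I" "\<not> (\<exists>z. z \<epsilon> un q q' \<and> z \<epsilon> x)" unfolding bs_iff by blast+
      then have "un p p' \<sqsubseteq> I" "\<not> (\<exists>z. z \<epsilon> un p p' \<and> z \<epsilon> un q q')" unfolding subs_def by blast+
      then have C: "?C (un p p') (un q q')" using pq(2) p' Fin_un un_subs by blast
      have "\<not> (\<exists>x. x \<epsilon> b \<and> x \<epsilon> bs I (un p p') (un q q'))"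
        using v(4) p'(5) subsD by (auto simp: bs_un)
      moreover have "b' = b" if "b' \<epsilon> f" "g b' = n" for b' using that b g(3) by blast
      ultimately have "?R n s (pr (un p p') (un q q'))"
        using pq(1) by (auto simp: subs_def)
      then show ?thesis using C prA by blast
    qed
  qed
  have start: "pr emp emp \<epsilon> A" by (auto simp: prA subs_def)
  obtain F where F: "DT (\<lambda>e. F (e 0))" "F emp = pr emp emp" "\<And>n. n \<epsilon> om \<Longrightarrow> F n \<epsilon> A"
    "\<And>n. n \<epsilon> om \<Longrightarrow> ?R n (F n) (F (sc n))"
    by (rule dependent_choice[of "pr emp emp" A ?R, OF start RD step], assumption, rule that)
  note [definable] = DT_app1[OF F(1)]
  define P where "P n = Sep I (\<lambda>i. \<exists>p q. F n = pr p q \<and> i \<epsilon> p)" for n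
  define Q where "Q n = Sep I (\<lambda>i. \<exists>p q. F n = pr p q \<and> i \<epsilon> q)" for n
  have P: "i \<epsilon> P n \<longleftrightarrow> i \<epsilon> I \<and> (\<exists>p q. F n = pr p q \<and> i \<epsilon> p)" for i n
    unfolding P_def by (rule Sep_iff) (intro definable)
  have Q: "i \<epsilon> Q n \<longleftrightarrow> i \<epsilon> I \<and> (\<exists>p q. F n = pr p q \<and> i \<epsilon> q)" for i n
    unfolding Q_def by (rule Sep_iff) (intro definable)
  have PD: "DT (\<lambda>e. P (e 0))" by (rule DT_ext, rule P, intro definable)
  have QD: "DT (\<lambda>e. Q (e 0))" by (rule DT_ext, rule Q, intro definable)
  note [definable] = DT_app1[OF PD] DT_app1[OF QD]
  have FPQ: "F n = pr (P n) (Q n) \<and> ?C (P n) (Q n)" if n: "n \<epsilon> om" for n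
  proof -
    obtain p q where pq: "F n = pr p q" "?C p q" using F(3)[OF n] unfolding A by blast
    have "p = P n" "q = Q n"
      by (rule extensionality, use pq in \<open>auto simp: P Q subs_def\<close>)+
    with pq show ?thesis by simp
  qed
  have next_step: "P n \<sqsubseteq> P (sc n) \<and> Q n \<sqsubseteq> Q (sc n) \<and>
    (\<forall>b. b \<epsilon> f \<and> g b = n \<longrightarrow> \<not> (\<exists>x. x \<epsilon> b \<and> x \<epsilon> bs I (P (sc n)) (Q (sc n))))" if "n \<epsilon> om" for n
    using F(4)[OF that] FPQ[OF that] FPQ[OF om_sc[OF that]] by blast
  have mono: "\<forall>m. m \<epsilon> n \<or> m = n \<longrightarrow> P m \<sqsubseteq> P n \<and> Q m \<sqsubseteq> Q n" if "n \<epsilon> om" for n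
    using that
  proof (induction rule: om_induct)
    case D
    show ?case by (intro definable)
  next
    case (succ n)
    then show ?case using next_step[OF succ(1)] unfolding sc_iff subs_def by blast
  qed simp
  define p where "p = Uni (Rep om P)"
  define q where "q = Uni (Rep om Q)"
  have p: "i \<epsilon> p \<longleftrightarrow> (\<exists>n. n \<epsilon> om \<and> i \<epsilon> P n)" for i
    unfolding p_def Uni_iff Rep_iff[OF PD] by blast
  have q: "i \<epsilon> q \<longleftrightarrow> (\<exists>n. n \<epsilon> om \<and> i \<epsilon> Q n)" for i
    unfolding q_def Uni_iff Rep_iff[OF QD] by blast
  have "p \<sqsubseteq> I" "q \<sqsubseteq> I" by (auto simp: p q P Q)
  moreover have "\<not> (\<exists>z. z \<epsilon> p \<and> z \<epsilon> q)"
  proof (intro notI, elim exE conjE)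
    fix z assume "z \<epsilon> p" "z \<epsilon> q"
    then obtain m n where mn: "m \<epsilon> om" "z \<epsilon> P m" "n \<epsilon> om" "z \<epsilon> Q n" unfolding p q by blast
    then obtain k where k: "k \<epsilon> om" "z \<epsilon> P k" "z \<epsilon> Q k"
      using Ord_linear[of m n] om_Ord mono[of m] mono[of n] subsD by metis
    then show False using FPQ[OF k(1)] by blast
  qed
  moreover have "lep om V" using omV by (rule subs_imp_lep)
  moreover from this have "lep (P n) V" "lep (Q n) V" if "n \<epsilon> om" for n
    using FPQ[OF that] Fin_lep_om lep_trans by blast+
  moreover from calculation have "lep p V" "lep q V"
    unfolding p_def q_def using lep_Uni[OF j PD] lep_Uni[OF j QD] by blast+
  ultimately obtain y where y: "y \<epsilon> Y" "y \<epsilon> bs I p q" using Y by blast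
  then obtain b where b: "b \<epsilon> f" "y \<epsilon> b" using f(3) by auto
  have n: "g b \<epsilon> om" using b g(2) by blast
  have "P (sc (g b)) \<sqsubseteq> p" "Q (sc (g b)) \<sqsubseteq> q" using om_sc[OF n] p q by blast+
  then have "y \<epsilon> bs I (P (sc (g b))) (Q (sc (g b)))" using y(2) unfolding bs_iff subs_def by blast
  then show False using next_step[OF n] b by blast
qed

text \<open>The members of the non-meager set: \<open>{x \<subseteq> V\<^sub>0 | x \<inter> a \<in> t}\<close> for small \<open>a\<close> and \<open>t\<close>, so that
  disjoint small sets \<open>p\<close> and \<open>q\<close> of points are separated by collecting in \<open>a\<close> an element of
  each difference between a member of \<open>p\<close> and a member of \<open>q\<close>. Here \<open>V\<^sub>0 = Pw V\<close>, and both parameters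
  are coded by elements of \<open>Pw V\<close>.\<close>

lemma small_nonmeager:
  assumes j: "pairing j tk V" and omV: "om \<sqsubseteq> V"
  obtains Y where "Y \<sqsubseteq> Pw (Pw (Pw V))" "\<not> mgr Y (Pw (Pw (Pw V))) (cube (Pw (Pw V)))" "lep Y (Pw V)"
proof -
  let ?B = "Pw V"
  let ?I = "Pw ?B"
  obtain dec where dec: "DT (\<lambda>e. dec (e 0))" "\<And>a. a \<sqsubseteq> ?B \<Longrightarrow> lep a V \<Longrightarrow> \<exists>c. c \<sqsubseteq> V \<and> dec c = a"
    by (rule coding[OF j], rule that)
  note [definable] = DT_app1[OF dec(1)]
  \<comment> \<open>The code \<open>c1\<close> is decoded once, to the set \<open>a\<close> of
    coordinates. The code \<open>c2\<close> is decoded twice, since its first decoding consists of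
    codes of the traces on \<open>a\<close> that make up \<open>t\<close>.\<close>
  define y where "y z = Sep ?I (\<lambda>x. \<exists>c1 c2 c. z = pr c1 c2 \<and> c \<epsilon> dec c2 \<and> cap x (dec c1) = dec c)" for z
  have y: "x \<epsilon> y z \<longleftrightarrow> x \<epsilon> ?I \<and> (\<exists>c1 c2 c. z = pr c1 c2 \<and> c \<epsilon> dec c2 \<and> cap x (dec c1) = dec c)" for x z
    unfolding y_def by (rule Sep_iff) (intro definable)
  have yD: "DT (\<lambda>e. y (e 0))" by (rule DT_ext, rule y, intro definable)
  define Y where "Y = Rep (prd ?B ?B) y"
  have Y: "u \<epsilon> Y \<longleftrightarrow> (\<exists>z. z \<epsilon> prd ?B ?B \<and> u = y z)" for u
    unfolding Y_def by (rule Rep_iff[OF yD])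
  have "y z \<sqsubseteq> ?I" for z using y by blast
  then have "u \<epsilon> Pw ?I" if "u \<epsilon> Y" for u using that unfolding Y by (metis Pw_iff)
  then have YI: "Y \<sqsubseteq> Pw ?I" by (rule subsI)
  obtain j' tk' where j': "pairing j' tk' ?B" using pairing_Pw[OF j] .
  have "lep Y ?B" unfolding Y_def using Rep_lep[OF yD] pairing_prd[OF j'] lep_trans by blast
  moreover have "\<not> mgr Y (Pw ?I) (cube ?I)"
  proof (rule cube_nonmeager[OF j omV YI])
    fix p q assume p: "p \<sqsubseteq> ?I" "q \<sqsubseteq> ?I" "\<not> (\<exists>z. z \<epsilon> p \<and> z \<epsilon> q)" "lep p V" "lep q V"
    let ?S = "\<lambda>z w. \<exists>x x'. z = pr x x' \<and> (w \<epsilon> x \<longleftrightarrow> \<not> w \<epsilon> x')"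
    have SD: "D (\<lambda>e. ?S (e 0) (e 1))" by (intro definable)
    have ex: "\<exists>w. w \<epsilon> ?B \<and> ?S z w" if "z \<epsilon> prd p q" for z
    proof -
      obtain x x' where x: "x \<epsilon> p" "x' \<epsilon> q" "z = pr x x'" using \<open>z \<epsilon> prd p q\<close> by (auto simp: prd_iff)
      then have "x \<noteq> x'" using p(3) by blast
      then obtain w where w: "w \<epsilon> x \<longleftrightarrow> \<not> w \<epsilon> x'" using extensionality by blast
      have "x \<sqsubseteq> ?B" "x' \<sqsubseteq> ?B" using x p(1,2) subsD Pw_iff by blast+
      then have "w \<epsilon> ?B" using w subsD by blast
      with x w show ?thesis by blast
    qed
    obtain \<delta> where \<delta>: "DT (\<lambda>e. \<delta> (e 0))" "\<And>z. z \<epsilon> prd p q \<Longrightarrow> \<delta> z \<epsilon> ?B \<and> ?S z (\<delta> z)"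
      by (rule choice_function[of "prd p q" ?B ?S, OF ex SD], assumption, rule that)
    define a where "a = Rep (prd p q) \<delta>"
    have a: "w \<epsilon> a \<longleftrightarrow> (\<exists>z. z \<epsilon> prd p q \<and> w = \<delta> z)" for w
      unfolding a_def by (rule Rep_iff[OF \<delta>(1)])
    have aB: "a \<sqsubseteq> ?B" unfolding subs_def a using \<delta>(2) by blast
    have aV: "lep a V"
      unfolding a_def using Rep_lep[OF \<delta>(1)] lep_prd[OF p(4,5)] pairing_prd[OF j] lep_trans by blast
    obtain c1 where c1: "c1 \<sqsubseteq> V" "dec c1 = a" using dec(2)[OF aB aV] by blast
    have TD: "D (\<lambda>e. dec (e 1) = cap (e 0) a)" by (intro definable)
    have ex': "\<exists>c. c \<epsilon> ?B \<and> dec c = cap x a" for x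
    proof -
      have "cap x a \<sqsubseteq> a" by auto
      then have "lep (cap x a) V" using aV subs_imp_lep lep_trans by blast
      moreover have "cap x a \<sqsubseteq> ?B" using subsD[OF aB] by (intro subsI) simp
      ultimately show ?thesis using dec(2)[of "cap x a"] Pw_iff by blast
    qed
    obtain \<gamma> where \<gamma>: "DT (\<lambda>e. \<gamma> (e 0))" "\<And>x. x \<epsilon> p \<Longrightarrow> \<gamma> x \<epsilon> ?B \<and> dec (\<gamma> x) = cap x a"
      by (rule choice_function[of p ?B "\<lambda>x c. dec c = cap x a", OF ex' TD], rule that)
    have sB: "Rep p \<gamma> \<sqsubseteq> ?B" unfolding subs_def Rep_iff[OF \<gamma>(1)] using \<gamma>(2) by blast
    have "lep (Rep p \<gamma>) V" using Rep_lep[OF \<gamma>(1)] p(4) lep_trans by blast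
    then obtain c2 where c2: "c2 \<sqsubseteq> V" "dec c2 = Rep p \<gamma>" using dec(2)[OF sB] by blast
    \<comment> \<open>The chosen point consists of the \<open>x\<close> with the same trace on
      \<open>a\<close> as some member of \<open>p\<close>. It contains \<open>p\<close>, and it
      misses \<open>q\<close> because \<open>a\<close> tells every member of \<open>q\<close> from
      every member of \<open>p\<close>.\<close>
    have in_y: "x \<epsilon> y (pr c1 c2) \<longleftrightarrow> x \<epsilon> ?I \<and> (\<exists>x'. x' \<epsilon> p \<and> cap x a = cap x' a)" for x
    proof -
      have "x \<epsilon> y (pr c1 c2) \<longleftrightarrow> x \<epsilon> ?I \<and> (\<exists>c. c \<epsilon> Rep p \<gamma> \<and> cap x a = dec c)"
        unfolding y using c1(2) c2(2) by auto
      then show ?thesis unfolding Rep_iff[OF \<gamma>(1)] using \<gamma>(2) by metis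
    qed
    have "\<not> x \<epsilon> y (pr c1 c2)" if x: "x \<epsilon> q" for x
    proof
      assume "x \<epsilon> y (pr c1 c2)"
      then obtain x' where x': "x' \<epsilon> p" "cap x a = cap x' a" unfolding in_y by blast
      then have z: "pr x' x \<epsilon> prd p q" using x by simp
      then have "\<delta> (pr x' x) \<epsilon> a" unfolding a by blast
      then have "\<delta> (pr x' x) \<epsilon> x \<longleftrightarrow> \<delta> (pr x' x) \<epsilon> x'" using x'(2) cap_iff by metis
      then show False using \<delta>(2)[OF z] by auto
    qed
    moreover have "p \<sqsubseteq> y (pr c1 c2)" using p(1) in_y subsD by blast
    moreover have "y (pr c1 c2) \<sqsubseteq> ?I" using in_y by blast
    ultimately have "y (pr c1 c2) \<epsilon> bs ?I p q" unfolding bs_iff by blast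
    moreover have "y (pr c1 c2) \<epsilon> Y" unfolding Y using c1(1) c2(1) by (intro exI[of _ "pr c1 c2"]) simp
    ultimately show "\<exists>u. u \<epsilon> Y \<and> u \<epsilon> bs ?I p q" by blast
  qed
  ultimately show thesis using that YI by blast
qed

section \<open>The \<pi>-weight of the open subsets of the cube\<close>

lemma cube_finite_point:
  assumes "u \<epsilon> cube I" "x \<epsilon> u" shows "\<exists>p. p \<epsilon> u \<and> Fin p"
proof -
  obtain p q where p: "Fin p" "Fin q" "q \<sqsubseteq> I" "x \<epsilon> bs I p q" "bs I p q \<sqsubseteq> u"
    by (rule cube_refine[OF assms], rule that)
  then have "p \<epsilon> bs I p q" unfolding bs_iff subs_def by blast
  then show ?thesis using p subsD by blast
qed

text \<open>Choose a finite point in each member of \<open>K\<close> and enlarge it by the finite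
  set \<open>un p q\<close>. These sets cover \<open>Pw V\<close>: for \<open>i\<close> outside
  \<open>un p q\<close> the basic set that additionally demands \<open>i\<close> contains a member
  of \<open>K\<close>, whose chosen point then has \<open>i\<close> as an element. The covering
  theorem \<open>koenig\<close> bounds \<open>K\<close> from below.\<close>

lemma cube_pi_base_lower:
  assumes j: "pairing j tk V" and omV: "om \<sqsubseteq> V" and u: "u \<epsilon> cube (Pw V)" "x \<epsilon> u"
    and K: "pi_base K (Rep (cube (Pw V)) (\<lambda>v. cap v u))"
  shows "lep (Pw V) K"
proof -
  let ?I = "Pw V"
  have RD: "DT (\<lambda>e. cap (e 0) u)" by (intro definable)
  have open_iff: "v \<epsilon> Rep (cube ?I) (\<lambda>v. cap v u) \<longleftrightarrow> v \<epsilon> cube ?I \<and> v \<sqsubseteq> u" for v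
  proof -
    have "cap w u \<epsilon> cube ?I" if "w \<epsilon> cube ?I" for w
      using that u(1) cube_topology[of ?I] by (simp add: topology_def)
    moreover have "v = cap v u" if "v \<sqsubseteq> u" using that by (intro extensionality) (auto simp: subs_def)
    ultimately show ?thesis unfolding Rep_iff[OF RD] by (auto simp: subs_def)
  qed
  obtain p q where p: "Fin p" "Fin q" "q \<sqsubseteq> ?I" "x \<epsilon> bs ?I p q" "bs ?I p q \<sqsubseteq> u"
    using u cube_refine by blast
  have pI: "p \<sqsubseteq> ?I" "\<not> (\<exists>z. z \<epsilon> p \<and> z \<epsilon> q)" using p(4) unfolding bs_iff subs_def by blast+
  have ptD: "D (\<lambda>e. e 1 \<epsilon> e 0 \<and> Fin (e 1))" by (intro definable)
  have pt: "\<exists>d. d \<epsilon> Pw ?I \<and> d \<epsilon> b \<and> Fin d" if "b \<epsilon> K" for b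
  proof -
    have b: "b \<epsilon> cube ?I" "\<exists>x. x \<epsilon> b" using K that open_iff unfolding pi_base_def by blast+
    then obtain d where "d \<epsilon> b" "Fin d" using cube_finite_point by blast
    moreover from this b have "d \<sqsubseteq> ?I" unfolding cube_iff using subsD Pw_iff by blast
    ultimately show ?thesis by auto
  qed
  obtain d where d: "DT (\<lambda>e. d (e 0))" "\<And>b. b \<epsilon> K \<Longrightarrow> d b \<epsilon> Pw ?I \<and> d b \<epsilon> b \<and> Fin (d b)"
    by (rule choice_function[of K "Pw ?I" "\<lambda>b d. d \<epsilon> b \<and> Fin d", OF pt ptD], assumption, rule that)
  note [definable] = DT_app1[OF d(1)]
  let ?d = "\<lambda>b. un (d b) (un p q)"
  have dD: "DT (\<lambda>e. ?d (e 0))" by (intro definable)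
  show ?thesis
  proof (rule koenig[OF j dD])
    fix b assume "b \<epsilon> K"
    then have "Fin (?d b)" using d(2) p(1,2) Fin_un by blast
    then show "lep (?d b) V" using Fin_lep_om omV subs_imp_lep lep_trans by blast
  next
    fix i assume i: "i \<sqsubseteq> V"
    let ?v = "if i \<epsilon> un p q then bs ?I p q else bs ?I (ins i p) q"
    have vu: "?v \<sqsubseteq> u" using p(5) by (auto simp: bs_iff subs_def)
    have "?v \<epsilon> cube ?I" using p by (auto intro!: bs_open)
    moreover have "\<exists>y. y \<epsilon> ?v"
    proof (cases "i \<epsilon> un p q")
      case True
      then show ?thesis using p(4) by auto
    next
      case False
      then have "ins i p \<epsilon> bs ?I (ins i p) q" using pI i by (auto simp: bs_iff subs_def)
      with False show ?thesis by auto
    qed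
    ultimately obtain b where b: "b \<epsilon> K" "b \<sqsubseteq> ?v"
      using K vu open_iff unfolding pi_base_def by blast
    then have "d b \<epsilon> ?v" using d(2) subsD by blast
    then have "i \<epsilon> ?d b" by (auto simp: bs_iff subs_def split: if_splits)
    with b show "\<exists>b. b \<epsilon> K \<and> i \<epsilon> ?d b" by blast
  qed
qed

text \<open>Basic sets are given by two finite subsets of \<open>Pw V\<close>, and there are at most
  |Pw V| of those because finite sets are small in the sense of \<open>coding\<close>. Disjointness
  of the two subsets keeps the basic sets nonempty.\<close>

lemma cube_pi_base_upper:
  assumes j: "pairing j tk V" and omV: "om \<sqsubseteq> V" and u: "u \<epsilon> cube (Pw V)"
  shows "\<exists>K. pi_base K (Rep (cube (Pw V)) (\<lambda>v. cap v u)) \<and> lep K (Pw V)"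
proof -
  let ?I = "Pw V"
  have RD: "DT (\<lambda>e. cap (e 0) u)" by (intro definable)
  define FI where "FI = Sep (Pw ?I) Fin"
  have FI: "p \<epsilon> FI \<longleftrightarrow> p \<epsilon> Pw ?I \<and> Fin p" for p
    unfolding FI_def by (rule Sep_iff) (intro definable)
  have "lep FI ?I"
  proof (rule small_subsets_lep[OF j])
    fix a assume "a \<epsilon> FI"
    then show "a \<sqsubseteq> ?I \<and> lep a V"
      using FI Fin_lep_om subs_imp_lep[OF omV] lep_trans Pw_iff by blast
  qed
  moreover obtain j' tk' where "pairing j' tk' ?I" using pairing_Pw[OF j] .
  ultimately have FI2: "lep (prd FI FI) ?I" using lep_prd pairing_prd lep_trans by blast
  let ?P = "\<lambda>b p q. p \<epsilon> FI \<and> q \<epsilon> FI \<and> \<not> (\<exists>z. z \<epsilon> p \<and> z \<epsilon> q) \<and> b = bs ?I p q \<and> b \<sqsubseteq> u"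
  define K where "K = Sep (cube ?I) (\<lambda>b. \<exists>p q. ?P b p q)"
  have K: "b \<epsilon> K \<longleftrightarrow> b \<epsilon> cube ?I \<and> (\<exists>p q. ?P b p q)" for b
    unfolding K_def by (rule Sep_iff) (intro definable)
  have "lep K (prd FI FI)"
  proof (rule lep_relation[of "\<lambda>b z. \<exists>p q. z = pr p q \<and> b = bs ?I p q"])
    show "D (\<lambda>e. \<exists>p q. e 1 = pr p q \<and> e 0 = bs ?I p q)" by (intro definable)
    show "b \<epsilon> K \<Longrightarrow> \<exists>z. z \<epsilon> prd FI FI \<and> (\<exists>p q. z = pr p q \<and> b = bs ?I p q)" for b
      unfolding K prd_iff by blast
  qed auto
  moreover have "pi_base K (Rep (cube ?I) (\<lambda>v. cap v u))"
    unfolding pi_base_def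
  proof (intro conjI allI impI)
    fix b assume "b \<epsilon> K"
    then obtain p q where b: "b \<epsilon> cube ?I" "?P b p q" unfolding K by blast
    have "b = cap b u" using b(2) by (intro extensionality) (auto simp: subs_def)
    with b show "b \<epsilon> Rep (cube ?I) (\<lambda>v. cap v u)" unfolding Rep_iff[OF RD] by blast
    have "p \<epsilon> b" using b(2) unfolding FI by (auto simp: bs_iff)
    then show "\<exists>x. x \<epsilon> b" by blast
  next
    fix v assume v: "v \<epsilon> Rep (cube ?I) (\<lambda>v. cap v u) \<and> (\<exists>x. x \<epsilon> v)"
    then obtain w x where w: "w \<epsilon> cube ?I" "v = cap w u" "x \<epsilon> v" unfolding Rep_iff[OF RD] by blast
    then have "v \<epsilon> cube ?I" using u cube_topology[of ?I] by (simp add: topology_def)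
    then obtain p q where p: "Fin p" "Fin q" "q \<sqsubseteq> ?I" "x \<epsilon> bs ?I p q" "bs ?I p q \<sqsubseteq> v"
      using w(3) cube_refine by blast
    have "p \<sqsubseteq> ?I" "\<not> (\<exists>z. z \<epsilon> p \<and> z \<epsilon> q)" using p(4) unfolding bs_iff subs_def by blast+
    moreover have "bs ?I p q \<sqsubseteq> u" using p(5) w(2) by (auto simp: subs_def)
    ultimately have "bs ?I p q \<epsilon> K" unfolding K FI Pw_iff[of _ ?I] using p bs_open by blast
    with p(5) show "\<exists>b. b \<epsilon> K \<and> b \<sqsubseteq> v" by blast
  qed
  ultimately show ?thesis using FI2 lep_trans by blast
qed

lemma cube_uniform_pi_weight:
  assumes j: "pairing j tk V" and omV: "om \<sqsubseteq> V" and u: "u \<epsilon> cube (Pw V)" "x \<epsilon> u"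
  shows "min_card (crd (Pw V)) (\<lambda>B. pi_base B (Rep (cube (Pw V)) (\<lambda>v. cap v u)))"
proof -
  obtain K where K: "pi_base K (Rep (cube (Pw V)) (\<lambda>v. cap v u))" "lep K (Pw V)"
    using cube_pi_base_upper[OF j omV u(1)] by blast
  have *: "lep (Pw V) (crd (Pw V))" "lep (crd (Pw V)) (Pw V)"
    using crd eqp_sym eqp_imp_lep by blast+
  show ?thesis
  proof (rule min_cardI[where y = K])
    show "Card (crd (Pw V))" by (rule crd(1))
    show "pi_base K (Rep (cube (Pw V)) (\<lambda>v. cap v u))" by (rule K(1))
    show "lep K (crd (Pw V))" using K(2) * lep_trans by blast
    show "pi_base B (Rep (cube (Pw V)) (\<lambda>v. cap v u)) \<Longrightarrow> lep (crd (Pw V)) B" for B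
      using cube_pi_base_lower[OF j omV u] * lep_trans by blast
  qed
qed

text \<open>Every element of \<kappa> lies in a countably infinite subset, namely with \<omega>
  adjoined, and hence in a member of the cofinal family. The bijection between \<kappa> and
  \<open>Pw V\<close> turns the family into a cover of \<open>Pw V\<close> by countable sets, to
  which \<open>koenig\<close> applies.\<close>

lemma cf_lower:
  assumes j: "pairing j tk V" and omV: "om \<sqsubseteq> V" and f: "cof f (crd (Pw V))"
  shows "lep (Pw V) f"
proof -
  let ?k = "crd (Pw V)"
  have ok: "Ord ?k" using crd Card_Ord by blast
  have V_k: "lep V ?k" using lep_Pw crd eqp_imp_lep lep_trans by blast
  have om_k: "om \<sqsubseteq> ?k"
  proof -
    have "\<not> ?k \<epsilon> om"
    proof
      assume "?k \<epsilon> om"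
      then have "?k \<sqsubseteq> om" using Ord_subs Ord_om by blast
      then have "lep ?k V" using omV subs_imp_lep lep_trans by blast
      then have "lep (Pw V) V" using crd eqp_imp_lep lep_trans by blast
      then show False using cantor by blast
    qed
    then show ?thesis using Ord_linear[of om ?k] ok Ord_subs[OF ok, of om] by auto
  qed
  have cover: "\<exists>b. b \<epsilon> f \<and> i \<epsilon> b" if i: "i \<epsilon> ?k" for i
  proof -
    have "lep (ins i om) om"
    \<comment> \<open>The element \<open>i\<close> takes the place of zero and the natural numbers
      other than \<open>i\<close> move up by one.\<close>
    proof (rule lepI[of "\<lambda>n. if n = i then emp else sc n"])
      show "DT (\<lambda>e. if e 0 = i then emp else sc (e 0))" by (intro definable)
      fix n m assume nm: "n \<epsilon> ins i om" "m \<epsilon> ins i om" "(if n = i then emp else sc n) = (if m = i then emp else sc m)"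
      have ne: "sc z \<noteq> emp" for z by (metis emp_iff sc_iff)
      have inj: "n = m" if "sc n = sc m"
      proof (rule ccontr)
        assume "n \<noteq> m"
        have "n \<epsilon> sc m" using that sc_iff[of n n] by simp
        moreover have "m \<epsilon> sc n" using that sc_iff[of m m] by simp
        ultimately show False using \<open>n \<noteq> m\<close> mem_asym by simp
      qed
      show "n = m"
        using nm(3) ne[of n] ne[of m] inj by (cases "n = i"; cases "m = i") auto
    qed auto
    moreover have "lep om (ins i om)" by (rule subs_imp_lep) auto
    ultimately have "eqp (ins i om) om" by (rule schroeder_bernstein)
    moreover have "ins i om \<sqsubseteq> ?k" using i om_k by (auto simp: subs_def)
    ultimately obtain b where "b \<epsilon> f" "ins i om \<sqsubseteq> b" using f unfolding cof_def by blast
    then show ?thesis using subsD by auto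
  qed
  obtain h where h: "DT (\<lambda>e. h (e 0))" "\<And>x. x \<epsilon> ?k \<Longrightarrow> h x \<epsilon> Pw V"
    "\<And>x y. x \<epsilon> ?k \<Longrightarrow> y \<epsilon> ?k \<Longrightarrow> h x = h y \<Longrightarrow> x = y" "\<And>y. y \<epsilon> Pw V \<Longrightarrow> \<exists>x. x \<epsilon> ?k \<and> h x = y"
    by (rule eqpE[OF eqp_sym[OF crd(2)[of "Pw V"]]], rule that)
  have dD: "DT (\<lambda>e. Rep (e 0) h)" by (intro DT_Rep1 h(1) definable)
  show ?thesis
  proof (rule koenig[OF j dD])
    fix b assume "b \<epsilon> f"
    then have "eqp b om" using f unfolding cof_def by blast
    then have "lep b V" using eqp_imp_lep omV subs_imp_lep lep_trans by blast
    then show "lep (Rep b h) V" using Rep_lep[OF h(1)] lep_trans by blast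
  next
    fix x assume "x \<sqsubseteq> V"
    then obtain i where "i \<epsilon> ?k" "h i = x" using h(4) by auto
    then show "\<exists>b. b \<epsilon> f \<and> x \<epsilon> Rep b h" unfolding Rep_iff[OF h(1)] using cover by blast
  qed
qed

lemma ex_cofinal_family: "\<exists>f. cof f k"
proof -
  have S: "a \<epsilon> Sep (Pw k) (\<lambda>a. eqp a om) \<longleftrightarrow> a \<epsilon> Pw k \<and> eqp a om" for a
    by (rule Sep_iff) (intro definable)
  show ?thesis
    by (rule exI[of _ "Sep (Pw k) (\<lambda>a. eqp a om)"]) (unfold cof_def S Pw_iff, use subs_refl in blast)
qed

text \<open>The non-meager set is built at \<open>W\<close>, so its size is at most |Pw W|; the
  bounds on \<pi>-weight and cofinality are taken one power set higher, at \<open>Pw W\<close>.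
  Cantor's theorem separates the two.\<close>

theorem small_nonmeager_cube:
  obtains X T k m c where
    "topology X T" "\<exists>x. x \<epsilon> X" "cpt X T" "haus X T" "\<not> (\<exists>x. x \<epsilon> X \<and> up x x \<epsilon> T)" "Card k"
    "\<And>u. u \<epsilon> T \<Longrightarrow> \<exists>x. x \<epsilon> u \<Longrightarrow> min_card k (\<lambda>B. pi_base B (Rep T (\<lambda>v. cap v u)))"
    "min_card m (\<lambda>y. y \<sqsubseteq> X \<and> \<not> mgr y X T)" "min_card c (\<lambda>f. cof f k)" "\<not> lep c m"
proof -
  obtain W where W: "om \<sqsubseteq> W" "pairing pr emp W" by (rule ex_pairing)
  let ?B = "Pw W"
  let ?I = "Pw ?B"
  obtain j tk where j: "pairing j tk ?B" using pairing_Pw[OF W(2)] .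
  have "lep om ?B" using W(1) subs_imp_lep lep_Pw lep_trans by blast
  \<comment> \<open>Natural numbers are subsets of \<omega> and thus of \<open>W\<close>, so
    \<omega> is also contained in \<open>Pw W\<close>.\<close>
  have omW: "n \<sqsubseteq> W" if "n \<epsilon> om" for n
    using that Ord_subs[OF Ord_om that] W(1) by (auto simp: subs_def)
  then have omB: "om \<sqsubseteq> ?B" by auto
  obtain Y where Y: "Y \<sqsubseteq> Pw ?I" "\<not> mgr Y (Pw ?I) (cube ?I)" "lep Y ?B"
    by (rule small_nonmeager[OF W(2,1)], rule that)
  have mD: "D (\<lambda>e. e 0 \<sqsubseteq> Pw ?I \<and> \<not> mgr (e 0) (Pw ?I) (cube ?I))" by (intro definable)
  obtain m where m: "min_card m (\<lambda>y. y \<sqsubseteq> Pw ?I \<and> \<not> mgr y (Pw ?I) (cube ?I))"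
    using ex_min_card[OF mD, of Y] Y by blast
  have cD: "D (\<lambda>e. cof (e 0) (crd ?I))" by (intro definable)
  obtain f where "cof f (crd ?I)" using ex_cofinal_family by blast
  then obtain c where c: "min_card c (\<lambda>f. cof f (crd ?I))" using ex_min_card[OF cD] by blast
  obtain g where "cof g (crd ?I)" "eqp g c" using min_card_attained[OF c] by blast
  then have "lep ?I c" using cf_lower[OF j omB] eqp_imp_lep lep_trans by blast
  moreover have "lep m ?B" using min_card_lep[OF m, of Y] Y lep_trans by blast
  ultimately have "\<not> lep c m" using cantor lep_trans by blast
  show thesis
  proof (rule that[of "Pw ?I" "cube ?I" "crd ?I" m c])
    show "\<exists>x. x \<epsilon> Pw ?I" by (rule exI[of _ emp]) auto
    show "\<not> (\<exists>x. x \<epsilon> Pw ?I \<and> up x x \<epsilon> cube ?I)"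
    proof (rule cube_no_isolated_points, rule ccontr)
      fix s assume "Fin s" "\<not> (\<exists>i. i \<epsilon> ?I \<and> \<not> i \<epsilon> s)"
      then have "?I \<sqsubseteq> s" by blast
      then have "lep ?I ?B" using \<open>Fin s\<close> Fin_lep_om \<open>lep om ?B\<close> subs_imp_lep lep_trans by blast
      then show False using cantor by blast
    qed
    show "min_card (crd ?I) (\<lambda>B. pi_base B (Rep (cube ?I) (\<lambda>v. cap v u)))"
      if "u \<epsilon> cube ?I" "\<exists>x. x \<epsilon> u" for u
      using cube_uniform_pi_weight[OF j omB that(1)] that(2) by blast
  qed (fact cube_topology cube_compact cube_hausdorff crd(1) m c \<open>\<not> lep c m\<close>)+
qed

end

section \<open>From positive numbers to a complete ordered field\<close>

text \<open>Positive numbers, without zero: addition alone then determines a strict linear order, by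
  \<open>tri\<close> and \<open>irr\<close>, and no sign cases arise. Natural numbers, fractions and
  cuts are all instances. The carrier is a set of the metalogic so that extensions of sets of the
  model can be inserted.\<close>

locale pos_semiring =
  fixes A :: "'a set" and pl :: "'a \<Rightarrow> 'a \<Rightarrow> 'a" (infixl "\<oplus>" 65)
    and tm :: "'a \<Rightarrow> 'a \<Rightarrow> 'a" (infixl "\<otimes>" 70) and one :: 'a ("\<one>")
  assumes pl_closed [simp]: "x \<in> A \<Longrightarrow> y \<in> A \<Longrightarrow> x \<oplus> y \<in> A"
    and tm_closed [simp]: "x \<in> A \<Longrightarrow> y \<in> A \<Longrightarrow> x \<otimes> y \<in> A"
    and one_closed [simp]: "\<one> \<in> A"
    and pl_assoc: "x \<in> A \<Longrightarrow> y \<in> A \<Longrightarrow> z \<in> A \<Longrightarrow> x \<oplus> y \<oplus> z = x \<oplus> (y \<oplus> z)"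
    and pl_comm: "x \<in> A \<Longrightarrow> y \<in> A \<Longrightarrow> x \<oplus> y = y \<oplus> x"
    and tm_assoc: "x \<in> A \<Longrightarrow> y \<in> A \<Longrightarrow> z \<in> A \<Longrightarrow> x \<otimes> y \<otimes> z = x \<otimes> (y \<otimes> z)"
    and tm_comm: "x \<in> A \<Longrightarrow> y \<in> A \<Longrightarrow> x \<otimes> y = y \<otimes> x"
    and distr: "x \<in> A \<Longrightarrow> y \<in> A \<Longrightarrow> z \<in> A \<Longrightarrow> x \<otimes> (y \<oplus> z) = x \<otimes> y \<oplus> x \<otimes> z"
    and tm_one [simp]: "x \<in> A \<Longrightarrow> x \<otimes> \<one> = x"
    and tri: "x \<in> A \<Longrightarrow> y \<in> A \<Longrightarrow> x = y \<or> (\<exists>z \<in> A. x \<oplus> z = y) \<or> (\<exists>z \<in> A. y \<oplus> z = x)"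
    and irr: "x \<in> A \<Longrightarrow> z \<in> A \<Longrightarrow> x \<oplus> z \<noteq> x"
begin

lemma pl_lcomm: "x \<in> A \<Longrightarrow> y \<in> A \<Longrightarrow> z \<in> A \<Longrightarrow> x \<oplus> (y \<oplus> z) = y \<oplus> (x \<oplus> z)"
  using pl_assoc[of x y z] pl_assoc[of y x z] pl_comm[of x y] by simp

lemma tm_lcomm: "x \<in> A \<Longrightarrow> y \<in> A \<Longrightarrow> z \<in> A \<Longrightarrow> x \<otimes> (y \<otimes> z) = y \<otimes> (x \<otimes> z)"
  using tm_assoc[of x y z] tm_assoc[of y x z] tm_comm[of x y] by simp

lemma distr_right: "x \<in> A \<Longrightarrow> y \<in> A \<Longrightarrow> z \<in> A \<Longrightarrow> (y \<oplus> z) \<otimes> x = y \<otimes> x \<oplus> z \<otimes> x"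
  using distr[of x y z] by (simp add: tm_comm)

lemma one_tm [simp]: "x \<in> A \<Longrightarrow> \<one> \<otimes> x = x"
  using tm_comm[of x \<one>] by simp

lemmas ac = pl_assoc pl_comm pl_lcomm tm_assoc tm_comm tm_lcomm distr distr_right

definition lt :: "'a \<Rightarrow> 'a \<Rightarrow> bool" where "lt x y \<longleftrightarrow> (\<exists>z \<in> A. x \<oplus> z = y)"

lemma lt_irrefl [simp]: "x \<in> A \<Longrightarrow> \<not> lt x x"
  using irr by (auto simp: lt_def)

lemma lt_trans: "x \<in> A \<Longrightarrow> lt x y \<Longrightarrow> lt y z \<Longrightarrow> lt x z"
  unfolding lt_def using pl_assoc pl_closed by metis

lemma lt_linear: "x \<in> A \<Longrightarrow> y \<in> A \<Longrightarrow> lt x y \<or> x = y \<or> lt y x"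
  using tri unfolding lt_def by blast

lemma lt_asym: "x \<in> A \<Longrightarrow> lt x y \<Longrightarrow> \<not> lt y x"
  using lt_trans lt_irrefl by blast

lemma lt_pl_self: "x \<in> A \<Longrightarrow> y \<in> A \<Longrightarrow> lt x (x \<oplus> y)"
  by (auto simp: lt_def)

lemma pl_mono: "x \<in> A \<Longrightarrow> y \<in> A \<Longrightarrow> z \<in> A \<Longrightarrow> lt x y \<Longrightarrow> lt (x \<oplus> z) (y \<oplus> z)"
proof -
  assume [simp]: "x \<in> A" "z \<in> A" and "lt x y"
  then obtain w where w: "w \<in> A" "y = x \<oplus> w" by (auto simp: lt_def)
  then have "x \<oplus> z \<oplus> w = y \<oplus> z" by (simp add: ac)
  with w(1) show ?thesis by (auto simp: lt_def)
qed

lemma tm_mono: "x \<in> A \<Longrightarrow> y \<in> A \<Longrightarrow> z \<in> A \<Longrightarrow> lt x y \<Longrightarrow> lt (x \<otimes> z) (y \<otimes> z)"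
  unfolding lt_def using distr_right tm_closed by metis

lemma pl_cancel: "x \<in> A \<Longrightarrow> y \<in> A \<Longrightarrow> z \<in> A \<Longrightarrow> x \<oplus> z = y \<oplus> z \<longleftrightarrow> x = y"
  using lt_linear[of x y] pl_mono[of x y z] pl_mono[of y x z] by auto

lemma tm_cancel: "x \<in> A \<Longrightarrow> y \<in> A \<Longrightarrow> z \<in> A \<Longrightarrow> x \<otimes> z = y \<otimes> z \<longleftrightarrow> x = y"
  using lt_linear[of x y] tm_mono[of x y z] tm_mono[of y x z] by auto

lemma lt_tm_iff: "x \<in> A \<Longrightarrow> y \<in> A \<Longrightarrow> z \<in> A \<Longrightarrow> lt (x \<otimes> z) (y \<otimes> z) \<longleftrightarrow> lt x y"
  using lt_linear[of x y] tm_mono[of x y z] tm_mono[of y x z] lt_asym[of "x \<otimes> z" "y \<otimes> z"] by auto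

lemma lt_tm_iff2: "x \<in> A \<Longrightarrow> y \<in> A \<Longrightarrow> z \<in> A \<Longrightarrow> lt (z \<otimes> x) (z \<otimes> y) \<longleftrightarrow> lt x y"
  using lt_tm_iff[of x y z] by (simp add: tm_comm)

text \<open>Independence of the representatives for the sum of fractions, multiplied out so that it
  is a statement about the semiring and available before fractions are constructed.\<close>

lemma fr_pl_cong:
  assumes [simp]: "a \<in> A" "b \<in> A" "c \<in> A" "d \<in> A" "a' \<in> A" "b' \<in> A" "c' \<in> A" "d' \<in> A"
    and 1: "a \<otimes> b' = a' \<otimes> b" and 2: "c \<otimes> d' = c' \<otimes> d"
  shows "(a \<otimes> d \<oplus> c \<otimes> b) \<otimes> (b' \<otimes> d') = (a' \<otimes> d' \<oplus> c' \<otimes> b') \<otimes> (b \<otimes> d)"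
proof -
  have "(a \<otimes> d \<oplus> c \<otimes> b) \<otimes> (b' \<otimes> d') = (a \<otimes> b') \<otimes> (d \<otimes> d') \<oplus> (c \<otimes> d') \<otimes> (b \<otimes> b')" by (simp add: ac)
  also have "\<dots> = (a' \<otimes> d' \<oplus> c' \<otimes> b') \<otimes> (b \<otimes> d)" unfolding 1 2 by (simp add: ac)
  finally show ?thesis .
qed

lemma fr_tm_cong:
  assumes [simp]: "a \<in> A" "b \<in> A" "c \<in> A" "d \<in> A" "a' \<in> A" "b' \<in> A" "c' \<in> A" "d' \<in> A"
    and 1: "a \<otimes> b' = a' \<otimes> b" and 2: "c \<otimes> d' = c' \<otimes> d"
  shows "(a \<otimes> c) \<otimes> (b' \<otimes> d') = (a' \<otimes> c') \<otimes> (b \<otimes> d)"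
proof -
  have "(a \<otimes> c) \<otimes> (b' \<otimes> d') = (a \<otimes> b') \<otimes> (c \<otimes> d')" by (simp add: ac)
  also have "\<dots> = (a' \<otimes> c') \<otimes> (b \<otimes> d)" unfolding 1 2 by (simp add: ac)
  finally show ?thesis .
qed

lemma fr_class:
  assumes [simp]: "a \<in> A" "b \<in> A" "c \<in> A" "d \<in> A" "x \<in> A" "y \<in> A" and 1: "a \<otimes> d = c \<otimes> b"
  shows "a \<otimes> y = x \<otimes> b \<longleftrightarrow> c \<otimes> y = x \<otimes> d"
proof -
  have "(a \<otimes> y) \<otimes> d = (a \<otimes> d) \<otimes> y" "(x \<otimes> b) \<otimes> d = (x \<otimes> d) \<otimes> b" by (simp_all add: ac)
  moreover have "(a \<otimes> d) \<otimes> y = (c \<otimes> y) \<otimes> b" unfolding 1 by (simp add: ac)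
  ultimately show ?thesis
    using tm_cancel[of "a \<otimes> y" "x \<otimes> b" d] tm_cancel[of "c \<otimes> y" "x \<otimes> d" b] by simp
qed

lemma df_pl_cong:
  assumes [simp]: "a \<in> A" "b \<in> A" "c \<in> A" "d \<in> A" "a' \<in> A" "b' \<in> A" "c' \<in> A" "d' \<in> A"
    and 1: "a \<oplus> b' = a' \<oplus> b" and 2: "c \<oplus> d' = c' \<oplus> d"
  shows "(a \<oplus> c) \<oplus> (b' \<oplus> d') = (a' \<oplus> c') \<oplus> (b \<oplus> d)"
proof -
  have "(a \<oplus> c) \<oplus> (b' \<oplus> d') = (a \<oplus> b') \<oplus> (c \<oplus> d')" by (simp add: ac)
  also have "\<dots> = (a' \<oplus> c') \<oplus> (b \<oplus> d)" unfolding 1 2 by (simp add: ac)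
  finally show ?thesis .
qed

lemma df_class:
  assumes [simp]: "a \<in> A" "b \<in> A" "c \<in> A" "d \<in> A" "x \<in> A" "y \<in> A" and 1: "a \<oplus> d = c \<oplus> b"
  shows "a \<oplus> y = x \<oplus> b \<longleftrightarrow> c \<oplus> y = x \<oplus> d"
proof -
  have "(a \<oplus> y) \<oplus> d = (a \<oplus> d) \<oplus> y" "(x \<oplus> b) \<oplus> d = (x \<oplus> d) \<oplus> b" by (simp_all add: ac)
  moreover have "(a \<oplus> d) \<oplus> y = (c \<oplus> y) \<oplus> b" unfolding 1 by (simp add: ac)
  ultimately show ?thesis
    using pl_cancel[of "a \<oplus> y" "x \<oplus> b" d] pl_cancel[of "c \<oplus> y" "x \<oplus> d" b] by simp
qed

lemma df_tm_cong1:
  assumes [simp]: "a \<in> A" "b \<in> A" "c \<in> A" "d \<in> A" "a' \<in> A" "b' \<in> A" and 1: "a \<oplus> b' = a' \<oplus> b"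
  shows "(a \<otimes> c \<oplus> b \<otimes> d) \<oplus> (a' \<otimes> d \<oplus> b' \<otimes> c) = (a' \<otimes> c \<oplus> b' \<otimes> d) \<oplus> (a \<otimes> d \<oplus> b \<otimes> c)"
proof -
  have "(a \<otimes> c \<oplus> b \<otimes> d) \<oplus> (a' \<otimes> d \<oplus> b' \<otimes> c) = (a \<oplus> b') \<otimes> c \<oplus> (a' \<oplus> b) \<otimes> d" by (simp add: ac)
  also have "\<dots> = (a' \<oplus> b) \<otimes> c \<oplus> (a \<oplus> b') \<otimes> d" unfolding 1 ..
  also have "\<dots> = (a' \<otimes> c \<oplus> b' \<otimes> d) \<oplus> (a \<otimes> d \<oplus> b \<otimes> c)" by (simp add: ac)
  finally show ?thesis .
qed

lemma df_tm_cong2: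
  assumes "a \<in> A" "b \<in> A" "c \<in> A" "d \<in> A" "c' \<in> A" "d' \<in> A" and "c \<oplus> d' = c' \<oplus> d"
  shows "(a \<otimes> c \<oplus> b \<otimes> d) \<oplus> (a \<otimes> d' \<oplus> b \<otimes> c') = (a \<otimes> c' \<oplus> b \<otimes> d') \<oplus> (a \<otimes> d \<oplus> b \<otimes> c)"
  using df_tm_cong1[of c d a b c' d'] assms by (simp add: ac)

end

locale pos_semifield = pos_semiring +
  assumes ex_inverse: "x \<in> A \<Longrightarrow> \<exists>y \<in> A. x \<otimes> y = \<one>"

text \<open>Fractions and their operations have to be objects of the model, so they are parameters
  here, known only through their equations.\<close>

locale fractions = pos_semiring +
  fixes fr :: "'a \<Rightarrow> 'a \<Rightarrow> 'b" and qpl qtm :: "'b \<Rightarrow> 'b \<Rightarrow> 'b"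
  assumes fr_eq: "a \<in> A \<Longrightarrow> b \<in> A \<Longrightarrow> c \<in> A \<Longrightarrow> d \<in> A \<Longrightarrow> fr a b = fr c d \<longleftrightarrow> a \<otimes> d = c \<otimes> b"
    and qpl: "a \<in> A \<Longrightarrow> b \<in> A \<Longrightarrow> c \<in> A \<Longrightarrow> d \<in> A \<Longrightarrow>
      qpl (fr a b) (fr c d) = fr (a \<otimes> d \<oplus> c \<otimes> b) (b \<otimes> d)"
    and qtm: "a \<in> A \<Longrightarrow> b \<in> A \<Longrightarrow> c \<in> A \<Longrightarrow> d \<in> A \<Longrightarrow> qtm (fr a b) (fr c d) = fr (a \<otimes> c) (b \<otimes> d)"
begin

definition Q :: "'b set" where "Q = {fr a b | a b. a \<in> A \<and> b \<in> A}"

lemma QE: "x \<in> Q \<Longrightarrow> (\<And>a b. a \<in> A \<Longrightarrow> b \<in> A \<Longrightarrow> x = fr a b \<Longrightarrow> thesis) \<Longrightarrow> thesis"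
  by (auto simp: Q_def)

lemma fr_Q [simp]: "a \<in> A \<Longrightarrow> b \<in> A \<Longrightarrow> fr a b \<in> Q"
  by (auto simp: Q_def)

lemma fr_less: "a \<in> A \<Longrightarrow> b \<in> A \<Longrightarrow> c \<in> A \<Longrightarrow> d \<in> A \<Longrightarrow> z \<in> A \<Longrightarrow> a \<otimes> d \<oplus> z = c \<otimes> b \<Longrightarrow>
  qpl (fr a b) (fr z (b \<otimes> d)) = fr c d"
proof -
  assume [simp]: "a \<in> A" "b \<in> A" "c \<in> A" "d \<in> A" "z \<in> A" and h: "a \<otimes> d \<oplus> z = c \<otimes> b"
  have "(a \<otimes> (b \<otimes> d) \<oplus> z \<otimes> b) \<otimes> d = (b \<otimes> d) \<otimes> (a \<otimes> d \<oplus> z)"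
    by (simp add: ac)
  also have "\<dots> = c \<otimes> (b \<otimes> (b \<otimes> d))"
    unfolding h by (simp add: ac)
  finally show ?thesis by (simp add: qpl fr_eq)
qed

sublocale Q: pos_semifield Q qpl qtm "fr \<one> \<one>"
proof
  fix x y assume xy: "x \<in> Q" "y \<in> Q"
  show "qpl x y \<in> Q" "qtm x y \<in> Q" "qpl x y = qpl y x" "qtm x y = qtm y x"
    using xy by (auto elim!: QE simp: qpl qtm fr_eq ac)
  show "x = y \<or> (\<exists>z\<in>Q. qpl x z = y) \<or> (\<exists>z\<in>Q. qpl y z = x)"
  proof -
    obtain a b c d where [simp]: "a \<in> A" "b \<in> A" "c \<in> A" "d \<in> A" and x: "x = fr a b" and y: "y = fr c d"
      using xy by (auto elim!: QE)
    consider "a \<otimes> d = c \<otimes> b" | z where "z \<in> A" "a \<otimes> d \<oplus> z = c \<otimes> b" | z where "z \<in> A" "c \<otimes> b \<oplus> z = a \<otimes> d"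
      using tri[of "a \<otimes> d" "c \<otimes> b"] by auto
    then show ?thesis
    proof cases
      case 1
      then show ?thesis by (simp add: x y fr_eq)
    next
      case 2
      then have "qpl x (fr z (b \<otimes> d)) = y" by (simp add: x y fr_less)
      with 2 show ?thesis by auto
    next
      case 3
      then have "qpl y (fr z (d \<otimes> b)) = x" by (simp add: x y fr_less)
      with 3 show ?thesis by auto
    qed
  qed
  show "qpl x y \<noteq> x"
  proof
    obtain a b c d where [simp]: "a \<in> A" "b \<in> A" "c \<in> A" "d \<in> A" and x: "x = fr a b" and y: "y = fr c d"
      using xy by (auto elim!: QE)
    assume "qpl x y = x"
    then have "a \<otimes> (b \<otimes> d) \<oplus> c \<otimes> (b \<otimes> b) = a \<otimes> (b \<otimes> d)" by (simp add: x y qpl fr_eq ac)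
    then show False using irr[of "a \<otimes> (b \<otimes> d)" "c \<otimes> (b \<otimes> b)"] by simp
  qed
next
  fix x y z assume "x \<in> Q" "y \<in> Q" "z \<in> Q"
  then show "qpl (qpl x y) z = qpl x (qpl y z)" "qtm (qtm x y) z = qtm x (qtm y z)"
    "qtm x (qpl y z) = qpl (qtm x y) (qtm x z)"
    by (auto elim!: QE simp: qpl qtm fr_eq ac)
next
  fix x assume x: "x \<in> Q"
  then show "qtm x (fr \<one> \<one>) = x" by (auto elim!: QE simp: qtm)
  obtain a b where [simp]: "a \<in> A" "b \<in> A" and "x = fr a b" using x by (auto elim!: QE)
  then show "\<exists>y\<in>Q. qtm x y = fr \<one> \<one>"
    by (intro bexI[of _ "fr b a"]) (auto simp: qtm fr_eq ac)
qed simp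

end

context pos_semifield
begin

section \<open>Dedekind cuts in a positive semifield\<close>

lemma ex_quotient: "x \<in> A \<Longrightarrow> y \<in> A \<Longrightarrow> \<exists>z \<in> A. x \<otimes> z = y"
proof -
  assume x: "x \<in> A" and y: "y \<in> A"
  obtain w where "w \<in> A" "x \<otimes> w = \<one>" using ex_inverse[OF x] by blast
  then show ?thesis using x y by (intro bexI[of _ "w \<otimes> y"]) (auto simp flip: tm_assoc)
qed

lemma ex_half: "x \<in> A \<Longrightarrow> \<exists>h \<in> A. h \<oplus> h = x"
proof -
  assume x: "x \<in> A"
  obtain h where "h \<in> A" "(\<one> \<oplus> \<one>) \<otimes> h = x" using ex_quotient[of "\<one> \<oplus> \<one>" x] x by auto
  then show ?thesis by (intro bexI[of _ h]) (auto simp: distr_right)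
qed

lemma dense: "x \<in> A \<Longrightarrow> y \<in> A \<Longrightarrow> lt x y \<Longrightarrow> \<exists>z \<in> A. lt x z \<and> lt z y"
proof -
  assume x: "x \<in> A" "y \<in> A" "lt x y"
  then obtain z where z: "z \<in> A" "x \<oplus> z = y" by (auto simp: lt_def)
  obtain h where h: "h \<in> A" "h \<oplus> h = z" using ex_half z by blast
  then have "x \<oplus> h \<oplus> h = y" using x z by (simp add: pl_assoc)
  then show ?thesis using x h lt_pl_self[of x h] lt_pl_self[of "x \<oplus> h" h] by auto
qed

lemma ex_less: "x \<in> A \<Longrightarrow> \<exists>y \<in> A. lt y x"
  using ex_half lt_pl_self by metis

lemma lt_one_tm: "x \<in> A \<Longrightarrow> z \<in> A \<Longrightarrow> lt z \<one> \<Longrightarrow> lt (x \<otimes> z) x"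
  using lt_tm_iff2[of z \<one> x] by simp

definition cut :: "'a set \<Rightarrow> bool" where
  "cut C \<longleftrightarrow> C \<subseteq> A \<and> C \<noteq> {} \<and> (\<exists>b \<in> A. b \<notin> C) \<and> (\<forall>x \<in> C. \<forall>y \<in> A. lt y x \<longrightarrow> y \<in> C) \<and>
    (\<forall>x \<in> C. \<exists>y \<in> C. lt x y)"

text \<open>All cuts that are elements of a model are Archimedean in this sense.\<close>

definition arch :: "'a set \<Rightarrow> bool" where "arch C \<longleftrightarrow> (\<forall>e \<in> A. \<exists>c \<in> C. c \<oplus> e \<notin> C)"

definition cadd :: "'a set \<Rightarrow> 'a set \<Rightarrow> 'a set" where "cadd C D = {c \<oplus> d | c d. c \<in> C \<and> d \<in> D}"

definition cmul :: "'a set \<Rightarrow> 'a set \<Rightarrow> 'a set" where "cmul C D = {c \<otimes> d | c d. c \<in> C \<and> d \<in> D}"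

definition cone :: "'a set" where "cone = {x \<in> A. lt x \<one>}"

text \<open>In this candidate for D - C, \<open>y\<close> is a point above \<open>C\<close>. The
  absence of a greatest element is inherited from \<open>D\<close>; in \<open>cinv\<close> below it
  comes from the strict inequality.\<close>

definition cdif :: "'a set \<Rightarrow> 'a set \<Rightarrow> 'a set" where
  "cdif D C = {x \<in> A. \<exists>y \<in> A. y \<notin> C \<and> y \<oplus> x \<in> D}"

definition cinv :: "'a set \<Rightarrow> 'a set" where
  "cinv C = {x \<in> A. \<exists>y \<in> A. y \<notin> C \<and> lt (x \<otimes> y) \<one>}"

lemma cut_sub: "cut C \<Longrightarrow> x \<in> C \<Longrightarrow> x \<in> A"
  by (auto simp: cut_def)

lemma cut_down: "cut C \<Longrightarrow> x \<in> C \<Longrightarrow> y \<in> A \<Longrightarrow> lt y x \<Longrightarrow> y \<in> C"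
  by (auto simp: cut_def)

lemma cut_open: "cut C \<Longrightarrow> x \<in> C \<Longrightarrow> \<exists>y \<in> C. lt x y"
  by (auto simp: cut_def)

lemma cut_lt: "cut C \<Longrightarrow> x \<in> C \<Longrightarrow> y \<in> A \<Longrightarrow> y \<notin> C \<Longrightarrow> lt x y"
  using lt_linear[of x y] cut_down[of C x y] cut_sub[of C x] by auto

lemma cutI:
  assumes "C \<subseteq> A" "x \<in> C" "b \<in> A" "b \<notin> C" "\<And>x y. x \<in> C \<Longrightarrow> y \<in> A \<Longrightarrow> lt y x \<Longrightarrow> y \<in> C"
    "\<And>x. x \<in> C \<Longrightarrow> \<exists>y \<in> C. lt x y"
  shows "cut C"
  using assms unfolding cut_def by blast

lemma cut_cadd: assumes C: "cut C" and D: "cut D" shows "cut (cadd C D)"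
proof -
  obtain c d b b' where c: "c \<in> C" and d: "d \<in> D" and b: "b \<in> A" "b \<notin> C" and b': "b' \<in> A" "b' \<notin> D"
    using C D by (auto simp: cut_def)
  show ?thesis
  proof (rule cutI[of _ "c \<oplus> d" "b \<oplus> b'"])
    show "cadd C D \<subseteq> A" using C D cut_sub by (auto simp: cadd_def)
    show "c \<oplus> d \<in> cadd C D" using c d by (auto simp: cadd_def)
    show "b \<oplus> b' \<in> A" using b b' by simp
    show "b \<oplus> b' \<notin> cadd C D"
    proof
      assume "b \<oplus> b' \<in> cadd C D"
      then obtain x y where x: "x \<in> C" "y \<in> D" and eq: "b \<oplus> b' = x \<oplus> y" by (auto simp: cadd_def)
      have xA: "x \<in> A" "y \<in> A" using x C D cut_sub by auto
      have "lt (x \<oplus> y) (b \<oplus> y)" using cut_lt[OF C x(1) b] xA b by (simp add: pl_mono)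
      moreover have "lt (b \<oplus> y) (b \<oplus> b')"
        using pl_mono[OF xA(2) b'(1) b(1)] cut_lt[OF D x(2) b'] xA b b' by (simp add: pl_comm)
      ultimately have "lt (x \<oplus> y) (x \<oplus> y)" unfolding eq using lt_trans xA pl_closed by blast
      then show False using xA by simp
    qed
  next
    fix x y assume "x \<in> cadd C D" and y: "y \<in> A" "lt y x"
    then obtain c d where c: "c \<in> C" "d \<in> D" "x = c \<oplus> d" by (auto simp: cadd_def)
    have cA: "c \<in> A" "d \<in> A" using c C D cut_sub by auto
    \<comment> \<open>An element below c + d is split by shrinking both summands by the common
      factor z < 1.\<close>
    then obtain z where z: "z \<in> A" "(c \<oplus> d) \<otimes> z = y" using ex_quotient[of "c \<oplus> d" y] y by auto
    then have "lt z \<one>" using y(2) c(3) lt_tm_iff2[of z \<one> "c \<oplus> d"] cA by simp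
    then have "c \<otimes> z \<in> C" "d \<otimes> z \<in> D"
      using cA z(1) lt_one_tm cut_down[OF C c(1)] cut_down[OF D c(2)] by auto
    moreover have "y = c \<otimes> z \<oplus> d \<otimes> z" using z cA by (simp add: distr_right)
    ultimately show "y \<in> cadd C D" by (auto simp: cadd_def)
  next
    fix x assume "x \<in> cadd C D"
    then obtain c d where c: "c \<in> C" "d \<in> D" "x = c \<oplus> d" by (auto simp: cadd_def)
    then obtain c' where c': "c' \<in> C" "lt c c'" using cut_open[OF C] by blast
    then have "lt x (c' \<oplus> d)" using c C D cut_sub by (auto intro: pl_mono)
    with c c' show "\<exists>y\<in>cadd C D. lt x y" by (auto simp: cadd_def)
  qed
qed

lemma cut_cmul: assumes C: "cut C" and D: "cut D" shows "cut (cmul C D)"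
proof -
  obtain c d b b' where c: "c \<in> C" and d: "d \<in> D" and b: "b \<in> A" "b \<notin> C" and b': "b' \<in> A" "b' \<notin> D"
    using C D by (auto simp: cut_def)
  show ?thesis
  proof (rule cutI[of _ "c \<otimes> d" "b \<otimes> b'"])
    show "cmul C D \<subseteq> A" using C D cut_sub by (auto simp: cmul_def)
    show "c \<otimes> d \<in> cmul C D" using c d by (auto simp: cmul_def)
    show "b \<otimes> b' \<in> A" using b b' by simp
    show "b \<otimes> b' \<notin> cmul C D"
    proof
      assume "b \<otimes> b' \<in> cmul C D"
      then obtain x y where x: "x \<in> C" "y \<in> D" and eq: "b \<otimes> b' = x \<otimes> y" by (auto simp: cmul_def)
      have xA: "x \<in> A" "y \<in> A" using x C D cut_sub by auto
      have "lt (x \<otimes> y) (b \<otimes> y)" using cut_lt[OF C x(1) b] xA b by (simp add: tm_mono)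
      moreover have "lt (b \<otimes> y) (b \<otimes> b')"
        using cut_lt[OF D x(2) b'] xA b b' by (simp add: lt_tm_iff2)
      ultimately have "lt (x \<otimes> y) (x \<otimes> y)" unfolding eq using lt_trans xA tm_closed by blast
      then show False using xA by simp
    qed
  next
    fix x y assume "x \<in> cmul C D" and y: "y \<in> A" "lt y x"
    then obtain c d where c: "c \<in> C" "d \<in> D" "x = c \<otimes> d" by (auto simp: cmul_def)
    have cA: "c \<in> A" "d \<in> A" using c C D cut_sub by auto
    then obtain z where z: "z \<in> A" "c \<otimes> z = y" using ex_quotient[of c y] y by auto
    then have "lt z d" using y(2) c(3) lt_tm_iff2[of z d c] cA by simp
    then have "z \<in> D" using z(1) cut_down[OF D c(2)] by auto
    with c z show "y \<in> cmul C D" by (auto simp: cmul_def)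
  next
    fix x assume "x \<in> cmul C D"
    then obtain c d where c: "c \<in> C" "d \<in> D" "x = c \<otimes> d" by (auto simp: cmul_def)
    then obtain c' where c': "c' \<in> C" "lt c c'" using cut_open[OF C] by blast
    then have "lt x (c' \<otimes> d)" using c C D cut_sub by (auto intro: tm_mono)
    with c c' show "\<exists>y\<in>cmul C D. lt x y" by (auto simp: cmul_def)
  qed
qed

lemma cut_cone: "cut cone"
proof -
  obtain x where x: "x \<in> A" "lt x \<one>" using ex_less[OF one_closed] by blast
  show ?thesis
  proof (rule cutI[of _ x \<one>])
    show "x \<in> cone" using x by (auto simp: cone_def)
    show "\<And>x y. x \<in> cone \<Longrightarrow> y \<in> A \<Longrightarrow> lt y x \<Longrightarrow> y \<in> cone" using lt_trans by (auto simp: cone_def)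
    show "\<And>x. x \<in> cone \<Longrightarrow> \<exists>y\<in>cone. lt x y" unfolding cone_def using dense[OF _ one_closed] by blast
  qed (auto simp: cone_def)
qed

lemma cadd_comm: "cut C \<Longrightarrow> cut D \<Longrightarrow> cadd C D = cadd D C"
  unfolding cadd_def using pl_comm cut_sub by blast

lemma cmul_comm: "cut C \<Longrightarrow> cut D \<Longrightarrow> cmul C D = cmul D C"
  unfolding cmul_def using tm_comm cut_sub by blast

lemma cadd_assoc:
  assumes "cut B" "cut C" "cut D" shows "cadd (cadd B C) D = cadd B (cadd C D)"
proof -
  have "b \<oplus> c \<oplus> d = b \<oplus> (c \<oplus> d)" if "b \<in> B" "c \<in> C" "d \<in> D" for b c d
    using that assms cut_sub pl_assoc by blast
  moreover have "x \<in> cadd (cadd B C) D \<longleftrightarrow> (\<exists>b\<in>B. \<exists>c\<in>C. \<exists>d\<in>D. x = b \<oplus> c \<oplus> d)"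
    "x \<in> cadd B (cadd C D) \<longleftrightarrow> (\<exists>b\<in>B. \<exists>c\<in>C. \<exists>d\<in>D. x = b \<oplus> (c \<oplus> d))" for x
    unfolding cadd_def by blast+
  ultimately show ?thesis by (intro set_eqI) simp
qed

lemma cmul_assoc:
  assumes "cut B" "cut C" "cut D" shows "cmul (cmul B C) D = cmul B (cmul C D)"
proof -
  have "b \<otimes> c \<otimes> d = b \<otimes> (c \<otimes> d)" if "b \<in> B" "c \<in> C" "d \<in> D" for b c d
    using that assms cut_sub tm_assoc by blast
  moreover have "x \<in> cmul (cmul B C) D \<longleftrightarrow> (\<exists>b\<in>B. \<exists>c\<in>C. \<exists>d\<in>D. x = b \<otimes> c \<otimes> d)"
    "x \<in> cmul B (cmul C D) \<longleftrightarrow> (\<exists>b\<in>B. \<exists>c\<in>C. \<exists>d\<in>D. x = b \<otimes> (c \<otimes> d))" for x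
    unfolding cmul_def by blast+
  ultimately show ?thesis by (intro set_eqI) simp
qed

lemma cmul_distr:
  assumes B: "cut B" and C: "cut C" and D: "cut D" shows "cmul B (cadd C D) = cadd (cmul B C) (cmul B D)"
proof
  have "b \<otimes> (c \<oplus> d) = b \<otimes> c \<oplus> b \<otimes> d" if "b \<in> B" "c \<in> C" "d \<in> D" for b c d
    using that assms cut_sub distr by blast
  then show "cmul B (cadd C D) \<subseteq> cadd (cmul B C) (cmul B D)" unfolding cmul_def cadd_def by blast
next
  show "cadd (cmul B C) (cmul B D) \<subseteq> cmul B (cadd C D)"
  proof
    fix x assume "x \<in> cadd (cmul B C) (cmul B D)"
    then obtain b c b' d where x: "x = b \<otimes> c \<oplus> b' \<otimes> d" and m: "b \<in> B" "c \<in> C" "b' \<in> B" "d \<in> D"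
      by (auto simp: cadd_def cmul_def)
    have mA [simp]: "b \<in> A" "c \<in> A" "b' \<in> A" "d \<in> A" using m B C D cut_sub by auto
    consider "lt b b'" | "b = b'" | "lt b' b" using lt_linear mA by blast
    then show "x \<in> cmul B (cadd C D)"
    proof cases
      case 1
      \<comment> \<open>The two products may have different left factors. The smaller one is
        expressed through the larger and its ratio is moved to the other factor, where downward
        closure absorbs it.\<close>
      obtain z where z: "z \<in> A" "b' \<otimes> z = b" using ex_quotient mA by blast
      then have "lt z \<one>" using 1 lt_tm_iff2[of z \<one> b'] by simp
      then have "c \<otimes> z \<in> C" using lt_one_tm cut_down[OF C m(2)] z by simp
      moreover have "x = b' \<otimes> (c \<otimes> z \<oplus> d)" using z unfolding x z(2)[symmetric] by (simp add: ac)
      ultimately show ?thesis using m by (auto simp: cadd_def cmul_def)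
    next
      case 2
      then have "x = b \<otimes> (c \<oplus> d)" using x by (simp add: distr)
      then show ?thesis using m by (auto simp: cadd_def cmul_def)
    next
      case 3
      obtain z where z: "z \<in> A" "b \<otimes> z = b'" using ex_quotient mA by blast
      then have "lt z \<one>" using 3 lt_tm_iff2[of z \<one> b] by simp
      then have "d \<otimes> z \<in> D" using lt_one_tm cut_down[OF D m(4)] z by simp
      moreover have "x = b \<otimes> (c \<oplus> d \<otimes> z)" using z unfolding x z(2)[symmetric] by (simp add: ac)
      ultimately show ?thesis using m by (auto simp: cadd_def cmul_def)
    qed
  qed
qed

lemma cmul_cone: assumes C: "cut C" shows "cmul C cone = C"
proof
  show "cmul C cone \<subseteq> C"
  proof
    fix x assume "x \<in> cmul C cone"
    then obtain c z where z: "x = c \<otimes> z" "c \<in> C" "z \<in> A" "lt z \<one>" by (auto simp: cmul_def cone_def)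
    have cA: "c \<in> A" using z(2) cut_sub C by blast
    show "x \<in> C" unfolding z(1)
      by (rule cut_down[OF C z(2)]) (use cA z lt_one_tm in auto)
  qed
  show "C \<subseteq> cmul C cone"
  proof
    fix c assume c: "c \<in> C"
    then obtain c' where c': "c' \<in> C" "lt c c'" using cut_open[OF C] by blast
    have cA: "c \<in> A" "c' \<in> A" using c c' cut_sub[OF C] by auto
    then obtain z where z: "z \<in> A" "c' \<otimes> z = c" using ex_quotient by blast
    then have "lt z \<one>" using c'(2) lt_tm_iff2[of z \<one> c'] cA by simp
    then show "c \<in> cmul C cone" using z c' by (auto simp: cmul_def cone_def)
  qed
qed

text \<open>With r = 1 + e, multiplying \<open>c\<close> by \<open>r\<close> adds
  \<open>c \<otimes> e\<close>. Take c1 in C with \<open>c1 \<oplus> c0 \<otimes> e\<close> outside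
  C; the larger of c0 and c1 then works.\<close>

lemma arch_mult:
  assumes C: "cut C" "arch C" and r: "r \<in> A" "lt \<one> r"
  shows "\<exists>c \<in> C. c \<otimes> r \<notin> C"
proof -
  obtain e where e: "e \<in> A" "\<one> \<oplus> e = r" using r by (auto simp: lt_def)
  obtain c0 where c0: "c0 \<in> C" using C by (auto simp: cut_def)
  have c0A: "c0 \<in> A" using c0 cut_sub C by blast
  obtain c1 where c1: "c1 \<in> C" "c1 \<oplus> c0 \<otimes> e \<notin> C" using C(2) c0A e(1) unfolding arch_def by (meson tm_closed)
  have c1A: "c1 \<in> A" using c1 cut_sub C by blast
  have r_eq: "c \<otimes> r = c \<oplus> c \<otimes> e" if "c \<in> A" for c using that e by (auto simp: distr)
  consider "lt c0 c1" | "c0 = c1" | "lt c1 c0" using lt_linear c0A c1A by blast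
  then show ?thesis
  proof cases
    case 1
    then have "lt (c0 \<otimes> e) (c1 \<otimes> e)" using c0A c1A e by (simp add: tm_mono)
    then have "lt (c1 \<oplus> c0 \<otimes> e) (c1 \<otimes> r)"
      using pl_mono[of "c0 \<otimes> e" "c1 \<otimes> e" c1] c0A c1A e(1) by (simp add: r_eq pl_comm)
    then have "c1 \<otimes> r \<notin> C" using c1(2) cut_down[OF C(1)] c0A c1A e(1) by (meson pl_closed tm_closed)
    then show ?thesis using c1 by blast
  next
    case 2
    then show ?thesis using c1 r_eq[OF c1A] by (intro bexI[of _ c1]) auto
  next
    case 3
    then have "lt (c1 \<oplus> c0 \<otimes> e) (c0 \<otimes> r)"
      using pl_mono[of c1 c0 "c0 \<otimes> e"] c0A c1A e(1) by (simp add: r_eq)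
    then have "c0 \<otimes> r \<notin> C" using c1(2) cut_down[OF C(1)] c0A c1A e(1) by (meson pl_closed tm_closed)
    then show ?thesis using c0 by blast
  qed
qed

lemma cut_cinv: assumes C: "cut C" shows "cut (cinv C)"
proof -
  obtain c b where c: "c \<in> C" and b: "b \<in> A" "b \<notin> C" using C by (auto simp: cut_def)
  have cA: "c \<in> A" using c cut_sub C by blast
  obtain w where w: "w \<in> A" "lt w \<one>" using ex_less[OF one_closed] by blast
  obtain x where x: "x \<in> A" "b \<otimes> x = w" using ex_quotient b w by blast
  obtain i where i: "i \<in> A" "c \<otimes> i = \<one>" using ex_inverse cA by blast
  show ?thesis
  proof (rule cutI[of _ x i])
    show "x \<in> cinv C" using x b w by (auto simp: cinv_def tm_comm[of b x])
    show "i \<notin> cinv C"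
    proof
      assume "i \<in> cinv C"
      then obtain y where y: "y \<in> A" "y \<notin> C" "lt (i \<otimes> y) \<one>" by (auto simp: cinv_def)
      have "lt (c \<otimes> (i \<otimes> y)) (c \<otimes> \<one>)" using y i cA lt_tm_iff2 by (meson one_closed tm_closed)
      moreover have "c \<otimes> (i \<otimes> y) = y" using i y cA by (simp flip: tm_assoc)
      ultimately have "lt y c" using cA by simp
      then show False using y c C cut_down by blast
    qed
  next
    fix x y assume "x \<in> cinv C" and y: "y \<in> A" "lt y x"
    then obtain z where z: "x \<in> A" "z \<in> A" "z \<notin> C" "lt (x \<otimes> z) \<one>" by (auto simp: cinv_def)
    then have "lt (y \<otimes> z) (x \<otimes> z)" using y by (simp add: tm_mono)
    then have "lt (y \<otimes> z) \<one>" using z y lt_trans by (meson tm_closed)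
    with y z show "y \<in> cinv C" by (auto simp: cinv_def)
  next
    fix x assume "x \<in> cinv C"
    then obtain y where y: "x \<in> A" "y \<in> A" "y \<notin> C" "lt (x \<otimes> y) \<one>" by (auto simp: cinv_def)
    then obtain v where v: "v \<in> A" "lt (x \<otimes> y) v" "lt v \<one>" using dense[of "x \<otimes> y" \<one>] by auto
    obtain x' where x': "x' \<in> A" "x' \<otimes> y = v" using ex_quotient[OF y(2) v(1)] y(2) tm_comm by metis
    then have "lt x x'" using v(2) lt_tm_iff[of x x' y] y by simp
    with x' y v show "\<exists>y\<in>cinv C. lt x y" by (auto simp: cinv_def)
  qed (use i in \<open>auto simp: cinv_def\<close>)
qed

lemma cmul_cinv: assumes C: "cut C" "arch C" shows "cmul C (cinv C) = cone"
proof
  show "cmul C (cinv C) \<subseteq> cone"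
  proof
    fix z assume "z \<in> cmul C (cinv C)"
    then obtain c x y where z: "z = c \<otimes> x" "c \<in> C" "x \<in> A" "y \<in> A" "y \<notin> C" "lt (x \<otimes> y) \<one>"
      by (auto simp: cmul_def cinv_def)
    have cA: "c \<in> A" using z cut_sub C by blast
    have "lt c y" using cut_lt C(1) z by blast
    then have "lt (c \<otimes> x) (x \<otimes> y)" using tm_mono[of c y x] cA z by (simp add: tm_comm)
    then have "lt (c \<otimes> x) \<one>" using z(6) lt_trans cA z(3) by (meson tm_closed)
    then show "z \<in> cone" using z cA by (simp add: cone_def)
  qed
  show "cone \<subseteq> cmul C (cinv C)"
  proof
    fix z assume "z \<in> cone"
    then have z: "z \<in> A" "lt z \<one>" by (auto simp: cone_def)
    \<comment> \<open>The gap between \<open>z\<close> and 1 is used up in one multiplication: r =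
      1/w exceeds 1, so some c in C has c r outside C, and x = z/c satisfies x (c r) = z/w <
      1.\<close>
    then obtain w where w: "w \<in> A" "lt z w" "lt w \<one>" using dense[of z \<one>] by auto
    obtain r where r: "r \<in> A" "w \<otimes> r = \<one>" using ex_inverse w by blast
    have "lt (w \<otimes> \<one>) (w \<otimes> r)" using w r by simp
    then have "lt \<one> r" using lt_tm_iff2[of \<one> r w] w r by simp
    then obtain c where c: "c \<in> C" "c \<otimes> r \<notin> C" using arch_mult C r by blast
    have cA: "c \<in> A" using c cut_sub C by blast
    obtain x where x: "x \<in> A" "c \<otimes> x = z" using ex_quotient cA z by blast
    have "x \<otimes> (c \<otimes> r) = z \<otimes> r" using x cA r by (simp add: ac flip: x(2))
    moreover have "lt (z \<otimes> r) \<one>" using tm_mono[of z w r] z w r by simp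
    ultimately have "x \<in> cinv C" using x c cA r unfolding cinv_def by auto
    with x c show "z \<in> cmul C (cinv C)" by (auto simp: cmul_def)
  qed
qed

lemma cut_linear: assumes "cut C" "cut D" shows "C \<subseteq> D \<or> D \<subseteq> C"
  using cut_lt cut_down cut_sub assms by (metis subsetI)

lemma cut_cdif:
  assumes C: "cut C" and D: "cut D" and "C \<subset> D" shows "cut (cdif D C)"
proof -
  obtain d1 where d1: "d1 \<in> D" "d1 \<notin> C" using \<open>C \<subset> D\<close> by blast
  have d1A: "d1 \<in> A" using d1 cut_sub D by blast
  obtain d2 where d2: "d2 \<in> D" "lt d1 d2" using d1 cut_open D by blast
  then obtain x where x: "x \<in> A" "d1 \<oplus> x = d2" by (auto simp: lt_def)
  obtain b where b: "b \<in> A" "b \<notin> D" using D by (auto simp: cut_def)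
  show ?thesis
  proof (rule cutI[of _ x b])
    show "x \<in> cdif D C" using x d1 d1A d2 by (auto simp: cdif_def)
    show "b \<notin> cdif D C"
    proof
      assume "b \<in> cdif D C"
      then obtain y where y: "y \<in> A" "y \<oplus> b \<in> D" by (auto simp: cdif_def)
      have "lt b (y \<oplus> b)" using lt_pl_self[of b y] b y by (simp add: pl_comm)
      then show False using y b cut_down D by blast
    qed
  next
    fix x x' assume "x \<in> cdif D C" and x': "x' \<in> A" "lt x' x"
    then obtain y where y: "x \<in> A" "y \<in> A" "y \<notin> C" "y \<oplus> x \<in> D" by (auto simp: cdif_def)
    then have "lt (y \<oplus> x') (y \<oplus> x)" using pl_mono[of x' x y] x' by (simp add: pl_comm)
    then have "y \<oplus> x' \<in> D" using y x' cut_down D by (meson pl_closed)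
    with y x' show "x' \<in> cdif D C" by (auto simp: cdif_def)
  next
    fix x assume "x \<in> cdif D C"
    then obtain y where y: "x \<in> A" "y \<in> A" "y \<notin> C" "y \<oplus> x \<in> D" by (auto simp: cdif_def)
    then obtain d where d: "d \<in> D" "lt (y \<oplus> x) d" using cut_open D by blast
    then obtain e where e: "e \<in> A" "y \<oplus> x \<oplus> e = d" by (auto simp: lt_def)
    then have "x \<oplus> e \<in> cdif D C" using y d by (auto simp: cdif_def pl_assoc)
    moreover have "lt x (x \<oplus> e)" using y e lt_pl_self by simp
    ultimately show "\<exists>y\<in>cdif D C. lt x y" by blast
  qed (use b in \<open>auto simp: cdif_def\<close>)
qed

lemma cadd_cdif:
  assumes C: "cut C" "arch C" and D: "cut D" and CD: "C \<subset> D" shows "cadd C (cdif D C) = D"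
proof
  show "cadd C (cdif D C) \<subseteq> D"
  proof
    fix z assume "z \<in> cadd C (cdif D C)"
    then obtain c x y where z: "z = c \<oplus> x" "c \<in> C" "x \<in> A" "y \<in> A" "y \<notin> C" "y \<oplus> x \<in> D"
      by (auto simp: cadd_def cdif_def)
    have cA: "c \<in> A" using z cut_sub C by blast
    have "lt c y" using cut_lt C(1) z by blast
    then have "lt z (y \<oplus> x)" using z cA by (simp add: pl_mono)
    then show "z \<in> D" using z cA cut_down[OF D z(6)] by simp
  qed
  show "D \<subseteq> cadd C (cdif D C)"
  proof
    fix d assume d: "d \<in> D"
    have dA: "d \<in> A" using d cut_sub D by blast
    obtain w where w: "w \<in> D" "w \<notin> C" using CD by blast
    have wA: "w \<in> A" using w cut_sub D by blast
    have "\<exists>d1 \<in> D. d1 \<notin> C \<and> (d = d1 \<or> lt d d1)"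
      using lt_linear[OF dA wA] w d cut_down[OF C(1)] wA by blast
    then obtain d1 where d1: "d1 \<in> D" "d1 \<notin> C" "d = d1 \<or> lt d d1" by blast
    have d1A: "d1 \<in> A" using d1 cut_sub D by blast
    obtain d2 where d2: "d2 \<in> D" "lt d1 d2" using d1 cut_open D by blast
    then obtain e where e: "e \<in> A" "d1 \<oplus> e = d2" by (auto simp: lt_def)
    \<comment> \<open>The point \<open>c\<close> is within \<open>e\<close> of the edge of
      \<open>C\<close>. With x = d1 - c, the point c + e above \<open>C\<close> has c + e + x = d1 +
      e = d2 in \<open>D\<close>.\<close>
    obtain c where c: "c \<in> C" "c \<oplus> e \<notin> C" using C(2) e(1) by (auto simp: arch_def)
    have cA: "c \<in> A" using c cut_sub C by blast
    have "lt c d1" using cut_lt C(1) c d1 d1A by blast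
    then obtain x where x: "x \<in> A" "c \<oplus> x = d1" by (auto simp: lt_def)
    have "c \<oplus> e \<oplus> x = d1 \<oplus> e" using x cA e by (simp add: ac flip: x(2))
    then have "x \<in> cdif D C" using x c cA e d2 unfolding cdif_def by auto
    then have "d1 \<in> cadd C (cdif D C)" using x c by (auto simp: cadd_def)
    then show "d \<in> cadd C (cdif D C)"
      using d1(3) dA cut_down[OF cut_cadd[OF C(1) cut_cdif[OF C(1) D CD]]] by blast
  qed
qed

text \<open>Here \<open>arch\<close> is essential: a cut closed under addition of some
  \<open>e\<close> absorbs the cut of all elements below \<open>e\<close>.\<close>

lemma cadd_irr: "cut C \<Longrightarrow> arch C \<Longrightarrow> cut D \<Longrightarrow> cadd C D \<noteq> C"
proof
  assume C: "cut C" "arch C" and D: "cut D" and eq: "cadd C D = C"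
  obtain e where e: "e \<in> D" "e \<in> A" using D by (auto simp: cut_def)
  then obtain c where "c \<in> C" "c \<oplus> e \<notin> C" using C(2) by (auto simp: arch_def)
  then show False using e eq unfolding cadd_def by blast
qed

lemma cut_Union:
  assumes "S \<noteq> {}" "\<And>C. C \<in> S \<Longrightarrow> cut C" "cut B" "\<And>C. C \<in> S \<Longrightarrow> C \<subseteq> B" shows "cut (\<Union>S)"
proof -
  obtain C x where x: "C \<in> S" "x \<in> C" using assms(1,2) unfolding cut_def by blast
  obtain b where b: "b \<in> A" "b \<notin> B" using assms(3) unfolding cut_def by blast
  show ?thesis
  proof (rule cutI[of _ x b])
    show "\<Union>S \<subseteq> A" using assms(2) cut_sub by blast
    show "x \<in> \<Union>S" using x by blast
    show "b \<in> A" "b \<notin> \<Union>S" using b assms(4) by blast+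
    show "\<And>x y. x \<in> \<Union>S \<Longrightarrow> y \<in> A \<Longrightarrow> lt y x \<Longrightarrow> y \<in> \<Union>S" using assms(2) cut_down by blast
    show "\<And>x. x \<in> \<Union>S \<Longrightarrow> \<exists>y\<in>\<Union>S. lt x y" using assms(2) cut_open by blast
  qed
qed

end

locale differences = pos_semifield +
  fixes df :: "'a \<Rightarrow> 'a \<Rightarrow> 'b" and rpl rtm :: "'b \<Rightarrow> 'b \<Rightarrow> 'b"
  assumes df_eq: "a \<in> A \<Longrightarrow> b \<in> A \<Longrightarrow> c \<in> A \<Longrightarrow> d \<in> A \<Longrightarrow> df a b = df c d \<longleftrightarrow> a \<oplus> d = c \<oplus> b"
    and rpl: "a \<in> A \<Longrightarrow> b \<in> A \<Longrightarrow> c \<in> A \<Longrightarrow> d \<in> A \<Longrightarrow> rpl (df a b) (df c d) = df (a \<oplus> c) (b \<oplus> d)"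
    and rtm: "a \<in> A \<Longrightarrow> b \<in> A \<Longrightarrow> c \<in> A \<Longrightarrow> d \<in> A \<Longrightarrow>
      rtm (df a b) (df c d) = df (a \<otimes> c \<oplus> b \<otimes> d) (a \<otimes> d \<oplus> b \<otimes> c)"
begin

section \<open>The ordered field of differences\<close>

definition R :: "'b set" where "R = {df a b | a b. a \<in> A \<and> b \<in> A}"

definition rlt :: "'b \<Rightarrow> 'b \<Rightarrow> bool" where
  "rlt x y \<longleftrightarrow> (\<exists>a b c d. a \<in> A \<and> b \<in> A \<and> c \<in> A \<and> d \<in> A \<and> x = df a b \<and> y = df c d \<and> lt (a \<oplus> d) (c \<oplus> b))"

text \<open>Since \<open>A\<close> has no zero, the zero of the field is 1 - 1, its unit is (1 + 1)
  - 1, and a positive \<open>p\<close> enters as (p + 1) - 1.\<close>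

definition rzero :: 'b where "rzero = df \<one> \<one>"

definition rone :: 'b where "rone = df (\<one> \<oplus> \<one>) \<one>"

definition pos :: "'a \<Rightarrow> 'b" where "pos p = df (p \<oplus> \<one>) \<one>"

lemma RE: "x \<in> R \<Longrightarrow> (\<And>a b. a \<in> A \<Longrightarrow> b \<in> A \<Longrightarrow> x = df a b \<Longrightarrow> thesis) \<Longrightarrow> thesis"
  by (auto simp: R_def)

lemma df_R [simp]: "a \<in> A \<Longrightarrow> b \<in> A \<Longrightarrow> df a b \<in> R"
  by (auto simp: R_def)

lemma pos_R [simp]: "p \<in> A \<Longrightarrow> pos p \<in> R"
  by (simp add: pos_def)

lemma R_simps [simp]: "x \<in> R \<Longrightarrow> y \<in> R \<Longrightarrow> rpl x y \<in> R" "x \<in> R \<Longrightarrow> y \<in> R \<Longrightarrow> rtm x y \<in> R"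
  "rzero \<in> R" "rone \<in> R"
  by (auto elim!: RE simp: rpl rtm rzero_def rone_def)

lemma rpl_comm: "x \<in> R \<Longrightarrow> y \<in> R \<Longrightarrow> rpl x y = rpl y x"
  by (auto elim!: RE simp: rpl ac)

lemma rtm_comm: "x \<in> R \<Longrightarrow> y \<in> R \<Longrightarrow> rtm x y = rtm y x"
  by (auto elim!: RE simp: rtm ac)

lemma rpl_assoc: "x \<in> R \<Longrightarrow> y \<in> R \<Longrightarrow> z \<in> R \<Longrightarrow> rpl (rpl x y) z = rpl x (rpl y z)"
  by (auto elim!: RE simp: rpl ac)

lemma rtm_assoc: "x \<in> R \<Longrightarrow> y \<in> R \<Longrightarrow> z \<in> R \<Longrightarrow> rtm (rtm x y) z = rtm x (rtm y z)"
  by (auto elim!: RE simp: rtm ac)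

lemma rtm_distr: "x \<in> R \<Longrightarrow> y \<in> R \<Longrightarrow> z \<in> R \<Longrightarrow> rtm x (rpl y z) = rpl (rtm x y) (rtm x z)"
  by (auto elim!: RE simp: rpl rtm ac)

lemma rpl_zero: "x \<in> R \<Longrightarrow> rpl x rzero = x"
  by (auto elim!: RE simp: rpl rzero_def df_eq ac)

lemma rtm_one: "x \<in> R \<Longrightarrow> rtm x rone = x"
  by (auto elim!: RE simp: rtm rone_def df_eq ac)

lemma rneg: "x \<in> R \<Longrightarrow> \<exists>y \<in> R. rpl x y = rzero"
proof (elim RE)
  fix a b assume "a \<in> A" "b \<in> A" "x = df a b"
  then show ?thesis by (intro bexI[of _ "df b a"]) (auto simp: rpl rzero_def df_eq ac)
qed

lemma rzero_neq_rone: "rzero \<noteq> rone"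
  using irr[of "\<one> \<oplus> \<one>" \<one>] by (auto simp: rzero_def rone_def df_eq ac)

lemma rinv: "x \<in> R \<Longrightarrow> x \<noteq> rzero \<Longrightarrow> \<exists>y \<in> R. rtm x y = rone"
proof (elim RE)
  fix a b assume [simp]: "a \<in> A" "b \<in> A" and x: "x = df a b" and nz: "x \<noteq> rzero"
  then have "a \<noteq> b" by (auto simp: rzero_def df_eq ac)
  then consider k where "k \<in> A" "b \<oplus> k = a" | k where "k \<in> A" "a \<oplus> k = b"
    using tri[of a b] by auto
  then show ?thesis
  proof cases
    case 1
    obtain j where j: "j \<in> A" "k \<otimes> j = \<one>" using ex_inverse 1 by blast
    then have "rtm x (df (j \<oplus> \<one>) \<one>) = rone"
      using 1(1) by (simp add: x rtm rone_def df_eq ac flip: 1(2))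
    then show ?thesis using j by (intro bexI[of _ "df (j \<oplus> \<one>) \<one>"]) auto
  next
    case 2
    obtain j where j: "j \<in> A" "k \<otimes> j = \<one>" using ex_inverse 2 by blast
    then have "rtm x (df \<one> (j \<oplus> \<one>)) = rone"
      using 2(1) by (simp add: x rtm rone_def df_eq ac flip: 2(2))
    then show ?thesis using j by (intro bexI[of _ "df \<one> (j \<oplus> \<one>)"]) auto
  qed
qed

text \<open>Reduces the order to addition of a positive element, the form from which transitivity,
  translation and density follow by algebra.\<close>

lemma rlt_iff: "x \<in> R \<Longrightarrow> y \<in> R \<Longrightarrow> rlt x y \<longleftrightarrow> (\<exists>p \<in> A. y = rpl x (pos p))"
proof
  assume "rlt x y"
  then obtain a b c d p where [simp]: "a \<in> A" "b \<in> A" "c \<in> A" "d \<in> A" "p \<in> A"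
    and *: "x = df a b" "y = df c d" "a \<oplus> d \<oplus> p = c \<oplus> b"
    by (auto simp: rlt_def lt_def)
  have "c \<oplus> (b \<oplus> \<one>) = c \<oplus> b \<oplus> \<one>" by (simp add: ac)
  also have "\<dots> = a \<oplus> (p \<oplus> \<one>) \<oplus> d" unfolding *(3)[symmetric] by (simp add: ac)
  finally have "y = rpl x (pos p)" by (simp add: * pos_def rpl df_eq)
  then show "\<exists>p\<in>A. y = rpl x (pos p)" using \<open>p \<in> A\<close> by blast
next
  assume "x \<in> R" "\<exists>p\<in>A. y = rpl x (pos p)"
  then obtain a b p where [simp]: "a \<in> A" "b \<in> A" "p \<in> A" and *: "x = df a b" "y = df (a \<oplus> (p \<oplus> \<one>)) (b \<oplus> \<one>)"
    by (auto elim!: RE simp: pos_def rpl)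
  have "a \<oplus> (b \<oplus> \<one>) \<oplus> p = a \<oplus> (p \<oplus> \<one>) \<oplus> b" by (simp add: ac)
  then have "lt (a \<oplus> (b \<oplus> \<one>)) (a \<oplus> (p \<oplus> \<one>) \<oplus> b)" unfolding lt_def using \<open>p \<in> A\<close> by blast
  then show "rlt x y" unfolding rlt_def
    by (intro exI[of _ a] exI[of _ b] exI[of _ "a \<oplus> (p \<oplus> \<one>)"] exI[of _ "b \<oplus> \<one>"]) (simp add: *)
qed

lemma pos_add: "p \<in> A \<Longrightarrow> q \<in> A \<Longrightarrow> rpl (pos p) (pos q) = pos (p \<oplus> q)"
  by (simp add: pos_def rpl df_eq ac)

lemma pos_mult: "p \<in> A \<Longrightarrow> q \<in> A \<Longrightarrow> rtm (pos p) (pos q) = pos (p \<otimes> q)"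
  by (simp add: pos_def rtm df_eq ac)

lemma rpl_cancel: "x \<in> R \<Longrightarrow> y \<in> R \<Longrightarrow> z \<in> R \<Longrightarrow> rpl x y = rpl x z \<longleftrightarrow> y = z"
proof
  assume x: "x \<in> R" and y: "y \<in> R" and z: "z \<in> R" and eq: "rpl x y = rpl x z"
  obtain w where w: "w \<in> R" "rpl x w = rzero" using rneg x by blast
  have "rpl (rpl w x) y = rpl (rpl w x) z" using eq x y z w by (simp add: rpl_assoc)
  then show "y = z" using w x y z rpl_comm[of w x] rpl_comm[of rzero y] rpl_comm[of rzero z]
    by (simp add: rpl_zero)
qed simp

lemma pos_eq: "p \<in> A \<Longrightarrow> q \<in> A \<Longrightarrow> pos p = pos q \<longleftrightarrow> p = q"
  by (simp add: pos_def df_eq pl_cancel)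

lemma pos_nonzero: "p \<in> A \<Longrightarrow> pos p \<noteq> rzero"
  using irr[of "\<one> \<oplus> \<one>" p] by (auto simp: pos_def rzero_def df_eq ac)

lemma rlt_irrefl: "x \<in> R \<Longrightarrow> \<not> rlt x x"
proof
  assume x: "x \<in> R" and "rlt x x"
  then obtain p where p: "p \<in> A" "rpl x rzero = rpl x (pos p)" using rlt_iff rpl_zero by auto
  then show False using rpl_cancel[of x rzero "pos p"] x pos_nonzero by auto
qed

lemma rlt_R: "rlt x y \<Longrightarrow> x \<in> R \<and> y \<in> R"
  by (auto simp: rlt_def)

lemma rltE:
  assumes "rlt x y" obtains p where "p \<in> A" "x \<in> R" "y \<in> R" "y = rpl x (pos p)"
proof -
  have "x \<in> R" "y \<in> R" using rlt_R[OF assms] by auto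
  then show thesis using that assms rlt_iff by auto
qed

lemma rlt_trans: "rlt x y \<Longrightarrow> rlt y z \<Longrightarrow> rlt x z"
proof -
  assume "rlt x y" "rlt y z"
  then obtain p q where "p \<in> A" "q \<in> A" "x \<in> R" "y = rpl x (pos p)" "z = rpl y (pos q)" "z \<in> R"
    by (elim rltE)
  then show ?thesis using rlt_iff[of x z] by (auto simp: rpl_assoc pos_add)
qed

lemma rlt_linear: "x \<in> R \<Longrightarrow> y \<in> R \<Longrightarrow> rlt x y \<or> x = y \<or> rlt y x"
proof (elim RE)
  fix a b c d assume *: "a \<in> A" "b \<in> A" "c \<in> A" "d \<in> A" "x = df a b" "y = df c d"
  then show ?thesis using lt_linear[of "a \<oplus> d" "c \<oplus> b"] unfolding rlt_def by (metis df_eq pl_closed)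
qed

lemma rlt_rpl: "rlt x y \<Longrightarrow> z \<in> R \<Longrightarrow> rlt (rpl x z) (rpl y z)"
proof -
  assume "rlt x y" and z: "z \<in> R"
  then obtain p where p: "p \<in> A" "x \<in> R" "y \<in> R" "y = rpl x (pos p)" by (elim rltE)
  then have "rpl y z = rpl (rpl x z) (pos p)"
    using z rpl_comm[of z "pos p"] by (simp add: rpl_assoc)
  then show ?thesis using p z rlt_iff by auto
qed

lemma rlt_zero_iff: "x \<in> R \<Longrightarrow> rlt rzero x \<longleftrightarrow> (\<exists>p \<in> A. x = pos p)"
  using rlt_iff[of rzero x] rpl_comm[of rzero] rpl_zero by auto

lemma rlt_rtm: "rlt rzero x \<Longrightarrow> rlt rzero y \<Longrightarrow> rlt rzero (rtm x y)"
  using rlt_zero_iff rlt_R pos_mult R_simps(2) tm_closed by metis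

lemma rlt_dense: "rlt x y \<Longrightarrow> \<exists>z. rlt x z \<and> rlt z y"
proof -
  assume "rlt x y"
  then obtain p where p: "p \<in> A" "x \<in> R" "y \<in> R" "y = rpl x (pos p)" by (elim rltE)
  obtain h where h: "h \<in> A" "h \<oplus> h = p" using ex_half p by blast
  have "y = rpl (rpl x (pos h)) (pos h)" using p h by (simp add: rpl_assoc pos_add)
  then show ?thesis using rlt_iff[of x "rpl x (pos h)"] rlt_iff[of "rpl x (pos h)" y] p h by auto
qed

lemma rlt_no_bounds: "x \<in> R \<Longrightarrow> (\<exists>y. rlt x y) \<and> (\<exists>y. rlt y x)"
proof -
  assume x: "x \<in> R"
  obtain w where w: "w \<in> R" "rpl (pos \<one>) w = rzero" using rneg[of "pos \<one>"] by auto
  have "rpl (rpl x w) (pos \<one>) = x"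
    using x w rpl_comm[of w "pos \<one>"] by (simp add: rpl_assoc rpl_zero)
  then have "rlt (rpl x w) x" using rlt_iff[of "rpl x w" x] x w by (auto intro!: bexI[of _ \<one>])
  moreover have "rlt x (rpl x (pos \<one>))" using x rlt_iff by auto
  ultimately show ?thesis by blast
qed

lemma rlt_shift: "w \<in> R \<Longrightarrow> p \<in> A \<Longrightarrow> q \<in> A \<Longrightarrow> rlt (rpl w (pos p)) (rpl w (pos q)) \<longleftrightarrow> lt p q"
proof -
  assume [simp]: "w \<in> R" "p \<in> A" "q \<in> A"
  have "rlt (rpl w (pos p)) (rpl w (pos q)) \<longleftrightarrow> (\<exists>r\<in>A. rpl w (pos q) = rpl w (pos (p \<oplus> r)))"
    by (subst rlt_iff) (auto simp: rpl_assoc pos_add)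
  also have "\<dots> \<longleftrightarrow> lt p q" by (auto simp: lt_def rpl_cancel pos_eq)
  finally show ?thesis .
qed

text \<open>Suprema reduce to suprema of sets of positive elements by a shift.\<close>

lemma ex_supremum:
  assumes "s \<subseteq> R" "x \<in> s" "b \<in> R" "\<And>y. y \<in> s \<Longrightarrow> y = b \<or> rlt y b"
    and sup: "\<And>w. w \<in> R \<Longrightarrow> \<exists>p \<in> A. rpl w (pos p) \<in> s \<Longrightarrow>
      \<exists>q \<in> A. \<forall>p \<in> A. rpl w (pos p) \<in> s \<longrightarrow> p = q \<or> lt p q \<Longrightarrow>
      \<exists>\<sigma> \<in> A. (\<forall>p \<in> A. rpl w (pos p) \<in> s \<longrightarrow> p = \<sigma> \<or> lt p \<sigma>) \<and>
        (\<forall>q \<in> A. (\<forall>p \<in> A. rpl w (pos p) \<in> s \<longrightarrow> p = q \<or> lt p q) \<longrightarrow> \<sigma> = q \<or> lt \<sigma> q)"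
  shows "\<exists>u \<in> R. (\<forall>y \<in> s. y = u \<or> rlt y u) \<and> (\<forall>c \<in> R. (\<forall>y \<in> s. y = c \<or> rlt y c) \<longrightarrow> u = c \<or> rlt u c)"
proof -
  have xR: "x \<in> R" using assms by blast
  \<comment> \<open>Seen from a point strictly below \<open>x\<close>, both \<open>x\<close> and all
    upper bounds of \<open>s\<close> are positive.\<close>
  obtain w where w: "rlt w x" using rlt_no_bounds[OF xR] by blast
  then have wR: "w \<in> R" using rlt_R by blast
  have above: "\<exists>r \<in> A. c = rpl w (pos r)" if "c \<in> R" "\<forall>y \<in> s. y = c \<or> rlt y c" for c
  proof -
    have "x = c \<or> rlt x c" using that(2) \<open>x \<in> s\<close> by blast
    then have "rlt w c" using w rlt_trans by blast
    then show ?thesis using rlt_iff[OF wR that(1)] by blast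
  qed
  have ub_iff: "(\<forall>y \<in> s. y = rpl w (pos q) \<or> rlt y (rpl w (pos q))) \<longleftrightarrow>
    (\<forall>p \<in> A. rpl w (pos p) \<in> s \<longrightarrow> p = q \<or> lt p q)" if q: "q \<in> A" for q
  proof
    assume *: "\<forall>y \<in> s. y = rpl w (pos q) \<or> rlt y (rpl w (pos q))"
    show "\<forall>p \<in> A. rpl w (pos p) \<in> s \<longrightarrow> p = q \<or> lt p q"
    proof (intro ballI impI)
      fix p assume p: "p \<in> A" "rpl w (pos p) \<in> s"
      then show "p = q \<or> lt p q"
        using * q wR rlt_shift[OF wR p(1) q] rpl_cancel[of w "pos p" "pos q"] pos_eq by auto
    qed
  next
    assume *: "\<forall>p \<in> A. rpl w (pos p) \<in> s \<longrightarrow> p = q \<or> lt p q"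
    show "\<forall>y \<in> s. y = rpl w (pos q) \<or> rlt y (rpl w (pos q))"
    proof
      fix y assume y: "y \<in> s"
      have wq: "rlt w (rpl w (pos q))" using wR q rlt_iff by auto
      have yR: "y \<in> R" using y assms(1) by blast
      consider "rlt w y" | "y = w" | "rlt y w" using rlt_linear[OF wR yR] by blast
      then show "y = rpl w (pos q) \<or> rlt y (rpl w (pos q))"
      proof cases
        case 1
        then obtain p where p: "p \<in> A" "y = rpl w (pos p)" using rlt_iff[OF wR yR] by blast
        then show ?thesis using * y rlt_shift[OF wR p(1) q] by blast
      qed (use wq rlt_trans in blast)+
    qed
  qed
  have "\<exists>p \<in> A. rpl w (pos p) \<in> s" using rlt_iff[OF wR xR] w \<open>x \<in> s\<close> by auto
  moreover obtain r where "r \<in> A" "b = rpl w (pos r)" using above[of b] assms by blast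
  then have "\<exists>q \<in> A. \<forall>p \<in> A. rpl w (pos p) \<in> s \<longrightarrow> p = q \<or> lt p q" using ub_iff assms(4) by blast
  ultimately obtain \<sigma> where \<sigma>: "\<sigma> \<in> A" "\<forall>p \<in> A. rpl w (pos p) \<in> s \<longrightarrow> p = \<sigma> \<or> lt p \<sigma>"
    "\<And>q. q \<in> A \<Longrightarrow> \<forall>p \<in> A. rpl w (pos p) \<in> s \<longrightarrow> p = q \<or> lt p q \<Longrightarrow> \<sigma> = q \<or> lt \<sigma> q"
    using sup[OF wR] by blast
  show ?thesis
  proof (intro bexI[of _ "rpl w (pos \<sigma>)"] conjI ballI impI)
    show "y = rpl w (pos \<sigma>) \<or> rlt y (rpl w (pos \<sigma>))" if "y \<in> s" for y
      using \<sigma>(1,2) ub_iff that by blast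
    fix c assume c: "c \<in> R" "\<forall>y \<in> s. y = c \<or> rlt y c"
    then obtain q where q: "q \<in> A" "c = rpl w (pos q)" using above by blast
    then have "\<sigma> = q \<or> lt \<sigma> q" using c(2) ub_iff \<sigma>(3) by blast
    then show "rpl w (pos \<sigma>) = c \<or> rlt (rpl w (pos \<sigma>)) c"
      using q rlt_shift[OF wR \<sigma>(1) q(1)] by blast
  qed (use wR \<sigma>(1) in auto)
qed

end

section \<open>The real line inside the model\<close>

context zfc
begin

text \<open>To carry the parameter \<open>m\<close> through \<open>om_recursion\<close>, the
  recursion runs on functions with domain \<omega>: its n-th value is the set of all pairs of
  \<open>m\<close> and \<open>F m n\<close>.\<close>

lemma om_recursion2:
  assumes g: "DT (\<lambda>e. g (e 0))" and h: "DT (\<lambda>e. h (e 0) (e 1))"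
  shows "\<exists>F. DT (\<lambda>e. F (e 0) (e 1)) \<and> (\<forall>m. m \<epsilon> om \<longrightarrow> F m emp = g m \<and>
    (\<forall>n. n \<epsilon> om \<longrightarrow> F m (sc n) = h m (F m n)))"
proof -
  note [definable] = DT_app1[OF g] DT_app2[OF h]
  have step: "DT (\<lambda>e. h (e 0) (ap f (e 0)))" for f by (intro definable)
  have HD: "DT (\<lambda>e. lam om (\<lambda>m. h m (ap (e 1) m)))"
    by (rule DT_ext, rule lam_iff[OF step], intro definable)
  obtain F where F: "DT (\<lambda>e. F (e 0))" "F emp = lam om g"
    "\<And>n. n \<epsilon> om \<Longrightarrow> F (sc n) = lam om (\<lambda>m. h m (ap (F n) m))"
    by (rule om_recursion[of "\<lambda>n f. lam om (\<lambda>m. h m (ap f m))" "lam om g", OF HD], rule that)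
  note [definable] = DT_app1[OF F(1)]
  have "DT (\<lambda>e. ap (F (e 1)) (e 0))" by (intro definable)
  moreover have "ap (F emp) m = g m" if "m \<epsilon> om" for m
    unfolding F(2) by (rule ap_lam[OF g that])
  moreover have "ap (F (sc n)) m = h m (ap (F n) m)" if "m \<epsilon> om" "n \<epsilon> om" for m n
    unfolding F(3)[OF that(2)] by (rule ap_lam[OF step that(1)])
  ultimately show ?thesis by (intro exI[of _ "\<lambda>m n. ap (F n) m"]) blast
qed

section \<open>Arithmetic on the natural numbers of the model\<close>

definition nadd :: "'m \<Rightarrow> 'm \<Rightarrow> 'm" where
  "nadd = (SOME F. DT (\<lambda>e. F (e 0) (e 1)) \<and> (\<forall>m. m \<epsilon> om \<longrightarrow> F m emp = m \<and>
    (\<forall>n. n \<epsilon> om \<longrightarrow> F m (sc n) = sc (F m n))))"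

lemma nadd: "DT (\<lambda>e. nadd (e 0) (e 1)) \<and> (\<forall>m. m \<epsilon> om \<longrightarrow> nadd m emp = m \<and>
    (\<forall>n. n \<epsilon> om \<longrightarrow> nadd m (sc n) = sc (nadd m n)))"
proof -
  have "DT (\<lambda>e. e 0)" "DT (\<lambda>e. sc (e 1))" by (intro definable)+
  then show ?thesis
    unfolding nadd_def by (rule someI_ex[OF om_recursion2[of "\<lambda>m. m" "\<lambda>m x. sc x"]])
qed

lemmas DT_nadd [definable] = DT_app2[OF nadd[THEN conjunct1]]

lemma nadd_simps [simp]: "m \<epsilon> om \<Longrightarrow> nadd m emp = m"
  "m \<epsilon> om \<Longrightarrow> n \<epsilon> om \<Longrightarrow> nadd m (sc n) = sc (nadd m n)"
  using nadd by blast+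

definition nmul :: "'m \<Rightarrow> 'm \<Rightarrow> 'm" where
  "nmul = (SOME F. DT (\<lambda>e. F (e 0) (e 1)) \<and> (\<forall>m. m \<epsilon> om \<longrightarrow> F m emp = emp \<and>
    (\<forall>n. n \<epsilon> om \<longrightarrow> F m (sc n) = nadd (F m n) m)))"

lemma nmul: "DT (\<lambda>e. nmul (e 0) (e 1)) \<and> (\<forall>m. m \<epsilon> om \<longrightarrow> nmul m emp = emp \<and>
    (\<forall>n. n \<epsilon> om \<longrightarrow> nmul m (sc n) = nadd (nmul m n) m))"
proof -
  have "DT (\<lambda>e. emp)" "DT (\<lambda>e. nadd (e 1) (e 0))" by (intro definable)+
  then show ?thesis
    unfolding nmul_def by (rule someI_ex[OF om_recursion2[of "\<lambda>m. emp" "\<lambda>m x. nadd x m"]])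
qed

lemmas DT_nmul [definable] = DT_app2[OF nmul[THEN conjunct1]]

lemma nmul_simps [simp]: "m \<epsilon> om \<Longrightarrow> nmul m emp = emp"
  "m \<epsilon> om \<Longrightarrow> n \<epsilon> om \<Longrightarrow> nmul m (sc n) = nadd (nmul m n) m"
  using nmul by blast+

lemma sc_eq [simp]: "sc m = sc n \<longleftrightarrow> m = n"
proof
  assume eq: "sc m = sc n"
  show "m = n"
  proof (rule ccontr)
    assume "m \<noteq> n"
    moreover have "m \<epsilon> sc n" "n \<epsilon> sc m" using eq sc_iff[of m m] sc_iff[of n n] by simp_all
    ultimately show False using mem_asym by simp
  qed
qed simp

lemma sc_neq_emp [simp]: "sc m \<noteq> emp"
  by (metis emp_iff sc_iff)

lemma nadd_om [simp]: "m \<epsilon> om \<Longrightarrow> n \<epsilon> om \<Longrightarrow> nadd m n \<epsilon> om"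
proof -
  assume m: "m \<epsilon> om" and "n \<epsilon> om"
  from \<open>n \<epsilon> om\<close> show ?thesis
  proof (induction rule: om_induct)
    case D
    show ?case by (intro definable)
  qed (use m in simp_all)
qed

lemma nadd_emp_left [simp]: "n \<epsilon> om \<Longrightarrow> nadd emp n = n"
proof (induction rule: om_induct)
  case D
  show ?case by (intro definable)
qed simp_all

lemma nadd_sc_left [simp]: "m \<epsilon> om \<Longrightarrow> n \<epsilon> om \<Longrightarrow> nadd (sc m) n = sc (nadd m n)"
proof -
  assume m: "m \<epsilon> om" and "n \<epsilon> om"
  from \<open>n \<epsilon> om\<close> show ?thesis
  proof (induction rule: om_induct)
    case D
    show ?case by (intro definable)
  qed (use m in simp_all)
qed

lemma nadd_comm: "m \<epsilon> om \<Longrightarrow> n \<epsilon> om \<Longrightarrow> nadd m n = nadd n m"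
proof -
  assume m: "m \<epsilon> om" and "n \<epsilon> om"
  from \<open>n \<epsilon> om\<close> show ?thesis
  proof (induction rule: om_induct)
    case D
    show ?case by (intro definable)
  qed (use m in simp_all)
qed

lemma nadd_assoc: "k \<epsilon> om \<Longrightarrow> m \<epsilon> om \<Longrightarrow> n \<epsilon> om \<Longrightarrow> nadd (nadd k m) n = nadd k (nadd m n)"
proof -
  assume m: "k \<epsilon> om" "m \<epsilon> om" and "n \<epsilon> om"
  from \<open>n \<epsilon> om\<close> show ?thesis
  proof (induction rule: om_induct)
    case D
    show ?case by (intro definable)
  qed (use m in simp_all)
qed

lemma nadd_lcomm: "k \<epsilon> om \<Longrightarrow> m \<epsilon> om \<Longrightarrow> n \<epsilon> om \<Longrightarrow> nadd k (nadd m n) = nadd m (nadd k n)"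
  using nadd_assoc[of k m n] nadd_assoc[of m k n] nadd_comm[of k m] by simp

lemma nmul_om [simp]: "m \<epsilon> om \<Longrightarrow> n \<epsilon> om \<Longrightarrow> nmul m n \<epsilon> om"
proof -
  assume m: "m \<epsilon> om" and "n \<epsilon> om"
  from \<open>n \<epsilon> om\<close> show ?thesis
  proof (induction rule: om_induct)
    case D
    show ?case by (intro definable)
  qed (use m in simp_all)
qed

lemma nmul_emp_left [simp]: "n \<epsilon> om \<Longrightarrow> nmul emp n = emp"
proof (induction rule: om_induct)
  case D
  show ?case by (intro definable)
qed simp_all

lemma nmul_sc_left [simp]: "m \<epsilon> om \<Longrightarrow> n \<epsilon> om \<Longrightarrow> nmul (sc m) n = nadd (nmul m n) n"
proof -
  assume m: "m \<epsilon> om" and "n \<epsilon> om"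
  from \<open>n \<epsilon> om\<close> show ?thesis
  proof (induction rule: om_induct)
    case D
    show ?case by (intro definable)
  next
    case (succ n)
    then show ?case using m nadd_assoc nadd_comm nadd_lcomm by simp
  qed (use m in simp_all)
qed

lemma nmul_comm: "m \<epsilon> om \<Longrightarrow> n \<epsilon> om \<Longrightarrow> nmul m n = nmul n m"
proof -
  assume m: "m \<epsilon> om" and "n \<epsilon> om"
  from \<open>n \<epsilon> om\<close> show ?thesis
  proof (induction rule: om_induct)
    case D
    show ?case by (intro definable)
  qed (use m in simp_all)
qed

lemma nmul_distr: "k \<epsilon> om \<Longrightarrow> m \<epsilon> om \<Longrightarrow> n \<epsilon> om \<Longrightarrow> nmul k (nadd m n) = nadd (nmul k m) (nmul k n)"
proof -
  assume m: "k \<epsilon> om" "m \<epsilon> om" and "n \<epsilon> om"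
  from \<open>n \<epsilon> om\<close> show ?thesis
  proof (induction rule: om_induct)
    case D
    show ?case by (intro definable)
  qed (use m in \<open>simp_all add: nadd_assoc\<close>)
qed

lemma nmul_assoc: "k \<epsilon> om \<Longrightarrow> m \<epsilon> om \<Longrightarrow> n \<epsilon> om \<Longrightarrow> nmul (nmul k m) n = nmul k (nmul m n)"
proof -
  assume m: "k \<epsilon> om" "m \<epsilon> om" and "n \<epsilon> om"
  from \<open>n \<epsilon> om\<close> show ?thesis
  proof (induction rule: om_induct)
    case D
    show ?case by (intro definable)
  qed (use m in \<open>simp_all add: nmul_distr\<close>)
qed

definition npos :: 'm where "npos = dif om (up emp emp)"

lemma npos_iff: "n \<epsilon> npos \<longleftrightarrow> n \<epsilon> om \<and> n \<noteq> emp"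
  by (simp add: npos_def)

lemma npos_sc: "n \<epsilon> npos \<longleftrightarrow> (\<exists>m. m \<epsilon> om \<and> n = sc m)"
  using om_cases[of n] by (auto simp: npos_iff)

lemma nat_trichotomy: "m \<epsilon> om \<Longrightarrow> n \<epsilon> om \<Longrightarrow>
  m = n \<or> (\<exists>z. z \<epsilon> npos \<and> nadd m z = n) \<or> (\<exists>z. z \<epsilon> npos \<and> nadd n z = m)"
proof -
  assume m: "m \<epsilon> om" and n: "n \<epsilon> om"
  from m show ?thesis
  proof (induction rule: om_induct)
    case D
    show ?case by (intro definable)
  next
    case zero
    show ?case using n by (auto simp: npos_iff)
  next
    case (succ m)
    from succ(2) show ?case
    proof (elim disjE exE conjE)
      assume "m = n"
      then have "sc emp \<epsilon> npos \<and> nadd n (sc emp) = sc m" using n by (simp add: npos_iff)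
      then show ?thesis by blast
    next
      fix z assume z: "z \<epsilon> npos" "nadd m z = n"
      then obtain w where w: "w \<epsilon> om" "z = sc w" by (auto simp: npos_sc)
      then have "nadd (sc m) w = n" using z(2) succ(1) by simp
      then show ?thesis using w succ(1) by (cases "w = emp") (auto simp: npos_iff)
    next
      fix z assume z: "z \<epsilon> npos" "nadd n z = m"
      then have "nadd n (sc z) = sc m" "sc z \<epsilon> npos" using n by (auto simp: npos_iff)
      then show ?thesis by blast
    qed
  qed
qed

lemma nadd_neq: "x \<epsilon> om \<Longrightarrow> z \<epsilon> npos \<Longrightarrow> nadd x z \<noteq> x"
proof -
  assume "x \<epsilon> om" and z: "z \<epsilon> npos"
  then show ?thesis
  proof (induction rule: om_induct)
    case D
    show ?case by (intro definable)
  qed (use z in \<open>simp_all add: npos_iff\<close>)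
qed

interpretation N: pos_semiring "{n. n \<epsilon> npos}" nadd nmul "sc emp"
proof
  fix x y assume xy: "x \<in> {n. n \<epsilon> npos}" "y \<in> {n. n \<epsilon> npos}"
  then obtain m n where "m \<epsilon> om" "n \<epsilon> om" "x = sc m" "y = sc n" by (auto simp: npos_sc)
  then show "nadd x y \<in> {n. n \<epsilon> npos}" "nmul x y \<in> {n. n \<epsilon> npos}" by (auto simp: npos_iff)
  show "x = y \<or> (\<exists>z\<in>{n. n \<epsilon> npos}. nadd x z = y) \<or> (\<exists>z\<in>{n. n \<epsilon> npos}. nadd y z = x)"
    using nat_trichotomy[of x y] xy by (simp add: npos_iff)
qed (auto simp: npos_iff nadd_assoc nmul_assoc nmul_distr nadd_neq intro: nadd_comm nmul_comm)

section \<open>Positive rationals of the model as classes of pairs\<close>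

definition fr :: "'m \<Rightarrow> 'm \<Rightarrow> 'm" where
  "fr a b = Sep (prd npos npos) (\<lambda>z. \<exists>x y. z = pr x y \<and> nmul a y = nmul x b)"

lemma fr_iff: "z \<epsilon> fr a b \<longleftrightarrow> z \<epsilon> prd npos npos \<and> (\<exists>x y. z = pr x y \<and> nmul a y = nmul x b)"
  unfolding fr_def by (rule Sep_iff) (intro definable)

lemma DT_fr [definable]: "DT s \<Longrightarrow> DT t \<Longrightarrow> DT (\<lambda>e. fr (s e) (t e))"
  by (rule DT_app2[of fr], rule DT_ext, rule fr_iff, intro definable)

lemma fr_eq:
  assumes "a \<epsilon> npos" "b \<epsilon> npos" "c \<epsilon> npos" "d \<epsilon> npos"
  shows "fr a b = fr c d \<longleftrightarrow> nmul a d = nmul c b"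
proof
  assume eq: "fr a b = fr c d"
  have "pr c d \<epsilon> fr a b" unfolding eq using assms by (auto simp: fr_iff)
  then show "nmul a d = nmul c b" by (auto simp: fr_iff)
next
  assume eq: "nmul a d = nmul c b"
  show "fr a b = fr c d"
    by (rule extensionality) (use N.fr_class[of a b c d] assms eq in \<open>auto simp: fr_iff prd_iff\<close>)
qed

text \<open>The sum is described by its elements, with representatives quantified inside, so that it
  is a total definable term; its independence of the representatives comes from
  \<open>N.fr_pl_cong\<close>.\<close>

definition qpl :: "'m \<Rightarrow> 'm \<Rightarrow> 'm" where
  "qpl x y = Sep (prd npos npos) (\<lambda>z. \<exists>a b c d. a \<epsilon> npos \<and> b \<epsilon> npos \<and> c \<epsilon> npos \<and> d \<epsilon> npos \<and>
    x = fr a b \<and> y = fr c d \<and> z \<epsilon> fr (nadd (nmul a d) (nmul c b)) (nmul b d))"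

lemma qpl_iff: "z \<epsilon> qpl x y \<longleftrightarrow> z \<epsilon> prd npos npos \<and>
  (\<exists>a b c d. a \<epsilon> npos \<and> b \<epsilon> npos \<and> c \<epsilon> npos \<and> d \<epsilon> npos \<and>
    x = fr a b \<and> y = fr c d \<and> z \<epsilon> fr (nadd (nmul a d) (nmul c b)) (nmul b d))"
  unfolding qpl_def by (rule Sep_iff) (intro definable)

lemma DT_qpl [definable]: "DT s \<Longrightarrow> DT t \<Longrightarrow> DT (\<lambda>e. qpl (s e) (t e))"
  by (rule DT_app2[of qpl], rule DT_ext, rule qpl_iff, intro definable)

definition qtm :: "'m \<Rightarrow> 'm \<Rightarrow> 'm" where
  "qtm x y = Sep (prd npos npos) (\<lambda>z. \<exists>a b c d. a \<epsilon> npos \<and> b \<epsilon> npos \<and> c \<epsilon> npos \<and> d \<epsilon> npos \<and>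
    x = fr a b \<and> y = fr c d \<and> z \<epsilon> fr (nmul a c) (nmul b d))"

lemma qtm_iff: "z \<epsilon> qtm x y \<longleftrightarrow> z \<epsilon> prd npos npos \<and>
  (\<exists>a b c d. a \<epsilon> npos \<and> b \<epsilon> npos \<and> c \<epsilon> npos \<and> d \<epsilon> npos \<and>
    x = fr a b \<and> y = fr c d \<and> z \<epsilon> fr (nmul a c) (nmul b d))"
  unfolding qtm_def by (rule Sep_iff) (intro definable)

lemma DT_qtm [definable]: "DT s \<Longrightarrow> DT t \<Longrightarrow> DT (\<lambda>e. qtm (s e) (t e))"
  by (rule DT_app2[of qtm], rule DT_ext, rule qtm_iff, intro definable)

lemma npos_closed [simp]: "x \<epsilon> npos \<Longrightarrow> y \<epsilon> npos \<Longrightarrow> nadd x y \<epsilon> npos"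
  "x \<epsilon> npos \<Longrightarrow> y \<epsilon> npos \<Longrightarrow> nmul x y \<epsilon> npos" "sc emp \<epsilon> npos"
  using N.pl_closed N.tm_closed N.one_closed by simp_all

interpretation F: fractions "{n. n \<epsilon> npos}" nadd nmul "sc emp" fr qpl qtm
proof
  fix a b c d assume "a \<in> {n. n \<epsilon> npos}" "b \<in> {n. n \<epsilon> npos}" "c \<in> {n. n \<epsilon> npos}" "d \<in> {n. n \<epsilon> npos}"
  then have m: "a \<epsilon> npos" "b \<epsilon> npos" "c \<epsilon> npos" "d \<epsilon> npos" by auto
  then show "fr a b = fr c d \<longleftrightarrow> nmul a d = nmul c b" by (rule fr_eq)
  show "qpl (fr a b) (fr c d) = fr (nadd (nmul a d) (nmul c b)) (nmul b d)"
  proof (rule extensionality)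
    fix z
    have "fr (nadd (nmul a' d') (nmul c' b')) (nmul b' d') = fr (nadd (nmul a d) (nmul c b)) (nmul b d)"
      if "a' \<epsilon> npos" "b' \<epsilon> npos" "c' \<epsilon> npos" "d' \<epsilon> npos" "fr a b = fr a' b'" "fr c d = fr c' d'" for a' b' c' d'
      using that m N.fr_pl_cong[of a b c d a' b' c' d'] by (simp add: fr_eq)
    then show "z \<epsilon> qpl (fr a b) (fr c d) \<longleftrightarrow> z \<epsilon> fr (nadd (nmul a d) (nmul c b)) (nmul b d)"
      unfolding qpl_iff using m fr_iff by metis
  qed
  show "qtm (fr a b) (fr c d) = fr (nmul a c) (nmul b d)"
  proof (rule extensionality)
    fix z
    have "fr (nmul a' c') (nmul b' d') = fr (nmul a c) (nmul b d)"
      if "a' \<epsilon> npos" "b' \<epsilon> npos" "c' \<epsilon> npos" "d' \<epsilon> npos" "fr a b = fr a' b'" "fr c d = fr c' d'" for a' b' c' d'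
      using that m N.fr_tm_cong[of a b c d a' b' c' d'] by (simp add: fr_eq)
    then show "z \<epsilon> qtm (fr a b) (fr c d) \<longleftrightarrow> z \<epsilon> fr (nmul a c) (nmul b d)"
      unfolding qtm_iff using m fr_iff by metis
  qed
qed

definition QQ :: 'm where
  "QQ = Sep (Pw (prd npos npos)) (\<lambda>q. \<exists>a b. a \<epsilon> npos \<and> b \<epsilon> npos \<and> q = fr a b)"

lemma QQ_iff: "q \<epsilon> QQ \<longleftrightarrow> (\<exists>a b. a \<epsilon> npos \<and> b \<epsilon> npos \<and> q = fr a b)"
proof -
  have "q \<epsilon> QQ \<longleftrightarrow> q \<epsilon> Pw (prd npos npos) \<and> (\<exists>a b. a \<epsilon> npos \<and> b \<epsilon> npos \<and> q = fr a b)"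
    unfolding QQ_def by (rule Sep_iff) (intro definable)
  then show ?thesis by (auto simp: fr_iff)
qed

lemma FQ: "F.Q = {q. q \<epsilon> QQ}"
  by (auto simp: F.Q_def QQ_iff)

interpretation Q: pos_semifield "{q. q \<epsilon> QQ}" qpl qtm "fr (sc emp) (sc emp)"
  using F.Q.pos_semifield_axioms unfolding FQ .

lemma QQ_closed [simp]: "x \<epsilon> QQ \<Longrightarrow> y \<epsilon> QQ \<Longrightarrow> qpl x y \<epsilon> QQ" "x \<epsilon> QQ \<Longrightarrow> y \<epsilon> QQ \<Longrightarrow> qtm x y \<epsilon> QQ"
  using Q.pl_closed Q.tm_closed by simp_all

text \<open>The link between the algebra over sets of the metalogic and the sets of the
  model.\<close>

abbreviation el :: "'m \<Rightarrow> 'm set" where "el c \<equiv> {x. x \<epsilon> c}"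

lemma el_eq [simp]: "el c = el d \<longleftrightarrow> c = d"
  using extensionality by blast

lemma Qlt_iff: "Q.lt x y \<longleftrightarrow> (\<exists>z. z \<epsilon> QQ \<and> qpl x z = y)"
  by (auto simp: Q.lt_def)

lemma D_Qlt [definable]: "DT s \<Longrightarrow> DT t \<Longrightarrow> D (\<lambda>e. Q.lt (s e) (t e))"
  by (rule D_app2[of Q.lt]) (unfold Qlt_iff, intro definable)

lemma Qcut_iff: "Q.cut (el c) \<longleftrightarrow> c \<sqsubseteq> QQ \<and> (\<exists>x. x \<epsilon> c) \<and> (\<exists>b. b \<epsilon> QQ \<and> \<not> b \<epsilon> c) \<and>
  (\<forall>x. x \<epsilon> c \<longrightarrow> (\<forall>y. y \<epsilon> QQ \<longrightarrow> Q.lt y x \<longrightarrow> y \<epsilon> c)) \<and> (\<forall>x. x \<epsilon> c \<longrightarrow> (\<exists>y. y \<epsilon> c \<and> Q.lt x y))"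
  unfolding Q.cut_def subs_def by blast

lemma D_Qcut [definable]: "DT s \<Longrightarrow> D (\<lambda>e. Q.cut (el (s e)))"
  by (rule D_app1[of "\<lambda>c. Q.cut (el c)"]) (unfold Qcut_iff, intro definable)

section \<open>Positive reals of the model as cuts of rationals\<close>

definition PP :: 'm where "PP = Sep (Pw QQ) (\<lambda>c. Q.cut (el c))"

lemma PP_iff: "c \<epsilon> PP \<longleftrightarrow> Q.cut (el c)"
proof -
  have "c \<epsilon> PP \<longleftrightarrow> c \<epsilon> Pw QQ \<and> Q.cut (el c)"
    unfolding PP_def by (rule Sep_iff) (intro definable)
  then show ?thesis by (auto simp: Qcut_iff)
qed

text \<open>The rationals of the model may look non-Archimedean from outside, but a cut that is an
  element of the model can be used in induction over \<omega> inside it. If adding \<open>e\<close>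
  never left \<open>c\<close>, all sums of \<open>x\<close> and multiples of \<open>e\<close> would
  lie in \<open>c\<close>, and one of them exceeds \<open>b\<close>.\<close>

lemma PP_archimedean: "c \<epsilon> PP \<Longrightarrow> Q.arch (el c)"
  unfolding Q.arch_def
proof (rule ballI, rule ccontr)
  fix e assume c: "c \<epsilon> PP" and "e \<in> el QQ" and no: "\<not> (\<exists>x\<in>el c. qpl x e \<notin> el c)"
  then have e: "e \<epsilon> QQ" and step: "\<And>x. x \<epsilon> c \<Longrightarrow> qpl x e \<epsilon> c" by auto
  have cut: "Q.cut (el c)" using c by (simp add: PP_iff)
  obtain x b where x: "x \<epsilon> c" "x \<epsilon> QQ" and b: "b \<epsilon> QQ" "\<not> b \<epsilon> c"
    using cut unfolding Qcut_iff using subsD by blast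
  let ?one = "fr (sc emp) (sc emp)"
  \<comment> \<open>This is the rational n + 1, as numerators have to be positive.\<close>
  let ?n = "\<lambda>n. fr (sc n) (sc emp)"
  have nQ: "?n n \<epsilon> QQ" if "n \<epsilon> om" for n
    unfolding QQ_iff by (intro exI[of _ "sc n"] exI[of _ "sc emp"]) (use that in \<open>simp add: npos_iff\<close>)
  have multiples: "qpl x (qtm (?n n) e) \<epsilon> c" if "n \<epsilon> om" for n
    using that
  proof (induction rule: om_induct)
    case D
    show ?case by (intro definable)
  next
    case zero
    show ?case using step x e by simp
  next
    case (succ n)
    have "sc n \<epsilon> npos" using succ(1) by (auto simp: npos_sc)
    then have "qpl (?n n) ?one = ?n (sc n)" using succ(1) F.qpl[of "sc n" "sc emp" "sc emp" "sc emp"] by simp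
    then have "qpl x (qtm (?n (sc n)) e) = qpl (qpl x (qtm (?n n) e)) e"
      using x e nQ[OF succ(1)] nQ[of emp] by (simp add: Q.pl_assoc Q.distr_right flip: \<open>qpl (?n n) ?one = ?n (sc n)\<close>)
    then show ?case using step succ(2) by simp
  qed
  obtain z where z: "z \<epsilon> QQ" "qtm z e = b"
    using Q.ex_quotient[of e b] e b(1) Q.tm_comm by auto
  obtain r s where r: "r \<epsilon> npos" "s \<epsilon> npos" "z = fr r s" using z(1) by (auto simp: QQ_iff)
  obtain n where n: "n \<epsilon> om" "r = sc n" using r(1) by (auto simp: npos_sc)
  \<comment> \<open>A fraction r/s is at most r: with s = k + 1, adding r k / s to it gives r, and
    for s = 1 the two agree.\<close>
  have "z = ?n n \<or> Q.lt z (?n n)"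
  proof (cases "s = sc emp")
    case False
    obtain k where k: "k \<epsilon> om" "s = sc k" using r(2) by (auto simp: npos_sc)
    then have kN: "k \<epsilon> npos" using False by (auto simp: npos_iff)
    have ss: "nmul s s = nadd (nmul s k) s" using k by simp
    have "nmul (nadd (nmul r s) (nmul (nmul r k) s)) (sc emp) = nmul r (nmul s s)"
      unfolding ss using r kN by (simp add: N.ac del: nmul_simps)
    then have "qpl z (fr (nmul r k) s) = ?n n"
      using r kN n by (simp add: F.qpl fr_eq)
    moreover have "fr (nmul r k) s \<epsilon> QQ" using kN r npos_closed(2) unfolding QQ_iff by blast
    ultimately show ?thesis unfolding Qlt_iff by blast
  qed (use r n in simp)
  moreover have "qpl x (qtm (?n n) e) \<epsilon> c" using multiples n by blast
  moreover have "Q.lt (qtm (?n n) e) (qpl x (qtm (?n n) e))"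
    using Q.lt_pl_self[of "qtm (?n n) e" x] x e nQ[OF n(1)] by (simp add: Q.pl_comm)
  moreover have "Q.lt b (qtm (?n n) e)" if "Q.lt z (?n n)"
    using Q.tm_mono[of z "?n n" e] that z e nQ[OF n(1)] by simp
  ultimately have "Q.lt b (qpl x (qtm (?n n) e))"
    using z Q.lt_trans[of b] b(1) by auto
  then show False using \<open>qpl x (qtm (?n n) e) \<epsilon> c\<close> Q.cut_down[OF cut] b by blast
qed

definition padd :: "'m \<Rightarrow> 'm \<Rightarrow> 'm" where
  "padd c d = Sep QQ (\<lambda>q. \<exists>x y. x \<epsilon> c \<and> y \<epsilon> d \<and> q = qpl x y)"

lemma padd_iff: "q \<epsilon> padd c d \<longleftrightarrow> q \<epsilon> QQ \<and> (\<exists>x y. x \<epsilon> c \<and> y \<epsilon> d \<and> q = qpl x y)"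
  unfolding padd_def by (rule Sep_iff) (intro definable)

lemma DT_padd [definable]: "DT s \<Longrightarrow> DT t \<Longrightarrow> DT (\<lambda>e. padd (s e) (t e))"
  by (rule DT_app2[of padd], rule DT_ext, rule padd_iff, intro definable)

definition pmul :: "'m \<Rightarrow> 'm \<Rightarrow> 'm" where
  "pmul c d = Sep QQ (\<lambda>q. \<exists>x y. x \<epsilon> c \<and> y \<epsilon> d \<and> q = qtm x y)"

lemma pmul_iff: "q \<epsilon> pmul c d \<longleftrightarrow> q \<epsilon> QQ \<and> (\<exists>x y. x \<epsilon> c \<and> y \<epsilon> d \<and> q = qtm x y)"
  unfolding pmul_def by (rule Sep_iff) (intro definable)

lemma DT_pmul [definable]: "DT s \<Longrightarrow> DT t \<Longrightarrow> DT (\<lambda>e. pmul (s e) (t e))"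
  by (rule DT_app2[of pmul], rule DT_ext, rule pmul_iff, intro definable)

lemma PP_QQ: "c \<epsilon> PP \<Longrightarrow> x \<epsilon> c \<Longrightarrow> x \<epsilon> QQ"
  using Q.cut_sub[of "el c" x] by (simp add: PP_iff)

lemma el_padd: "c \<epsilon> PP \<Longrightarrow> d \<epsilon> PP \<Longrightarrow> el (padd c d) = Q.cadd (el c) (el d)"
  using PP_QQ by (auto simp: padd_iff Q.cadd_def)

lemma el_pmul: "c \<epsilon> PP \<Longrightarrow> d \<epsilon> PP \<Longrightarrow> el (pmul c d) = Q.cmul (el c) (el d)"
  using PP_QQ by (auto simp: pmul_iff Q.cmul_def)

lemma PP_closed [simp]: "c \<epsilon> PP \<Longrightarrow> d \<epsilon> PP \<Longrightarrow> padd c d \<epsilon> PP" "c \<epsilon> PP \<Longrightarrow> d \<epsilon> PP \<Longrightarrow> pmul c d \<epsilon> PP"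
  using Q.cut_cadd Q.cut_cmul by (simp_all add: PP_iff[of "padd c d"] PP_iff[of "pmul c d"] el_padd el_pmul)
    (simp_all add: PP_iff)

definition pone :: 'm where "pone = Sep QQ (\<lambda>x. Q.lt x (fr (sc emp) (sc emp)))"

lemma el_pone: "el pone = Q.cone"
proof -
  have "x \<epsilon> pone \<longleftrightarrow> x \<epsilon> QQ \<and> Q.lt x (fr (sc emp) (sc emp))" for x
    unfolding pone_def by (rule Sep_iff) (intro definable)
  then show ?thesis by (auto simp: Q.cone_def)
qed

lemma pone_PP [simp]: "pone \<epsilon> PP"
  using Q.cut_cone by (simp add: PP_iff el_pone)

lemma ex_difference: "c \<epsilon> PP \<Longrightarrow> d \<epsilon> PP \<Longrightarrow> el c \<subset> el d \<Longrightarrow> \<exists>z. z \<epsilon> PP \<and> padd c z = d"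
proof -
  assume c: "c \<epsilon> PP" and d: "d \<epsilon> PP" and cd: "el c \<subset> el d"
  \<comment> \<open>The set \<open>Q.cdif (el d) (el c)\<close> lives in the metalogic; this
    separation exhibits it as the extension of an element of the model.\<close>
  define z where "z = Sep QQ (\<lambda>x. \<exists>y. y \<epsilon> QQ \<and> \<not> y \<epsilon> c \<and> qpl y x \<epsilon> d)"
  have "x \<epsilon> z \<longleftrightarrow> x \<epsilon> QQ \<and> (\<exists>y. y \<epsilon> QQ \<and> \<not> y \<epsilon> c \<and> qpl y x \<epsilon> d)" for x
    unfolding z_def by (rule Sep_iff) (intro definable)
  then have z: "el z = Q.cdif (el d) (el c)" by (auto simp: Q.cdif_def)
  have "z \<epsilon> PP" unfolding PP_iff z by (rule Q.cut_cdif) (use c d cd in \<open>simp_all add: PP_iff\<close>)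
  moreover have "el (padd c z) = el d"
    unfolding el_padd[OF c \<open>z \<epsilon> PP\<close>] z
    by (rule Q.cadd_cdif) (use c d cd PP_archimedean in \<open>simp_all add: PP_iff\<close>)
  ultimately show ?thesis by auto
qed

interpretation P: pos_semifield "{c. c \<epsilon> PP}" padd pmul pone
proof
  fix x y assume "x \<in> el PP" "y \<in> el PP"
  then have xy: "x \<epsilon> PP" "y \<epsilon> PP" and cut: "Q.cut (el x)" "Q.cut (el y)" by (auto simp: PP_iff)
  show "padd x y \<in> el PP" "pmul x y \<in> el PP" using xy by simp_all
  have "el (padd x y) = el (padd y x)" "el (pmul x y) = el (pmul y x)"
    using xy cut Q.cadd_comm Q.cmul_comm by (simp_all add: el_padd el_pmul del: el_eq)
  then show "padd x y = padd y x" "pmul x y = pmul y x" by simp_all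
  have "el x \<subset> el y \<or> el x = el y \<or> el y \<subset> el x" using Q.cut_linear[OF cut] by blast
  then show "x = y \<or> (\<exists>z\<in>el PP. padd x z = y) \<or> (\<exists>z\<in>el PP. padd y z = x)"
    using ex_difference xy by (metis el_eq mem_Collect_eq)
  have "el (padd x y) \<noteq> el x"
    using Q.cadd_irr cut xy PP_archimedean by (simp add: el_padd del: el_eq)
  then show "padd x y \<noteq> x" by auto
next
  fix x y z assume "x \<in> el PP" "y \<in> el PP" "z \<in> el PP"
  then have xyz: "x \<epsilon> PP" "y \<epsilon> PP" "z \<epsilon> PP" and cut: "Q.cut (el x)" "Q.cut (el y)" "Q.cut (el z)"
    by (auto simp: PP_iff)
  have "el (padd (padd x y) z) = el (padd x (padd y z))" "el (pmul (pmul x y) z) = el (pmul x (pmul y z))"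
    "el (pmul x (padd y z)) = el (padd (pmul x y) (pmul x z))"
    using xyz cut Q.cadd_assoc Q.cmul_assoc Q.cmul_distr by (simp_all add: el_padd el_pmul del: el_eq)
  then show "padd (padd x y) z = padd x (padd y z)" "pmul (pmul x y) z = pmul x (pmul y z)"
    "pmul x (padd y z) = padd (pmul x y) (pmul x z)" by simp_all
next
  show "pone \<in> el PP" by simp
  fix x assume "x \<in> el PP"
  then have x: "x \<epsilon> PP" and cut: "Q.cut (el x)" by (auto simp: PP_iff)
  have "el (pmul x pone) = el x"
    using x cut Q.cmul_cone by (simp add: el_pmul el_pone del: el_eq)
  then show "pmul x pone = x" by simp
  define z where "z = Sep QQ (\<lambda>w. \<exists>y. y \<epsilon> QQ \<and> \<not> y \<epsilon> x \<and> Q.lt (qtm w y) (fr (sc emp) (sc emp)))"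
  have "w \<epsilon> z \<longleftrightarrow> w \<epsilon> QQ \<and> (\<exists>y. y \<epsilon> QQ \<and> \<not> y \<epsilon> x \<and> Q.lt (qtm w y) (fr (sc emp) (sc emp)))" for w
    unfolding z_def by (rule Sep_iff) (intro definable)
  then have z: "el z = Q.cinv (el x)" by (auto simp: Q.cinv_def)
  have zP: "z \<epsilon> PP" unfolding PP_iff z by (rule Q.cut_cinv[OF cut])
  have "el (pmul x z) = el pone"
    unfolding el_pmul[OF x zP] z el_pone by (rule Q.cmul_cinv[OF cut PP_archimedean[OF x]])
  then have "pmul x z = pone" by simp
  with zP show "\<exists>y\<in>el PP. pmul x y = pone" by auto
qed

text \<open>The order that addition induces on cuts is inclusion, which is why unions are
  suprema.\<close>

lemma P_le_iff: "p \<epsilon> PP \<Longrightarrow> q \<epsilon> PP \<Longrightarrow> p = q \<or> P.lt p q \<longleftrightarrow> p \<sqsubseteq> q"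
proof -
  have lt_sub: "p \<sqsubseteq> q" if pq: "p \<epsilon> PP" "q \<epsilon> PP" "P.lt p q" for p q
  proof (rule subsI)
    fix x assume x: "x \<epsilon> p"
    obtain z where z: "z \<epsilon> PP" "padd p z = q" using pq(3) by (auto simp: P.lt_def)
    obtain y where y: "y \<epsilon> z" using z(1) by (auto simp: PP_iff Qcut_iff)
    have "x \<epsilon> QQ" "y \<epsilon> QQ" using x y PP_QQ pq z by blast+
    then have "Q.lt x (qpl x y)" using Q.lt_pl_self by simp
    moreover have "qpl x y \<epsilon> q"
      unfolding z(2)[symmetric] padd_iff using x y \<open>x \<epsilon> QQ\<close> \<open>y \<epsilon> QQ\<close> QQ_closed(1) by blast
    ultimately show "x \<epsilon> q" using Q.cut_down[of "el q" "qpl x y" x] pq(2) \<open>x \<epsilon> QQ\<close> by (simp add: PP_iff)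
  qed
  assume p: "p \<epsilon> PP" and q: "q \<epsilon> PP"
  show ?thesis
  proof
    show "p = q \<or> P.lt p q \<Longrightarrow> p \<sqsubseteq> q" using lt_sub p q by auto
    assume "p \<sqsubseteq> q"
    then show "p = q \<or> P.lt p q"
      using P.lt_linear[of p q] lt_sub[OF q p] subs_antisym p q by auto
  qed
qed

section \<open>Reals of the model as differences of positive reals\<close>

definition dif_cls :: "'m \<Rightarrow> 'm \<Rightarrow> 'm" where
  "dif_cls a b = Sep (prd PP PP) (\<lambda>z. \<exists>x y. z = pr x y \<and> padd a y = padd x b)"

lemma dif_cls_iff: "z \<epsilon> dif_cls a b \<longleftrightarrow> z \<epsilon> prd PP PP \<and> (\<exists>x y. z = pr x y \<and> padd a y = padd x b)"
  unfolding dif_cls_def by (rule Sep_iff) (intro definable)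

lemma DT_dif_cls [definable]: "DT s \<Longrightarrow> DT t \<Longrightarrow> DT (\<lambda>e. dif_cls (s e) (t e))"
  by (rule DT_app2[of dif_cls], rule DT_ext, rule dif_cls_iff, intro definable)

lemma dif_cls_eq:
  assumes "a \<epsilon> PP" "b \<epsilon> PP" "c \<epsilon> PP" "d \<epsilon> PP"
  shows "dif_cls a b = dif_cls c d \<longleftrightarrow> padd a d = padd c b"
proof
  assume eq: "dif_cls a b = dif_cls c d"
  have "pr c d \<epsilon> dif_cls a b" unfolding eq using assms by (auto simp: dif_cls_iff)
  then show "padd a d = padd c b" by (auto simp: dif_cls_iff)
next
  assume eq: "padd a d = padd c b"
  show "dif_cls a b = dif_cls c d"
    by (rule extensionality) (use P.df_class[of a b c d] assms eq in \<open>auto simp: dif_cls_iff prd_iff\<close>)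
qed

definition radd :: "'m \<Rightarrow> 'm \<Rightarrow> 'm" where
  "radd x y = Sep (prd PP PP) (\<lambda>z. \<exists>a b c d. a \<epsilon> PP \<and> b \<epsilon> PP \<and> c \<epsilon> PP \<and> d \<epsilon> PP \<and>
    x = dif_cls a b \<and> y = dif_cls c d \<and> z \<epsilon> dif_cls (padd a c) (padd b d))"

lemma radd_iff: "z \<epsilon> radd x y \<longleftrightarrow> z \<epsilon> prd PP PP \<and>
  (\<exists>a b c d. a \<epsilon> PP \<and> b \<epsilon> PP \<and> c \<epsilon> PP \<and> d \<epsilon> PP \<and>
    x = dif_cls a b \<and> y = dif_cls c d \<and> z \<epsilon> dif_cls (padd a c) (padd b d))"
  unfolding radd_def by (rule Sep_iff) (intro definable)

lemma DT_radd [definable]: "DT s \<Longrightarrow> DT t \<Longrightarrow> DT (\<lambda>e. radd (s e) (t e))"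
  by (rule DT_app2[of radd], rule DT_ext, rule radd_iff, intro definable)

definition rmul :: "'m \<Rightarrow> 'm \<Rightarrow> 'm" where
  "rmul x y = Sep (prd PP PP) (\<lambda>z. \<exists>a b c d. a \<epsilon> PP \<and> b \<epsilon> PP \<and> c \<epsilon> PP \<and> d \<epsilon> PP \<and>
    x = dif_cls a b \<and> y = dif_cls c d \<and>
    z \<epsilon> dif_cls (padd (pmul a c) (pmul b d)) (padd (pmul a d) (pmul b c)))"

lemma rmul_iff: "z \<epsilon> rmul x y \<longleftrightarrow> z \<epsilon> prd PP PP \<and>
  (\<exists>a b c d. a \<epsilon> PP \<and> b \<epsilon> PP \<and> c \<epsilon> PP \<and> d \<epsilon> PP \<and> x = dif_cls a b \<and> y = dif_cls c d \<and>
    z \<epsilon> dif_cls (padd (pmul a c) (pmul b d)) (padd (pmul a d) (pmul b c)))"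
  unfolding rmul_def by (rule Sep_iff) (intro definable)

lemma DT_rmul [definable]: "DT s \<Longrightarrow> DT t \<Longrightarrow> DT (\<lambda>e. rmul (s e) (t e))"
  by (rule DT_app2[of rmul], rule DT_ext, rule rmul_iff, intro definable)

interpretation G: differences "{c. c \<epsilon> PP}" padd pmul pone dif_cls radd rmul
proof
  fix a b c d assume "a \<in> el PP" "b \<in> el PP" "c \<in> el PP" "d \<in> el PP"
  then have m: "a \<epsilon> PP" "b \<epsilon> PP" "c \<epsilon> PP" "d \<epsilon> PP" by auto
  then show "dif_cls a b = dif_cls c d \<longleftrightarrow> padd a d = padd c b" by (rule dif_cls_eq)
  show "radd (dif_cls a b) (dif_cls c d) = dif_cls (padd a c) (padd b d)"
  proof (rule extensionality)
    fix z
    have "dif_cls (padd a' c') (padd b' d') = dif_cls (padd a c) (padd b d)"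
      if "a' \<epsilon> PP" "b' \<epsilon> PP" "c' \<epsilon> PP" "d' \<epsilon> PP" "dif_cls a b = dif_cls a' b'" "dif_cls c d = dif_cls c' d'"
      for a' b' c' d'
      using that m P.df_pl_cong[of a b c d a' b' c' d'] by (simp add: dif_cls_eq)
    then show "z \<epsilon> radd (dif_cls a b) (dif_cls c d) \<longleftrightarrow> z \<epsilon> dif_cls (padd a c) (padd b d)"
      unfolding radd_iff using m dif_cls_iff by metis
  qed
  show "rmul (dif_cls a b) (dif_cls c d) = dif_cls (padd (pmul a c) (pmul b d)) (padd (pmul a d) (pmul b c))"
  proof (rule extensionality)
    fix z
    let ?m = "\<lambda>a b c d. dif_cls (padd (pmul a c) (pmul b d)) (padd (pmul a d) (pmul b c))"
    have "?m a' b' c' d' = ?m a b c d"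
      if n: "a' \<epsilon> PP" "b' \<epsilon> PP" "c' \<epsilon> PP" "d' \<epsilon> PP" and eq: "dif_cls a b = dif_cls a' b'" "dif_cls c d = dif_cls c' d'"
      for a' b' c' d'
    proof -
      have "?m a b c d = ?m a' b' c d"
        using n m eq(1) P.df_tm_cong1[of a b c d a' b'] by (simp add: dif_cls_eq)
      also have "\<dots> = ?m a' b' c' d'"
        using n m eq(2) P.df_tm_cong2[of a' b' c d c' d'] by (simp add: dif_cls_eq)
      finally show ?thesis by simp
    qed
    then show "z \<epsilon> rmul (dif_cls a b) (dif_cls c d) \<longleftrightarrow> z \<epsilon> ?m a b c d"
      unfolding rmul_iff using m dif_cls_iff by metis
  qed
qed

definition RR :: 'm where
  "RR = Sep (Pw (prd PP PP)) (\<lambda>r. \<exists>a b. a \<epsilon> PP \<and> b \<epsilon> PP \<and> r = dif_cls a b)"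

lemma RR_iff: "r \<epsilon> RR \<longleftrightarrow> (\<exists>a b. a \<epsilon> PP \<and> b \<epsilon> PP \<and> r = dif_cls a b)"
proof -
  have "r \<epsilon> RR \<longleftrightarrow> r \<epsilon> Pw (prd PP PP) \<and> (\<exists>a b. a \<epsilon> PP \<and> b \<epsilon> PP \<and> r = dif_cls a b)"
    unfolding RR_def by (rule Sep_iff) (intro definable)
  then show ?thesis by (auto simp: dif_cls_iff)
qed

lemma GR [simp]: "r \<in> G.R \<longleftrightarrow> r \<epsilon> RR"
  by (auto simp: G.R_def RR_iff)

lemma Plt_iff: "P.lt x y \<longleftrightarrow> (\<exists>z. z \<epsilon> PP \<and> padd x z = y)"
  by (auto simp: P.lt_def)

lemma D_Plt [definable]: "DT s \<Longrightarrow> DT t \<Longrightarrow> D (\<lambda>e. P.lt (s e) (t e))"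
  by (rule D_app2[of P.lt]) (unfold Plt_iff, intro definable)

lemma rlt_iff: "G.rlt x y \<longleftrightarrow> (\<exists>a b c d. a \<epsilon> PP \<and> b \<epsilon> PP \<and> c \<epsilon> PP \<and> d \<epsilon> PP \<and>
  x = dif_cls a b \<and> y = dif_cls c d \<and> P.lt (padd a d) (padd c b))"
  by (simp add: G.rlt_def)

lemma D_rlt [definable]: "DT s \<Longrightarrow> DT t \<Longrightarrow> D (\<lambda>e. G.rlt (s e) (t e))"
  by (rule D_app2[of G.rlt]) (unfold rlt_iff, intro definable)

lemma DT_pos [definable]: "DT s \<Longrightarrow> DT (\<lambda>e. G.pos (s e))"
  unfolding G.pos_def by (intro definable)

theorem supremum:
  assumes s: "s \<sqsubseteq> RR" "x \<epsilon> s" and b: "b \<epsilon> RR" "\<And>y. y \<epsilon> s \<Longrightarrow> y = b \<or> G.rlt y b"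
  obtains u where "u \<epsilon> RR" "\<And>y. y \<epsilon> s \<Longrightarrow> y = u \<or> G.rlt y u"
    "\<And>c. c \<epsilon> RR \<Longrightarrow> \<forall>y. y \<epsilon> s \<longrightarrow> y = c \<or> G.rlt y c \<Longrightarrow> u = c \<or> G.rlt u c"
proof -
  have "\<exists>u \<in> G.R. (\<forall>y \<in> el s. y = u \<or> G.rlt y u) \<and>
    (\<forall>c \<in> G.R. (\<forall>y \<in> el s. y = c \<or> G.rlt y c) \<longrightarrow> u = c \<or> G.rlt u c)"
  proof (rule G.ex_supremum[of "el s" x b])
    fix w assume w: "w \<in> G.R" "\<exists>p \<in> el PP. radd w (G.pos p) \<in> el s"
      "\<exists>q \<in> el PP. \<forall>p \<in> el PP. radd w (G.pos p) \<in> el s \<longrightarrow> p = q \<or> P.lt p q"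
    define t where "t = Sep PP (\<lambda>p. radd w (G.pos p) \<epsilon> s)"
    have t: "p \<epsilon> t \<longleftrightarrow> p \<epsilon> PP \<and> radd w (G.pos p) \<epsilon> s" for p
      unfolding t_def by (rule Sep_iff) (intro definable)
    obtain p0 q0 where p0: "p0 \<epsilon> t" and q0: "q0 \<epsilon> PP" "\<And>p. p \<epsilon> t \<Longrightarrow> p \<sqsubseteq> q0"
      using w(2,3) P_le_iff by (auto simp: t)
    \<comment> \<open>The supremum of a set of cuts is its union, a proper part of the rationals
      because the upper bound \<open>q0\<close> contains it.\<close>
    define \<sigma> where "\<sigma> = Uni t"
    have "el \<sigma> = \<Union> (el ` el t)" by (auto simp: \<sigma>_def)
    moreover have "Q.cut (\<Union> (el ` el t))"
      by (rule Q.cut_Union[of _ "el q0"]) (use p0 q0 in \<open>auto simp: t subs_def simp flip: PP_iff\<close>)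
    ultimately have \<sigma>P: "\<sigma> \<epsilon> PP" by (simp add: PP_iff)
    have "p \<sqsubseteq> \<sigma>" if "p \<epsilon> t" for p
      unfolding \<sigma>_def subs_def Uni_iff using that by blast
    moreover have "\<sigma> \<sqsubseteq> q" if "\<And>p. p \<epsilon> t \<Longrightarrow> p \<sqsubseteq> q" for q using that by (auto simp: \<sigma>_def subs_def)
    ultimately show "\<exists>\<sigma> \<in> el PP. (\<forall>p \<in> el PP. radd w (G.pos p) \<in> el s \<longrightarrow> p = \<sigma> \<or> P.lt p \<sigma>) \<and>
        (\<forall>q \<in> el PP. (\<forall>p \<in> el PP. radd w (G.pos p) \<in> el s \<longrightarrow> p = q \<or> P.lt p q) \<longrightarrow> \<sigma> = q \<or> P.lt \<sigma> q)"
      using \<sigma>P P_le_iff by (intro bexI[of _ \<sigma>]) (auto simp: t)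
  qed (use assms subsD in auto)
  then show thesis using that by auto
qed

subsection \<open>The defining properties of the real line\<close>

definition comm_mon :: "'m \<Rightarrow> 'm \<Rightarrow> 'm \<Rightarrow> bool" where
  "comm_mon R f z \<longleftrightarrow> func f (prd R R) R \<and>
    (\<forall>x y w u v t. pr (pr x y) u \<epsilon> f \<and> pr (pr u w) t \<epsilon> f \<and> pr (pr y w) v \<epsilon> f \<longrightarrow> pr (pr x v) t \<epsilon> f) \<and>
    (\<forall>x y w. pr (pr x y) w \<epsilon> f \<longrightarrow> pr (pr y x) w \<epsilon> f) \<and> z \<epsilon> R \<and>
    (\<forall>x. x \<epsilon> R \<longrightarrow> pr (pr x z) x \<epsilon> f)"

lemma sat_comm_monoid [simp]: "R < d \<Longrightarrow> f < d \<Longrightarrow> z < d \<Longrightarrow> sat E (=) e (comm_monoid_op R f z d) \<longleftrightarrow>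
  comm_mon (e (d - Suc R)) (e (d - Suc f)) (e (d - Suc z))"
  by (simp add: comm_monoid_op_def comm_mon_def)

definition fld :: "'m \<Rightarrow> 'm \<Rightarrow> 'm \<Rightarrow> 'm \<Rightarrow> 'm \<Rightarrow> bool" where
  "fld R add mul zero one \<longleftrightarrow> comm_mon R add zero \<and> (\<forall>x. x \<epsilon> R \<longrightarrow> (\<exists>y. pr (pr x y) zero \<epsilon> add)) \<and>
    comm_mon R mul one \<and> (\<forall>x. x \<epsilon> R \<and> x \<noteq> zero \<longrightarrow> (\<exists>y. pr (pr x y) one \<epsilon> mul)) \<and> zero \<noteq> one \<and>
    (\<forall>x y z s u v w. pr (pr y z) s \<epsilon> add \<and> pr (pr x s) w \<epsilon> mul \<and> pr (pr x y) u \<epsilon> mul \<and>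
      pr (pr x z) v \<epsilon> mul \<longrightarrow> pr (pr u v) w \<epsilon> add)"

lemma sat_field [simp]: "R < d \<Longrightarrow> a < d \<Longrightarrow> m < d \<Longrightarrow> z < d \<Longrightarrow> k < d \<Longrightarrow>
  sat E (=) e (is_field R a m z k d) \<longleftrightarrow>
    fld (e (d - Suc R)) (e (d - Suc a)) (e (d - Suc m)) (e (d - Suc z)) (e (d - Suc k))"
  by (simp add: is_field_def fld_def)

definition linorder :: "'m \<Rightarrow> 'm \<Rightarrow> bool" where
  "linorder R lt \<longleftrightarrow> (\<forall>x. x \<epsilon> R \<longrightarrow> \<not> pr x x \<epsilon> lt) \<and>
    (\<forall>x y z. x \<epsilon> R \<and> y \<epsilon> R \<and> z \<epsilon> R \<and> pr x y \<epsilon> lt \<and> pr y z \<epsilon> lt \<longrightarrow> pr x z \<epsilon> lt) \<and>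
    (\<forall>x y. x \<epsilon> R \<and> y \<epsilon> R \<longrightarrow> pr x y \<epsilon> lt \<or> x = y \<or> pr y x \<epsilon> lt)"

lemma sat_linorder [simp]: "R < d \<Longrightarrow> l < d \<Longrightarrow>
  sat E (=) e (is_strict_linorder R l d) \<longleftrightarrow> linorder (e (d - Suc R)) (e (d - Suc l))"
  by (simp add: is_strict_linorder_def linorder_def)

definition ordered_fld :: "'m \<Rightarrow> 'm \<Rightarrow> 'm \<Rightarrow> 'm \<Rightarrow> 'm \<Rightarrow> 'm \<Rightarrow> bool" where
  "ordered_fld R add mul zero one lt \<longleftrightarrow> fld R add mul zero one \<and> linorder R lt \<and>
    (\<forall>x y z u v. x \<epsilon> R \<and> y \<epsilon> R \<and> pr x y \<epsilon> lt \<and> pr (pr x z) u \<epsilon> add \<and> pr (pr y z) v \<epsilon> add \<longrightarrow>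
      pr u v \<epsilon> lt) \<and>
    (\<forall>x y z. x \<epsilon> R \<and> y \<epsilon> R \<and> pr zero x \<epsilon> lt \<and> pr zero y \<epsilon> lt \<and> pr (pr x y) z \<epsilon> mul \<longrightarrow> pr zero z \<epsilon> lt)"

lemma sat_ordered_field [simp]: "R < d \<Longrightarrow> a < d \<Longrightarrow> m < d \<Longrightarrow> z < d \<Longrightarrow> k < d \<Longrightarrow> l < d \<Longrightarrow>
  sat E (=) e (is_ordered_field R a m z k l d) \<longleftrightarrow>
    ordered_fld (e (d - Suc R)) (e (d - Suc a)) (e (d - Suc m)) (e (d - Suc z)) (e (d - Suc k)) (e (d - Suc l))"
  by (simp add: is_ordered_field_def ordered_fld_def)

definition upper_bound :: "'m \<Rightarrow> 'm \<Rightarrow> 'm \<Rightarrow> 'm \<Rightarrow> bool" where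
  "upper_bound b s R lt \<longleftrightarrow> b \<epsilon> R \<and> (\<forall>x. x \<epsilon> s \<longrightarrow> x = b \<or> pr x b \<epsilon> lt)"

lemma sat_upper_bound [simp]: "b < d \<Longrightarrow> s < d \<Longrightarrow> R < d \<Longrightarrow> l < d \<Longrightarrow>
  sat E (=) e (is_upper_bound b s R l d) \<longleftrightarrow>
    upper_bound (e (d - Suc b)) (e (d - Suc s)) (e (d - Suc R)) (e (d - Suc l))"
  by (simp add: is_upper_bound_def upper_bound_def)

definition order_complete :: "'m \<Rightarrow> 'm \<Rightarrow> bool" where
  "order_complete R lt \<longleftrightarrow> (\<forall>s. s \<sqsubseteq> R \<and> (\<exists>x. x \<epsilon> s) \<and> (\<exists>b. upper_bound b s R lt) \<longrightarrow>
    (\<exists>b. upper_bound b s R lt \<and> (\<forall>c. upper_bound c s R lt \<longrightarrow> b = c \<or> pr b c \<epsilon> lt)))"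

lemma sat_order_complete [simp]: "R < d \<Longrightarrow> l < d \<Longrightarrow>
  sat E (=) e (is_order_complete R l d) \<longleftrightarrow> order_complete (e (d - Suc R)) (e (d - Suc l))"
  by (simp add: is_order_complete_def order_complete_def)

definition interval_topology :: "'m \<Rightarrow> 'm \<Rightarrow> 'm \<Rightarrow> bool" where
  "interval_topology T R lt \<longleftrightarrow> (\<forall>u. u \<epsilon> T \<longleftrightarrow> u \<sqsubseteq> R \<and> (\<forall>x. x \<epsilon> u \<longrightarrow>
    (\<exists>a b. a \<epsilon> R \<and> b \<epsilon> R \<and> pr a x \<epsilon> lt \<and> pr x b \<epsilon> lt \<and>
      (\<forall>y. y \<epsilon> R \<and> pr a y \<epsilon> lt \<and> pr y b \<epsilon> lt \<longrightarrow> y \<epsilon> u))))"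

lemma sat_interval_topology [simp]: "T < d \<Longrightarrow> R < d \<Longrightarrow> l < d \<Longrightarrow>
  sat E (=) e (is_interval_topology T R l d) \<longleftrightarrow>
    interval_topology (e (d - Suc T)) (e (d - Suc R)) (e (d - Suc l))"
  by (simp add: is_interval_topology_def interval_topology_def)

definition real_line :: "'m \<Rightarrow> 'm \<Rightarrow> bool" where
  "real_line R T \<longleftrightarrow> (\<exists>add mul zero one lt. ordered_fld R add mul zero one lt \<and> order_complete R lt \<and>
    interval_topology T R lt)"

lemma sat_real_line [simp]: "R < d \<Longrightarrow> T < d \<Longrightarrow>
  sat E (=) e (is_real_line R T d) \<longleftrightarrow> real_line (e (d - Suc R)) (e (d - Suc T))"
  by (simp add: is_real_line_def real_line_def)

section \<open>The topology of the real line and its Baire property\<close>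

definition SS :: 'm where
  "SS = Sep (Pw RR) (\<lambda>u. \<forall>x. x \<epsilon> u \<longrightarrow> (\<exists>a b. G.rlt a x \<and> G.rlt x b \<and>
    (\<forall>y. G.rlt a y \<and> G.rlt y b \<longrightarrow> y \<epsilon> u)))"

lemma SS_iff: "u \<epsilon> SS \<longleftrightarrow> u \<sqsubseteq> RR \<and> (\<forall>x. x \<epsilon> u \<longrightarrow> (\<exists>a b. G.rlt a x \<and> G.rlt x b \<and>
    (\<forall>y. G.rlt a y \<and> G.rlt y b \<longrightarrow> y \<epsilon> u)))"
proof -
  have "u \<epsilon> SS \<longleftrightarrow> u \<epsilon> Pw RR \<and> (\<forall>x. x \<epsilon> u \<longrightarrow> (\<exists>a b. G.rlt a x \<and> G.rlt x b \<and>
    (\<forall>y. G.rlt a y \<and> G.rlt y b \<longrightarrow> y \<epsilon> u)))"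
    unfolding SS_def by (rule Sep_iff) (intro definable)
  then show ?thesis by simp
qed

lemma rlt_RR: "G.rlt x y \<Longrightarrow> x \<epsilon> RR \<and> y \<epsilon> RR"
  using G.rlt_R[of x y] by simp

theorem real_line_RR: "real_line RR SS"
proof -
  \<comment> \<open>The formula for the real line speaks of operations that are sets, so the
    definable operations are replaced by their graphs.\<close>
  define graph where "graph f = Sep (prd (prd RR RR) RR) (\<lambda>p. \<exists>x y. p = pr (pr x y) (f x y))" for f
  have graph: "p \<epsilon> graph f \<longleftrightarrow> p \<epsilon> prd (prd RR RR) RR \<and> (\<exists>x y. p = pr (pr x y) (f x y))"
    if "DT (\<lambda>e. f (e 0) (e 1))" for p f
    unfolding graph_def by (rule Sep_iff) (intro definable DT_app2[OF that])
  have graph_pr: "pr (pr x y) z \<epsilon> graph f \<longleftrightarrow> x \<epsilon> RR \<and> y \<epsilon> RR \<and> z = f x y"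
    and graph_func: "func (graph f) (prd RR RR) RR"
    if "DT (\<lambda>e. f (e 0) (e 1))" and cl: "\<And>x y. x \<epsilon> RR \<Longrightarrow> y \<epsilon> RR \<Longrightarrow> f x y \<epsilon> RR" for f x y z
  proof -
    show *: "pr (pr x y) z \<epsilon> graph f \<longleftrightarrow> x \<epsilon> RR \<and> y \<epsilon> RR \<and> z = f x y" for x y z
      using cl unfolding graph[OF that(1)] by auto
    show "func (graph f) (prd RR RR) RR"
      unfolding func_def
    proof (intro conjI allI impI)
      fix p assume "p \<epsilon> graph f"
      then have "p \<epsilon> prd (prd RR RR) RR" using graph[OF that(1)] by blast
      then show "\<exists>x y. x \<epsilon> prd RR RR \<and> y \<epsilon> RR \<and> p = pr x y" by (simp add: prd_iff[of p])
    next
      fix q assume "q \<epsilon> prd RR RR"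
      then obtain x y where "q = pr x y" "x \<epsilon> RR" "y \<epsilon> RR" by (auto simp: prd_iff)
      then show "\<exists>!y. pr q y \<epsilon> graph f" by (simp add: *)
    qed
  qed
  have cl: "x \<epsilon> RR \<Longrightarrow> y \<epsilon> RR \<Longrightarrow> radd x y \<epsilon> RR" "x \<epsilon> RR \<Longrightarrow> y \<epsilon> RR \<Longrightarrow> rmul x y \<epsilon> RR" for x y
    using G.R_simps(1,2)[of x y] by simp_all
  have zo: "G.rzero \<epsilon> RR" "G.rone \<epsilon> RR" using G.R_simps(3,4) by simp_all
  have DR: "DT (\<lambda>e. radd (e 0) (e 1))" "DT (\<lambda>e. rmul (e 0) (e 1))" by (intro definable)+
  note add = graph_pr[OF DR(1) cl(1)] and mul = graph_pr[OF DR(2) cl(2)]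
  define lt where "lt = Sep (prd RR RR) (\<lambda>p. \<exists>x y. p = pr x y \<and> G.rlt x y)"
  have "p \<epsilon> lt \<longleftrightarrow> p \<epsilon> prd RR RR \<and> (\<exists>x y. p = pr x y \<and> G.rlt x y)" for p
    unfolding lt_def by (rule Sep_iff) (intro definable)
  then have lt: "pr x y \<epsilon> lt \<longleftrightarrow> G.rlt x y" for x y using rlt_RR by auto
  have "comm_mon RR (graph radd) G.rzero"
    using graph_func[OF DR(1) cl(1)] zo cl G.rpl_assoc G.rpl_comm G.rpl_zero by (simp add: comm_mon_def add)
  moreover have "comm_mon RR (graph rmul) G.rone"
    using graph_func[OF DR(2) cl(2)] zo cl G.rtm_assoc G.rtm_comm G.rtm_one by (simp add: comm_mon_def mul)
  moreover have "\<exists>y. pr (pr x y) G.rzero \<epsilon> graph radd" if "x \<epsilon> RR" for x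
    using G.rneg[of x] that by (auto simp: add)
  moreover have "\<exists>y. pr (pr x y) G.rone \<epsilon> graph rmul" if "x \<epsilon> RR" "x \<noteq> G.rzero" for x
    using G.rinv[of x] that by (auto simp: mul)
  ultimately have "fld RR (graph radd) (graph rmul) G.rzero G.rone"
    using G.rtm_distr G.rzero_neq_rone cl unfolding fld_def by (simp add: add mul)
  moreover have "linorder RR lt"
    unfolding linorder_def lt using G.rlt_irrefl G.rlt_trans G.rlt_linear GR by blast
  ultimately have "ordered_fld RR (graph radd) (graph rmul) G.rzero G.rone lt"
    unfolding ordered_fld_def lt by (auto simp: add mul intro: G.rlt_rpl G.rlt_rtm)
  moreover have "order_complete RR lt"
    unfolding order_complete_def upper_bound_def lt
  proof (intro allI impI; elim conjE exE)
    fix s x b assume "s \<sqsubseteq> RR" "x \<epsilon> s" "b \<epsilon> RR" "\<forall>x. x \<epsilon> s \<longrightarrow> x = b \<or> G.rlt x b"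
    then obtain u where "u \<epsilon> RR" "\<And>y. y \<epsilon> s \<Longrightarrow> y = u \<or> G.rlt y u"
      "\<And>c. c \<epsilon> RR \<Longrightarrow> \<forall>y. y \<epsilon> s \<longrightarrow> y = c \<or> G.rlt y c \<Longrightarrow> u = c \<or> G.rlt u c"
      using supremum[of s x b] by metis
    then show "\<exists>b. (b \<epsilon> RR \<and> (\<forall>x. x \<epsilon> s \<longrightarrow> x = b \<or> G.rlt x b)) \<and>
      (\<forall>c. c \<epsilon> RR \<and> (\<forall>x. x \<epsilon> s \<longrightarrow> x = c \<or> G.rlt x c) \<longrightarrow> b = c \<or> G.rlt b c)" by blast
  qed
  moreover have "interval_topology SS RR lt"
    unfolding interval_topology_def lt SS_iff using rlt_RR by blast
  ultimately show ?thesis unfolding real_line_def by blast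
qed

lemma SS_topology: "topology RR SS"
  unfolding topology_def
proof (intro conjI allI impI)
  show "emp \<epsilon> SS" by (auto simp: SS_iff)
  show "u \<epsilon> SS \<Longrightarrow> u \<sqsubseteq> RR" for u by (simp add: SS_iff)
  show "RR \<epsilon> SS" unfolding SS_iff using G.rlt_no_bounds rlt_RR GR subs_refl by meson
next
  fix u v assume uv: "u \<epsilon> SS \<and> v \<epsilon> SS"
  show "cap u v \<epsilon> SS" unfolding SS_iff
  proof (intro conjI allI impI)
    show "cap u v \<sqsubseteq> RR" using uv by (auto simp: SS_iff subs_def)
    fix x assume "x \<epsilon> cap u v"
    then have x: "x \<epsilon> u" "x \<epsilon> v" by auto
    obtain a b where a: "G.rlt a x" "G.rlt x b" "\<And>y. G.rlt a y \<Longrightarrow> G.rlt y b \<Longrightarrow> y \<epsilon> u"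
      using uv x(1) unfolding SS_iff by blast
    obtain c d where c: "G.rlt c x" "G.rlt x d" "\<And>y. G.rlt c y \<Longrightarrow> G.rlt y d \<Longrightarrow> y \<epsilon> v"
      using uv x(2) unfolding SS_iff by blast
    have "\<exists>l. G.rlt l x \<and> (\<forall>y. G.rlt l y \<longrightarrow> G.rlt a y \<and> G.rlt c y)"
      using G.rlt_linear[of a c] a(1) c(1) rlt_RR G.rlt_trans GR by metis
    moreover have "\<exists>r. G.rlt x r \<and> (\<forall>y. G.rlt y r \<longrightarrow> G.rlt y b \<and> G.rlt y d)"
      using G.rlt_linear[of b d] a(2) c(2) rlt_RR G.rlt_trans GR by metis
    ultimately show "\<exists>a b. G.rlt a x \<and> G.rlt x b \<and> (\<forall>y. G.rlt a y \<and> G.rlt y b \<longrightarrow> y \<epsilon> cap u v)"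
      using a(3) c(3) cap_iff by metis
  qed
next
  fix s assume s: "s \<sqsubseteq> SS"
  show "Uni s \<epsilon> SS" unfolding SS_iff
  proof (intro conjI allI impI)
    show "Uni s \<sqsubseteq> RR" using s unfolding subs_def SS_iff by auto
    fix x assume "x \<epsilon> Uni s"
    then obtain u where u: "u \<epsilon> s" "x \<epsilon> u" by auto
    then obtain a b where "G.rlt a x" "G.rlt x b" "\<And>y. G.rlt a y \<Longrightarrow> G.rlt y b \<Longrightarrow> y \<epsilon> u"
      using s subsD SS_iff by meson
    with u(1) show "\<exists>a b. G.rlt a x \<and> G.rlt x b \<and> (\<forall>y. G.rlt a y \<and> G.rlt y b \<longrightarrow> y \<epsilon> Uni s)"
      by auto
  qed
qed

lemma interval_open: "Sep RR (\<lambda>y. G.rlt a y \<and> G.rlt y b) \<epsilon> SS"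
  and interval_iff: "y \<epsilon> Sep RR (\<lambda>y. G.rlt a y \<and> G.rlt y b) \<longleftrightarrow> G.rlt a y \<and> G.rlt y b"
proof -
  have "y \<epsilon> Sep RR (\<lambda>y. G.rlt a y \<and> G.rlt y b) \<longleftrightarrow> y \<epsilon> RR \<and> G.rlt a y \<and> G.rlt y b" for y
    by (rule Sep_iff) (intro definable)
  then show *: "y \<epsilon> Sep RR (\<lambda>y. G.rlt a y \<and> G.rlt y b) \<longleftrightarrow> G.rlt a y \<and> G.rlt y b" for y
    using rlt_RR by blast
  show "Sep RR (\<lambda>y. G.rlt a y \<and> G.rlt y b) \<epsilon> SS" unfolding SS_iff * subs_def using rlt_RR by blast
qed

text \<open>Baire's argument with nested closed intervals: each interval avoids the nowhere dense
  sets with the current number, and the supremum of the left endpoints belongs to all of them. Order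
  completeness of the model is applied through \<open>supremum\<close>.\<close>

theorem RR_not_meager: "\<not> mgr RR RR SS"
proof
  assume "mgr RR RR SS"
  then obtain f where f: "lep f om" "\<And>b. b \<epsilon> f \<Longrightarrow> nwd b RR SS" "RR = Uni f"
    by (auto simp: mgr_def)
  obtain g where g: "DT (\<lambda>e. g (e 0))" "\<And>x. x \<epsilon> f \<Longrightarrow> g x \<epsilon> om"
    "\<And>x y. x \<epsilon> f \<Longrightarrow> y \<epsilon> f \<Longrightarrow> g x = g y \<Longrightarrow> x = y"
    by (rule lepE[OF f(1)], rule that)
  note [definable] = DT_app1[OF g(1)]
  define A where "A = Sep (prd RR RR) (\<lambda>s. \<exists>a b. s = pr a b \<and> G.rlt a b)"
  have "s \<epsilon> A \<longleftrightarrow> s \<epsilon> prd RR RR \<and> (\<exists>a b. s = pr a b \<and> G.rlt a b)" for s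
    unfolding A_def by (rule Sep_iff) (intro definable)
  then have A: "s \<epsilon> A \<longleftrightarrow> (\<exists>a b. s = pr a b \<and> G.rlt a b)" for s using rlt_RR by auto
  \<comment> \<open>The interval is closed where it avoids the sets, since the limit point may be an
    endpoint as far as the argument tells; strict nesting is what the smaller interval is chosen
    for.\<close>
  let ?R = "\<lambda>n s s'. \<forall>a b a' b'. s = pr a b \<and> s' = pr a' b' \<longrightarrow> G.rlt a a' \<and> G.rlt b' b \<and>
    (\<forall>c. c \<epsilon> f \<and> g c = n \<longrightarrow> \<not> (\<exists>x. x \<epsilon> c \<and> (x = a' \<or> G.rlt a' x) \<and> (x = b' \<or> G.rlt x b')))"
  have RD: "D (\<lambda>e. ?R (e 0) (e 1) (e 2))" by (intro definable)
  have step: "\<exists>s'. s' \<epsilon> A \<and> ?R n s s'" if s: "s \<epsilon> A" for n s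
  proof -
    obtain a b where ab: "s = pr a b" "G.rlt a b" using s unfolding A by blast
    let ?I = "Sep RR (\<lambda>y. G.rlt a y \<and> G.rlt y b)"
    obtain x0 where x0: "x0 \<epsilon> ?I" using G.rlt_dense[OF ab(2)] interval_iff by blast
    have "\<exists>v x. v \<epsilon> SS \<and> x \<epsilon> v \<and> v \<sqsubseteq> ?I \<and> (\<forall>c. c \<epsilon> f \<and> g c = n \<longrightarrow> \<not> (\<exists>z. z \<epsilon> v \<and> z \<epsilon> c))"
    proof (cases "\<exists>c. c \<epsilon> f \<and> g c = n")
      case True
      then obtain c where c: "c \<epsilon> f" "g c = n" by blast
      obtain v x where "v \<epsilon> SS" "x \<epsilon> v" "v \<sqsubseteq> ?I" "\<not> (\<exists>z. z \<epsilon> v \<and> z \<epsilon> c)"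
        using nwd_refine[OF f(2)[OF c(1)] SS_topology interval_open x0] by blast
      moreover have "c' = c" if "c' \<epsilon> f" "g c' = n" for c' using that c g(3) by blast
      ultimately show ?thesis by blast
    next
      case False
      then show ?thesis using interval_open x0 subs_refl by blast
    qed
    then obtain v x where v: "v \<epsilon> SS" "x \<epsilon> v" "v \<sqsubseteq> ?I"
      "\<And>c. c \<epsilon> f \<Longrightarrow> g c = n \<Longrightarrow> \<not> (\<exists>z. z \<epsilon> v \<and> z \<epsilon> c)" by blast
    obtain l r where l: "G.rlt l x" "G.rlt x r" "\<And>y. G.rlt l y \<Longrightarrow> G.rlt y r \<Longrightarrow> y \<epsilon> v"
      using v(1,2) unfolding SS_iff by blast
    obtain a' where a': "G.rlt l a'" "G.rlt a' x" using G.rlt_dense l(1) by blast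
    obtain b' where b': "G.rlt x b'" "G.rlt b' r" using G.rlt_dense l(2) by blast
    have sub: "y \<epsilon> v" if "y = a' \<or> G.rlt a' y" "y = b' \<or> G.rlt y b'" for y
      using that l(3) a' b' G.rlt_trans by metis
    have "a' \<epsilon> v" "b' \<epsilon> v" using sub a'(2) b'(1) G.rlt_trans by blast+
    then have "G.rlt a a'" "G.rlt b' b" using v(3) subsD interval_iff by blast+
    moreover have "G.rlt a' b'" using a'(2) b'(1) G.rlt_trans by blast
    moreover have "\<not> (\<exists>x. x \<epsilon> c \<and> (x = a' \<or> G.rlt a' x) \<and> (x = b' \<or> G.rlt x b'))"
      if "c \<epsilon> f" "g c = n" for c
      using sub v(4)[OF that] by blast
    ultimately show ?thesis
      unfolding A ab(1) by (intro exI[of _ "pr a' b'"]) auto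
  qed
  obtain a0 b0 where "G.rlt a0 b0" using G.rlt_no_bounds[OF G.R_simps(3)] by blast
  then have start: "pr a0 b0 \<epsilon> A" unfolding A by blast
  obtain F where F: "DT (\<lambda>e. F (e 0))" "F emp = pr a0 b0" "\<And>n. n \<epsilon> om \<Longrightarrow> F n \<epsilon> A"
    "\<And>n. n \<epsilon> om \<Longrightarrow> ?R n (F n) (F (sc n))"
    by (rule dependent_choice[of "pr a0 b0" A ?R, OF start RD step], assumption, rule that)
  note [definable] = DT_app1[OF F(1)]
  have mono: "\<forall>m a b c d. (m \<epsilon> n \<or> m = n) \<and> F m = pr a b \<and> F n = pr c d \<longrightarrow>
      (a = c \<or> G.rlt a c) \<and> (d = b \<or> G.rlt d b)" if "n \<epsilon> om" for n
    using that
  proof (induction rule: om_induct)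
    case D
    show ?case by (intro definable)
  next
    case (succ n)
    show ?case
    proof (intro allI impI; elim conjE)
      fix m a b c d assume m: "m \<epsilon> sc n \<or> m = sc n" and Fm: "F m = pr a b" and Fn: "F (sc n) = pr c d"
      obtain p q where pq: "F n = pr p q" using F(3)[OF succ(1)] unfolding A by blast
      then have pc: "G.rlt p c" "G.rlt d q" using F(4)[OF succ(1)] Fn by blast+
      consider "m = sc n" | "m \<epsilon> n \<or> m = n" using m by auto
      then show "(a = c \<or> G.rlt a c) \<and> (d = b \<or> G.rlt d b)"
      proof cases
        case 1
        then show ?thesis using Fm Fn by auto
      next
        case 2
        then have "(a = p \<or> G.rlt a p) \<and> (q = b \<or> G.rlt q b)" using succ(2) Fm pq by blast
        then show ?thesis using pc G.rlt_trans by blast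
      qed
    qed
  qed auto
  define s where "s = Sep RR (\<lambda>x. \<exists>n b. n \<epsilon> om \<and> F n = pr x b)"
  have "x \<epsilon> s \<longleftrightarrow> x \<epsilon> RR \<and> (\<exists>n b. n \<epsilon> om \<and> F n = pr x b)" for x
    unfolding s_def by (rule Sep_iff) (intro definable)
  moreover have Flt: "G.rlt a b" if "n \<epsilon> om" "F n = pr a b" for n a b
    using F(3)[OF that(1)] that(2) unfolding A by auto
  ultimately have s: "x \<epsilon> s \<longleftrightarrow> (\<exists>n b. n \<epsilon> om \<and> F n = pr x b)" for x using rlt_RR by blast
  have below: "G.rlt a b" if a: "a \<epsilon> s" and n: "n \<epsilon> om" "F n = pr c b" for a b c n
  proof -
    obtain m d where m: "m \<epsilon> om" "F m = pr a d" using a s by blast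
    consider "m \<epsilon> n \<or> m = n" | "n \<epsilon> m \<or> n = m" using Ord_linear[of m n] om_Ord m(1) n(1) by blast
    then show ?thesis
    proof cases
      case 1
      then have "a = c \<or> G.rlt a c" using mono[OF n(1)] m(2) n(2) by blast
      then show ?thesis using Flt[OF n] G.rlt_trans by blast
    next
      case 2
      then have "d = b \<or> G.rlt d b" using mono[OF m(1)] m(2) n(2) by blast
      then show ?thesis using Flt[OF m] G.rlt_trans by blast
    qed
  qed
  have sR: "s \<sqsubseteq> RR" using s Flt rlt_RR by blast
  have a0: "a0 \<epsilon> s" using F(2) s om_emp by blast
  have b0: "b0 \<epsilon> RR" using \<open>G.rlt a0 b0\<close> rlt_RR by blast
  have ub: "y = b0 \<or> G.rlt y b0" if "y \<epsilon> s" for y using below[OF that om_emp F(2)] by blast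
  obtain x where x: "x \<epsilon> RR" "\<And>y. y \<epsilon> s \<Longrightarrow> y = x \<or> G.rlt y x"
    "\<And>c. c \<epsilon> RR \<Longrightarrow> \<forall>y. y \<epsilon> s \<longrightarrow> y = c \<or> G.rlt y c \<Longrightarrow> x = c \<or> G.rlt x c"
    by (rule supremum[OF sR a0 b0 ub], assumption, rule that)
  obtain c where c: "c \<epsilon> f" "x \<epsilon> c" using x(1) f(3) by auto
  define n where "n = g c"
  have n: "n \<epsilon> om" using c g(2) by (simp add: n_def)
  obtain a b where ab: "F n = pr a b" using F(3)[OF n] unfolding A by blast
  obtain a' b' where ab': "F (sc n) = pr a' b'" using F(3)[OF om_sc[OF n]] unfolding A by blast
  have "a' \<epsilon> s" using ab' s om_sc[OF n] by blast
  then have "x = a' \<or> G.rlt a' x" using x(2) by blast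
  \<comment> \<open>Each right endpoint is an upper bound of all left endpoints, so the supremum
    does not exceed it.\<close>
  moreover have "x = b' \<or> G.rlt x b'"
    using x(3)[of b'] below[OF _ om_sc[OF n] ab'] Flt[OF om_sc[OF n] ab'] rlt_RR by blast
  ultimately show False using F(4)[OF n] ab ab' c by (simp add: n_def) blast
qed

section \<open>The theorem\<close>

theorem sat_small_non_meager_space: "sat E (=) e small_non_meager_space"
proof -
  obtain X T k m c where XT: "topology X T" "\<exists>x. x \<epsilon> X" "cpt X T" "haus X T"
    "\<not> (\<exists>x. x \<epsilon> X \<and> up x x \<epsilon> T)" "Card k"
    "\<And>u. u \<epsilon> T \<Longrightarrow> \<exists>x. x \<epsilon> u \<Longrightarrow> min_card k (\<lambda>B. pi_base B (Rep T (\<lambda>v. cap v u)))"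
    and m: "min_card m (\<lambda>y. y \<sqsubseteq> X \<and> \<not> mgr y X T)" and c: "min_card c (\<lambda>f. cof f k)" and cm: "\<not> lep c m"
    by (rule small_nonmeager_cube, rule that)
  have "D (\<lambda>e. e 0 \<sqsubseteq> RR \<and> \<not> mgr (e 0) RR SS)" by (intro definable)
  then obtain n where n: "min_card n (\<lambda>y. y \<sqsubseteq> RR \<and> \<not> mgr y RR SS)"
    using ex_min_card[of "\<lambda>y. y \<sqsubseteq> RR \<and> \<not> mgr y RR SS" RR] RR_not_meager by auto
  \<comment> \<open>The cardinal \<open>n\<close> is nonzero because the empty set is meager. An
    element of \<open>n\<close> embeds \<open>c\<close> into the product, so that m < c passes to m
    < p.\<close>
  obtain z where z: "z \<epsilon> n"
  proof -
    obtain y where y: "y \<sqsubseteq> RR" "\<not> mgr y RR SS" "eqp y n" using min_card_attained[OF n] by blast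
    have "Uni emp = emp" by (rule emp_eqI) simp
    moreover have "lep emp om" by (rule subs_imp_lep) auto
    ultimately have "mgr emp RR SS" unfolding mgr_def by (intro exI[of _ emp]) auto
    then obtain x where "x \<epsilon> y" using y(2) emp_eqI by metis
    then show thesis using y(3) that by (elim eqpE) blast
  qed
  define p where "p = crd (prd c n)"
  have p: "Card p" "eqp (prd c n) p" using crd by (simp_all add: p_def)
  have "lep c (prd c n)"
  proof (rule lepI[of "\<lambda>x. pr x z"])
    show "DT (\<lambda>e. pr (e 0) z)" by (intro definable)
  qed (use z in auto)
  then have "lep c p" using p(2) eqp_imp_lep lep_trans by blast
  then have "m \<epsilon> p" using Card_less[OF min_card_Card[OF m] p(1)] cm lep_trans by blast
  then show ?thesis
    unfolding small_non_meager_space_def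
    using XT m c real_line_RR n p
    by (simp add: numeral_2_eq_2) blast
qed

end

theorem theorem5p3:
  assumes "consistent ZFC"
  shows "consistent (insert small_non_meager_space ZFC)"
proof -
  obtain E :: "nat \<Rightarrow> nat \<Rightarrow> bool" where E: "\<forall>p \<in> ZFC. \<forall>e. sat E (=) e p"
    using ZFC_model[OF assms] by blast
  then interpret zfc E by unfold_locales blast
  show ?thesis
    unfolding consistent_def
  proof
    assume "insert small_non_meager_space ZFC \<turnstile> Fls"
    then have "sat E (=) (\<lambda>_. 0) Fls"
      by (rule soundness) (use E sat_small_non_meager_space in auto)
    then show False by simp
  qed
qed

end
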